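(* Let $d\in\{1,2\}$, $s\geq 1$ an integer, $T>0$, $p^a=0$ and $z_b\in C^s_b(\mathbb{R}^d)$. Let $(\eta,\boldsymbol{u},w)$ be a solution of the free-surface hydrostatic Euler system (E) (written in the context) such that $\eta\in C^s_b((0,T)\times\mathbb{R}^d)$, $\boldsymbol{u}\in C^s_b((0,T)\times\Omega_t)^d$ and $w\in C^s_b((0,T)\times\Omega_t)$. Let $\phi_0\in C^s_b(\tilde\Omega)$ satisfy $\phi_0(\boldsymbol{x},0)=z_b(\boldsymbol{x})$, $\phi_0(\boldsymbol{x},1)=\eta_0(\boldsymbol{x})$ and $\partial_\lambda\phi_0(\boldsymbol{x},\lambda)>0$. Then there exists $T^*\in(0,T]$ such that the Cauchy problem $$\frac{\partial\phi}{\partial t}+\boldsymbol{u}(t,\boldsymbol{x},\phi)\cdot\nabla_{\boldsymbol{x}}\phi=w(t,\boldsymbol{x},\phi)\ \text{ in }(0,T^* )\times\tilde\Omega,\qquad \phi(0,\boldsymbol{x},\lambda)=\phi_0(\boldsymbol{x},\lambda)\ \text{ in }\tilde\Omega,$$ admits a unique solution $\phi\in C^s((0,T^* )\times\tilde\Omega)$. Moreover, if $\inf_{(\boldsymbol{x},\lambda)\in\mathbb{R}^d\times I}\partial_\lambda\phi_0(\boldsymbol{x},\lambda)>0$, then for $t\in(0,T^* )$ we have $\partial_\lambda\phi(t,\boldsymbol{x},\lambda)>0$, so in particular the map $$(\mathrm{Id},\phi(t)):\tilde\Omega\to\Omega_t,\qquad (\boldsymbol{x},\lambda)\mapsto(\boldsymbol{x},\phi(t,\boldsymbol{x},\lambda))$$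 is an orientation preserving $C^s$-diffeomorphism, provided it is a diffeomorphism at $t=0$, i.e. provided that $\phi_0(\boldsymbol{x},0)=z_b(\boldsymbol{x})$ and $\phi_0(\boldsymbol{x},1)=\eta_0(\boldsymbol{x})$.
   Context: $I=(0,1)$, $\tilde\Omega=\mathbb{R}^d\times I$; $g>0$ is the gravity constant; $z_b:\mathbb{R}^d\to\mathbb{R}$ is the time-independent bottom. $C^s_b$ denotes the space of $C^s$ functions all of whose derivatives up to order $s$ are continuous and bounded (values at boundary points such as $\lambda=0,1$ are understood by continuous extension). The fluid domain is $\Omega_t=\{(\boldsymbol{x},z)\in\mathbb{R}^d\times\mathbb{R}: z_b(\boldsymbol{x})<z<\eta(t,\boldsymbol{x})\}$ and $(0,T)\times\Omega_t$ denotes $\{(t,\boldsymbol{x},z)\in(0,T)\times\mathbb{R}^d\times\mathbb{R}:(\boldsymbol{x},z)\in\Omega_t\}$. System (E), for the unknowns $\eta(t,\boldsymbol{x})\in\mathbb{R}$, $\boldsymbol{u}(t,\boldsymbol{x},z)\in\mathbb{R}^d$ (horizontal velocity), $w(t,\boldsymbol{x},z)\in\mathbb{R}$ (vertical velocity), with $p^a$ the atmospheric pressure: $$\begin{cases}\partial_t\eta+\boldsymbol{u}_s\cdot\nabla_{\boldsymbol{x}}\eta-w_s=0 & \text{in }(0,T)\times\mathbb{R}^d,\\ \boldsymbol{u}_b\cdot\nabla_{\boldsymbol{x}}z_b-w_b=0 & \text{in }(0,T)\times\mathbb{R}^d,\\ \partial_t\boldsymbol{u}+\boldsymbol{u}\cdot\nabla_{\boldsymbol{x}}\boldsymbol{u}+w\,\partial_z\boldsymbol{u}+g\nabla_{\boldsymbol{x}}\eta=-\nabla_{\boldsymbol{x}}p^a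 & \text{in }(0,T)\times\Omega_t,\\ \nabla_{\boldsymbol{x}}\cdot\boldsymbol{u}+\partial_z w=0 & \text{in }(0,T)\times\Omega_t,\\ \boldsymbol{u}|_{t=0}=\boldsymbol{u}_0\ \text{in }\Omega_0,\qquad \eta|_{t=0}=\eta_0\ \text{in }\mathbb{R}^d,\end{cases}$$ where the subscripts $s$ and $b$ denote values at the surface and at the bottom, e.g. $w_s(t,\boldsymbol{x})=w(t,\boldsymbol{x},\eta(t,\boldsymbol{x}))$, $w_b(t,\boldsymbol{x})=w(t,\boldsymbol{x},z_b(\boldsymbol{x}))$. *)

theory Defs
  imports "HOL-Analysis.Analysis"
begin

text \<open>
  The spaces \<open>C\<^sup>s\<close> and \<open>C\<^sup>s\<^sub>b\<close> on a set \<open>U\<close>, by iterated partial derivatives along the standard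
  basis.  Derivatives are two-sided, so both predicates are meant for open \<open>U\<close> only.
\<close>

primrec Cs_on :: "nat \<Rightarrow> ('a::euclidean_space \<Rightarrow> 'b::real_normed_vector) \<Rightarrow> 'a set \<Rightarrow> bool" where
  "Cs_on 0 f U \<longleftrightarrow> continuous_on U f"
| "Cs_on (Suc s) f U \<longleftrightarrow> continuous_on U f \<and> (\<forall>p\<in>U. f differentiable (at p)) \<and>
     (\<forall>e\<in>Basis. Cs_on s (\<lambda>p. frechet_derivative f (at p) e) U)"

primrec Csb_on :: "nat \<Rightarrow> ('a::euclidean_space \<Rightarrow> 'b::real_normed_vector) \<Rightarrow> 'a set \<Rightarrow> bool" where
  "Csb_on 0 f U \<longleftrightarrow> continuous_on U f \<and> bounded (f ` U)"
| "Csb_on (Suc s) f U \<longleftrightarrow> continuous_on U f \<and> bounded (f ` U) \<and> (\<forall>p\<in>U. f differentiable (at p)) \<and>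
     (\<forall>e\<in>Basis. Csb_on s (\<lambda>p. frechet_derivative f (at p) e) U)"

text \<open>
  The value at \<open>p \<in> closure U\<close> of the continuous extension of \<open>f\<close> from \<open>U\<close>
  (unspecified when the limit does not exist or \<open>p \<notin> closure U\<close>).
\<close>

definition cont_ext :: "'a::topological_space set \<Rightarrow> ('a \<Rightarrow> 'b::t2_space) \<Rightarrow> 'a \<Rightarrow> 'b" where
  "cont_ext U f p = (if p \<in> U then f p else Lim (at p within U) f)"

definition grad :: "(real^'n \<Rightarrow> real) \<Rightarrow> real^'n \<Rightarrow> real^'n" where
  "grad f x = (\<chi> k. frechet_derivative f (at x) (axis k 1))"

definition strip :: "((real^'n) \<times> real) set" where
  "strip = UNIV \<times> {0<..<1}"

definition fluid_slice :: "(real^'n \<Rightarrow> real) \<Rightarrow> (real^'n \<Rightarrow> real) \<Rightarrow> ((real^'n) \<times> real) set" where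
  "fluid_slice zb h = {(x, z). zb x < z \<and> z < h x}"

definition fluid_domain ::
  "real \<Rightarrow> (real^'n \<Rightarrow> real) \<Rightarrow> (real \<times> (real^'n) \<Rightarrow> real) \<Rightarrow> (real \<times> (real^'n) \<times> real) set" where
  "fluid_domain T zb \<eta> = {(t, x, z). 0 < t \<and> t < T \<and> (x, z) \<in> fluid_slice zb (\<lambda>y. \<eta> (t, y))}"

text \<open>
  The momentum equation is written componentwise.  The traces of the velocity at the surface and at
  the bottom, and the initial values, are taken by continuous extension from the open sets
  \<open>(0,T) \<times> \<Omega>\<^sub>t\<close> and \<open>(0,T) \<times> \<real>\<^sup>d\<close>.
\<close>

definition hydrostatic_euler ::
  "real \<Rightarrow> (real \<times> (real^'n) \<Rightarrow> real) \<Rightarrow> (real^'n \<Rightarrow> real) \<Rightarrow> real \<Rightarrow>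
   (real^'n \<Rightarrow> real) \<Rightarrow> ((real^'n) \<times> real \<Rightarrow> real^'n) \<Rightarrow>
   (real \<times> (real^'n) \<Rightarrow> real) \<Rightarrow> (real \<times> (real^'n) \<times> real \<Rightarrow> real^'n) \<Rightarrow>
   (real \<times> (real^'n) \<times> real \<Rightarrow> real) \<Rightarrow> bool" where
  "hydrostatic_euler g pa zb T \<eta>0 u0 \<eta> u w \<longleftrightarrow>
    (let Q = fluid_domain T zb \<eta> in
      (\<forall>t\<in>{0<..<T}. \<forall>x.
         deriv (\<lambda>\<tau>. \<eta> (\<tau>, x)) t
         + cont_ext Q u (t, x, \<eta> (t, x)) \<bullet> grad (\<lambda>y. \<eta> (t, y)) x
         - cont_ext Q w (t, x, \<eta> (t, x)) = 0) \<and>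
      (\<forall>t\<in>{0<..<T}. \<forall>x.
         cont_ext Q u (t, x, zb x) \<bullet> grad zb x - cont_ext Q w (t, x, zb x) = 0) \<and>
      (\<forall>(t, x, z)\<in>Q. \<forall>k.
         deriv (\<lambda>\<tau>. u (\<tau>, x, z) $ k) t
         + u (t, x, z) \<bullet> grad (\<lambda>y. u (t, y, z) $ k) x
         + w (t, x, z) * deriv (\<lambda>\<zeta>. u (t, x, \<zeta>) $ k) z
         + g * grad (\<lambda>y. \<eta> (t, y)) x $ k
         = - grad (\<lambda>y. pa (t, y)) x $ k) \<and>
      (\<forall>(t, x, z)\<in>Q.
         (\<Sum>k\<in>UNIV. grad (\<lambda>y. u (t, y, z) $ k) x $ k) + deriv (\<lambda>\<zeta>. w (t, x, \<zeta>)) z = 0) \<and>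
      (\<forall>(x, z)\<in>fluid_slice zb \<eta>0. (u \<longlongrightarrow> u0 (x, z)) (at (0, x, z) within Q)) \<and>
      (\<forall>x. (\<eta> \<longlongrightarrow> \<eta>0 x) (at (0, x) within {0<..<T} \<times> UNIV)))"

text \<open>
  \<open>\<phi>\<close> is a \<open>C\<^sup>s\<close> solution on \<open>(0,S) \<times> strip\<close> of the Cauchy problem.  For \<open>u(t,x,\<phi>)\<close> and
  \<open>w(t,x,\<phi>)\<close> to make sense, the point \<open>(t,x,\<phi>)\<close> has to lie in the closure of the fluid domain \<open>Q\<close>,
  to which the velocity is extended continuously.
\<close>

definition layer_solution ::
  "nat \<Rightarrow> (real \<times> (real^'n) \<times> real) set \<Rightarrow> (real \<times> (real^'n) \<times> real \<Rightarrow> real^'n) \<Rightarrow>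
   (real \<times> (real^'n) \<times> real \<Rightarrow> real) \<Rightarrow> ((real^'n) \<times> real \<Rightarrow> real) \<Rightarrow> real \<Rightarrow>
   (real \<times> (real^'n) \<times> real \<Rightarrow> real) \<Rightarrow> bool" where
  "layer_solution s Q u w \<phi>0 S \<phi> \<longleftrightarrow>
    Cs_on s \<phi> ({0<..<S} \<times> strip) \<and>
    (\<forall>(t, x, l)\<in>{0<..<S} \<times> strip.
       (t, x, \<phi> (t, x, l)) \<in> closure Q \<and>
       deriv (\<lambda>\<tau>. \<phi> (\<tau>, x, l)) t
       + cont_ext Q u (t, x, \<phi> (t, x, l)) \<bullet> grad (\<lambda>y. \<phi> (t, y, l)) x
       = cont_ext Q w (t, x, \<phi> (t, x, l))) \<and>
    (\<forall>(x, l)\<in>strip. (\<phi> \<longlongrightarrow> \<phi>0 (x, l)) (at (0, x, l) within {0<..<S} \<times> strip))"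

text \<open>
  Determinant of a linear endomorphism of \<open>\<real>\<^sup>d \<times> \<real>\<close>: the matrix is taken in the standard basis,
  \<open>Some k\<close> indexing the \<open>k\<close>-th horizontal direction and \<open>None\<close> the vertical one.
\<close>

definition coord :: "'n option \<Rightarrow> (real^'n) \<times> real \<Rightarrow> real" where
  "coord i p = (case i of None \<Rightarrow> snd p | Some k \<Rightarrow> fst p $ k)"

definition unit_vec :: "'n option \<Rightarrow> (real^'n) \<times> real" where
  "unit_vec i = (case i of None \<Rightarrow> (0, 1) | Some k \<Rightarrow> (axis k 1, 0))"

definition det_lin :: "((real^'n) \<times> real \<Rightarrow> (real^'n) \<times> real) \<Rightarrow> real" where
  "det_lin L = det (\<chi> i j. coord i (L (unit_vec j)) :: real^('n option)^('n option))"

definition oriented_Cs_diffeo ::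
  "nat \<Rightarrow> ((real^'n) \<times> real \<Rightarrow> (real^'n) \<times> real) \<Rightarrow>
   ((real^'n) \<times> real) set \<Rightarrow> ((real^'n) \<times> real) set \<Rightarrow> bool" where
  "oriented_Cs_diffeo s F U V \<longleftrightarrow>
    bij_betw F U V \<and> Cs_on s F U \<and> Cs_on s (inv_into U F) V \<and>
    (\<forall>p\<in>U. det_lin (frechet_derivative F (at p)) > 0)"

end

theory Submission
  imports Defs
begin

text \<open>
  The equation for \<open>\<phi>\<close> is solved by characteristics.  The velocity \<open>(u, w)\<close> is Lipschitz on the
  fluid domain, which is quasiconvex, so it extends to a globally bounded Lipschitz field \<open>V\<close>.  For
  \<open>q = (t, x, l)\<close> with \<open>t\<close> small, a contraction argument gives a unique curve \<open>c = (X, Z)\<close> with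
  \<open>c'(\<theta>) = t V(t\<theta>, c(\<theta>))\<close> on \<open>[0, 1]\<close>, \<open>X(1) = x\<close> and \<open>Z(0) = \<phi>\<^sub>0(X(0), l)\<close>, and \<open>\<phi>(q) = Z(1)\<close>.
  The kinematic conditions at surface and bottom and a Gronwall argument keep these curves inside the
  fluid domain.  Hence only the smoothness of \<open>(u, w)\<close> inside the domain enters: \<open>c\<close> solves an
  integral equation, its partial derivatives in \<open>q\<close> solve linear Fredholm equations with kernel of
  small norm, and regularity is bootstrapped through them.  Uniqueness, positivity of the depth and
  of \<open>\<partial>\<^sub>\<lambda>\<phi>\<close> all come from one minimum principle in backward cones.
\<close>

text \<open>The characteristic through a point solves a two-point problem: its horizontal position
  is prescribed at the end, its height only at the start, and there through \<open>\<phi>0\<close>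
  at a foot that is itself unknown. This is why a contraction replaces an initial value problem and
  why the time is short. Stretching all curves over the same interval makes \<open>t\<close> a
  parameter on the same footing as \<open>x\<close> and \<open>l\<close>. One smallness condition
  serves twice: the contraction constant is S L (3 + G), and the linearised kernel is at most S L (1
  + n G) over an index set of mass n + 1. It involves bounds on first derivatives only, so each
  further derivative is gained on the same time interval. The main obstacle is the moving boundary.
  The Lipschitz extension of the velocity need not be differentiable across the surface or the
  bottom, and the geometry needed to build it, a positive depth at all positive times, has to be
  drawn from the equations first. To avoid a circle, the extension is first made locally, over bases
  where the depth is already positive.\<close>

section \<open>Families of \<open>C\<^sup>k\<close> functions\<close>

text \<open>
  Regularity of a family indexed by \<open>I\<close>, with derivatives locally bounded uniformly in the index;
  this is what survives integration over the index.
\<close>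

definition loc_bdd :: "'i set \<Rightarrow> ('i \<Rightarrow> 'q::metric_space \<Rightarrow> 'b::real_normed_vector) \<Rightarrow> 'q set \<Rightarrow> bool" where
  "loc_bdd I a U \<longleftrightarrow> (\<forall>q\<in>U. \<exists>r>0. \<exists>B. \<forall>i\<in>I. \<forall>p\<in>U \<inter> ball q r. norm (a i p) \<le> B)"

primrec Cs_unif :: "nat \<Rightarrow> 'i set \<Rightarrow> ('i \<Rightarrow> 'q::euclidean_space \<Rightarrow> 'b::real_normed_vector) \<Rightarrow> 'q set \<Rightarrow> bool" where
  "Cs_unif 0 I a U \<longleftrightarrow> (\<forall>i\<in>I. continuous_on U (a i)) \<and> loc_bdd I a U"
| "Cs_unif (Suc k) I a U \<longleftrightarrow> (\<forall>i\<in>I. continuous_on U (a i)) \<and> loc_bdd I a U \<and>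
     (\<forall>i\<in>I. \<forall>q\<in>U. a i differentiable (at q)) \<and>
     (\<forall>e\<in>Basis. Cs_unif k I (\<lambda>i q. frechet_derivative (a i) (at q) e) U)"

lemma loc_bddI:
  assumes "\<And>q. q \<in> U \<Longrightarrow> \<exists>r>0. \<exists>B. \<forall>i\<in>I. \<forall>p\<in>U \<inter> ball q r. norm (a i p) \<le> B"
  shows "loc_bdd I a U"
  using assms unfolding loc_bdd_def by blast

lemma loc_bddE:
  assumes "loc_bdd I a U" "q \<in> U"
  obtains r B where "r > 0" "B > 0" "\<And>i p. i \<in> I \<Longrightarrow> p \<in> U \<Longrightarrow> dist q p < r \<Longrightarrow> norm (a i p) \<le> B"
proof -
  obtain r B where r: "r > 0" "\<forall>i\<in>I. \<forall>p\<in>U \<inter> ball q r. norm (a i p) \<le> B"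
    using assms unfolding loc_bdd_def by blast
  show ?thesis
  proof (rule that[of r "max B 1"])
    fix i p assume "i \<in> I" "p \<in> U" "dist q p < r"
    then have "norm (a i p) \<le> B" using r(2) by auto
    then show "norm (a i p) \<le> max B 1" by simp
  qed (use r in auto)
qed

text \<open>The last premise asks only for a bound on \<open>c\<close> in terms of bounds on
  \<open>a\<close> and \<open>b\<close>, so that sums, products and linear images share one
  argument.\<close>

lemma loc_bdd_binary:
  assumes "loc_bdd I a U" "loc_bdd I b U"
    and "\<And>A B. \<exists>C. \<forall>i\<in>I. \<forall>p\<in>U. norm (a i p) \<le> A \<longrightarrow> norm (b i p) \<le> B \<longrightarrow> norm (c i p) \<le> C"
  shows "loc_bdd I c U"
proof (rule loc_bddI)
  fix q assume q: "q \<in> U"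
  obtain r1 A where A: "r1 > 0" "\<And>i p. i \<in> I \<Longrightarrow> p \<in> U \<Longrightarrow> dist q p < r1 \<Longrightarrow> norm (a i p) \<le> A"
    using loc_bddE[OF assms(1) q] by metis
  obtain r2 B where B: "r2 > 0" "\<And>i p. i \<in> I \<Longrightarrow> p \<in> U \<Longrightarrow> dist q p < r2 \<Longrightarrow> norm (b i p) \<le> B"
    using loc_bddE[OF assms(2) q] by metis
  obtain C where C: "\<forall>i\<in>I. \<forall>p\<in>U. norm (a i p) \<le> A \<longrightarrow> norm (b i p) \<le> B \<longrightarrow> norm (c i p) \<le> C"
    using assms(3) by blast
  show "\<exists>r>0. \<exists>B. \<forall>i\<in>I. \<forall>p\<in>U \<inter> ball q r. norm (c i p) \<le> B"
    by (rule exI[of _ "min r1 r2"], rule conjI, use A(1) B(1) in simp, rule exI[of _ C])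
       (use A(2) B(2) C in auto)
qed

lemma Cs_unif_cont: "Cs_unif k I a U \<Longrightarrow> i \<in> I \<Longrightarrow> continuous_on U (a i)"
  by (cases k) auto

lemma Cs_unif_loc_bdd: "Cs_unif k I a U \<Longrightarrow> loc_bdd I a U"
  by (cases k) auto

lemma Cs_unif_Suc_le: "Cs_unif (Suc k) I a U \<Longrightarrow> Cs_unif k I a U"
  by (induction k arbitrary: a) auto

lemma Cs_unif_has_derivative:
  "Cs_unif (Suc k) I a U \<Longrightarrow> i \<in> I \<Longrightarrow> q \<in> U \<Longrightarrow>
    (a i has_derivative frechet_derivative (a i) (at q)) (at q)"
  by (auto simp: frechet_derivative_works[symmetric])

lemma Cs_unif_frechet:
  "Cs_unif (Suc k) I a U \<Longrightarrow> e \<in> Basis \<Longrightarrow> Cs_unif k I (\<lambda>i q. frechet_derivative (a i) (at q) e) U"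
  by simp

text \<open>\<open>frechet_derivative\<close> is a choice among all derivatives, so the functions
  need only have the same set of derivatives at \<open>q\<close>.\<close>

lemma frechet_derivative_cong_open:
  assumes "open U" "q \<in> U" "\<And>p. p \<in> U \<Longrightarrow> f p = g p"
  shows "frechet_derivative f (at q) = frechet_derivative g (at q)"
proof -
  have "(f has_derivative D) (at q) \<longleftrightarrow> (g has_derivative D) (at q)" for D
    using assms by (metis has_derivative_transform_within_open)
  then show ?thesis unfolding frechet_derivative_def by simp
qed

lemma loc_bdd_cong:
  assumes "\<And>i q. i \<in> I \<Longrightarrow> q \<in> U \<Longrightarrow> a i q = b i q" "loc_bdd I a U"
  shows "loc_bdd I b U"
proof (rule loc_bddI)
  fix q assume "q \<in> U"
  then obtain r B where "r > 0" "\<And>i p. i \<in> I \<Longrightarrow> p \<in> U \<Longrightarrow> dist q p < r \<Longrightarrow> norm (a i p) \<le> B"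
    using loc_bddE[OF assms(2)] by metis
  then show "\<exists>r>0. \<exists>B. \<forall>i\<in>I. \<forall>p\<in>U \<inter> ball q r. norm (b i p) \<le> B"
    using assms(1) by (intro exI[of _ r] conjI exI[of _ B]) auto
qed

lemma loc_bdd_reindex:
  assumes "loc_bdd I a U" "\<And>j. j \<in> J \<Longrightarrow> f j \<in> I"
  shows "loc_bdd J (\<lambda>j. a (f j)) U"
proof (rule loc_bddI)
  fix q assume "q \<in> U"
  then obtain r B where "r > 0" "\<And>i p. i \<in> I \<Longrightarrow> p \<in> U \<Longrightarrow> dist q p < r \<Longrightarrow> norm (a i p) \<le> B"
    using loc_bddE[OF assms(1)] by metis
  then show "\<exists>r>0. \<exists>B. \<forall>i\<in>J. \<forall>p\<in>U \<inter> ball q r. norm (a (f i) p) \<le> B"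
    using assms(2) by (intro exI[of _ r] conjI exI[of _ B]) auto
qed

lemma loc_bdd_if_bounded:
  assumes "\<And>i q. i \<in> I \<Longrightarrow> q \<in> U \<Longrightarrow> norm (a i q) \<le> B"
  shows "loc_bdd I a U"
  using assms by (intro loc_bddI exI[of _ "1::real"] conjI exI[of _ B]) auto

lemma Cs_unif_cong:
  assumes "open U"
  shows "(\<And>i q. i \<in> I \<Longrightarrow> q \<in> U \<Longrightarrow> a i q = b i q) \<Longrightarrow> Cs_unif k I a U \<Longrightarrow> Cs_unif k I b U"
proof (induction k arbitrary: a b)
  case 0
  then have "continuous_on U (b i)" if "i \<in> I" for i
    using that continuous_on_cong[of U U "a i" "b i"] by auto
  moreover have "loc_bdd I b U" by (rule loc_bdd_cong[of I U a]) (use 0 in auto)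
  ultimately show ?case by simp
next
  case (Suc k)
  have "continuous_on U (b i)" if "i \<in> I" for i
    using that Suc.prems continuous_on_cong[of U U "a i" "b i"] by auto
  moreover have "loc_bdd I b U" by (rule loc_bdd_cong[of I U a]) (use Suc.prems in auto)
  moreover have "b i differentiable (at q)" if "i \<in> I" "q \<in> U" for i q
    using Suc.prems that assms
    by (metis (no_types, lifting) Cs_unif.simps(2) differentiable_def has_derivative_transform_within_open)
  moreover have "Cs_unif k I (\<lambda>i q. frechet_derivative (b i) (at q) e) U" if "e \<in> Basis" for e
  proof (rule Suc.IH)
    show "Cs_unif k I (\<lambda>i q. frechet_derivative (a i) (at q) e) U"
      using Suc.prems that by simp
    show "frechet_derivative (a i) (at q) e = frechet_derivative (b i) (at q) e"
      if "i \<in> I" "q \<in> U" for i q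
      using frechet_derivative_cong_open[OF assms \<open>q \<in> U\<close>, of "a i" "b i"] Suc.prems(1) that by simp
  qed
  ultimately show ?case by simp
qed

text \<open>Lets a derivative be supplied in explicit form instead of through the choice operator;
  continuity follows from differentiability.\<close>

lemma Cs_unif_SucI:
  assumes "open U"
    and der: "\<And>i q. i \<in> I \<Longrightarrow> q \<in> U \<Longrightarrow> (a i has_derivative a' i q) (at q)"
    and "loc_bdd I a U"
    and "\<And>e. e \<in> Basis \<Longrightarrow> Cs_unif k I (\<lambda>i q. a' i q e) U"
  shows "Cs_unif (Suc k) I a U"
proof -
  have eq: "a' i q = frechet_derivative (a i) (at q)" if "i \<in> I" "q \<in> U" for i q
    using der[OF that] frechet_derivative_at by blast
  have "continuous_on U (a i)" if "i \<in> I" for i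
    by (meson continuous_at_imp_continuous_on der has_derivative_continuous that)
  moreover have "Cs_unif k I (\<lambda>i q. frechet_derivative (a i) (at q) e) U" if "e \<in> Basis" for e
    by (rule Cs_unif_cong[OF assms(1) _ assms(4)[OF that]]) (simp add: eq)
  ultimately show ?thesis
    using assms(3) der by (simp, metis differentiable_def)
qed

text \<open>Pulls a family back along a map of index sets, for instance to read a family in \<sigma>
  as one in pairs that contain \<sigma>.\<close>

lemma Cs_unif_reindex:
  "Cs_unif k I a U \<Longrightarrow> (\<And>j. j \<in> J \<Longrightarrow> f j \<in> I) \<Longrightarrow> Cs_unif k J (\<lambda>j. a (f j)) U"
proof (induction k arbitrary: a)
  case 0
  then show ?case using loc_bdd_reindex[of I a U J f] by auto
next
  case (Suc k)
  have "loc_bdd J (\<lambda>j. a (f j)) U" using Suc.prems loc_bdd_reindex[of I a U J f] by auto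
  moreover have "Cs_unif k J (\<lambda>j q. frechet_derivative (a (f j)) (at q) e) U" if "e \<in> Basis" for e
    using Suc.IH[OF Cs_unif_frechet[OF Suc.prems(1) that] Suc.prems(2)] by simp
  ultimately show ?case using Suc.prems by simp
qed

lemma loc_bdd_Times_finite:
  assumes "finite J" and bd: "\<And>j. j \<in> J \<Longrightarrow> loc_bdd I (a j) U"
  shows "loc_bdd (J \<times> I) (\<lambda>(j,i). a j i) U"
  proof (rule loc_bddI)
    fix q assume q: "q \<in> U"
    have "\<exists>r>0. \<exists>B. \<forall>i\<in>I. \<forall>p\<in>U \<inter> ball q r. norm (a j i p) \<le> B" if "j \<in> J" for j
      using bd[OF that] q unfolding loc_bdd_def by blast
    then obtain r B where rB: "\<And>j. j \<in> J \<Longrightarrow> r j > 0 \<and> (\<forall>i\<in>I. \<forall>p\<in>U \<inter> ball q (r j). norm (a j i p) \<le> B j)"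
      by metis
    \<comment> \<open>The inserted 1 and 0 keep \<open>R\<close> and \<open>C\<close> well defined
      when \<open>J\<close> is empty.\<close>
    define R where "R = Min (insert 1 (r ` J))"
    define C where "C = Max (insert 0 (B ` J))"
    have R: "R > 0" "\<And>j. j \<in> J \<Longrightarrow> R \<le> r j"
      using assms rB by (auto simp: R_def)
    have C: "\<And>j. j \<in> J \<Longrightarrow> B j \<le> C" using assms by (auto simp: C_def)
    show "\<exists>r>0. \<exists>B. \<forall>i\<in>J\<times>I. \<forall>p\<in>U \<inter> ball q r. norm ((case i of (j, i) \<Rightarrow> a j i) p) \<le> B"
    proof (rule exI[of _ R], rule conjI[OF R(1)], rule exI[of _ C], intro ballI)
      fix ji p assume ji: "ji \<in> J \<times> I" and p: "p \<in> U \<inter> ball q R"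
      obtain j i where ji_eq: "ji = (j, i)" by fastforce
      have "dist q p < r j" using p R(2)[of j] ji ji_eq by simp
      then have "norm (a j i p) \<le> B j" using rB[of j] ji ji_eq p by simp
      also have "\<dots> \<le> C" using C ji ji_eq by simp
      finally show "norm ((case ji of (j, i) \<Rightarrow> a j i) p) \<le> C" by (simp add: ji_eq)
    qed
  qed

text \<open>The index of a curve component is a pair of a direction and a time. There are finitely
  many directions, so regularity can be shown for each direction separately and then joined.\<close>

lemma Cs_unif_Times_finite:
  assumes "finite J"
  shows "(\<And>j. j \<in> J \<Longrightarrow> Cs_unif k I (a j) U) \<Longrightarrow> Cs_unif k (J \<times> I) (\<lambda>(j,i). a j i) U"
proof (induction k arbitrary: a)
  case 0
  then show ?case using loc_bdd_Times_finite[OF assms, of I a U] by auto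
next
  case (Suc k)
  have "Cs_unif k (J \<times> I) (\<lambda>(j,i) q. frechet_derivative (a j i) (at q) e) U" if "e \<in> Basis" for e
    using Suc.IH[of "\<lambda>j i q. frechet_derivative (a j i) (at q) e"] Suc.prems that
    by (simp add: case_prod_unfold)
  then show ?case using loc_bdd_Times_finite[OF assms, of I a U] Suc.prems by (auto simp: case_prod_unfold)
qed

text \<open>Constant in \<open>q\<close>, but free to vary with the index. In this form the weights
  \<open>\<kappa>0\<close>, which jump in their time arguments, enter smooth families.\<close>

lemma Cs_unif_const:
  assumes "\<And>i. i \<in> I \<Longrightarrow> norm (c i) \<le> B"
  shows "Cs_unif k I (\<lambda>i q. c i :: 'b::real_normed_vector) U"
  using assms
proof (induction k arbitrary: c B)
  case 0
  then show ?case using loc_bdd_if_bounded[of I U "\<lambda>i q. c i" B] by auto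
next
  case (Suc k)
  have "loc_bdd I (\<lambda>i q. c i) U" using Suc.prems by (rule loc_bdd_if_bounded)
  moreover have "Cs_unif k I (\<lambda>i q. 0::'b) U" using Suc.IH[of "\<lambda>_. 0" 0] by simp
  ultimately show ?case by (simp add: frechet_derivative_const)
qed

lemma Cs_unif_bounded_linear:
  assumes "open U" "bounded_linear A"
  shows "Cs_unif k I a U \<Longrightarrow> Cs_unif k I (\<lambda>i q. A (a i q)) U"
proof (induction k arbitrary: a)
  obtain K where K: "\<And>x. norm (A x) \<le> norm x * K" "K \<ge> 0"
    using bounded_linear.nonneg_bounded[OF assms(2)] by auto
  have *: "loc_bdd I (\<lambda>i q. A (a i q)) U" if "loc_bdd I a U" for a
    using that that by (rule loc_bdd_binary) (use K in \<open>metis mult.commute mult_left_mono order_trans\<close>)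
  {
    case 0
    then show ?case using * linear_continuous_on_compose[OF _ ] assms(2)
      by (auto intro!: bounded_linear.continuous_on[OF assms(2)])
  next
    case (Suc k)
    show ?case
    proof (rule Cs_unif_SucI[OF assms(1), where a' = "\<lambda>i q e. A (frechet_derivative (a i) (at q) e)"])
      show "((\<lambda>q. A (a i q)) has_derivative (\<lambda>e. A (frechet_derivative (a i) (at q) e))) (at q)"
        if "i \<in> I" "q \<in> U" for i q
        by (rule bounded_linear.has_derivative[OF assms(2) Cs_unif_has_derivative[OF Suc.prems that]])
      show "loc_bdd I (\<lambda>i q. A (a i q)) U" by (rule *[OF Cs_unif_loc_bdd[OF Suc.prems]])
      show "Cs_unif k I (\<lambda>i q. A (frechet_derivative (a i) (at q) e)) U" if "e \<in> Basis" for e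
        by (rule Suc.IH) (use Suc.prems that in simp)
    qed
  }
qed

lemma Cs_unif_add:
  fixes a b :: "'i \<Rightarrow> 'q::euclidean_space \<Rightarrow> 'b::real_normed_vector"
  assumes "open U"
  shows "Cs_unif k I a U \<Longrightarrow> Cs_unif k I b U \<Longrightarrow> Cs_unif k I (\<lambda>i q. a i q + b i q) U"
proof (induction k arbitrary: a b)
  have *: "loc_bdd I (\<lambda>i q. a i q + b i q) U" if "loc_bdd I a U" "loc_bdd I b U" for a b :: "'i \<Rightarrow> 'q \<Rightarrow> 'b"
    using that by (rule loc_bdd_binary) (meson add_mono norm_triangle_le)
  {
    case 0
    then show ?case using * by (auto intro: continuous_on_add)
  next
    case (Suc k)
    show ?case
      by (rule Cs_unif_SucI[OF assms(1), where a' = "\<lambda>i q e. frechet_derivative (a i) (at q) e + frechet_derivative (b i) (at q) e"])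
         (use Suc.prems in \<open>auto intro!: has_derivative_add Suc.IH Cs_unif_has_derivative * simp del: Cs_unif.simps intro: Cs_unif_loc_bdd Cs_unif_frechet\<close>)
  }
qed

lemma Cs_unif_scaleR:
  fixes a :: "'i \<Rightarrow> 'q::euclidean_space \<Rightarrow> real" and b :: "'i \<Rightarrow> 'q \<Rightarrow> 'b::real_normed_vector"
  assumes "open U"
  shows "Cs_unif k I a U \<Longrightarrow> Cs_unif k I b U \<Longrightarrow> Cs_unif k I (\<lambda>i q. a i q *\<^sub>R b i q) U"
proof (induction k arbitrary: a b)
  have *: "loc_bdd I (\<lambda>i q. a i q *\<^sub>R b i q) U" if "loc_bdd I a U" "loc_bdd I b U"
    for a :: "'i \<Rightarrow> 'q::euclidean_space \<Rightarrow> real" and b :: "'i \<Rightarrow> 'q \<Rightarrow> 'b::real_normed_vector"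
  proof (rule loc_bdd_binary[OF that])
    show "\<exists>C. \<forall>i\<in>I. \<forall>p\<in>U. norm (a i p) \<le> A \<longrightarrow> norm (b i p) \<le> B \<longrightarrow> norm (a i p *\<^sub>R b i p) \<le> C" for A B
      by (rule exI[of _ "\<bar>A\<bar> * B"]) (auto intro!: mult_mono)
  qed
  {
    case 0
    then show ?case using *[of a b] by (auto intro: continuous_on_scaleR)
  next
    case (Suc k)
    show ?case
    proof (rule Cs_unif_SucI[OF assms(1), where a' = "\<lambda>i q e. a i q *\<^sub>R frechet_derivative (b i) (at q) e + frechet_derivative (a i) (at q) e *\<^sub>R b i q"])
      show "((\<lambda>q. a i q *\<^sub>R b i q) has_derivative (\<lambda>e. a i q *\<^sub>R frechet_derivative (b i) (at q) e + frechet_derivative (a i) (at q) e *\<^sub>R b i q)) (at q)"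
        if "i \<in> I" "q \<in> U" for i q
        by (rule has_derivative_scaleR[OF Cs_unif_has_derivative[OF Suc.prems(1) that] Cs_unif_has_derivative[OF Suc.prems(2) that]])
      show "loc_bdd I (\<lambda>i q. a i q *\<^sub>R b i q) U"
        by (rule *) (use Suc.prems Cs_unif_loc_bdd in blast)+
      show "Cs_unif k I (\<lambda>i q. a i q *\<^sub>R frechet_derivative (b i) (at q) e + frechet_derivative (a i) (at q) e *\<^sub>R b i q) U" if "e \<in> Basis" for e
        by (intro Cs_unif_add[OF assms] Suc.IH Cs_unif_Suc_le[OF Suc.prems(1)] Cs_unif_Suc_le[OF Suc.prems(2)]
              Cs_unif_frechet[OF Suc.prems(1) that] Cs_unif_frechet[OF Suc.prems(2) that])
    qed
  }
qed

lemma Cs_unif_mult: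
  fixes a b :: "'i \<Rightarrow> 'q::euclidean_space \<Rightarrow> real"
  assumes "open U" "Cs_unif k I a U" "Cs_unif k I b U"
  shows "Cs_unif k I (\<lambda>i q. a i q * b i q) U"
  using Cs_unif_scaleR[OF assms] by simp

lemma Cs_unif_sum:
  assumes "open U" "finite J" "\<And>j. j \<in> J \<Longrightarrow> Cs_unif k I (a j) U"
  shows "Cs_unif k I (\<lambda>i q. \<Sum>j\<in>J. a j i q) U"
  using assms(2,3)
proof (induction J)
  case empty
  then show ?case using Cs_unif_const[of I "\<lambda>_. 0" 0] by simp
next
  case (insert j J)
  then show ?case by (auto intro!: Cs_unif_add[OF assms(1)])
qed

lemma Cs_unif_linear:
  assumes "open U" "bounded_linear A"
  shows "Cs_unif k I (\<lambda>i q. A q) U"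
proof -
  have bd: "loc_bdd I (\<lambda>i q. A q) U"
  proof (rule loc_bddI)
    fix q assume "q \<in> U"
    obtain K where K: "\<And>x. norm (A x) \<le> norm x * K" "K \<ge> 0"
      using bounded_linear.nonneg_bounded[OF assms(2)] by auto
    have "norm (A p) \<le> (norm q + 1) * K" if "p \<in> ball q 1" for p
    proof -
      have "norm p \<le> norm q + 1" using that norm_triangle_sub[of p q] by (simp add: dist_norm norm_minus_commute)
      then show ?thesis using K by (meson mult_right_mono order_trans)
    qed
    then show "\<exists>r>0. \<exists>B. \<forall>i\<in>I. \<forall>p\<in>U \<inter> ball q r. norm (A p) \<le> B"
      by (intro exI[of _ "1::real"] conjI exI[of _ "(norm q + 1) * K"]) auto
  qed
  show ?thesis
  proof (cases k)
    case 0
    then show ?thesis using bd linear_continuous_on[OF assms(2)] by simp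
  next
    case (Suc k')
    show ?thesis unfolding Suc
      by (rule Cs_unif_SucI[OF assms(1), where a' = "\<lambda>i q. A"])
         (auto intro!: bd bounded_linear_imp_has_derivative assms Cs_unif_const[of _ _ "norm (A _)"])
  qed
qed

section \<open>Composition, and passing between \<open>Cs_on\<close>, \<open>Csb_on\<close> and
  uniform families\<close>

lemma Csb_on_Suc_le: "Csb_on (Suc k) f U \<Longrightarrow> Csb_on k f U"
  by (induction k arbitrary: f) auto

lemma Cs_on_Suc_le: "Cs_on (Suc k) f U \<Longrightarrow> Cs_on k f U"
  by (induction k arbitrary: f) auto

lemma Cs_unif_imp_Cs_on: "Cs_unif k I a U \<Longrightarrow> i \<in> I \<Longrightarrow> Cs_on k (a i) U"
proof (induction k arbitrary: a)
  case (Suc k)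
  have "Cs_on k (\<lambda>p. frechet_derivative (a i) (at p) e) U" if "e \<in> Basis" for e
    using Suc.IH[OF Cs_unif_frechet[OF Suc.prems(1) that] Suc.prems(2)] by simp
  then show ?case using Suc.prems by simp
qed simp

lemma Csb_on_0: "Csb_on k h V \<Longrightarrow> Csb_on 0 h V"
  by (cases k) auto

text \<open>By the chain rule a partial derivative is a sum of products of partials of
  \<open>g i\<close> with composites of partials of \<open>h\<close>, so the induction runs over all
  \<open>h\<close> with \<open>g\<close> fixed. The bounds on \<open>h\<close> are global on
  \<open>V\<close>, because for varying \<open>i\<close> the points \<open>g i q\<close> may come
  arbitrarily close to the boundary of \<open>V\<close>, as the curves do near time 0.\<close>

lemma Cs_unif_compose:
  fixes h :: "'p::euclidean_space \<Rightarrow> 'b::real_normed_vector"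
  assumes "open U" and gV: "\<And>i q. i \<in> I \<Longrightarrow> q \<in> U \<Longrightarrow> g i q \<in> V"
  shows "Csb_on k h V \<Longrightarrow> Cs_unif k I g U \<Longrightarrow> Cs_unif k I (\<lambda>i q. h (g i q)) U"
proof (induction k arbitrary: h)
  have *: "loc_bdd I (\<lambda>i q. h (g i q)) U" if h: "Csb_on 0 h V" for h :: "'p \<Rightarrow> 'b"
  proof -
    obtain B where "\<forall>x\<in>V. norm (h x) \<le> B" using h by (auto simp: bounded_iff)
    then show ?thesis by (intro loc_bdd_if_bounded[of _ _ _ B]) (auto simp: gV)
  qed
  {
    case 0
    have "continuous_on U (\<lambda>q. h (g i q))" if "i \<in> I" for i
      by (rule continuous_on_compose2[of V h]) (use 0 that gV in auto)
    then show ?case using * 0 by simp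
  next
    case (Suc k)
    have hd: "(h has_derivative frechet_derivative h (at p)) (at p)" if "p \<in> V" for p
      using Suc.prems(1) that by (simp add: frechet_derivative_works[symmetric])
    show ?case
    proof (rule Cs_unif_SucI[OF assms(1), where a' = "\<lambda>i q e. \<Sum>b\<in>Basis. (frechet_derivative (g i) (at q) e \<bullet> b) *\<^sub>R frechet_derivative h (at (g i q)) b"])
      show "((\<lambda>q. h (g i q)) has_derivative (\<lambda>e. \<Sum>b\<in>Basis. (frechet_derivative (g i) (at q) e \<bullet> b) *\<^sub>R frechet_derivative h (at (g i q)) b)) (at q)"
        if iq: "i \<in> I" "q \<in> U" for i q
      proof -
        have lin: "linear (frechet_derivative h (at (g i q)))"
          using hd[OF gV[OF iq]] has_derivative_linear by blast
        have rep: "frechet_derivative h (at (g i q)) y = (\<Sum>b\<in>Basis. (y \<bullet> b) *\<^sub>R frechet_derivative h (at (g i q)) b)" for y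
          using linear_sum[OF lin, of "\<lambda>b. (y \<bullet> b) *\<^sub>R b" Basis] euclidean_representation[of y]
          by (simp add: linear_cmul[OF lin])
        show ?thesis
          unfolding rep[symmetric]
          by (rule has_derivative_compose[OF Cs_unif_has_derivative[OF Suc.prems(2) iq] hd[OF gV[OF iq]]])
      qed
      show "loc_bdd I (\<lambda>i q. h (g i q)) U" by (rule *[OF Csb_on_0[OF Suc.prems(1)]])
      show "Cs_unif k I (\<lambda>i q. \<Sum>b\<in>Basis. (frechet_derivative (g i) (at q) e \<bullet> b) *\<^sub>R frechet_derivative h (at (g i q)) b) U"
        if "e \<in> Basis" for e
      proof (rule Cs_unif_sum[OF assms(1) finite_Basis], rule Cs_unif_scaleR[OF assms(1)])
        fix b :: 'p assume b: "b \<in> Basis"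
        show "Cs_unif k I (\<lambda>i q. frechet_derivative (g i) (at q) e \<bullet> b) U"
          by (rule Cs_unif_bounded_linear[OF assms(1) bounded_linear_inner_left Cs_unif_frechet[OF Suc.prems(2) that]])
        show "Cs_unif k I (\<lambda>i q. frechet_derivative h (at (g i q)) b) U"
          by (rule Suc.IH[OF _ Cs_unif_Suc_le[OF Suc.prems(2)]]) (use Suc.prems(1) b in simp)
      qed
    qed
  }
qed

lemma Csb_on_imp_Cs_unif: "Csb_on k h V \<Longrightarrow> Cs_unif k I (\<lambda>_. h) V"
proof (induction k arbitrary: h)
  have *: "loc_bdd I (\<lambda>_. h) V" if h: "bounded (h ` V)" for h :: "'a \<Rightarrow> 'b"
  proof -
    obtain B where "\<forall>x\<in>V. norm (h x) \<le> B" using h by (auto simp: bounded_iff)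
    then show ?thesis by (intro loc_bdd_if_bounded[of _ _ _ B]) auto
  qed
  {
    case 0 then show ?case using * by simp
  next
    case (Suc k) then show ?case using * by simp
  }
qed

lemma Cs_on_subset: "Cs_on k f U \<Longrightarrow> W \<subseteq> U \<Longrightarrow> Cs_on k f W"
  by (induction k arbitrary: f) (auto intro: continuous_on_subset)

lemma Csb_on_subset: "Csb_on k f U \<Longrightarrow> W \<subseteq> U \<Longrightarrow> Csb_on k f W"
  by (induction k arbitrary: f) (auto intro: continuous_on_subset bounded_subset[OF _ image_mono])

lemma Cs_on_local:
  "(\<And>p. p \<in> U \<Longrightarrow> \<exists>W. open W \<and> p \<in> W \<and> Cs_on k f W) \<Longrightarrow> Cs_on k f U"
proof (induction k arbitrary: f)
  have *: "continuous_on U f" if "\<And>p. p \<in> U \<Longrightarrow> \<exists>W. open W \<and> p \<in> W \<and> continuous_on W f" for f :: "'a \<Rightarrow> 'b"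
    by (rule continuous_at_imp_continuous_on) (use that continuous_on_eq_continuous_at in blast)
  {
    case 0 then show ?case using * by simp
  next
    case (Suc k)
    have W: "\<exists>W. open W \<and> p \<in> W \<and> continuous_on W f \<and> f differentiable (at p) \<and>
        (\<forall>e\<in>Basis. Cs_on k (\<lambda>p. frechet_derivative f (at p) e) W)" if "p \<in> U" for p
      using Suc.prems[OF that] by auto
    have "continuous_on U f" by (rule *) (use W in meson)
    moreover have "Cs_on k (\<lambda>p. frechet_derivative f (at p) e) U" if "e \<in> Basis" for e
      by (rule Suc.IH) (use W that in meson)
    moreover have "\<forall>p\<in>U. f differentiable (at p)" using W by meson
    ultimately show ?case by simp
  }
qed

text \<open>Continuity bounds each derivative near \<open>p\<close>, and there are finitely many
  partials of each order, so finitely many neighbourhoods are intersected. This makes the uniform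
  calculus, with a one-point index set, available for plain \<open>Cs_on\<close>.\<close>

lemma Cs_on_imp_local_Csb_on:
  "open V \<Longrightarrow> p \<in> V \<Longrightarrow> Cs_on k h V \<Longrightarrow> \<exists>W. open W \<and> p \<in> W \<and> W \<subseteq> V \<and> Csb_on k h W"
proof (induction k arbitrary: h)
  have *: "\<exists>W. open W \<and> p \<in> W \<and> W \<subseteq> V \<and> bounded (h ` W)" if "continuous_on V h" "open V" "p \<in> V" for h :: "'a \<Rightarrow> 'b"
  proof -
    have "open (V \<inter> h -` ball (h p) 1)" using that by (simp add: continuous_open_preimage)
    moreover have "bounded (h ` (V \<inter> h -` ball (h p) 1))"
      by (rule bounded_subset[of "ball (h p) 1"]) auto
    ultimately show ?thesis using that by (intro exI[of _ "V \<inter> h -` ball (h p) 1"]) auto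
  qed
  {
    case 0
    then show ?case using *[of h] by simp (meson continuous_on_subset)
  next
    case (Suc k)
    obtain W0 where W0: "open W0" "p \<in> W0" "W0 \<subseteq> V" "bounded (h ` W0)" using *[of h] Suc.prems by auto
    have "\<exists>W. open W \<and> p \<in> W \<and> W \<subseteq> V \<and> Csb_on k (\<lambda>p. frechet_derivative h (at p) e) W" if "e \<in> Basis" for e
      by (rule Suc.IH) (use Suc.prems that in auto)
    then obtain W where W: "\<And>e. e \<in> Basis \<Longrightarrow> open (W e) \<and> p \<in> W e \<and> W e \<subseteq> V \<and> Csb_on k (\<lambda>p. frechet_derivative h (at p) e) (W e)"
      by metis
    define X where "X = W0 \<inter> (\<Inter>e\<in>Basis. W e)"
    have "open X" unfolding X_def by (intro open_Int W0 open_INT ballI finite_Basis) (use W in blast)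
    moreover have "p \<in> X" "X \<subseteq> V" using W W0 by (auto simp: X_def)
    moreover have "Csb_on (Suc k) h X"
    proof -
      have "Csb_on k (\<lambda>p. frechet_derivative h (at p) e) X" if "e \<in> Basis" for e
        by (rule Csb_on_subset[of _ _ "W e"]) (use W that X_def in auto)
      moreover have "bounded (h ` X)" by (rule bounded_subset[OF W0(4)]) (auto simp: X_def)
      ultimately show ?thesis using Suc.prems \<open>X \<subseteq> V\<close> by (auto intro: continuous_on_subset)
    qed
    ultimately show ?case by blast
  }
qed

lemma Cs_on_imp_Cs_unif_local:
  assumes "open U" "Cs_on k f U" "p \<in> U"
  obtains W where "open W" "p \<in> W" "W \<subseteq> U" "Cs_unif k {()} (\<lambda>_. f) W"
proof -
  obtain W where "open W" "p \<in> W" "W \<subseteq> U" "Csb_on k f W"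
    using Cs_on_imp_local_Csb_on[OF assms(1,3,2)] by auto
  then show ?thesis using that Csb_on_imp_Cs_unif by blast
qed

text \<open>Near \<open>g p\<close> the outer function has bounded derivatives; on the preimage of
  that neighbourhood the uniform composition lemma applies.\<close>

lemma Cs_on_compose:
  fixes h :: "'p::euclidean_space \<Rightarrow> 'b::real_normed_vector" and g :: "'q::euclidean_space \<Rightarrow> 'p"
  assumes "open U" "open V" "g ` U \<subseteq> V" "Cs_on k h V" "Cs_on k g U"
  shows "Cs_on k (\<lambda>q. h (g q)) U"
proof (rule Cs_on_local)
  fix p assume p: "p \<in> U"
  obtain W where W: "open W" "g p \<in> W" "W \<subseteq> V" "Csb_on k h W"
    using Cs_on_imp_local_Csb_on[OF assms(2) _ assms(4), of "g p"] assms(3) p by blast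
  have cg: "continuous_on U g" using assms(5) by (cases k) auto
  have o: "open (U \<inter> g -` W)" using cg assms(1) W(1) by (simp add: continuous_open_preimage)
  obtain X where X: "open X" "p \<in> X" "X \<subseteq> U \<inter> g -` W" "Cs_unif k {()} (\<lambda>_. g) X"
    using Cs_on_imp_Cs_unif_local[OF o Cs_on_subset[OF assms(5)], of p] p W(2) by auto
  have "Cs_unif k {()} (\<lambda>_ q. h (g q)) X"
    by (rule Cs_unif_compose[OF X(1) _ W(4) X(4)]) (use X(3) in auto)
  then have "Cs_on k (\<lambda>q. h (g q)) X" using Cs_unif_imp_Cs_on by fastforce
  then show "\<exists>W. open W \<and> p \<in> W \<and> Cs_on k (\<lambda>q. h (g q)) W" using X by blast
qed

section \<open>Linear Fredholm equations with parameters\<close>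

text \<open>Limits in the parameter are taken along sequences throughout, because the integrals in
  them are controlled by dominated convergence.\<close>

lemma tendsto_at_sequentiallyI:
  fixes g :: "'a::metric_space \<Rightarrow> 'b::topological_space"
  assumes "open W" "x \<in> W"
    and seq: "\<And>X. (\<And>n. X n \<in> W - {x}) \<Longrightarrow> X \<longlonglongrightarrow> x \<Longrightarrow> (\<lambda>n. g (X n)) \<longlonglongrightarrow> l"
  shows "(g \<longlongrightarrow> l) (at x)"
proof -
  have "(g \<longlongrightarrow> l) (at x within W)"
    unfolding tendsto_at_iff_sequentially comp_def using seq by blast
  then show ?thesis using assms(1,2) at_within_open by metis
qed

lemma has_derivative_iff_tendsto_real:
  fixes f :: "'a::real_normed_vector \<Rightarrow> real"
  shows "(f has_derivative f') (at q) \<longleftrightarrow>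
    bounded_linear f' \<and> ((\<lambda>p. (f p - f q - f' (p - q)) / norm (p - q)) \<longlongrightarrow> 0) (at q)"
  unfolding has_derivative_at_within
  by (metis (no_types, lifting) Lim_cong_within diff_diff_add divide_inverse_commute real_scaleR_def)

lemma has_derivative_seqD:
  fixes f :: "'a::real_normed_vector \<Rightarrow> real"
  assumes "(f has_derivative f') (at q)" "X \<longlonglongrightarrow> q" "\<And>n. X n \<noteq> q"
  shows "(\<lambda>n. (f (X n) - f q - f' (X n - q)) / norm (X n - q)) \<longlonglongrightarrow> 0"
proof -
  have "((\<lambda>p. (f p - f q - f' (p - q)) / norm (p - q)) \<longlongrightarrow> 0) (at q)"
    using assms(1) has_derivative_iff_tendsto_real by blast
  then show ?thesis
    using assms(2,3) unfolding tendsto_at_iff_sequentially comp_def by auto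
qed

lemma linear_Basis_expansion:
  fixes f :: "'a::euclidean_space \<Rightarrow> 'b::real_vector"
  assumes "linear f"
  shows "f v = (\<Sum>e\<in>Basis. (v \<bullet> e) *\<^sub>R f e)"
  using linear_sum[OF assms, of "\<lambda>e. (v \<bullet> e) *\<^sub>R e" Basis] euclidean_representation[of v]
  by (simp add: linear_cmul[OF assms])

lemma has_derivative_seqI:
  fixes f :: "'a::euclidean_space \<Rightarrow> real"
  assumes "open W" "q \<in> W"
    and "\<And>X. (\<And>n. X n \<in> W) \<Longrightarrow> (\<And>n. X n \<noteq> q) \<Longrightarrow> X \<longlonglongrightarrow> q \<Longrightarrow>
      (\<lambda>n. (f (X n) - f q - (\<Sum>e\<in>Basis. ((X n - q) \<bullet> e) * D e)) / norm (X n - q)) \<longlonglongrightarrow> 0"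
  shows "(f has_derivative (\<lambda>v. \<Sum>e\<in>Basis. (v \<bullet> e) * D e)) (at q)"
  unfolding has_derivative_iff_tendsto_real
proof
  show "bounded_linear (\<lambda>v. \<Sum>e\<in>Basis. (v \<bullet> e) * D e)"
    by (intro bounded_linear_sum bounded_linear_compose[OF bounded_linear_mult_left bounded_linear_inner_left])
  show "((\<lambda>p. (f p - f q - (\<Sum>e\<in>Basis. ((p - q) \<bullet> e) * D e)) / norm (p - q)) \<longlongrightarrow> 0) (at q)"
    by (rule tendsto_at_sequentiallyI[OF assms(1,2)]) (use assms(3) in auto)
qed

lemma has_derivative_partials_sum:
  fixes f :: "'a::euclidean_space \<Rightarrow> real"
  assumes "f differentiable (at q)"
  shows "(f has_derivative (\<lambda>v. \<Sum>e\<in>Basis. (v \<bullet> e) * frechet_derivative f (at q) e)) (at q)"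
proof -
  have d: "(f has_derivative frechet_derivative f (at q)) (at q)"
    using assms by (simp add: frechet_derivative_works[symmetric])
  have "frechet_derivative f (at q) = (\<lambda>v. \<Sum>e\<in>Basis. (v \<bullet> e) * frechet_derivative f (at q) e)"
    by (rule ext, subst linear_Basis_expansion[OF has_derivative_linear[OF d]], simp)
  then show ?thesis by (rule has_derivative_eq_rhs[OF d])
qed

text \<open>A derivative in direction \<open>e\<close> is the pointwise limit of difference
  quotients along one fixed null sequence, and each quotient is measurable in
  \<open>m\<close>.\<close>

lemma frechet_derivative_measurable:
  fixes a :: "'m \<Rightarrow> 'q::euclidean_space \<Rightarrow> real"
  assumes "open U" "q \<in> U" and meas: "\<And>p. p \<in> U \<Longrightarrow> (\<lambda>m. a m p) \<in> borel_measurable M"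
    and diff: "\<And>m. m \<in> space M \<Longrightarrow> a m differentiable (at q)"
  shows "(\<lambda>m. frechet_derivative (a m) (at q) e) \<in> borel_measurable M"
proof -
  obtain r where r: "r > 0" "ball q r \<subseteq> U" using assms(1,2) open_contains_ball by blast
  \<comment> \<open>The factor keeps \<open>q + h n *\<^sub>R e\<close> in the ball; the added 1
    covers \<open>e = 0\<close>.\<close>
  define h where "h n = r / (norm e + 1) * inverse (real (Suc n))" for n :: nat
  have h0: "h n > 0" for n unfolding h_def using r(1)
    by (intro divide_pos_pos mult_pos_pos) (auto simp: add_nonneg_pos)
  have hl: "h \<longlonglongrightarrow> 0" unfolding h_def
    using tendsto_mult[OF tendsto_const LIMSEQ_inverse_real_of_nat, of "r / (norm e + 1)"] by simp
  have inU: "q + h n *\<^sub>R e \<in> U" for n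
  proof -
    have "h n \<le> r / (norm e + 1) * 1" unfolding h_def
      by (rule mult_left_mono) (use r in \<open>auto simp: field_simps\<close>)
    then have "norm e * h n \<le> norm e * (r / (norm e + 1))" by (intro mult_left_mono) auto
    also have "\<dots> < r"
    proof -
      have "norm e * r < r * (norm e + 1)" using r(1) by (simp add: algebra_simps)
      moreover have "norm e + 1 > 0" by (simp add: add_nonneg_pos)
      ultimately show ?thesis by (simp add: pos_divide_less_eq)
    qed
    finally have "norm e * (h n) < r" .
    then show ?thesis using r h0[of n] by (auto simp: dist_norm mult.commute intro!: subsetD[OF r(2)])
  qed
  show ?thesis
  proof (rule borel_measurable_LIMSEQ_real)
    fix m assume m: "m \<in> space M"
    let ?D = "frechet_derivative (a m) (at q)"
    have d: "(a m has_derivative ?D) (at (q + 0 *\<^sub>R e))" using diff[OF m] by (simp add: frechet_derivative_works[symmetric])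
    have "((\<lambda>s. a m (q + s *\<^sub>R e)) has_derivative (\<lambda>s. ?D (s *\<^sub>R e))) (at 0)"
      by (rule has_derivative_compose[where f = "\<lambda>s. q + s *\<^sub>R e", OF _ d]) (auto intro!: derivative_eq_intros)
    then have "((\<lambda>s. a m (q + s *\<^sub>R e)) has_real_derivative ?D e) (at 0)"
      unfolding has_field_derivative_def
      by (simp add: linear_cmul[OF has_derivative_linear[OF d]] mult.commute[of _ "?D e"])
    then have "((\<lambda>s. (a m (q + s *\<^sub>R e) - a m q) / s) \<longlongrightarrow> ?D e) (at 0)"
      by (simp add: DERIV_def)
    then show "(\<lambda>n. (a m (q + h n *\<^sub>R e) - a m q) / h n) \<longlonglongrightarrow> ?D e"
      unfolding tendsto_at_iff_sequentially comp_def using hl h0 by (auto simp: less_le)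
  next
    show "(\<lambda>m. (a m (q + h n *\<^sub>R e) - a m q) / h n) \<in> borel_measurable M" for n
      using meas[OF inU] meas[OF assms(2)] by measurable
  qed
qed

text \<open>The partials are bounded near \<open>q\<close> uniformly in the index and balls are
  convex, so the mean value inequality gives one Lipschitz constant for the whole family. It
  dominates the difference quotients under an integral.\<close>

lemma Cs_unif_lipschitz:
  fixes a :: "'i \<Rightarrow> 'q::euclidean_space \<Rightarrow> real"
  assumes "open U" "Cs_unif (Suc k) I a U" "q \<in> U"
  obtains r K where "r > 0" "K > 0" "ball q r \<subseteq> U"
    "\<And>i p p'. i \<in> I \<Longrightarrow> p \<in> ball q r \<Longrightarrow> p' \<in> ball q r \<Longrightarrow> \<bar>a i p - a i p'\<bar> \<le> K * norm (p - p')"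
    "\<And>i p e. i \<in> I \<Longrightarrow> p \<in> ball q r \<Longrightarrow> e \<in> Basis \<Longrightarrow> \<bar>frechet_derivative (a i) (at p) e\<bar> \<le> K"
proof -
  have "\<exists>r B. r > 0 \<and> B > 0 \<and> (\<forall>i\<in>I. \<forall>p\<in>U. dist q p < r \<longrightarrow> norm (frechet_derivative (a i) (at p) e) \<le> B)" if "e \<in> Basis" for e
    using loc_bddE[OF Cs_unif_loc_bdd[OF Cs_unif_frechet[OF assms(2) that]] assms(3)] by metis
  then obtain r B where rB: "\<And>e. e \<in> Basis \<Longrightarrow> r e > 0 \<and> B e > 0 \<and>
      (\<forall>i\<in>I. \<forall>p\<in>U. dist q p < r e \<longrightarrow> norm (frechet_derivative (a i) (at p) e) \<le> B e)"
    by metis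
  obtain r0 where r0: "r0 > 0" "ball q r0 \<subseteq> U" using assms(1,3) open_contains_ball by blast
  define R where "R = Min (insert r0 (r ` Basis))"
  define K where "K = (\<Sum>e\<in>Basis. B e)"
  have R: "R > 0" "R \<le> r0" "\<And>e. e \<in> Basis \<Longrightarrow> R \<le> r e"
    using rB r0 unfolding R_def by (auto intro!: Min_le simp del: Min_insert)
  have K0: "K > 0" unfolding K_def using rB by (intro sum_pos) auto
  have sub: "ball q R \<subseteq> U" using R r0 by auto
  have bd: "\<bar>frechet_derivative (a i) (at p) e\<bar> \<le> B e" if "i \<in> I" "p \<in> ball q R" "e \<in> Basis" for i p e
    using rB[OF that(3)] R(3)[OF that(3)] that sub by auto
  have BK: "B e \<le> K" if "e \<in> Basis" for e
    unfolding K_def by (rule member_le_sum) (use that rB in \<open>auto intro: less_imp_le\<close>)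
  show ?thesis
  proof (rule that[OF R(1) K0 sub])
    fix i p p' assume i: "i \<in> I" and pp: "p \<in> ball q R" "p' \<in> ball q R"
    show "\<bar>a i p - a i p'\<bar> \<le> K * norm (p - p')"
      unfolding real_norm_def[symmetric]
    proof (rule differentiable_bound[where S = "ball q R" and f' = "\<lambda>x. frechet_derivative (a i) (at x)"])
      fix x assume x: "x \<in> ball q R"
      have d: "(a i has_derivative frechet_derivative (a i) (at x)) (at x)"
        by (rule Cs_unif_has_derivative[OF assms(2) i]) (use x sub in auto)
      then show "(a i has_derivative frechet_derivative (a i) (at x)) (at x within ball q R)"
        by (rule has_derivative_at_withinI)
      show "onorm (frechet_derivative (a i) (at x)) \<le> K"
      proof (rule onorm_le)
        fix v
        have "norm (frechet_derivative (a i) (at x) v) = \<bar>\<Sum>e\<in>Basis. (v \<bullet> e) * frechet_derivative (a i) (at x) e\<bar>"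
          by (subst linear_Basis_expansion[OF has_derivative_linear[OF d]]) simp
        also have "\<dots> \<le> (\<Sum>e\<in>Basis. norm v * B e)"
          by (rule order_trans[OF sum_abs], rule sum_mono)
             (auto simp: abs_mult intro!: mult_mono Basis_le_norm bd i x)
        finally show "norm (frechet_derivative (a i) (at x) v) \<le> K * norm v"
          by (simp add: K_def sum_distrib_left mult.commute)
      qed
    qed (use pp in auto)
  next
    fix i p e assume "i \<in> I" "p \<in> ball q R" "e \<in> (Basis::'q set)"
    then show "\<bar>frechet_derivative (a i) (at p) e\<bar> \<le> K" using bd BK by (meson order_trans)
  qed
qed

section \<open>Differentiation under the integral sign\<close>

context finite_measure begin

lemma integral_tendsto_bounded:
  fixes f :: "nat \<Rightarrow> 'a \<Rightarrow> real"
  assumes "\<And>n. f n \<in> borel_measurable M" "\<And>x. x \<in> space M \<Longrightarrow> (\<lambda>n. f n x) \<longlonglongrightarrow> g x"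
    and "\<And>n x. x \<in> space M \<Longrightarrow> \<bar>f n x\<bar> \<le> K"
  shows "(\<lambda>n. \<integral>x. f n x \<partial>M) \<longlonglongrightarrow> (\<integral>x. g x \<partial>M)"
proof (rule integral_dominated_convergence[where w = "\<lambda>_. K"])
  show "g \<in> borel_measurable M" by (rule borel_measurable_LIMSEQ_real[OF assms(2,1)])
qed (use assms in auto)

lemma integrable_bounded:
  fixes f :: "'a \<Rightarrow> real"
  assumes "f \<in> borel_measurable M" "\<And>x. x \<in> space M \<Longrightarrow> \<bar>f x\<bar> \<le> K"
  shows "integrable M f"
  by (rule integrable_const_bound[where B = K]) (use assms in auto)

lemma integral_abs_bounded:
  fixes f :: "'a \<Rightarrow> real"
  assumes "\<And>x. x \<in> space M \<Longrightarrow> \<bar>f x\<bar> \<le> K" "K \<ge> 0"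
  shows "\<bar>\<integral>x. f x \<partial>M\<bar> \<le> K * measure M (space M)"
proof -
  have "\<bar>\<integral>x. f x \<partial>M\<bar> \<le> (\<integral>x. \<bar>f x\<bar> \<partial>M)" by (rule integral_abs_bound)
  also have "\<dots> \<le> (\<integral>x. K \<partial>M)" by (rule integral_mono') (use assms in auto)
  finally show ?thesis by (simp add: mult.commute)
qed

text \<open>The Taylor remainder divided by the increment tends to 0 at each point of the measure
  space and is bounded through the common Lipschitz constant, so dominated convergence gives the
  derivative. The new integrand is measurable by \<open>frechet_derivative_measurable\<close>, which
  lets the induction continue.\<close>

lemma Cs_unif_integral:
  fixes a :: "'i \<times> 'a \<Rightarrow> 'q::euclidean_space \<Rightarrow> real"
  assumes U: "open U"
  shows "Cs_unif k (I \<times> space M) a U \<Longrightarrow>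
    (\<And>i q. i \<in> I \<Longrightarrow> q \<in> U \<Longrightarrow> (\<lambda>x. a (i, x) q) \<in> borel_measurable M) \<Longrightarrow>
    Cs_unif k I (\<lambda>i q. \<integral>x. a (i, x) q \<partial>M) U"
proof (induction k arbitrary: a)
  have bd: "loc_bdd I (\<lambda>i q. \<integral>x. a (i, x) q \<partial>M) U" if "loc_bdd (I \<times> space M) a U" for a :: "'i \<times> 'a \<Rightarrow> 'q \<Rightarrow> real"
  proof (rule loc_bddI)
    fix q assume "q \<in> U"
    then obtain r B where rB: "r > 0" "B > 0" "\<And>i p. i \<in> I \<times> space M \<Longrightarrow> p \<in> U \<Longrightarrow> dist q p < r \<Longrightarrow> norm (a i p) \<le> B"
      using loc_bddE[OF \<open>loc_bdd (I \<times> space M) a U\<close>] by metis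
    show "\<exists>r>0. \<exists>B. \<forall>i\<in>I. \<forall>p\<in>U \<inter> ball q r. norm (\<integral>x. a (i, x) p \<partial>M) \<le> B"
      by (rule exI[of _ r], rule conjI[OF rB(1)], rule exI[of _ "B * measure M (space M)"])
         (use rB in \<open>auto intro!: integral_abs_bounded simp: \<close>)
  qed
  {
    case 0
    have "continuous_on U (\<lambda>q. \<integral>x. a (i, x) q \<partial>M)" if i: "i \<in> I" for i
      unfolding continuous_on_sequentially comp_def
    proof (intro allI ballI impI)
      fix X q assume q: "q \<in> U" and X: "(\<forall>n. X n \<in> U) \<and> X \<longlonglongrightarrow> q"
      obtain r B where rB: "r > 0" "B > 0" "\<And>i p. i \<in> I \<times> space M \<Longrightarrow> p \<in> U \<Longrightarrow> dist q p < r \<Longrightarrow> norm (a i p) \<le> B"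
        using loc_bddE[OF Cs_unif_loc_bdd[OF 0(1)] q] by metis
      obtain n0 where n0: "\<And>n. n \<ge> n0 \<Longrightarrow> dist (X n) q < r"
        using X rB(1) unfolding lim_sequentially by blast
      show "(\<lambda>n. \<integral>x. a (i, x) (X n) \<partial>M) \<longlonglongrightarrow> (\<integral>x. a (i, x) q \<partial>M)"
      \<comment> \<open>Only the tail lies in the ball on which \<open>B\<close> bounds the
        integrand.\<close>
      proof (rule LIMSEQ_offset[where k = n0], rule integral_tendsto_bounded)
        show "(\<lambda>x. a (i, x) (X (n + n0))) \<in> borel_measurable M" for n using 0(2)[OF i] X by blast
        show "(\<lambda>n. a (i, x) (X (n + n0))) \<longlonglongrightarrow> a (i, x) q" if "x \<in> space M" for x
        proof -
          have "continuous_on U (a (i, x))" using 0(1) i that by auto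
          then have "(\<lambda>n. a (i, x) (X n)) \<longlonglongrightarrow> a (i, x) q"
            using X q unfolding continuous_on_sequentially comp_def by blast
          then show ?thesis by (rule LIMSEQ_ignore_initial_segment)
        qed
        show "\<bar>a (i, x) (X (n + n0))\<bar> \<le> B" if "x \<in> space M" for n x
          using rB(3)[of "(i,x)" "X (n + n0)"] X n0[of "n+n0"] i that by (auto simp: dist_commute)
      qed
    qed
    then show ?case using bd[of a] 0(1) by simp
  next
    case (Suc k)
    show ?case
    proof (rule Cs_unif_SucI[OF U, where a' = "\<lambda>i q v. \<Sum>e\<in>Basis. (v \<bullet> e) * (\<integral>x. frechet_derivative (a (i, x)) (at q) e \<partial>M)"])
      have meas: "(\<lambda>x. frechet_derivative (a (i, x)) (at q) e) \<in> borel_measurable M" if "i \<in> I" "q \<in> U" for i q e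
        by (rule frechet_derivative_measurable[OF U that(2)]) (use Suc.prems that in auto)
      show "loc_bdd I (\<lambda>i q. \<integral>x. a (i, x) q \<partial>M) U" by (rule bd[OF Cs_unif_loc_bdd[OF Suc.prems(1)]])
      show "Cs_unif k I (\<lambda>i q. \<Sum>e'\<in>Basis. (e \<bullet> e') * (\<integral>x. frechet_derivative (a (i, x)) (at q) e' \<partial>M)) U"
        if e: "e \<in> Basis" for e
      proof -
        have "Cs_unif k I (\<lambda>i q. \<integral>x. (\<lambda>ix q. frechet_derivative (a ix) (at q) e) (i, x) q \<partial>M) U"
          by (rule Suc.IH[OF Cs_unif_frechet[OF Suc.prems(1) e]]) (use meas in auto)
        moreover have "(\<Sum>e'\<in>Basis. (e \<bullet> e') * (\<integral>x. frechet_derivative (a (i, x)) (at q) e' \<partial>M)) = (\<integral>x. frechet_derivative (a (i, x)) (at q) e \<partial>M)" for i q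
          using e by (simp add: inner_Basis if_distrib[of "\<lambda>x. x * _"] sum.delta cong: if_cong)
        ultimately show ?thesis by simp
      qed
      fix i q assume i: "i \<in> I" and q: "q \<in> U"
      obtain r K where rK: "r > 0" "K > 0" "ball q r \<subseteq> U"
        "\<And>i p p'. i \<in> I \<times> space M \<Longrightarrow> p \<in> ball q r \<Longrightarrow> p' \<in> ball q r \<Longrightarrow> \<bar>a i p - a i p'\<bar> \<le> K * norm (p - p')"
        "\<And>i p e. i \<in> I \<times> space M \<Longrightarrow> p \<in> ball q r \<Longrightarrow> e \<in> Basis \<Longrightarrow> \<bar>frechet_derivative (a i) (at p) e\<bar> \<le> K"
        using Cs_unif_lipschitz[OF U Suc.prems(1) q] by metis
      obtain r' B where rB: "r' > 0" "B > 0" "\<And>i p. i \<in> I \<times> space M \<Longrightarrow> p \<in> U \<Longrightarrow> dist q p < r' \<Longrightarrow> norm (a i p) \<le> B"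
        using loc_bddE[OF Cs_unif_loc_bdd[OF Suc.prems(1)] q] by metis
      show "((\<lambda>q. \<integral>x. a (i, x) q \<partial>M) has_derivative (\<lambda>v. \<Sum>e\<in>Basis. (v \<bullet> e) * (\<integral>x. frechet_derivative (a (i, x)) (at q) e \<partial>M))) (at q)"
      proof (rule has_derivative_seqI[where W = "ball q (min r r')"])
        fix X assume X: "\<And>n. X n \<in> ball q (min r r')" "\<And>n. X n \<noteq> q" "X \<longlonglongrightarrow> q"
        let ?D = "\<lambda>x e. frechet_derivative (a (i, x)) (at q) e"
        let ?R = "\<lambda>n x. (a (i, x) (X n) - a (i, x) q - (\<Sum>e\<in>Basis. ((X n - q) \<bullet> e) * ?D x e)) / norm (X n - q)"
        have XU: "X n \<in> U" for n using X(1)[of n] rK(3) by auto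
        have "(\<lambda>n. \<integral>x. ?R n x \<partial>M) \<longlonglongrightarrow> (\<integral>x. 0 \<partial>M)"
        proof (rule integral_tendsto_bounded)
          show "?R n \<in> borel_measurable M" for n
            using Suc.prems(2)[OF i q] Suc.prems(2)[OF i XU] meas[OF i q] by measurable
          show "(\<lambda>n. ?R n x) \<longlonglongrightarrow> 0" if x: "x \<in> space M" for x
          proof (rule has_derivative_seqD[OF has_derivative_partials_sum X(3,2)])
            show "a (i, x) differentiable at q" using Suc.prems(1) i x q by auto
          qed
          \<comment> \<open>\<open>K\<close> from the increment of \<open>a\<close>, and another
            \<open>K\<close> for each coordinate of the linear part.\<close>
          show "\<bar>?R n x\<bar> \<le> K + DIM('q) * K" if x: "x \<in> space M" for n x
          proof -
            have "\<bar>a (i, x) (X n) - a (i, x) q\<bar> \<le> K * norm (X n - q)" using rK(4)[of "(i,x)" "X n" q] X(1)[of n] i x rK(1) by auto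
            moreover have "\<bar>\<Sum>e\<in>Basis. ((X n - q) \<bullet> e) * ?D x e\<bar> \<le> (\<Sum>e\<in>(Basis::'q set). norm (X n - q) * K)"
              by (rule order_trans[OF sum_abs], rule sum_mono)
                 (use rK i x in \<open>auto simp: abs_mult intro!: mult_mono Basis_le_norm\<close>)
            ultimately have "\<bar>a (i, x) (X n) - a (i, x) q - (\<Sum>e\<in>Basis. ((X n - q) \<bullet> e) * ?D x e)\<bar> \<le> (K + DIM('q) * K) * norm (X n - q)"
              by (simp add: algebra_simps)
            then show ?thesis using X(2)[of n] by (simp add: divide_le_eq)
          qed
        qed
        moreover have "(\<integral>x. ?R n x \<partial>M) = ((\<integral>x. a (i, x) (X n) \<partial>M) - (\<integral>x. a (i, x) q \<partial>M) - (\<Sum>e\<in>Basis. ((X n - q) \<bullet> e) * (\<integral>x. ?D x e \<partial>M))) / norm (X n - q)" for n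
        proof -
          have i1: "integrable M (\<lambda>x. a (i, x) (X n))" "integrable M (\<lambda>x. a (i, x) q)"
            by (rule integrable_bounded[where K = B], use Suc.prems(2) i XU q in blast,
                use rB(3)[of "(i,_)"] rB(1) X(1)[of n] i XU q in auto)+
          have i2: "integrable M (\<lambda>x. ?D x e)" if "e \<in> Basis" for e
            by (rule integrable_bounded[where K = K]) (use meas[OF i q] rK(5)[of "(i,_)" q e] rK(1) i that in auto)
          show ?thesis using i1 i2 by (simp add: Bochner_Integration.integral_sum)
        qed
        ultimately show "(\<lambda>n. ((\<integral>x. a (i, x) (X n) \<partial>M) - (\<integral>x. a (i, x) q \<partial>M) - (\<Sum>e\<in>Basis. ((X n - q) \<bullet> e) * (\<integral>x. ?D x e \<partial>M))) / norm (X n - q)) \<longlonglongrightarrow> 0"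
          by (simp only: Bochner_Integration.integral_zero)
      qed (use rK rB in auto)
    qed
  }
qed

end

section \<open>Kernels of operator norm at most 1/2: absorption, existence,
  differentiability\<close>

locale fredholm = finite_measure M for M :: "'m measure" +
  fixes B :: real
  assumes B_nonneg: "B \<ge> 0" and B_small: "B * measure M (space M) \<le> 1/2"
begin

text \<open>After integration of the last premise, the mean of the absolute value of
  \<open>r\<close> reappears on the right with a factor at most 1/2 and is absorbed; boundedness of
  \<open>r\<close> makes it finite, so the subtraction is legitimate.\<close>

lemma mean_abs_bound:
  fixes r :: "'m \<Rightarrow> real"
  assumes "r \<in> borel_measurable M" "\<And>m. m \<in> space M \<Longrightarrow> \<bar>r m\<bar> \<le> C"
    and "\<rho> \<in> borel_measurable M" "\<And>m. m \<in> space M \<Longrightarrow> \<bar>\<rho> m\<bar> \<le> C'"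
    and "\<And>m. m \<in> space M \<Longrightarrow> \<bar>r m\<bar> \<le> \<rho> m + B * (\<integral>x. \<bar>r x\<bar> \<partial>M)"
  shows "(\<integral>x. \<bar>r x\<bar> \<partial>M) \<le> 2 * (\<integral>x. \<rho> x \<partial>M)"
proof -
  let ?I = "\<integral>x. \<bar>r x\<bar> \<partial>M"
  have i: "integrable M (\<lambda>x. \<bar>r x\<bar>)" "integrable M \<rho>"
    by (rule integrable_bounded[of _ C], use assms in auto) (rule integrable_bounded[of _ C'], use assms in auto)
  have I0: "?I \<ge> 0" by simp
  have "?I \<le> (\<integral>x. \<rho> x + B * ?I \<partial>M)"
    by (rule integral_mono) (use i assms in auto)
  also have "\<dots> = (\<integral>x. \<rho> x \<partial>M) + (B * measure M (space M)) * ?I" using i by (simp add: mult_ac)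
  also have "(B * measure M (space M)) * ?I \<le> 1/2 * ?I"
    by (rule mult_right_mono[OF B_small I0])
  finally show ?thesis by simp
qed

text \<open>The crude bound \<open>C\<close> serves to make the integrals finite. The result depends
  on the source alone, so a solution is locally bounded in a parameter wherever its source
  is.\<close>

lemma abs_bound_self_improve:
  fixes r :: "'m \<Rightarrow> real"
  assumes "r \<in> borel_measurable M" "\<And>m. m \<in> space M \<Longrightarrow> \<bar>r m\<bar> \<le> C"
    and "\<And>m. m \<in> space M \<Longrightarrow> \<bar>r m\<bar> \<le> A + B * (\<integral>x. \<bar>r x\<bar> \<partial>M)" "A \<ge> 0" "m \<in> space M"
  shows "\<bar>r m\<bar> \<le> 2 * A"
proof -
  have "(\<integral>x. \<bar>r x\<bar> \<partial>M) \<le> 2 * (\<integral>x. A \<partial>M)"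
    by (rule mean_abs_bound[OF assms(1,2) _ _ assms(3), of "\<bar>A\<bar>"]) auto
  then have "B * (\<integral>x. \<bar>r x\<bar> \<partial>M) \<le> B * (2 * (measure M (space M) * A))"
    by (intro mult_left_mono B_nonneg) simp
  also have "\<dots> = 2 * A * (B * measure M (space M))" by simp
  also have "\<dots> \<le> 2 * A * (1/2)" by (intro mult_left_mono B_small) (use assms(4) in simp)
  finally show ?thesis using assms(3)[OF assms(5)] by simp
qed

text \<open>The means of the absolute values of \<open>r n\<close> vanish first, by
  \<open>mean_abs_bound\<close> and dominated convergence for \<open>\<rho> n\<close>; the pointwise
  inequality then gives convergence at each \<open>m\<close>.\<close>

lemma tendsto_zero_self_improve:
  fixes r \<rho> :: "nat \<Rightarrow> 'm \<Rightarrow> real"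
  assumes "\<And>n. r n \<in> borel_measurable M" "\<And>n m. m \<in> space M \<Longrightarrow> \<bar>r n m\<bar> \<le> C"
    and "\<And>n. \<rho> n \<in> borel_measurable M" "\<And>n m. m \<in> space M \<Longrightarrow> \<bar>\<rho> n m\<bar> \<le> C'"
    and "\<And>n m. m \<in> space M \<Longrightarrow> \<bar>r n m\<bar> \<le> \<bar>\<rho> n m\<bar> + B * (\<integral>x. \<bar>r n x\<bar> \<partial>M)"
    and lim: "\<And>m. m \<in> space M \<Longrightarrow> (\<lambda>n. \<rho> n m) \<longlonglongrightarrow> 0" and m: "m \<in> space M"
  shows "(\<lambda>n. r n m) \<longlonglongrightarrow> 0"
proof -
  let ?I = "\<lambda>n. \<integral>x. \<bar>r n x\<bar> \<partial>M"
  have "(\<lambda>n. \<integral>x. \<bar>\<rho> n x\<bar> \<partial>M) \<longlonglongrightarrow> (\<integral>x. 0 \<partial>M)"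
    by (rule integral_tendsto_bounded[where K = C']) (use assms lim in \<open>auto intro: tendsto_rabs_zero\<close>)
  then have l2: "(\<lambda>n. 2 * (\<integral>x. \<bar>\<rho> n x\<bar> \<partial>M)) \<longlonglongrightarrow> 0"
    using tendsto_mult_right_zero[of _ sequentially 2] by simp
  have "?I n \<le> 2 * (\<integral>x. \<bar>\<rho> n x\<bar> \<partial>M)" for n
    by (rule mean_abs_bound[OF assms(1,2)]) (use assms in auto)
  then have "?I \<longlonglongrightarrow> 0"
    by (intro tendsto_sandwich[OF _ _ tendsto_const l2]) auto
  then have "(\<lambda>n. \<bar>\<rho> n m\<bar> + B * ?I n) \<longlonglongrightarrow> 0 + B * 0"
    by (intro tendsto_intros tendsto_rabs_zero lim m)
  then have "(\<lambda>n. \<bar>\<rho> n m\<bar> + B * ?I n) \<longlonglongrightarrow> 0" by simp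
  then show ?thesis
    by (rule Lim_null_comparison[rotated]) (use assms(5)[OF m] in auto)
qed

lemma kernel_bound:
  fixes r :: "'m \<Rightarrow> real"
  assumes "r \<in> borel_measurable M" "\<And>m. m \<in> space M \<Longrightarrow> \<bar>r m\<bar> \<le> C"
    and "\<And>x. x \<in> space M \<Longrightarrow> \<bar>N x\<bar> \<le> B"
  shows "\<bar>\<integral>x. N x * r x \<partial>M\<bar> \<le> B * (\<integral>x. \<bar>r x\<bar> \<partial>M)"
proof -
  have "\<bar>\<integral>x. N x * r x \<partial>M\<bar> \<le> (\<integral>x. \<bar>N x * r x\<bar> \<partial>M)" by (rule integral_abs_bound)
  also have "\<dots> \<le> (\<integral>x. B * \<bar>r x\<bar> \<partial>M)"
    by (rule integral_mono')
       (use assms B_nonneg in \<open>auto simp: abs_mult intro!: mult_mono integrable_mult_right integrable_bounded[of _ C]\<close>)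
  finally show ?thesis by simp
qed

lemma kernel_integrable:
  fixes r :: "'m \<Rightarrow> real"
  assumes "r \<in> borel_measurable M" "\<And>m. m \<in> space M \<Longrightarrow> \<bar>r m\<bar> \<le> C"
    and "\<And>x. x \<in> space M \<Longrightarrow> \<bar>N x\<bar> \<le> B'" "N \<in> borel_measurable M"
  shows "integrable M (\<lambda>x. N x * r x)"
proof (rule integrable_bounded)
  show "(\<lambda>x. N x * r x) \<in> borel_measurable M" using assms by measurable
  show "\<bar>N x * r x\<bar> \<le> \<bar>B'\<bar> * \<bar>C\<bar>" if "x \<in> space M" for x
    unfolding abs_mult using assms(2,3)[OF that] by (intro mult_mono) linarith+
qed

lemma kernel_measurable:
  fixes r :: "'m \<Rightarrow> real"
  assumes "r \<in> borel_measurable M" "(\<lambda>p. N p) \<in> borel_measurable (M \<Otimes>\<^sub>M M)"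
  shows "(\<lambda>m. \<integral>x. N (m, x) * r x \<partial>M) \<in> borel_measurable M"
proof (rule borel_measurable_lebesgue_integral)
  have "(\<lambda>p. N p * r (snd p)) \<in> borel_measurable (M \<Otimes>\<^sub>M M)" using assms by measurable
  then show "(\<lambda>(m, x). N (m, x) * r x) \<in> borel_measurable (M \<Otimes>\<^sub>M M)" by (simp add: case_prod_unfold)
qed

text \<open>Picard iteration from 0. Each application of the operator halves the sup norm, so
  increments decay geometrically, and 2 C is an invariant bound: C + (2 C) / 2 = 2 C. Pointwise
  limits are enough, since measurability and, by dominated convergence, the equation pass to the
  limit.\<close>

lemma solution_exists:
  fixes b :: "'m \<Rightarrow> real" and N :: "'m \<times> 'm \<Rightarrow> real"
  assumes b: "b \<in> borel_measurable M" "\<And>m. m \<in> space M \<Longrightarrow> \<bar>b m\<bar> \<le> C" "C \<ge> 0"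
    and N: "N \<in> borel_measurable (M \<Otimes>\<^sub>M M)" "\<And>m x. m \<in> space M \<Longrightarrow> x \<in> space M \<Longrightarrow> \<bar>N (m, x)\<bar> \<le> B"
  obtains y where "y \<in> borel_measurable M" "\<And>m. m \<in> space M \<Longrightarrow> \<bar>y m\<bar> \<le> 2 * C"
    "\<And>m. m \<in> space M \<Longrightarrow> y m = b m + (\<integral>x. N (m, x) * y x \<partial>M)"
proof -
  define Y where "Y n = ((\<lambda>y m. b m + (\<integral>x. N (m, x) * y x \<partial>M)) ^^ n) (\<lambda>_. 0)" for n
  have YS: "Y (Suc n) m = b m + (\<integral>x. N (m, x) * Y n x \<partial>M)" for n m by (simp add: Y_def)
  have Nm: "(\<lambda>x. N (m, x)) \<in> borel_measurable M" if "m \<in> space M" for m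
    using measurable_Pair2[OF N(1) that] by simp
  have int_half: "\<bar>\<integral>x. N (m, x) * r x \<partial>M\<bar> \<le> K / 2"
    if "m \<in> space M" "\<And>x. x \<in> space M \<Longrightarrow> \<bar>r x\<bar> \<le> K" "K \<ge> 0" for m K and r :: "'m \<Rightarrow> real"
  proof -
    have "\<bar>\<integral>x. N (m, x) * r x \<partial>M\<bar> \<le> (B * K) * measure M (space M)"
      by (rule integral_abs_bounded) (use that N B_nonneg in \<open>auto simp: abs_mult intro!: mult_mono\<close>)
    also have "\<dots> = (B * measure M (space M)) * K" by simp
    also have "\<dots> \<le> 1/2 * K" by (intro mult_right_mono B_small that)
    finally show ?thesis by simp
  qed
  have Y: "Y n \<in> borel_measurable M \<and> (\<forall>m\<in>space M. \<bar>Y n m\<bar> \<le> 2 * C)" for n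
  proof (induction n)
    case 0 then show ?case using b(3) by (simp add: Y_def)
  next
    case (Suc n)
    have "Y (Suc n) \<in> borel_measurable M"
      unfolding YS[abs_def] by (intro borel_measurable_add b kernel_measurable N) (use Suc in auto)
    moreover have "\<bar>Y (Suc n) m\<bar> \<le> 2 * C" if "m \<in> space M" for m
    proof -
      have "\<bar>\<integral>x. N (m, x) * Y n x \<partial>M\<bar> \<le> 2 * C / 2"
        by (rule int_half[OF that]) (use Suc b in auto)
      then show ?thesis using b(2)[OF that] unfolding YS by linarith
    qed
    ultimately show ?case by simp
  qed
  have d: "\<bar>Y (Suc n) m - Y n m\<bar> \<le> C * (1/2) ^ n" if "m \<in> space M" for n m
    using that
  proof (induction n arbitrary: m)
    case 0 then show ?case using b by (simp add: Y_def)
  next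
    case (Suc n)
    have i: "integrable M (\<lambda>x. N (m, x) * Y k x)" for k
      by (rule kernel_integrable[where C = "2 * C" and B' = B]) (use Y N(2) Nm Suc.prems in auto)
    have "Y (Suc (Suc n)) m - Y (Suc n) m = (\<integral>x. N (m, x) * (Y (Suc n) x - Y n x) \<partial>M)"
      unfolding YS[of "Suc n" m] YS[of n m] using i by (simp add: right_diff_distrib)
    also have "\<bar>\<dots>\<bar> \<le> C * (1/2) ^ n / 2"
      by (rule int_half) (use Suc b in auto)
    finally show ?case by simp
  qed
  have "convergent (\<lambda>n. Y n m)" if "m \<in> space M" for m
  proof -
    have "summable (\<lambda>n. Y (Suc n) m - Y n m)"
      by (rule summable_comparison_test'[where N = 0 and g = "\<lambda>n. C * (1/2) ^ n"])
         (use d[OF that] in \<open>auto intro!: summable_mult summable_geometric\<close>)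
    then have "(\<lambda>n. \<Sum>i<n. Y (Suc i) m - Y i m) \<longlonglongrightarrow> (\<Sum>n. Y (Suc n) m - Y n m)"
      by (rule summable_LIMSEQ)
    then have "(\<lambda>n. Y n m - Y 0 m) \<longlonglongrightarrow> (\<Sum>n. Y (Suc n) m - Y n m)"
      by (simp only: sum_lessThan_telescope[of "\<lambda>n. Y n m"])
    then show ?thesis by (auto simp: Y_def convergent_def)
  qed
  then have lim: "(\<lambda>n. Y n m) \<longlonglongrightarrow> lim (\<lambda>n. Y n m)" if "m \<in> space M" for m
    using that convergent_LIMSEQ_iff by blast
  define y where "y m = lim (\<lambda>n. Y n m)" for m
  show ?thesis
  proof (rule that)
    show ym: "y \<in> borel_measurable M"
      by (rule borel_measurable_LIMSEQ_real[of _ Y]) (use lim Y in \<open>auto simp: y_def\<close>)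
    show "\<bar>y m\<bar> \<le> 2 * C" if "m \<in> space M" for m
      by (rule LIMSEQ_le_const2[OF tendsto_rabs[OF lim[OF that, folded y_def]]]) (use Y that in auto)
    show "y m = b m + (\<integral>x. N (m, x) * y x \<partial>M)" if m: "m \<in> space M" for m
    proof (rule LIMSEQ_unique)
      show "(\<lambda>n. Y (Suc n) m) \<longlonglongrightarrow> y m" unfolding y_def by (rule LIMSEQ_Suc[OF lim[OF m]])
      have "(\<lambda>n. \<integral>x. N (m, x) * Y n x \<partial>M) \<longlonglongrightarrow> (\<integral>x. N (m, x) * y x \<partial>M)"
      proof (rule integral_tendsto_bounded)
        show "(\<lambda>x. N (m, x) * Y n x) \<in> borel_measurable M" for n
          by (intro borel_measurable_times Nm[OF m]) (use Y in auto)
        show "(\<lambda>n. N (m, x) * Y n x) \<longlonglongrightarrow> N (m, x) * y x" if "x \<in> space M" for x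
          unfolding y_def by (intro tendsto_intros lim that)
        show "\<bar>N (m, x) * Y n x\<bar> \<le> B * (2 * C)" if "x \<in> space M" for x n
          using N(2)[OF m that] Y that B_nonneg by (auto simp: abs_mult intro!: mult_mono)
      qed
      then show "(\<lambda>n. Y (Suc n) m) \<longlonglongrightarrow> b m + (\<integral>x. N (m, x) * y x \<partial>M)"
        unfolding YS by (intro tendsto_intros)
    qed
  qed
qed

text \<open>The remainder quotients \<open>R n\<close> of \<open>c\<close> with candidate derivative
  \<open>y\<close> satisfy the same linear equation, with a source \<open>\<rho> n\<close> that
  tends to 0 by \<open>rem\<close>; hence they tend to 0 as well. Only an approximate linear
  equation for the increments of \<open>c\<close> is asked for, so the lemma serves both for
  solutions of linear equations and for the curves, which solve a nonlinear one.\<close>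

lemma solution_has_derivative:
  fixes c :: "'m \<Rightarrow> 'q::euclidean_space \<Rightarrow> real" and N :: "'m \<times> 'm \<Rightarrow> real"
  assumes r: "r > 0"
    and cm: "\<And>p. p \<in> ball q r \<Longrightarrow> (\<lambda>m. c m p) \<in> borel_measurable M"
    and lip: "\<And>m p. m \<in> space M \<Longrightarrow> p \<in> ball q r \<Longrightarrow> \<bar>c m p - c m q\<bar> \<le> L * norm (p - q)"
    and bm: "\<And>e. e \<in> Basis \<Longrightarrow> b e \<in> borel_measurable M"
    and Nmeas: "N \<in> borel_measurable (M \<Otimes>\<^sub>M M)"
    and NB: "\<And>m x. m \<in> space M \<Longrightarrow> x \<in> space M \<Longrightarrow> \<bar>N (m, x)\<bar> \<le> B"
    and ym: "\<And>e. e \<in> Basis \<Longrightarrow> y e \<in> borel_measurable M"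
    and yb: "\<And>e m. e \<in> Basis \<Longrightarrow> m \<in> space M \<Longrightarrow> \<bar>y e m\<bar> \<le> K"
    and yeq: "\<And>e m. e \<in> Basis \<Longrightarrow> m \<in> space M \<Longrightarrow> y e m = b e m + (\<integral>x. N (m, x) * y e x \<partial>M)"
    and rem: "\<And>X m. (\<And>n. X n \<in> ball q r) \<Longrightarrow> (\<And>n. X n \<noteq> q) \<Longrightarrow> X \<longlonglongrightarrow> q \<Longrightarrow> m \<in> space M \<Longrightarrow>
      (\<lambda>n. (c m (X n) - c m q - (\<Sum>e\<in>Basis. ((X n - q) \<bullet> e) * b e m)
        - (\<integral>x. N (m, x) * (c x (X n) - c x q) \<partial>M)) / norm (X n - q)) \<longlonglongrightarrow> 0"
    and m: "m \<in> space M"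
  shows "(c m has_derivative (\<lambda>v. \<Sum>e\<in>Basis. (v \<bullet> e) * y e m)) (at q)"
proof (rule has_derivative_seqI[where W = "ball q r"])
  fix X assume X: "\<And>n. X n \<in> ball q r" "\<And>n. X n \<noteq> q" "X \<longlonglongrightarrow> q"
  let ?v = "\<lambda>n. norm (X n - q)"
  have vpos: "?v n > 0" for n using X(2) by simp
  define R where "R n m = (c m (X n) - c m q - (\<Sum>e\<in>Basis. ((X n - q) \<bullet> e) * y e m)) / ?v n" for n m
  define \<rho> where "\<rho> n m = (c m (X n) - c m q - (\<Sum>e\<in>Basis. ((X n - q) \<bullet> e) * b e m)
        - (\<integral>x. N (m, x) * (c x (X n) - c x q) \<partial>M)) / ?v n" for n m
  have Nm: "(\<lambda>x. N (m, x)) \<in> borel_measurable M" if "m \<in> space M" for m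
    using measurable_Pair2[OF Nmeas that] by simp
  have dm: "(\<lambda>m. c m (X n) - c m q) \<in> borel_measurable M" for n
    using cm[OF X(1)] cm[of q] r by simp
  have Rm: "R n \<in> borel_measurable M" for n
    unfolding R_def[abs_def] using dm ym by measurable
  have \<rho>m: "\<rho> n \<in> borel_measurable M" for n
    unfolding \<rho>_def[abs_def] using dm bm kernel_measurable[OF dm Nmeas] by measurable
  have K0: "\<bar>K\<bar> \<ge> 0" by simp
  have yb': "\<bar>y e m\<bar> \<le> \<bar>K\<bar>" if "e \<in> Basis" "m \<in> space M" for e m
    using yb[OF that] by linarith
  have Rb: "\<bar>R n m\<bar> \<le> L + DIM('q) * \<bar>K\<bar>" if m: "m \<in> space M" for n m
  proof -
    have "\<bar>c m (X n) - c m q\<bar> \<le> L * ?v n" by (rule lip[OF m X(1)])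
    moreover have "\<bar>\<Sum>e\<in>Basis. ((X n - q) \<bullet> e) * y e m\<bar> \<le> (\<Sum>e\<in>(Basis::'q set). ?v n * \<bar>K\<bar>)"
      by (rule order_trans[OF sum_abs], rule sum_mono)
         (use yb'[OF _ m] in \<open>auto simp: abs_mult intro!: mult_mono Basis_le_norm\<close>)
    ultimately have "\<bar>c m (X n) - c m q - (\<Sum>e\<in>Basis. ((X n - q) \<bullet> e) * y e m)\<bar> \<le> (L + DIM('q) * \<bar>K\<bar>) * ?v n"
      by (simp add: algebra_simps)
    then show ?thesis using vpos[of n] by (simp add: divide_le_eq R_def)
  qed
  \<comment> \<open>The equation for \<open>y\<close> trades the source terms \<open>b\<close> in
    \<open>\<rho>\<close> for the derivative terms in \<open>R\<close>.\<close>
  have eq: "R n m = \<rho> n m + (\<integral>x. N (m, x) * R n x \<partial>M)" if m: "m \<in> space M" for n m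
  proof -
    have i1: "integrable M (\<lambda>x. N (m, x) * (c x (X n) - c x q))"
      by (rule kernel_integrable[where C = "L * ?v n" and B' = B]) (use lip[OF _ X(1)] NB m Nm dm in auto)
    have i2: "integrable M (\<lambda>x. N (m, x) * y e x)" if "e \<in> Basis" for e
      by (rule kernel_integrable[where C = K and B' = B]) (use yb NB m Nm ym that in auto)
    have "(\<integral>x. N (m, x) * R n x \<partial>M) = (\<integral>x. (N (m, x) * (c x (X n) - c x q) - (\<Sum>e\<in>Basis. ((X n - q) \<bullet> e) * (N (m, x) * y e x))) / ?v n \<partial>M)"
      by (simp add: R_def right_diff_distrib sum_distrib_left mult_ac)
    also have "\<dots> = ((\<integral>x. N (m, x) * (c x (X n) - c x q) \<partial>M) - (\<Sum>e\<in>Basis. ((X n - q) \<bullet> e) * (\<integral>x. N (m, x) * y e x \<partial>M))) / ?v n"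
    proof -
      have "integrable M (\<lambda>x. \<Sum>e\<in>Basis. ((X n - q) \<bullet> e) * (N (m, x) * y e x))" using i2 by auto
      then show ?thesis using i1 i2
        by (subst integral_divide_zero, subst Bochner_Integration.integral_diff) (simp_all add: Bochner_Integration.integral_sum)
    qed
    also have "(\<Sum>e\<in>Basis. ((X n - q) \<bullet> e) * (\<integral>x. N (m, x) * y e x \<partial>M))
        = (\<Sum>e\<in>Basis. ((X n - q) \<bullet> e) * y e m) - (\<Sum>e\<in>Basis. ((X n - q) \<bullet> e) * b e m)"
      unfolding sum_subtractf[symmetric] by (rule sum.cong) (use yeq m in \<open>auto simp: algebra_simps\<close>)
    finally have fin: "(\<integral>x. N (m, x) * R n x \<partial>M) = ((\<integral>x. N (m, x) * (c x (X n) - c x q) \<partial>M)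
      - ((\<Sum>e\<in>Basis. ((X n - q) \<bullet> e) * y e m) - (\<Sum>e\<in>Basis. ((X n - q) \<bullet> e) * b e m))) / ?v n" .
    show ?thesis unfolding fin unfolding R_def \<rho>_def by (simp add: diff_divide_distrib)
  qed
  have kb: "\<bar>\<integral>x. N (m, x) * R n x \<partial>M\<bar> \<le> B * (\<integral>x. \<bar>R n x\<bar> \<partial>M)" if "m \<in> space M" for n m
    by (rule kernel_bound[OF Rm Rb NB[OF that]])
  have "(\<lambda>n. R n m) \<longlonglongrightarrow> 0"
  proof (rule tendsto_zero_self_improve[OF Rm Rb \<rho>m])
    \<comment> \<open>Read backwards from \<open>eq\<close>: \<open>\<rho> n\<close> is
      \<open>R n\<close> minus its integral against the kernel, and both are already
      bounded.\<close>
    show "\<bar>\<rho> n m\<bar> \<le> (L + DIM('q) * \<bar>K\<bar>) + B * ((L + DIM('q) * \<bar>K\<bar>) * measure M (space M))" if "m \<in> space M" for n m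
    proof -
      have "L + DIM('q) * \<bar>K\<bar> \<ge> 0" using Rb[OF that, of n] by linarith
      then have "\<bar>\<integral>x. \<bar>R n x\<bar> \<partial>M\<bar> \<le> (L + DIM('q) * \<bar>K\<bar>) * measure M (space M)"
        by (rule integral_abs_bounded[rotated]) (use Rb in simp)
      then have "(\<integral>x. \<bar>R n x\<bar> \<partial>M) \<le> (L + DIM('q) * \<bar>K\<bar>) * measure M (space M)"
        by (rule order_trans[OF abs_ge_self])
      then have "B * (\<integral>x. \<bar>R n x\<bar> \<partial>M) \<le> B * ((L + DIM('q) * \<bar>K\<bar>) * measure M (space M))"
        by (rule mult_left_mono[OF _ B_nonneg])
      then show ?thesis using eq[OF that, of n] kb[OF that, of n] Rb[OF that, of n] by linarith
    qed
    show "\<bar>R n m\<bar> \<le> \<bar>\<rho> n m\<bar> + B * (\<integral>x. \<bar>R n x\<bar> \<partial>M)" if "m \<in> space M" for n m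
      using eq[OF that, of n] kb[OF that, of n] by linarith
    show "(\<lambda>n. \<rho> n m) \<longlonglongrightarrow> 0" if "m \<in> space M" for m
      unfolding \<rho>_def by (rule rem[OF X that])
  qed (use m in auto)
  then show "(\<lambda>n. (c m (X n) - c m q - (\<Sum>e\<in>Basis. ((X n - q) \<bullet> e) * y e m)) / ?v n) \<longlonglongrightarrow> 0"
    unfolding R_def .
qed (use r in auto)

end

section \<open>Continuity and smoothness of the solution in a parameter\<close>

context fredholm begin

text \<open>The increment of \<open>y\<close> solves the equation with the kernel at the new
  parameter; its source \<open>\<rho>\<close> collects the increments of \<open>b\<close> and of
  \<open>N\<close> and vanishes in the limit.\<close>

lemma Cs_unif_0_solution:
  fixes y b :: "'m \<Rightarrow> 'q::euclidean_space \<Rightarrow> real" and N :: "'m \<times> 'm \<Rightarrow> 'q \<Rightarrow> real"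
  assumes U: "open U"
    and b: "Cs_unif 0 (space M) b U" and N: "Cs_unif 0 (space M \<times> space M) N U"
    and bm: "\<And>q. q \<in> U \<Longrightarrow> (\<lambda>m. b m q) \<in> borel_measurable M"
    and Nmeas: "\<And>q. q \<in> U \<Longrightarrow> (\<lambda>p. N p q) \<in> borel_measurable (M \<Otimes>\<^sub>M M)"
    and NB: "\<And>m x q. m \<in> space M \<Longrightarrow> x \<in> space M \<Longrightarrow> q \<in> U \<Longrightarrow> \<bar>N (m, x) q\<bar> \<le> B"
    and ym: "\<And>q. q \<in> U \<Longrightarrow> (\<lambda>m. y m q) \<in> borel_measurable M"
    and yb: "loc_bdd (space M) y U"
    and yeq: "\<And>m q. m \<in> space M \<Longrightarrow> q \<in> U \<Longrightarrow> y m q = b m q + (\<integral>x. N (m, x) q * y x q \<partial>M)"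
  shows "Cs_unif 0 (space M) y U"
proof -
  have "continuous_on U (y m)" if m: "m \<in> space M" for m
    unfolding continuous_on_sequentially comp_def
  proof (intro allI ballI impI)
    fix X0 q assume q: "q \<in> U" and X0: "(\<forall>n. X0 n \<in> U) \<and> X0 \<longlonglongrightarrow> q"
    obtain r1 C where C: "r1 > 0" "C > 0" "\<And>i p. i \<in> space M \<Longrightarrow> p \<in> U \<Longrightarrow> dist q p < r1 \<Longrightarrow> norm (y i p) \<le> C"
      using loc_bddE[OF yb q] by metis
    obtain r2 C' where C': "r2 > 0" "C' > 0" "\<And>i p. i \<in> space M \<Longrightarrow> p \<in> U \<Longrightarrow> dist q p < r2 \<Longrightarrow> norm (b i p) \<le> C'"
      using loc_bddE[OF Cs_unif_loc_bdd[OF b] q] by metis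
    obtain n0 where n0: "\<And>n. n \<ge> n0 \<Longrightarrow> dist (X0 n) q < min r1 r2"
      using X0 C(1) C'(1) unfolding lim_sequentially by (metis min_less_iff_conj)
    define X where "X n = X0 (n + n0)" for n
    have X: "X n \<in> U" "dist q (X n) < r1" "dist q (X n) < r2" for n
      using X0 n0[of "n + n0"] by (auto simp: X_def dist_commute)
    have Xl: "X \<longlonglongrightarrow> q" unfolding X_def using X0 LIMSEQ_ignore_initial_segment by blast
    have Nm: "(\<lambda>x. N (m, x) p) \<in> borel_measurable M" if "m \<in> space M" "p \<in> U" for m p
      using measurable_Pair2[OF Nmeas[OF that(2)] that(1)] by simp
    have yC: "\<bar>y x (X n)\<bar> \<le> C" "\<bar>y x q\<bar> \<le> C" if "x \<in> space M" for x n
      using C(3)[OF that X(1)[of n] X(2)] C(3)[OF that q] C(1) by auto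
    define \<rho> where "\<rho> n m = b m (X n) - b m q + (\<integral>x. (N (m, x) (X n) - N (m, x) q) * y x q \<partial>M)" for n m
    have eq: "y m (X n) - y m q = \<rho> n m + (\<integral>x. N (m, x) (X n) * (y x (X n) - y x q) \<partial>M)" if m: "m \<in> space M" for n m
    proof -
      have i: "integrable M (\<lambda>x. N (m, x) p * y x p')" if "p \<in> {q, X n}" "p' \<in> {q, X n}" for p p'
        by (rule kernel_integrable[where C = C and B' = B]) (use that ym q X yC NB m Nm in auto)
      show ?thesis
        unfolding \<rho>_def yeq[OF m q] yeq[OF m X(1)] using i
        by (simp add: left_diff_distrib right_diff_distrib)
    qed
    have "(\<lambda>n. y m (X n) - y m q) \<longlonglongrightarrow> 0"
    proof (rule tendsto_zero_self_improve[where \<rho> = \<rho> and r = "\<lambda>n m. y m (X n) - y m q"])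
      show "(\<lambda>m. y m (X n) - y m q) \<in> borel_measurable M" for n using ym q X by auto
      show "\<bar>y m (X n) - y m q\<bar> \<le> 2 * C" if "m \<in> space M" for n m using yC(1)[OF that, of n] yC(2)[OF that] by linarith
      show "\<rho> n \<in> borel_measurable M" for n
        unfolding \<rho>_def[abs_def]
        by (intro borel_measurable_add borel_measurable_diff bm q X kernel_measurable[OF ym, where N = "\<lambda>p. N p (X n) - N p q"] Nmeas)
      show "\<bar>\<rho> n m\<bar> \<le> 2 * C' + (2 * B * C) * measure M (space M)" if "m \<in> space M" for n m
      proof -
        have "\<bar>\<integral>x. (N (m, x) (X n) - N (m, x) q) * y x q \<partial>M\<bar> \<le> (2 * B * C) * measure M (space M)"
        proof (rule integral_abs_bounded)
          fix x assume x: "x \<in> space M"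
          have "\<bar>N (m, x) (X n) - N (m, x) q\<bar> \<le> 2 * B" using NB[OF that x q] NB[OF that x X(1), of n] by linarith
          then show "\<bar>(N (m, x) (X n) - N (m, x) q) * y x q\<bar> \<le> 2 * B * C"
            using yC(2)[OF x] B_nonneg by (auto simp: abs_mult intro!: mult_mono)
        qed (use B_nonneg C in auto)
        moreover have "\<bar>b m (X n)\<bar> \<le> C'" "\<bar>b m q\<bar> \<le> C'"
          using C'(3)[OF that X(1)[of n] X(3)] C'(3)[OF that q] C'(1) by auto
        ultimately show ?thesis unfolding \<rho>_def by linarith
      qed
      show "\<bar>y m (X n) - y m q\<bar> \<le> \<bar>\<rho> n m\<bar> + B * (\<integral>x. \<bar>y x (X n) - y x q\<bar> \<partial>M)" if "m \<in> space M" for n m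
      proof -
        have "\<bar>\<integral>x. N (m, x) (X n) * (y x (X n) - y x q) \<partial>M\<bar> \<le> B * (\<integral>x. \<bar>y x (X n) - y x q\<bar> \<partial>M)"
        proof (rule kernel_bound[where C = "2 * C"])
          show "\<bar>y m (X n) - y m q\<bar> \<le> 2 * C" if "m \<in> space M" for m using yC(1)[OF that, of n] yC(2)[OF that] by linarith
        qed (use ym q X NB that in auto)
        then show ?thesis using eq[OF that, of n] by linarith
      qed
      show "(\<lambda>n. \<rho> n m) \<longlonglongrightarrow> 0" if m: "m \<in> space M" for m
      proof -
        have "(\<lambda>n. b m (X n)) \<longlonglongrightarrow> b m q"
          using Cs_unif_cont[OF b m] Xl X q unfolding continuous_on_sequentially comp_def by blast
        then have 1: "(\<lambda>n. b m (X n) - b m q) \<longlonglongrightarrow> 0" by (simp add: LIM_zero)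
        have "(\<lambda>n. \<integral>x. (N (m, x) (X n) - N (m, x) q) * y x q \<partial>M) \<longlonglongrightarrow> (\<integral>x. 0 \<partial>M)"
        proof (rule integral_tendsto_bounded)
          show "(\<lambda>x. (N (m, x) (X n) - N (m, x) q) * y x q) \<in> borel_measurable M" for n
            using Nm[OF m X(1)] Nm[OF m q] ym[OF q] by measurable
          show "(\<lambda>n. (N (m, x) (X n) - N (m, x) q) * y x q) \<longlonglongrightarrow> 0" if "x \<in> space M" for x
          proof -
            have "continuous_on U (N (m, x))" using N m that by auto
            then have "(\<lambda>n. N (m, x) (X n)) \<longlonglongrightarrow> N (m, x) q"
              using Xl X q unfolding continuous_on_sequentially comp_def by blast
            then show ?thesis by (intro tendsto_mult_left_zero) (simp add: LIM_zero)
          qed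
          show "\<bar>(N (m, x) (X n) - N (m, x) q) * y x q\<bar> \<le> 2 * B * C" if x: "x \<in> space M" for n x
          proof -
            have "\<bar>N (m, x) (X n) - N (m, x) q\<bar> \<le> 2 * B" using NB[OF m x q] NB[OF m x X(1), of n] by linarith
            then show "\<bar>(N (m, x) (X n) - N (m, x) q) * y x q\<bar> \<le> 2 * B * C"
              using yC(2)[OF x] B_nonneg by (auto simp: abs_mult intro!: mult_mono)
          qed
        qed
        then show ?thesis unfolding \<rho>_def using tendsto_add[OF 1] by fastforce
      qed
    qed (rule m)
    then have "(\<lambda>n. y m (X n)) \<longlonglongrightarrow> y m q" by (simp add: LIM_zero_iff)
    then show "(\<lambda>n. y m (X0 n)) \<longlonglongrightarrow> y m q" unfolding X_def by (rule LIMSEQ_offset)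
  qed
  then show ?thesis using yb by simp
qed

text \<open>Formal differentiation of the equation in direction \<open>e\<close> gives the same
  equation with source \<open>b' e\<close>, which contains \<open>y\<close> itself. By induction
  \<open>y\<close> is of order \<open>k\<close>, hence so is the source, hence by induction again
  the solution \<open>Y e\<close>; it remains to see that \<open>Y e\<close> is the partial
  derivative of \<open>y\<close>.\<close>

lemma Cs_unif_solution:
  fixes y b :: "'m \<Rightarrow> 'q::euclidean_space \<Rightarrow> real" and N :: "'m \<times> 'm \<Rightarrow> 'q \<Rightarrow> real"
  assumes U: "open U"
    and Nmeas: "\<And>q. q \<in> U \<Longrightarrow> (\<lambda>p. N p q) \<in> borel_measurable (M \<Otimes>\<^sub>M M)"
    and NB: "\<And>m x q. m \<in> space M \<Longrightarrow> x \<in> space M \<Longrightarrow> q \<in> U \<Longrightarrow> \<bar>N (m, x) q\<bar> \<le> B"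
  shows "Cs_unif k (space M) b U \<Longrightarrow> Cs_unif k (space M \<times> space M) N U \<Longrightarrow>
    (\<And>q. q \<in> U \<Longrightarrow> (\<lambda>m. b m q) \<in> borel_measurable M) \<Longrightarrow>
    (\<And>q. q \<in> U \<Longrightarrow> (\<lambda>m. y m q) \<in> borel_measurable M) \<Longrightarrow> loc_bdd (space M) y U \<Longrightarrow>
    (\<And>m q. m \<in> space M \<Longrightarrow> q \<in> U \<Longrightarrow> y m q = b m q + (\<integral>x. N (m, x) q * y x q \<partial>M)) \<Longrightarrow>
    Cs_unif k (space M) y U"
proof (induction k arbitrary: b y)
  case 0
  then show ?case using Cs_unif_0_solution[OF U] Nmeas NB by blast
next
  case (Suc k)
  note b = Suc.prems(1) and N = Suc.prems(2) and bm = Suc.prems(3) and ym = Suc.prems(4) and yb = Suc.prems(5) and yeq = Suc.prems(6)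
  have yk: "Cs_unif k (space M) y U"
    by (rule Suc.IH[OF Cs_unif_Suc_le[OF b] Cs_unif_Suc_le[OF N] bm ym yb yeq])
  have ycont: "continuous_on U (y m)" if "m \<in> space M" for m by (rule Cs_unif_cont[OF yk that])
  have Nm: "(\<lambda>x. N (m, x) p) \<in> borel_measurable M" if "m \<in> space M" "p \<in> U" for m p
    using measurable_Pair2[OF Nmeas[OF that(2)] that(1)] by simp
  let ?bD = "\<lambda>e m q. frechet_derivative (b m) (at q) e"
  let ?ND = "\<lambda>e p q. frechet_derivative (N p) (at q) e"
  define b' where "b' e m q = ?bD e m q + (\<integral>x. ?ND e (m, x) q * y x q \<partial>M)" for e m q
  have bDm: "(\<lambda>m. ?bD e m q) \<in> borel_measurable M" if "q \<in> U" for e q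
    by (rule frechet_derivative_measurable[OF U that bm]) (use b that in auto)
  have NDm: "(\<lambda>p. ?ND e p q) \<in> borel_measurable (M \<Otimes>\<^sub>M M)" if "q \<in> U" for e q
    by (rule frechet_derivative_measurable[OF U that Nmeas]) (use N that in \<open>auto simp: space_pair_measure\<close>)
  have NDm1: "(\<lambda>x. ?ND e (m, x) q) \<in> borel_measurable M" if "m \<in> space M" "q \<in> U" for e m q
    using measurable_Pair2[OF NDm[OF that(2)] that(1)] by simp
  have b'm: "(\<lambda>m. b' e m q) \<in> borel_measurable M" if "q \<in> U" for e q
    unfolding b'_def using bDm[OF that] kernel_measurable[OF ym[OF that] NDm[OF that]] by measurable
  have b'k: "Cs_unif k (space M) (b' e) U" if e: "e \<in> Basis" for e
  proof -
    have "Cs_unif k (space M \<times> space M) (\<lambda>p q. ?ND e p q * y (snd p) q) U"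
      by (intro Cs_unif_mult[OF U] Cs_unif_frechet[OF N e] Cs_unif_reindex[OF yk]) auto
    then have "Cs_unif k (space M) (\<lambda>m q. \<integral>x. (\<lambda>p q. ?ND e p q * y (snd p) q) (m, x) q \<partial>M) U"
      by (rule Cs_unif_integral[OF U]) (use NDm1 ym in auto)
    then show ?thesis
      unfolding b'_def[abs_def] using Cs_unif_add[OF U Cs_unif_frechet[OF b e]] by simp
  qed
  \<comment> \<open>\<open>Y e q\<close> is picked separately at each \<open>q\<close>. The middle
    clause, quantified over all \<open>C\<close>, forces each pick to be at most twice its source,
    so that local bounds in \<open>q\<close> survive the choice.\<close>
  define sol where "sol e q Y \<longleftrightarrow> Y \<in> borel_measurable M \<and>
      (\<forall>C\<ge>0. (\<forall>m\<in>space M. \<bar>b' e m q\<bar> \<le> C) \<longrightarrow> (\<forall>m\<in>space M. \<bar>Y m\<bar> \<le> 2 * C)) \<and>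
      (\<forall>m\<in>space M. Y m = b' e m q + (\<integral>x. N (m, x) q * Y x \<partial>M))" for e q Y
  have ex: "\<exists>Y. sol e q Y" if e: "e \<in> Basis" and q: "q \<in> U" for e q
  proof -
    obtain r C where C: "C > 0" "r > 0" "\<And>m p. m \<in> space M \<Longrightarrow> p \<in> U \<Longrightarrow> dist q p < r \<Longrightarrow> norm (b' e m p) \<le> C"
      using loc_bddE[OF Cs_unif_loc_bdd[OF b'k[OF e]] q] by metis
    then have C': "\<bar>b' e m q\<bar> \<le> C" if "m \<in> space M" for m using C(3)[OF that q] by simp
    obtain Y where Y: "Y \<in> borel_measurable M" "\<And>m. m \<in> space M \<Longrightarrow> \<bar>Y m\<bar> \<le> 2 * C"
      "\<And>m. m \<in> space M \<Longrightarrow> Y m = b' e m q + (\<integral>x. N (m, x) q * Y x \<partial>M)"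
      by (rule solution_exists[OF b'm[OF q, of e] C' _ Nmeas[OF q]]) (use NB q C(1) in auto)
    have "\<bar>Y m\<bar> \<le> 2 * D" if D: "D \<ge> 0" "\<forall>m\<in>space M. \<bar>b' e m q\<bar> \<le> D" and m: "m \<in> space M" for D m
    proof (rule abs_bound_self_improve[OF Y(1,2) _ D(1) m])
      fix m assume m: "m \<in> space M"
      show "\<bar>Y m\<bar> \<le> D + B * (\<integral>x. \<bar>Y x\<bar> \<partial>M)"
      proof -
        have "\<bar>\<integral>x. N (m, x) q * Y x \<partial>M\<bar> \<le> B * (\<integral>x. \<bar>Y x\<bar> \<partial>M)"
          by (rule kernel_bound[OF Y(1,2) NB[OF m _ q]])
        moreover have "\<bar>b' e m q\<bar> \<le> D" using D(2) m by blast
        ultimately show ?thesis using Y(3)[OF m] by linarith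
      qed
    qed
    then show ?thesis using Y(1,3) unfolding sol_def by (intro exI[of _ Y]) simp
  qed
  define Y where "Y e q = (SOME Y. sol e q Y)" for e q
  have "sol e q (Y e q)" if "e \<in> Basis" "q \<in> U" for e q
    unfolding Y_def by (rule someI_ex[OF ex[OF that]])
  then have Y: "\<And>e q. e \<in> Basis \<Longrightarrow> q \<in> U \<Longrightarrow> Y e q \<in> borel_measurable M"
    and YC: "\<And>e q C m. e \<in> Basis \<Longrightarrow> q \<in> U \<Longrightarrow> C \<ge> 0 \<Longrightarrow> (\<And>m. m \<in> space M \<Longrightarrow> \<bar>b' e m q\<bar> \<le> C) \<Longrightarrow> m \<in> space M \<Longrightarrow> \<bar>Y e q m\<bar> \<le> 2 * C"
    and Yeq: "\<And>e q m. e \<in> Basis \<Longrightarrow> q \<in> U \<Longrightarrow> m \<in> space M \<Longrightarrow> Y e q m = b' e m q + (\<integral>x. N (m, x) q * Y e q x \<partial>M)"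
    unfolding sol_def by blast+
  have Yk: "Cs_unif k (space M) (\<lambda>m q. Y e q m) U" if e: "e \<in> Basis" for e
  proof (rule Suc.IH[OF b'k[OF e] Cs_unif_Suc_le[OF N]])
    show "loc_bdd (space M) (\<lambda>m q. Y e q m) U"
    proof (rule loc_bddI)
      fix q assume q: "q \<in> U"
      obtain r C where C: "r > 0" "C > 0" "\<And>m p. m \<in> space M \<Longrightarrow> p \<in> U \<Longrightarrow> dist q p < r \<Longrightarrow> norm (b' e m p) \<le> C"
        using loc_bddE[OF Cs_unif_loc_bdd[OF b'k[OF e]] q] by metis
      show "\<exists>r>0. \<exists>B. \<forall>m\<in>space M. \<forall>p\<in>U \<inter> ball q r. norm (Y e p m) \<le> B"
        by (rule exI[of _ r], rule conjI[OF C(1)], rule exI[of _ "2 * C"])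
           (use C in \<open>auto intro!: YC[OF e]\<close>)
    qed
  qed (use Y Yeq b'm e in auto)
  show ?case
  proof (rule Cs_unif_SucI[OF U, where a' = "\<lambda>m q v. \<Sum>e\<in>Basis. (v \<bullet> e) * Y e q m"])
    show "loc_bdd (space M) y U" by (rule yb)
    show "Cs_unif k (space M) (\<lambda>m q. \<Sum>e'\<in>Basis. (e \<bullet> e') * Y e' q m) U" if e: "e \<in> Basis" for e
    proof -
      have "(\<Sum>e'\<in>Basis. (e \<bullet> e') * Y e' q m) = Y e q m" for m q
        using e by (simp add: inner_Basis if_distrib[of "\<lambda>x. x * _"] cong: if_cong)
      then show ?thesis using Yk[OF e] by simp
    qed
    fix m q assume m: "m \<in> space M" and q: "q \<in> U"
    obtain r1 Kb where Kb: "r1 > 0" "Kb > 0" "ball q r1 \<subseteq> U"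
      "\<And>i p p'. i \<in> space M \<Longrightarrow> p \<in> ball q r1 \<Longrightarrow> p' \<in> ball q r1 \<Longrightarrow> \<bar>b i p - b i p'\<bar> \<le> Kb * norm (p - p')"
      using Cs_unif_lipschitz[OF U b q] by metis
    obtain r2 KN where KN: "r2 > 0" "KN > 0" "ball q r2 \<subseteq> U"
      "\<And>i p p'. i \<in> space M \<times> space M \<Longrightarrow> p \<in> ball q r2 \<Longrightarrow> p' \<in> ball q r2 \<Longrightarrow> \<bar>N i p - N i p'\<bar> \<le> KN * norm (p - p')"
      "\<And>i p e. i \<in> space M \<times> space M \<Longrightarrow> p \<in> ball q r2 \<Longrightarrow> e \<in> Basis \<Longrightarrow> \<bar>frechet_derivative (N i) (at p) e\<bar> \<le> KN"
      using Cs_unif_lipschitz[OF U N q] by metis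
    obtain r3 C where C: "r3 > 0" "C > 0" "\<And>i p. i \<in> space M \<Longrightarrow> p \<in> U \<Longrightarrow> dist q p < r3 \<Longrightarrow> norm (y i p) \<le> C"
      using loc_bddE[OF yb q] by metis
    define r where "r = min r1 (min r2 r3)"
    have r: "r > 0" "ball q r \<subseteq> U" "ball q r \<subseteq> ball q r1" "ball q r \<subseteq> ball q r2"
      using Kb KN C by (auto simp: r_def)
    have yC: "\<bar>y i p\<bar> \<le> C" if "i \<in> space M" "p \<in> ball q r" for i p
      using C(3)[OF that(1)] that(2) r(2) by (auto simp: r_def)
    have split: "y m p - y m q = (b m p - b m q) + (\<integral>x. (N (m, x) p - N (m, x) q) * y x p \<partial>M) + (\<integral>x. N (m, x) q * (y x p - y x q) \<partial>M)"
      if m: "m \<in> space M" and p: "p \<in> ball q r" for m p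
    proof -
      have pU: "p \<in> U" using p r by auto
      have i: "integrable M (\<lambda>x. N (m, x) p1 * y x p2)" if "p1 \<in> {q, p}" "p2 \<in> {q, p}" for p1 p2
        by (rule kernel_integrable[where C = C and B' = B]) (use that ym q pU p yC r(1) NB m Nm in auto)
      show ?thesis
        unfolding yeq[OF m q] yeq[OF m pU] using i
        by (simp add: left_diff_distrib right_diff_distrib)
    qed
    \<comment> \<open>\<open>Kb\<close> for the change of \<open>b\<close>, \<open>KN\<close> times
      the bound \<open>C\<close> on \<open>y\<close> for the change of the kernel; the factor 2 is
      the absorption in \<open>abs_bound_self_improve\<close>.\<close>
    define L where "L = 2 * (Kb + KN * C * measure M (space M))"
    have lip: "\<bar>y m p - y m q\<bar> \<le> L * norm (p - q)" if m: "m \<in> space M" and p: "p \<in> ball q r" for m p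
    proof -
      have pU: "p \<in> U" using p r by auto
      have ymd: "(\<lambda>x. y x p - y x q) \<in> borel_measurable M" using ym pU q by auto
      have ydC: "\<bar>y x p - y x q\<bar> \<le> 2 * C" if "x \<in> space M" for x
        using yC[OF that p] yC[OF that, of q] r(1) by (auto simp: abs_le_iff)
      have "\<bar>y m p - y m q\<bar> \<le> 2 * ((Kb + KN * C * measure M (space M)) * norm (p - q))"
      proof (rule abs_bound_self_improve[OF ymd ydC _ _ m])
        fix m assume m: "m \<in> space M"
        have "\<bar>\<integral>x. (N (m, x) p - N (m, x) q) * y x p \<partial>M\<bar> \<le> (KN * norm (p - q) * C) * measure M (space M)"
          by (rule integral_abs_bounded)
             (use KN C m p r yC in \<open>auto simp: abs_mult intro!: mult_mono KN(4)\<close>)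
        moreover have "\<bar>b m p - b m q\<bar> \<le> Kb * norm (p - q)" using Kb(4)[OF m] p r Kb(1) by auto
        moreover have "\<bar>\<integral>x. N (m, x) q * (y x p - y x q) \<partial>M\<bar> \<le> B * (\<integral>x. \<bar>y x p - y x q\<bar> \<partial>M)"
          by (rule kernel_bound[OF ymd ydC NB[OF m _ q]])
        ultimately show "\<bar>y m p - y m q\<bar> \<le> (Kb + KN * C * measure M (space M)) * norm (p - q) + B * (\<integral>x. \<bar>y x p - y x q\<bar> \<partial>M)"
          using split[OF m p] by (simp add: algebra_simps)
      qed (use Kb KN C in auto)
      then show ?thesis unfolding L_def by (simp only: mult.assoc)
    qed
    have "\<exists>K. \<forall>e\<in>Basis. \<forall>m\<in>space M. \<bar>Y e q m\<bar> \<le> K"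
    proof -
      have "\<exists>K. \<forall>m\<in>space M. \<bar>Y e q m\<bar> \<le> K" if e: "e \<in> Basis" for e
      proof -
        obtain r' C where "r' > 0" "\<And>m p. m \<in> space M \<Longrightarrow> p \<in> U \<Longrightarrow> dist q p < r' \<Longrightarrow> norm (Y e p m) \<le> C"
          using loc_bddE[OF Cs_unif_loc_bdd[OF Yk[OF e]] q] by metis
        then show ?thesis using q by (intro exI[of _ C]) auto
      qed
      then obtain K where K: "\<And>e m. e \<in> Basis \<Longrightarrow> m \<in> space M \<Longrightarrow> \<bar>Y e q m\<bar> \<le> K e" by metis
      show ?thesis
      proof (intro exI[of _ "Max (K ` Basis)"] ballI)
        fix e :: 'q and m assume "e \<in> Basis" "m \<in> space M"
        then show "\<bar>Y e q m\<bar> \<le> Max (K ` Basis)"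
          by (intro order_trans[OF K]) auto
      qed
    qed
    then obtain K where K: "\<And>e m. e \<in> Basis \<Longrightarrow> m \<in> space M \<Longrightarrow> \<bar>Y e q m\<bar> \<le> K" by blast
    show "(y m has_derivative (\<lambda>v. \<Sum>e\<in>Basis. (v \<bullet> e) * Y e q m)) (at q)"
    proof (rule solution_has_derivative[where y = "\<lambda>e. Y e q" and b = "\<lambda>e m. b' e m q" and N = "\<lambda>p. N p q", OF r(1)])
      fix X m assume X: "\<And>n. X n \<in> ball q r" "\<And>n. X n \<noteq> q" "X \<longlonglongrightarrow> q" and m: "m \<in> space M"
      have XU: "X n \<in> U" for n using X(1)[of n] r by auto
      let ?v = "\<lambda>n. norm (X n - q)"
      have vpos: "?v n > 0" for n using X(2) by simp
      let ?S = "\<lambda>n f. \<Sum>e\<in>Basis. ((X n - q) \<bullet> e) * f e"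
      \<comment> \<open>\<open>J\<close> is the increment of the kernel times
        \<open>y x (X n)\<close>, minus the linear term with \<open>y x q\<close>, all divided by
        \<open>?v n\<close>. The split separates a Taylor remainder of \<open>N\<close> from an
        increment of \<open>y\<close>: in each product one factor tends to 0 and the other is
        bounded.\<close>
      define J where "J n x = ((N (m, x) (X n) - N (m, x) q - ?S n (\<lambda>e. ?ND e (m, x) q)) / ?v n) * y x (X n)
        + (?S n (\<lambda>e. ?ND e (m, x) q) / ?v n) * (y x (X n) - y x q)" for n x
      have Sb: "\<bar>?S n (\<lambda>e. ?ND e (m, x) q) / ?v n\<bar> \<le> DIM('q) * KN" if x: "x \<in> space M" for n x
      proof -
        have "\<bar>?S n (\<lambda>e. ?ND e (m, x) q)\<bar> \<le> (\<Sum>e\<in>(Basis::'q set). ?v n * KN)"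
          by (rule order_trans[OF sum_abs], rule sum_mono)
             (use KN m x in \<open>auto simp: abs_mult intro!: mult_mono Basis_le_norm\<close>)
        then show ?thesis using vpos[of n] by (simp add: divide_le_eq mult_ac)
      qed
      have Db: "\<bar>(N (m, x) (X n) - N (m, x) q) / ?v n\<bar> \<le> KN" if x: "x \<in> space M" for n x
      proof -
        have "\<bar>N (m, x) (X n) - N (m, x) q\<bar> \<le> KN * ?v n"
          by (rule KN(4)) (use x m X(1)[of n] r KN(1) in auto)
        then show ?thesis using vpos[of n] by (simp add: divide_le_eq)
      qed
      have Jm: "J n \<in> borel_measurable M" for n
        unfolding J_def[abs_def] using Nm[OF m XU] Nm[OF m q] NDm1[OF m q] ym[OF XU] ym[OF q] by measurable
      have l1: "(\<lambda>n. (b m (X n) - b m q - ?S n (\<lambda>e. ?bD e m q)) / ?v n) \<longlonglongrightarrow> 0"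
        by (rule has_derivative_seqD[OF has_derivative_partials_sum X(3,2)]) (use b m q in auto)
      have l2: "(\<lambda>n. \<integral>x. J n x \<partial>M) \<longlonglongrightarrow> (\<integral>x. 0 \<partial>M)"
      proof (rule integral_tendsto_bounded[OF Jm])
        fix x assume x: "x \<in> space M"
        have yl: "(\<lambda>n. y x (X n)) \<longlonglongrightarrow> y x q"
          using ycont[OF x] X(3) XU q unfolding continuous_on_sequentially comp_def by blast
        have "(\<lambda>n. (N (m, x) (X n) - N (m, x) q - ?S n (\<lambda>e. ?ND e (m, x) q)) / ?v n) \<longlonglongrightarrow> 0"
          by (rule has_derivative_seqD[OF has_derivative_partials_sum X(3,2)]) (use N m x q in auto)
        then have 1: "(\<lambda>n. ((N (m, x) (X n) - N (m, x) q - ?S n (\<lambda>e. ?ND e (m, x) q)) / ?v n) * y x (X n)) \<longlonglongrightarrow> 0 * y x q"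
          using yl by (rule tendsto_mult)
        have 2: "(\<lambda>n. (?S n (\<lambda>e. ?ND e (m, x) q) / ?v n) * (y x (X n) - y x q)) \<longlonglongrightarrow> 0"
        proof (rule Lim_null_comparison)
          show "\<forall>\<^sub>F n in sequentially. norm ((?S n (\<lambda>e. ?ND e (m, x) q) / ?v n) * (y x (X n) - y x q)) \<le> (DIM('q) * KN) * \<bar>y x (X n) - y x q\<bar>"
            using Sb[OF x] by (intro always_eventually allI) (simp only: real_norm_def abs_mult mult_right_mono abs_ge_zero)
          have "(\<lambda>n. (DIM('q) * KN) * \<bar>y x (X n) - y x q\<bar>) \<longlonglongrightarrow> (DIM('q) * KN) * \<bar>y x q - y x q\<bar>"
            by (intro tendsto_intros yl)
          then show "(\<lambda>n. (DIM('q) * KN) * \<bar>y x (X n) - y x q\<bar>) \<longlonglongrightarrow> 0" by simp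
        qed
        show "(\<lambda>n. J n x) \<longlonglongrightarrow> 0" unfolding J_def using tendsto_add[OF 1 2] by simp
        show "\<bar>J n x\<bar> \<le> (KN + DIM('q) * KN) * C + DIM('q) * KN * (2 * C)" for n
        proof -
          have "\<bar>(N (m, x) (X n) - N (m, x) q - ?S n (\<lambda>e. ?ND e (m, x) q)) / ?v n\<bar> \<le> KN + DIM('q) * KN"
            using Db[OF x, of n] Sb[OF x, of n] unfolding diff_divide_distrib by linarith
          moreover have "\<bar>y x (X n)\<bar> \<le> C" "\<bar>y x (X n) - y x q\<bar> \<le> 2 * C"
            using yC[OF x X(1)[of n]] yC[OF x, of q] r(1) by (auto simp: abs_le_iff)
          ultimately have "\<bar>((N (m, x) (X n) - N (m, x) q - ?S n (\<lambda>e. ?ND e (m, x) q)) / ?v n) * y x (X n)\<bar> \<le> (KN + DIM('q) * KN) * C"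
            "\<bar>(?S n (\<lambda>e. ?ND e (m, x) q) / ?v n) * (y x (X n) - y x q)\<bar> \<le> DIM('q) * KN * (2 * C)"
            unfolding abs_mult using Sb[OF x, of n] KN(2) by (auto intro!: mult_mono simp del: abs_divide)
          then show ?thesis unfolding J_def by linarith
        qed
      qed
      have eq: "(y m (X n) - y m q - ?S n (\<lambda>e. b' e m q) - (\<integral>x. N (m, x) q * (y x (X n) - y x q) \<partial>M)) / ?v n
        = (b m (X n) - b m q - ?S n (\<lambda>e. ?bD e m q)) / ?v n + (\<integral>x. J n x \<partial>M)" for n
      proof -
        have i1: "integrable M (\<lambda>x. N (m, x) p1 * y x (X n))" if "p1 \<in> {q, X n}" for p1
          by (rule kernel_integrable[where C = C and B' = B]) (use that ym q XU X(1)[of n] yC NB m Nm in auto)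
        have i2: "integrable M (\<lambda>x. ?ND e (m, x) q * y x q)" if "e \<in> Basis" for e
          by (rule kernel_integrable[where C = C and B' = KN]) (use that ym q yC KN m NDm1 r in auto)
        have "J n x = ((N (m, x) (X n) * y x (X n) - N (m, x) q * y x (X n)) - ?S n (\<lambda>e. ?ND e (m, x) q * y x q)) / ?v n" for x
        proof -
          have "?S n (\<lambda>e. ?ND e (m, x) q * y x q) = ?S n (\<lambda>e. ?ND e (m, x) q) * y x q"
            unfolding sum_distrib_right by (simp only: mult.assoc)
          then show ?thesis unfolding J_def using vpos[of n]
            by (simp only: times_divide_eq_left add_divide_distrib[symmetric]) (simp add: algebra_simps)
        qed
        then have "(\<integral>x. J n x \<partial>M) = (\<integral>x. ((N (m, x) (X n) * y x (X n) - N (m, x) q * y x (X n)) - ?S n (\<lambda>e. ?ND e (m, x) q * y x q)) / ?v n \<partial>M)" by simp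
        also have "\<dots> = ((\<integral>x. N (m, x) (X n) * y x (X n) - N (m, x) q * y x (X n) \<partial>M) - ?S n (\<lambda>e. \<integral>x. ?ND e (m, x) q * y x q \<partial>M)) / ?v n"
        proof -
          have "integrable M (\<lambda>x. ?S n (\<lambda>e. ?ND e (m, x) q * y x q))"
            using i2 by (intro Bochner_Integration.integrable_sum integrable_mult_right) auto
          moreover have "integrable M (\<lambda>x. N (m, x) (X n) * y x (X n) - N (m, x) q * y x (X n))"
            using i1 by (intro Bochner_Integration.integrable_diff) auto
          moreover have "(\<integral>x. ?S n (\<lambda>e. ?ND e (m, x) q * y x q) \<partial>M) = ?S n (\<lambda>e. \<integral>x. ?ND e (m, x) q * y x q \<partial>M)"
            by (subst Bochner_Integration.integral_sum) (use i2 in \<open>auto intro!: integrable_mult_right\<close>)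
          ultimately show ?thesis by (subst integral_divide_zero, subst Bochner_Integration.integral_diff) auto
        qed
        finally have Jeq: "(\<integral>x. J n x \<partial>M) = ((\<integral>x. (N (m, x) (X n) - N (m, x) q) * y x (X n) \<partial>M) - ?S n (\<lambda>e. \<integral>x. ?ND e (m, x) q * y x q \<partial>M)) / ?v n"
          by (simp add: left_diff_distrib)
        have "?S n (\<lambda>e. b' e m q) = ?S n (\<lambda>e. ?bD e m q) + ?S n (\<lambda>e. \<integral>x. ?ND e (m, x) q * y x q \<partial>M)"
          by (simp add: b'_def distrib_left sum.distrib)
        then show ?thesis unfolding Jeq split[OF m X(1)] by (simp add: add_divide_distrib diff_divide_distrib)
      qed
      show "(\<lambda>n. (y m (X n) - y m q - ?S n (\<lambda>e. b' e m q) - (\<integral>x. N (m, x) q * (y x (X n) - y x q) \<partial>M)) / ?v n) \<longlonglongrightarrow> 0"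
        unfolding eq using tendsto_add[OF l1 l2] by simp
    qed (use ym r lip b'm q Nmeas NB Y K Yeq m in auto)
  qed
qed

end

section \<open>Minimum principle and Lipschitz extension\<close>

text \<open>If the bound failed, \<open>h\<close>, which is \<open>f\<close> times a growing
  exponential, would reach a level below \<open>m\<close> somewhere in the backward cone of
  \<open>(t1, x1)\<close>. At the first such time \<open>tr\<close> supplies a direction
  \<open>a\<close> along which \<open>h\<close> increases strictly, so \<open>h\<close> was smaller
  still a moment earlier; as the norm of \<open>a\<close> is at most \<open>A\<close>, that earlier
  point is in the cone, a contradiction. The direction may depend on the point in any manner, so no
  curves have to be integrated.\<close>

lemma cone_lower_bound:
  fixes f :: "real \<times> 'a::euclidean_space \<Rightarrow> real"
  assumes diff: "\<And>t x. 0 < t \<Longrightarrow> t < S \<Longrightarrow> f differentiable (at (t, x))"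
    and init: "\<And>x. (f \<longlongrightarrow> f0 x) (at (0, x) within {0<..<S} \<times> UNIV)"
    and m: "m > 0" "\<And>x. norm (x - x1) \<le> A * t1 \<Longrightarrow> m \<le> f0 x"
    and tr: "\<And>t x. 0 < t \<Longrightarrow> t < S \<Longrightarrow> f (t, x) > 0 \<Longrightarrow>
      \<exists>a. norm a \<le> A \<and> frechet_derivative f (at (t, x)) (1, a) \<ge> - C * f (t, x)"
    and t1: "0 < t1" "t1 < S" and A: "A \<ge> 0"
  shows "m * exp (- (C + 1) * t1) \<le> f (t1, x1)"
proof (rule ccontr)
  assume neg: "\<not> m * exp (- (C + 1) * t1) \<le> f (t1, x1)"
  define h where "h p = exp ((C + 1) * fst p) * f p" for p :: "real \<times> 'a"
  have "f (t1, x1) * exp ((C + 1) * t1) < m * exp (- (C + 1) * t1) * exp ((C + 1) * t1)"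
    using neg by simp
  moreover have "exp (- (C + 1) * t1) * exp ((C + 1) * t1) = 1"
    unfolding exp_add[symmetric] by (simp add: algebra_simps)
  ultimately have h1: "h (t1, x1) < m"
    by (simp only: h_def fst_conv mult.assoc mult_1_right mult.commute[of "exp ((C + 1) * t1)"])
  \<comment> \<open>Below \<open>m\<close>, so that the contact set stays away from time 0;
    positive, so that \<open>f\<close> is positive at first contact and \<open>tr\<close> applies;
    at least \<open>h (t1, x1)\<close>, so that the contact set is not empty.\<close>
  define m' where "m' = (max 0 (h (t1, x1)) + m) / 2"
  have m': "0 < m'" "m' < m" "h (t1, x1) \<le> m'" using h1 m(1) by (auto simp: m'_def)
  define K where "K = {p :: real \<times> 'a. 0 \<le> fst p \<and> fst p \<le> t1 \<and> norm (snd p - x1) \<le> A * (t1 - fst p)}"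
  have K_closed: "closed K"
    unfolding K_def by (intro closed_Collect_conj closed_Collect_le continuous_intros)
  have "K \<subseteq> {0..t1} \<times> cball x1 (A * t1)"
  proof
    fix p assume p: "p \<in> K"
    then have "A * (t1 - fst p) \<le> A * t1" using A by (auto simp: K_def intro!: mult_left_mono)
    then show "p \<in> {0..t1} \<times> cball x1 (A * t1)" using p
      by (auto simp: K_def mem_Times_iff dist_norm norm_minus_commute)
  qed
  then have K_bdd: "bounded K" by (rule bounded_subset[rotated]) (intro bounded_Times bounded_cball bounded_closed_interval)
  \<comment> \<open>Closed in spite of the strict condition on time: towards time 0 the values of
    \<open>h\<close> in the cone tend to initial values, which are at least
    \<open>m\<close>.\<close>
  define E where "E = {p \<in> K. 0 < fst p \<and> h p \<le> m'}"
  have h_cont: "isCont h (t, x)" if "0 < t" "t < S" for t x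
    unfolding h_def using differentiable_imp_continuous_within[OF diff[OF that]]
    by (intro continuous_intros) auto
  have "closed E"
    unfolding closed_sequential_limits
  proof (intro allI impI)
    fix X p assume X: "(\<forall>n. X n \<in> E) \<and> X \<longlonglongrightarrow> p"
    then have XK: "X n \<in> K" "0 < fst (X n)" "h (X n) \<le> m'" for n by (auto simp: E_def)
    have pK: "p \<in> K" using closed_sequentially[OF K_closed] XK(1) X by blast
    obtain t x where p: "p = (t, x)" by fastforce
    show "p \<in> E"
    proof (cases "t = 0")
      case True
      have "(\<lambda>n. f (X n)) \<longlonglongrightarrow> f0 x"
      proof -
        have "X n \<in> {0<..<S} \<times> UNIV - {(0, x)}" for n
          using XK(1,2)[of n] t1 by (auto simp: K_def mem_Times_iff)
        then show ?thesis
          using init[of x] X unfolding tendsto_at_iff_sequentially comp_def p True by blast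
      qed
      moreover have "(\<lambda>n. fst (X n)) \<longlonglongrightarrow> 0" using tendsto_fst[of X p sequentially] X p True by simp
      ultimately have "(\<lambda>n. h (X n)) \<longlonglongrightarrow> exp ((C + 1) * 0) * f0 x"
        unfolding h_def by (intro tendsto_intros)
      then have "f0 x \<le> m'" using LIMSEQ_le_const2[of "\<lambda>n. h (X n)" _ m'] XK(3) by auto
      moreover have "m \<le> f0 x" using pK p True by (intro m(2)) (auto simp: K_def)
      ultimately show ?thesis using m' by simp
    next
      case False
      then have t: "0 < t" "t < S" using pK p t1 by (auto simp: K_def)
      have "(\<lambda>n. h (X n)) \<longlonglongrightarrow> h p" using isCont_tendsto_compose[OF h_cont[OF t]] X p by blast
      then have "h p \<le> m'" using LIMSEQ_le_const2[of "\<lambda>n. h (X n)" _ m'] XK(3) by auto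
      then show ?thesis using pK t p by (simp add: E_def)
    qed
  qed
  moreover have "bounded E" by (rule bounded_subset[OF K_bdd]) (auto simp: E_def)
  ultimately have "compact E" using compact_eq_bounded_closed by blast
  moreover have "(t1, x1) \<in> E" using t1 m' by (auto simp: E_def K_def)
  moreover have "continuous_on E (fst :: real \<times> 'a \<Rightarrow> real)" by (intro continuous_intros)
  ultimately obtain p where p: "p \<in> E" "\<And>p'. p' \<in> E \<Longrightarrow> fst p \<le> fst p'"
    using continuous_attains_inf[of E fst] by blast
  obtain t x where tx: "p = (t, x)" by fastforce
  have t: "0 < t" "t \<le> t1" "t < S" "h (t, x) \<le> m'" and xK: "norm (x - x1) \<le> A * (t1 - t)"
    using p(1) t1 by (auto simp: E_def K_def tx)
  \<comment> \<open>Minimality of the time of \<open>p\<close>: earlier points of the cone lie above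
    the level.\<close>
  have gt: "h (t - s, x - s *\<^sub>R a) > m'" if a: "norm a \<le> A" and s: "0 < s" "s < t" for a s
  proof (rule ccontr)
    assume "\<not> h (t - s, x - s *\<^sub>R a) > m'"
    moreover have "norm (x - s *\<^sub>R a - x1) \<le> A * (t1 - (t - s))"
    proof -
      have "norm (x - s *\<^sub>R a - x1) \<le> norm (x - x1) + norm (s *\<^sub>R a)"
        using norm_triangle_ineq4[of "x - x1" "s *\<^sub>R a"] by (simp add: algebra_simps)
      also have "\<dots> \<le> A * (t1 - t) + s * A" using xK a s by (auto intro!: add_mono)
      finally show ?thesis by (simp add: algebra_simps)
    qed
    ultimately have "(t - s, x - s *\<^sub>R a) \<in> E" using s t by (auto simp: E_def K_def)
    then show False using p(2) s tx by fastforce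
  qed
  have along: "((\<lambda>s. h (t - s, x - s *\<^sub>R a)) has_real_derivative
      - exp ((C + 1) * t) * ((C + 1) * f (t, x) + frechet_derivative f (at (t, x)) (1, a))) (at 0)" for a
  proof -
    let ?D = "frechet_derivative f (at (t, x))"
    have d: "(f has_derivative ?D) (at (t - 0, x - 0 *\<^sub>R a))"
      using diff[OF t(1,3)] by (simp add: frechet_derivative_works[symmetric])
    have "((\<lambda>s. f (t - s, x - s *\<^sub>R a)) has_derivative (\<lambda>s. ?D (- s, - (s *\<^sub>R a)))) (at 0)"
      by (rule has_derivative_compose[where f = "\<lambda>s. (t - s, x - s *\<^sub>R a)", OF _ d]) (auto intro!: derivative_eq_intros)
    moreover have "?D (- s, - (s *\<^sub>R a)) = - ?D (1, a) * s" for s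
      using linear_cmul[OF has_derivative_linear[OF d], of "- s" "(1, a)"] by simp
    ultimately have "((\<lambda>s. f (t - s, x - s *\<^sub>R a)) has_real_derivative - ?D (1, a)) (at 0)"
      unfolding has_field_derivative_def by (simp only:)
    note [derivative_intros] = this
    show ?thesis unfolding h_def
      by (auto intro!: derivative_eq_intros simp: algebra_simps)
  qed
  \<comment> \<open>Approach from earlier times in the direction \<open>a = 0\<close>, which is
    admissible because \<open>A\<close> is nonnegative.\<close>
  have "h (t, x) \<ge> m'"
  proof (rule tendsto_lowerbound[where F = "at_right 0" and f = "\<lambda>s. h (t - s, x - s *\<^sub>R 0)"])
    have "((\<lambda>s. h (t - s, x - s *\<^sub>R 0)) \<longlongrightarrow> h (t - 0, x - 0 *\<^sub>R 0)) (at 0)"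
      using DERIV_isCont[OF along[of 0]] unfolding isCont_def .
    then show "((\<lambda>s. h (t - s, x - s *\<^sub>R 0)) \<longlongrightarrow> h (t, x)) (at_right 0)"
      by (auto intro: filterlim_mono at_le)
    show "\<forall>\<^sub>F s in at_right 0. m' \<le> h (t - s, x - s *\<^sub>R 0)"
      using gt[of 0] A t by (intro eventually_at_rightI[of 0 t]) (auto intro: less_imp_le)
  qed simp
  then have hm: "h (t, x) = m'" using t by simp
  then have fpos: "f (t, x) > 0" using m' unfolding h_def by (metis exp_gt_zero zero_less_mult_pos)
  obtain a where a: "norm a \<le> A" "frechet_derivative f (at (t, x)) (1, a) \<ge> - C * f (t, x)"
    using tr[OF t(1,3) fpos] by blast
  \<comment> \<open>Here the 1 in the exponent makes the sign strict.\<close>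
  have "(C + 1) * f (t, x) + frechet_derivative f (at (t, x)) (1, a) > 0" using a(2) fpos by (simp add: algebra_simps)
  then have "- exp ((C + 1) * t) * ((C + 1) * f (t, x) + frechet_derivative f (at (t, x)) (1, a)) < 0"
    by (simp add: mult_neg_pos)
  from DERIV_neg_dec_right[OF along this] obtain d where d: "d > 0" "\<And>s. 0 < s \<Longrightarrow> s < d \<Longrightarrow> h (t - s, x - s *\<^sub>R a) < h (t, x)"
    by auto
  define s where "s = min d t / 2"
  have "0 < s" "s < d" "s < t" using d(1) t(1) by (auto simp: s_def)
  then show False using d(2)[of s] gt[OF a(1), of s] hm by simp
qed

section \<open>Lipschitz extension, and Lipschitz bounds on the fluid domain\<close>

lemma lipschitz_extension_real:
  fixes f :: "'a::metric_space \<Rightarrow> real"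
  assumes "S \<noteq> {}" "L \<ge> 0"
    and lip: "\<And>x y. x \<in> S \<Longrightarrow> y \<in> S \<Longrightarrow> \<bar>f x - f y\<bar> \<le> L * dist x y"
    and bd: "\<And>x. x \<in> S \<Longrightarrow> \<bar>f x\<bar> \<le> B"
  obtains g where "\<And>x. x \<in> S \<Longrightarrow> g x = f x" "\<And>x y. \<bar>g x - g y\<bar> \<le> L * dist x y" "\<And>x. \<bar>g x\<bar> \<le> B"
proof -
  \<comment> \<open>McShane's formula, the lower envelope of the cones over the graph of
    \<open>f\<close>. Truncation to the range from -B to B afterwards does not increase the
    Lipschitz constant.\<close>
  define h where "h x = (INF y\<in>S. f y + L * dist x y)" for x
  have bb: "bdd_below ((\<lambda>y. f y + L * dist x y) ` S)" for x
  proof (rule bdd_belowI2[of _ "- B"])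
    fix y assume "y \<in> S"
    then have "- B \<le> f y" using bd[of y] by linarith
    moreover have "0 \<le> L * dist x y" using assms(2) by simp
    ultimately show "- B \<le> f y + L * dist x y" by linarith
  qed
  have hf: "h x = f x" if x: "x \<in> S" for x
  proof (rule antisym)
    show "h x \<le> f x" using cINF_lower[OF bb x, of x] by (simp add: h_def)
    show "f x \<le> h x" unfolding h_def
      by (rule cINF_greatest[OF assms(1)]) (use lip[OF x] in \<open>force simp: abs_le_iff\<close>)
  qed
  have hle: "h x \<le> h y + L * dist x y" for x y
  proof -
    have "h x - L * dist x y \<le> f z + L * dist y z" if z: "z \<in> S" for z
    proof -
      have "h x \<le> f z + L * dist x z" unfolding h_def by (rule cINF_lower[OF bb z])
      moreover have "L * dist x z \<le> L * (dist x y + dist y z)"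
        by (intro mult_left_mono dist_triangle assms)
      ultimately show ?thesis by (simp add: algebra_simps)
    qed
    then have "h x - L * dist x y \<le> h y" unfolding h_def[of y] by (intro cINF_greatest[OF assms(1)])
    then show ?thesis by simp
  qed
  show ?thesis
  proof (rule that[of "\<lambda>x. max (- B) (min B (h x))"])
    show "max (- B) (min B (h x)) = f x" if "x \<in> S" for x using hf[OF that] bd[OF that] by auto
    show "\<bar>max (- B) (min B (h x)) - max (- B) (min B (h y))\<bar> \<le> L * dist x y" for x y
      using hle[of x y] hle[of y x] assms(2) by (auto simp: max_def min_def dist_commute)
    obtain x0 where "x0 \<in> S" using assms(1) by blast
    then have "B \<ge> 0" using bd[of x0] by linarith
    then show "\<bar>max (- B) (min B (h x))\<bar> \<le> B" for x by auto
  qed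
qed

text \<open>Componentwise extension; the factor CARD('n) is the price of bounding a norm by the sum
  of the components.\<close>

lemma lipschitz_extension_cart:
  fixes f :: "'a::metric_space \<Rightarrow> real^'n" and L B :: real
  assumes "S \<noteq> {}" "L \<ge> 0"
    and lip: "\<And>x y. x \<in> S \<Longrightarrow> y \<in> S \<Longrightarrow> norm (f x - f y) \<le> L * dist x y"
    and bd: "\<And>x. x \<in> S \<Longrightarrow> norm (f x) \<le> B"
  obtains g where "\<And>x. x \<in> S \<Longrightarrow> g x = f x"
    "\<And>x y. norm (g x - g y) \<le> CARD('n) * L * dist x y" "\<And>x. norm (g x) \<le> CARD('n) * B"
proof -
  have "\<exists>g::'a \<Rightarrow> real. (\<forall>x\<in>S. g x = f x $ k) \<and> (\<forall>x y. \<bar>g x - g y\<bar> \<le> L * dist x y) \<and> (\<forall>x. \<bar>g x\<bar> \<le> B)" for k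
  proof -
    have "\<bar>f x $ k - f y $ k\<bar> \<le> L * dist x y" if "x \<in> S" "y \<in> S" for x y
      using component_le_norm_cart[of "f x - f y" k] lip[OF that] by simp
    moreover have "\<bar>f x $ k\<bar> \<le> B" if "x \<in> S" for x
      using component_le_norm_cart[of "f x" k] bd[OF that] by simp
    ultimately obtain g :: "'a \<Rightarrow> real" where "\<And>x. x \<in> S \<Longrightarrow> g x = f x $ k" "\<And>x y. \<bar>g x - g y\<bar> \<le> L * dist x y" "\<And>x. \<bar>g x\<bar> \<le> B"
      using lipschitz_extension_real[of S L "\<lambda>x. f x $ k" B] assms by (metis (no_types, lifting))
    then show ?thesis by blast
  qed
  then obtain g where g: "\<And>k x. x \<in> S \<Longrightarrow> g k x = f x $ k" "\<And>k x y. \<bar>g k x - g k y\<bar> \<le> L * dist x y" "\<And>k x. \<bar>g k x\<bar> \<le> B"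
    by metis
  show ?thesis
  proof (rule that[of "\<lambda>x. \<chi> k. g k x"])
    show "(\<chi> k. g k x) = f x" if "x \<in> S" for x using g(1)[OF that] by (simp add: vec_eq_iff)
    have "norm ((\<chi> k. g k x) - (\<chi> k. g k y)) \<le> (\<Sum>k\<in>(UNIV::'n set). L * dist x y)" for x y
      by (rule order_trans[OF norm_le_l1_cart], rule sum_mono) (simp add: g(2))
    then show "norm ((\<chi> k. g k x) - (\<chi> k. g k y)) \<le> CARD('n) * L * dist x y" for x y by (simp add: mult.assoc)
    have "norm (\<chi> k. g k x) \<le> (\<Sum>k\<in>(UNIV::'n set). B)" for x
      by (rule order_trans[OF norm_le_l1_cart], rule sum_mono) (simp add: g(3))
    then show "norm (\<chi> k. g k x) \<le> CARD('n) * B" for x by simp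
  qed
qed

lemma Csb_on_Suc_derivative_bound:
  fixes f :: "'a::euclidean_space \<Rightarrow> 'b::real_normed_vector"
  assumes "Csb_on (Suc k) f U"
  obtains K where "K > 0" "\<And>p v. p \<in> U \<Longrightarrow> norm (frechet_derivative f (at p) v) \<le> K * norm v"
proof -
  have "\<exists>B. \<forall>p\<in>U. norm (frechet_derivative f (at p) e) \<le> B" if "e \<in> Basis" for e
    using Csb_on_0[of k "\<lambda>p. frechet_derivative f (at p) e" U] assms that by (auto simp: bounded_iff)
  then obtain B where B: "\<And>e p. e \<in> Basis \<Longrightarrow> p \<in> U \<Longrightarrow> norm (frechet_derivative f (at p) e) \<le> B e" by metis
  show ?thesis
  \<comment> \<open>The added 1 makes the constant strictly positive.\<close>
  proof (rule that[of "(\<Sum>e\<in>Basis. \<bar>B e\<bar>) + 1"])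
    show "(\<Sum>e\<in>Basis. \<bar>B e\<bar>) + 1 > 0" by (simp add: add_nonneg_pos sum_nonneg)
    fix p v assume p: "p \<in> U"
    let ?D = "frechet_derivative f (at p)"
    have "(f has_derivative ?D) (at p)" using assms p by (simp add: frechet_derivative_works[symmetric])
    then have lin: "linear ?D" by (rule has_derivative_linear)
    have "?D v = ?D (\<Sum>e\<in>Basis. (v \<bullet> e) *\<^sub>R e)" by (simp add: euclidean_representation)
    also have "\<dots> = (\<Sum>e\<in>Basis. (v \<bullet> e) *\<^sub>R ?D e)" by (simp add: linear_sum[OF lin] linear_cmul[OF lin])
    also have "norm \<dots> \<le> (\<Sum>e\<in>Basis. norm v * \<bar>B e\<bar>)"
    proof (rule order_trans[OF norm_sum], rule sum_mono)
      fix e :: 'a assume e: "e \<in> Basis"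
      have "norm (?D e) \<le> \<bar>B e\<bar>" using B[OF e p] by linarith
      then show "norm ((v \<bullet> e) *\<^sub>R ?D e) \<le> norm v * \<bar>B e\<bar>"
        using Basis_le_norm[OF e, of v] by (auto intro!: mult_mono)
    qed
    also have "\<dots> \<le> ((\<Sum>e\<in>Basis. \<bar>B e\<bar>) + 1) * norm v"
      by (simp add: sum_distrib_left[symmetric] algebra_simps)
    finally show "norm (?D v) \<le> ((\<Sum>e\<in>Basis. \<bar>B e\<bar>) + 1) * norm v" .
  qed
qed

lemma lipschitz_of_derivative_bound:
  fixes f :: "'a::euclidean_space \<Rightarrow> 'b::real_normed_vector" and K :: real
  assumes "convex U" "\<And>p. p \<in> U \<Longrightarrow> (f has_derivative f' p) (at p)"
    and "\<And>p v. p \<in> U \<Longrightarrow> norm (f' p v) \<le> K * norm v" "p \<in> U" "q \<in> U"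
  shows "norm (f p - f q) \<le> K * norm (p - q)"
proof (rule differentiable_bound[OF assms(1), where f' = f'])
  show "(f has_derivative f' x) (at x within U)" if "x \<in> U" for x
    by (rule has_derivative_at_withinI[OF assms(2)[OF that]])
  show "onorm (f' x) \<le> K" if "x \<in> U" for x by (rule onorm_le) (use assms(3)[OF that] in auto)
qed (use assms in auto)

lemma norm_triple_ge:
  fixes t :: real and x :: "'a::euclidean_space" and z :: real
  shows "norm (t, x) \<le> norm (t, x, z)" "\<bar>z\<bar> \<le> norm (t, x, z)" "norm x \<le> norm (t, x, z)" "\<bar>t\<bar> \<le> norm (t, x, z)"
    "norm (t, x, z) \<le> \<bar>t\<bar> + norm x + \<bar>z\<bar>"
proof -
  show "norm (t, x) \<le> norm (t, x, z)" by (simp add: norm_Pair)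
  show "\<bar>z\<bar> \<le> norm (t, x, z)" by (metis norm_snd_le order_trans real_norm_def snd_conv)
  show "norm x \<le> norm (t, x, z)" by (metis norm_fst_le norm_snd_le order_trans fst_conv snd_conv)
  show "\<bar>t\<bar> \<le> norm (t, x, z)" by (metis norm_fst_le fst_conv real_norm_def)
  have "norm (t, x, z) \<le> norm t + norm (x, z)" "norm (x, z) \<le> norm x + norm z" by (rule norm_Pair_le)+
  then show "norm (t, x, z) \<le> \<bar>t\<bar> + norm x + \<bar>z\<bar>" by simp
qed

text \<open>
  The two points are joined by a path of constant relative height \<open>\<theta>\<close> followed by a vertical
  segment, of total length at most \<open>2 + 2 * G\<close> times their distance.
\<close>

lemma fluid_domain_lipschitz:
  fixes f :: "real \<times> (real^'n) \<times> real \<Rightarrow> 'b::real_normed_vector"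
  assumes P: "convex P" "P \<subseteq> {0<..<T} \<times> UNIV"
    and depth: "\<And>t x. (t, x) \<in> P \<Longrightarrow> zb x < \<eta> (t, x)"
    and \<eta>: "\<And>p. p \<in> P \<Longrightarrow> (\<eta> has_derivative \<eta>' p) (at p)" "\<And>p v. p \<in> P \<Longrightarrow> \<bar>\<eta>' p v\<bar> \<le> G * norm v"
    and zb: "\<And>x. (zb has_derivative zb' x) (at x)" "\<And>x v. \<bar>zb' x v\<bar> \<le> G * norm v"
    and f: "\<And>p. p \<in> fluid_domain T zb \<eta> \<Longrightarrow> (f has_derivative f' p) (at p)"
      "\<And>p v. p \<in> fluid_domain T zb \<eta> \<Longrightarrow> norm (f' p v) \<le> K * norm v"
    and K: "K \<ge> 0" and G: "G \<ge> 0"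
    and p: "(t, x, z) \<in> fluid_domain T zb \<eta>" "(t', x', z') \<in> fluid_domain T zb \<eta>" "(t, x) \<in> P" "(t', x') \<in> P"
  shows "norm (f (t, x, z) - f (t', x', z')) \<le> K * (2 + 2 * G) * norm ((t, x, z) - (t', x', z'))"
proof -
  define \<theta> where "\<theta> = (z - zb x) / (\<eta> (t, x) - zb x)"
  have z: "zb x < z" "z < \<eta> (t, x)" using p by (auto simp: fluid_domain_def fluid_slice_def)
  have \<theta>: "0 < \<theta>" "\<theta> < 1" using z by (auto simp: \<theta>_def)
  define \<zeta> where "\<zeta> b = (1 - \<theta>) * zb (snd b) + \<theta> * \<eta> b" for b
  have \<zeta>z: "\<zeta> (t, x) = z"
  proof -
    have "\<theta> * (\<eta> (t, x) - zb x) = z - zb x" using z by (simp add: \<theta>_def)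
    then show ?thesis by (simp add: \<zeta>_def algebra_simps)
  qed
  define \<zeta>' where "\<zeta>' b v = (1 - \<theta>) * zb' (snd b) (snd v) + \<theta> * \<eta>' b v" for b v
  have \<zeta>d: "(\<zeta> has_derivative \<zeta>' b) (at b)" if "b \<in> P" for b
    unfolding \<zeta>_def[abs_def] \<zeta>'_def[abs_def]
    by (intro has_derivative_add has_derivative_mult_right \<eta>(1)[OF that]
        has_derivative_compose[OF has_derivative_snd[OF has_derivative_ident] zb(1)])
  \<comment> \<open>A convex combination of the slopes of bottom and surface is bounded by the
    common \<open>G\<close>.\<close>
  have \<zeta>b: "\<bar>\<zeta>' b v\<bar> \<le> G * norm v" if "b \<in> P" for b v
  proof -
    have "\<bar>zb' (snd b) (snd v)\<bar> \<le> G * norm v"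
      using zb(2)[of "snd b" "snd v"] mult_left_mono[OF norm_snd_le[of "snd v" "fst v"] G] by simp
    then have "\<bar>(1 - \<theta>) * zb' (snd b) (snd v)\<bar> \<le> (1 - \<theta>) * (G * norm v)" "\<bar>\<theta> * \<eta>' b v\<bar> \<le> \<theta> * (G * norm v)"
      using \<eta>(2)[OF that, of v] \<theta> by (auto simp: abs_mult)
    then have "\<bar>\<zeta>' b v\<bar> \<le> (1 - \<theta>) * (G * norm v) + \<theta> * (G * norm v)" unfolding \<zeta>'_def by linarith
    then show ?thesis by (simp add: algebra_simps)
  qed
  have inQ: "(fst b, snd b, \<zeta> b) \<in> fluid_domain T zb \<eta>" if b: "b \<in> P" for b
  proof -
    have d: "zb (snd b) < \<eta> b" using depth[of "fst b" "snd b"] b by simp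
    have "zb (snd b) < \<zeta> b"
      using mult_strict_left_mono[OF d \<theta>(1)] by (simp add: \<zeta>_def algebra_simps)
    moreover have "\<zeta> b < \<eta> b"
      using mult_strict_left_mono[OF d, of "1 - \<theta>"] \<theta>(2) by (simp add: \<zeta>_def algebra_simps)
    ultimately show ?thesis using b P(2) by (auto simp: fluid_domain_def fluid_slice_def)
  qed
  define F where "F b = f (fst b, snd b, \<zeta> b)" for b
  let ?b = "(t, x)" and ?b' = "(t', x')"
  have 1: "norm (F ?b - F ?b') \<le> K * (1 + G) * norm (?b - ?b')"
  proof (rule lipschitz_of_derivative_bound[OF P(1), where f' = "\<lambda>b v. f' (fst b, snd b, \<zeta> b) (fst v, snd v, \<zeta>' b v)"])
    fix b assume b: "b \<in> P"
    show "(F has_derivative (\<lambda>v. f' (fst b, snd b, \<zeta> b) (fst v, snd v, \<zeta>' b v))) (at b)"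
      unfolding F_def[abs_def]
      by (rule has_derivative_compose[where f = "\<lambda>b. (fst b, snd b, \<zeta> b)", OF _ f(1)[OF inQ[OF b]]]) (auto intro!: derivative_eq_intros \<zeta>d[OF b])
    fix v
    have "norm (fst v, snd v, \<zeta>' b v) \<le> norm v + G * norm v"
    proof -
      have "(fst v, snd v, \<zeta>' b v) = (fst v, snd v, 0) + (0, 0, \<zeta>' b v)" by simp
      then have "norm (fst v, snd v, \<zeta>' b v) \<le> norm (fst v, snd v, 0::real) + norm (0::real, 0::real^'n, \<zeta>' b v)"
        by (metis norm_triangle_ineq)
      moreover have "norm (fst v, snd v, 0::real) = norm v" by (cases v) (simp add: norm_Pair)
      moreover have "norm (0::real, 0::real^'n, \<zeta>' b v) = \<bar>\<zeta>' b v\<bar>" by (simp add: norm_Pair)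
      ultimately show ?thesis using \<zeta>b[OF b, of v] by linarith
    qed
    then have "K * norm (fst v, snd v, \<zeta>' b v) \<le> K * (norm v + G * norm v)" by (rule mult_left_mono[OF _ K])
    then show "norm (f' (fst b, snd b, \<zeta> b) (fst v, snd v, \<zeta>' b v)) \<le> K * (1 + G) * norm v"
      using f(2)[OF inQ[OF b], of "(fst v, snd v, \<zeta>' b v)"] by (simp add: algebra_simps)
  qed (use p in auto)
  have 2: "\<bar>\<zeta> ?b - \<zeta> ?b'\<bar> \<le> G * norm (?b - ?b')"
    unfolding real_norm_def[symmetric]
    by (rule lipschitz_of_derivative_bound[OF P(1) \<zeta>d]) (use \<zeta>b p in auto)
  define I where "I = {zb x'<..<\<eta> (t', x')}"
  have vert: "(t', x', y) \<in> fluid_domain T zb \<eta>" if "y \<in> I" for y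
    using that p(2) by (auto simp: I_def fluid_domain_def fluid_slice_def)
  have 3: "norm (f (t', x', \<zeta> ?b') - f (t', x', z')) \<le> K * norm (\<zeta> ?b' - z')"
  proof (rule lipschitz_of_derivative_bound[where U = I and f' = "\<lambda>y v. f' (t', x', y) (0, 0, v)"])
    show "convex I" by (simp add: I_def)
    show "((\<lambda>y. f (t', x', y)) has_derivative (\<lambda>v. f' (t', x', y) (0, 0, v))) (at y)" if "y \<in> I" for y
      by (rule has_derivative_compose[where f = "\<lambda>y. (t', x', y)", OF _ f(1)[OF vert[OF that]]]) (auto intro!: derivative_eq_intros)
    show "norm (f' (t', x', y) (0, 0, v)) \<le> K * norm v" if "y \<in> I" for y v
      using f(2)[OF vert[OF that], of "(0, 0, v)"] by (simp add: norm_Pair)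
    show "\<zeta> (t', x') \<in> I" using inQ[OF p(4)] by (auto simp: I_def fluid_domain_def fluid_slice_def)
    show "z' \<in> I" using p(2) by (auto simp: I_def fluid_domain_def fluid_slice_def)
  qed
  let ?N = "norm ((t, x, z) - (t', x', z'))"
  have b: "norm (?b - ?b') \<le> ?N" using norm_triple_ge(1)[of "t - t'" "x - x'" "z - z'"] by simp
  have "\<bar>z - z'\<bar> \<le> ?N" using norm_triple_ge(2)[of "z - z'" "t - t'" "x - x'"] by simp
  \<comment> \<open>Length of the vertical segment: the height difference of the end points plus the
    rise of the graph of \<open>\<zeta>\<close> between the bases.\<close>
  then have "norm (\<zeta> ?b' - z') \<le> ?N + G * ?N"
    using 2 mult_left_mono[OF b G] by (simp add: \<zeta>z abs_le_iff)
  then have "norm (f (t', x', \<zeta> ?b') - f (t', x', z')) \<le> K * (?N + G * ?N)"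
    by (rule order_trans[OF 3 mult_left_mono[OF _ K]])
  moreover have "norm (F ?b - F ?b') \<le> K * (1 + G) * ?N"
    by (rule order_trans[OF 1]) (use b K G in \<open>auto intro!: mult_left_mono\<close>)
  moreover have "norm (f (t, x, z) - f (t', x', z')) \<le> norm (F ?b - F ?b') + norm (f (t', x', \<zeta> ?b') - f (t', x', z'))"
    using norm_triangle_ineq[of "F ?b - F ?b'" "f (t', x', \<zeta> ?b') - f (t', x', z')"] by (simp add: F_def \<zeta>z)
  ultimately show ?thesis by (simp add: algebra_simps)
qed

text \<open>Turns traces into values of the Lipschitz extension. Membership of \<open>p\<close> in
  the closure makes the limit from within \<open>Q\<close> unique.\<close>

lemma cont_ext_eq:
  fixes f :: "'a::metric_space \<Rightarrow> 'b::t2_space"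
  assumes "p \<in> closure Q" "open W" "p \<in> W" "isCont g p" "\<And>x. x \<in> Q \<inter> W \<Longrightarrow> f x = g x"
  shows "cont_ext Q f p = g p"
proof (cases "p \<in> Q")
  case True
  then show ?thesis using assms by (simp add: cont_ext_def)
next
  case False
  then have "p islimpt Q" using assms(1) by (simp add: closure_def)
  then have nb: "at p within Q \<noteq> bot" using trivial_limit_within by blast
  have "(g \<longlongrightarrow> g p) (at p within Q)" using assms(4) isCont_def tendsto_within_subset by blast
  moreover have "\<forall>\<^sub>F x in at p within Q. g x = f x"
    unfolding eventually_at_topological using assms by auto
  ultimately have "(f \<longlongrightarrow> g p) (at p within Q)" by (rule Lim_transform_eventually)
  then show ?thesis using False tendsto_Lim[OF nb] by (simp add: cont_ext_def)
qed

lemma inner_grad: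
  fixes f :: "real^'n \<Rightarrow> real"
  assumes "(f has_derivative f') (at x)"
  shows "v \<bullet> grad f x = f' v"
proof -
  have f': "frechet_derivative f (at x) = f'" using frechet_derivative_at[OF assms] by simp
  have lin: "linear f'" by (rule has_derivative_linear[OF assms])
  have "f' v = f' (\<Sum>k\<in>UNIV. v $ k *\<^sub>R axis k 1)" 
    by (subst basis_expansion[of v, unfolded scalar_mult_eq_scaleR, symmetric]) (rule refl)
  also have "\<dots> = (\<Sum>k\<in>UNIV. v $ k * f' (axis k 1))" by (simp add: linear_sum[OF lin] linear_cmul[OF lin])
  finally show ?thesis by (simp add: grad_def f' inner_vec_def)
qed

lemma has_derivative_deriv_time:
  fixes f :: "real \<times> 'a::real_normed_vector \<Rightarrow> real"
  assumes "(f has_derivative f') (at (t, y))"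
  shows "deriv (\<lambda>\<tau>. f (\<tau>, y)) t = f' (1, 0)"
proof -
  have lin: "linear f'" by (rule has_derivative_linear[OF assms])
  have "((\<lambda>\<tau>. f (\<tau>, y)) has_derivative (\<lambda>s. f' (s, 0))) (at t)"
    by (rule has_derivative_compose[where f = "\<lambda>\<tau>. (\<tau>, y)", OF _ assms]) (auto intro!: derivative_eq_intros)
  moreover have "(\<lambda>s. f' (s, 0)) = (*) (f' (1, 0))"
  proof
    fix s :: real
    show "f' (s, 0) = f' (1, 0) * s" using linear_cmul[OF lin, of s "(1, 0)"] by simp
  qed
  ultimately show ?thesis by (intro DERIV_imp_deriv) (simp only: has_field_derivative_def)
qed

lemma has_derivative_deriv_last:
  fixes f :: "real \<times> 'a::real_normed_vector \<times> real \<Rightarrow> real"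
  assumes "(f has_derivative f') (at (t, x, l))"
  shows "((\<lambda>\<mu>. f (t, x, \<mu>)) has_real_derivative f' (0, 0, 1)) (at l)"
proof -
  have lin: "linear f'" by (rule has_derivative_linear[OF assms])
  have "((\<lambda>\<mu>. f (t, x, \<mu>)) has_derivative (\<lambda>s. f' (0, 0, s))) (at l)"
    by (rule has_derivative_compose[where f = "\<lambda>\<mu>. (t, x, \<mu>)", OF _ assms]) (auto intro!: derivative_eq_intros)
  moreover have "(\<lambda>s. f' (0, 0, s)) = (*) (f' (0, 0, 1))"
  proof
    fix s :: real
    show "f' (0, 0, s) = f' (0, 0, 1) * s" using linear_cmul[OF lin, of s "(0, 0, 1)"] by simp
  qed
  ultimately show ?thesis by (simp only: has_field_derivative_def)
qed

section \<open>Characteristics\<close>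

lemma norm_fst_le_norm: "norm (fst p) \<le> norm p"
  by (metis norm_fst_le prod.collapse)

lemma norm_snd_le_norm: "norm (snd p) \<le> norm p"
  by (metis norm_snd_le prod.collapse)

lemma norm_le_fst_snd: "norm p \<le> norm (fst p) + norm (snd p)"
  by (metis norm_Pair_le prod.collapse)

lemma vector_derivative_bound_within:
  fixes g :: "real \<Rightarrow> 'b::real_normed_vector"
  assumes "\<And>\<theta>. \<theta> \<in> {0..1} \<Longrightarrow> (g has_vector_derivative d \<theta>) (at \<theta> within {0..1})"
    and "\<And>\<theta>. \<theta> \<in> {0..1} \<Longrightarrow> norm (d \<theta>) \<le> e" and "a \<in> {0..1}" "b \<in> {0..1}"
  shows "norm (g a - g b) \<le> e"
proof -
  have "norm (g a - g b) \<le> e * norm (a - b)"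
  proof (rule differentiable_bound[where S = "{0..1}" and f' = "\<lambda>\<theta> s. s *\<^sub>R d \<theta>"])
    show "(g has_derivative (\<lambda>s. s *\<^sub>R d x)) (at x within {0..1})" if "x \<in> {0..1}" for x
      using assms(1)[OF that] by (simp add: has_vector_derivative_def)
    show "onorm (\<lambda>s. s *\<^sub>R d x) \<le> e" if "x \<in> {0..1}" for x
      by (rule onorm_le) (use assms(2)[OF that] in \<open>auto simp: mult.commute[of e] intro: mult_left_mono\<close>)
  qed (use assms in auto)
  also have "\<dots> \<le> e * 1"
    by (rule mult_left_mono) (use assms(3,4) order_trans[OF norm_ge_zero assms(2)[OF assms(3)]] in auto)
  finally show ?thesis by simp
qed

locale characteristics =
  fixes V :: "real \<times> (real^'n) \<times> real \<Rightarrow> (real^'n) \<times> real"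
    and \<phi>0 :: "(real^'n) \<times> real \<Rightarrow> real" and L A G S :: real
  assumes V_lip: "norm (V p - V q) \<le> L * norm (p - q)"
    and V_bound: "norm (V p) \<le> A"
    and \<phi>0_lip: "a \<in> strip \<Longrightarrow> b \<in> strip \<Longrightarrow> \<bar>\<phi>0 a - \<phi>0 b\<bar> \<le> G * norm (a - b)"
    and L_nonneg: "L \<ge> 0" and A_nonneg: "A \<ge> 0" and G_nonneg: "G \<ge> 0" and S_pos: "S > 0"
    and small: "S * L * (4 + CARD('n) * G) * (CARD('n) + 1) \<le> 1/2"
begin

text \<open>3 + G is the Lipschitz factor of the fixed point map: 2 for the horizontal displacement
  between \<theta> and 1, taken as a difference of two integrals, 1 for the vertical displacement,
  and G for the moved foot inside \<open>\<phi>0\<close>.\<close>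

lemma small3: "S * L * (3 + G) \<le> 1/2"
proof -
  have n: "real CARD('n) \<ge> 1" using zero_less_card_finite[where 'a = 'n] by linarith
  then have "1 * G \<le> CARD('n) * G" by (intro mult_right_mono G_nonneg)
  then have "(3 + G) * 1 \<le> (4 + CARD('n) * G) * (CARD('n) + 1)"
    using n G_nonneg by (intro mult_mono) auto
  then have "S * L * ((3 + G) * 1) \<le> S * L * ((4 + CARD('n) * G) * (CARD('n) + 1))"
    using S_pos L_nonneg by (intro mult_left_mono) auto
  then show ?thesis using small unfolding mult.assoc mult_1_right by (rule order_trans)
qed

definition is_characteristic :: "real \<times> (real^'n) \<times> real \<Rightarrow> (real \<Rightarrow> (real^'n) \<times> real) \<Rightarrow> bool" where
  "is_characteristic q c \<longleftrightarrow>
    (\<forall>\<theta>\<in>{0..1}. (c has_vector_derivative fst q *\<^sub>R V (fst q * \<theta>, c \<theta>)) (at \<theta> within {0..1})) \<and>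
    fst (c 1) = fst (snd q) \<and> snd (c 0) = \<phi>0 (fst (c 0), snd (snd q))"

lemma V_cont: "continuous_on UNIV V"
proof (rule continuous_at_imp_continuous_on, intro ballI)
  fix p
  show "isCont V p"
    unfolding isCont_def
  proof (rule Lim_null[THEN iffD2], rule Lim_null_comparison)
    show "\<forall>\<^sub>F x in at p. norm (V x - V p) \<le> L * norm (x - p)" using V_lip by (intro always_eventually) blast
    have "((\<lambda>x. L * norm (x - p)) \<longlongrightarrow> L * norm (p - p)) (at p)" by (intro tendsto_intros)
    then show "((\<lambda>x. L * norm (x - p)) \<longlongrightarrow> 0) (at p)" by simp
  qed
qed

lemma characteristic_cont: "is_characteristic q c \<Longrightarrow> continuous_on {0..1} c"
  unfolding is_characteristic_def
  by (meson continuous_on_eq_continuous_within has_vector_derivative_continuous)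

text \<open>The Lipschitz constant of a curve in its data that comes out of
  \<open>characteristic_stable\<close>. The outer 2 is the absorption of a term with factor 1/2; A +
  S L bounds the effect of \<open>t\<close> on the right-hand side.\<close>

definition stab :: real where "stab = 2 * ((1 + G) + (2 + G) * (A + S * L))"

lemma stab_nonneg: "stab \<ge> 0"
  unfolding stab_def using G_nonneg A_nonneg S_pos L_nonneg by auto

text \<open>The data sit at both ends, so the largest distance \<open>D\<close> is estimated by
  itself with factor at most 1/2: horizontally starting from \<theta> = 1, vertically from \<theta>
  = 0. Equal data force D = 0, which is uniqueness.\<close>

lemma characteristic_stable:
  assumes c: "is_characteristic (t, x, l) c" and c': "is_characteristic (t', x', l') c'"
    and t: "0 \<le> t'" "t' \<le> S" and l: "0 < l" "l < 1" "0 < l'" "l' < 1" and th: "\<theta> \<in> {0..1}"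
  shows "norm (c \<theta> - c' \<theta>) \<le> stab * (\<bar>t - t'\<bar> + norm (x - x') + \<bar>l - l'\<bar>)"
proof -
  have cont: "continuous_on {0..1} (\<lambda>\<theta>. norm (c \<theta> - c' \<theta>))"
    by (intro continuous_intros characteristic_cont[OF c] characteristic_cont[OF c'])
  obtain \<theta>0 where \<theta>0: "\<theta>0 \<in> {0..1}" "\<And>\<theta>. \<theta> \<in> {0..1} \<Longrightarrow> norm (c \<theta> - c' \<theta>) \<le> norm (c \<theta>0 - c' \<theta>0)"
    using continuous_attains_sup[OF _ _ cont] by auto
  define D where "D = norm (c \<theta>0 - c' \<theta>0)"
  have D: "norm (c \<theta> - c' \<theta>) \<le> D" if "\<theta> \<in> {0..1}" for \<theta> using \<theta>0(2)[OF that] by (simp add: D_def)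
  have D0: "D \<ge> 0" by (simp add: D_def)
  \<comment> \<open>Bound for the speed of the difference of the curves: \<open>t\<close> enters as
    a factor, with \<open>A\<close>, and inside the time argument, with
    \<open>S * L\<close>.\<close>
  define e where "e = \<bar>t - t'\<bar> * (A + S * L) + S * L * D"
  let ?g = "\<lambda>\<theta>. c \<theta> - c' \<theta>" and ?d = "\<lambda>\<theta>. t *\<^sub>R V (t * \<theta>, c \<theta>) - t' *\<^sub>R V (t' * \<theta>, c' \<theta>)"
  have gd: "(?g has_vector_derivative ?d \<theta>) (at \<theta> within {0..1})" if "\<theta> \<in> {0..1}" for \<theta>
    using c c' that unfolding is_characteristic_def by (auto intro!: has_vector_derivative_diff)
  have de: "norm (?d \<theta>) \<le> e" if th: "\<theta> \<in> {0..1}" for \<theta>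
  proof -
    have "?d \<theta> = (t - t') *\<^sub>R V (t * \<theta>, c \<theta>) + t' *\<^sub>R (V (t * \<theta>, c \<theta>) - V (t' * \<theta>, c' \<theta>))"
      by (simp add: algebra_simps)
    moreover have "norm ((t - t') *\<^sub>R V (t * \<theta>, c \<theta>)) \<le> \<bar>t - t'\<bar> * A" using V_bound by (simp add: mult_left_mono)
    moreover have "norm (t' *\<^sub>R (V (t * \<theta>, c \<theta>) - V (t' * \<theta>, c' \<theta>))) \<le> S * (L * (\<bar>t - t'\<bar> + D))"
    proof -
      have "norm ((t * \<theta>, c \<theta>) - (t' * \<theta>, c' \<theta>)) \<le> norm (t * \<theta> - t' * \<theta>) + norm (c \<theta> - c' \<theta>)"
        using norm_Pair_le[of "t * \<theta> - t' * \<theta>" "c \<theta> - c' \<theta>"] by simp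
      moreover have "norm (t * \<theta> - t' * \<theta>) \<le> \<bar>t - t'\<bar>"
        using th mult_left_mono[of \<theta> 1 "\<bar>t - t'\<bar>"] by (simp add: abs_mult left_diff_distrib[symmetric])
      ultimately have "norm ((t * \<theta>, c \<theta>) - (t' * \<theta>, c' \<theta>)) \<le> \<bar>t - t'\<bar> + D" using D[OF th] by linarith
      then have "norm (V (t * \<theta>, c \<theta>) - V (t' * \<theta>, c' \<theta>)) \<le> L * (\<bar>t - t'\<bar> + D)"
        by (intro order_trans[OF V_lip] mult_left_mono L_nonneg)
      then show ?thesis using t L_nonneg D0 by (auto intro!: mult_mono)
    qed
    ultimately have "norm (?d \<theta>) \<le> \<bar>t - t'\<bar> * A + S * (L * (\<bar>t - t'\<bar> + D))"
      by (metis (no_types, lifting) add_mono norm_triangle_le)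
    then show ?thesis by (simp add: e_def algebra_simps)
  qed
  have ge: "norm (?g a - ?g b) \<le> e" if "a \<in> {0..1}" "b \<in> {0..1}" for a b
    by (rule vector_derivative_bound_within[OF gd de that])
  have X: "norm (fst (?g a)) \<le> norm (x - x') + e" if "a \<in> {0..1}" for a
  proof -
    have "fst (?g 1) = x - x'" using c c' by (simp add: is_characteristic_def)
    moreover have "norm (fst (?g a - ?g 1)) \<le> e" using ge[OF that, of 1] norm_fst_le_norm[of "?g a - ?g 1"] by simp
    ultimately show ?thesis using norm_triangle_sub[of "fst (?g a)" "fst (?g 1)"] by simp
  qed
  have Z: "\<bar>snd (?g a)\<bar> \<le> G * (norm (x - x') + e + \<bar>l - l'\<bar>) + e" if "a \<in> {0..1}" for a
  proof -
    have "\<bar>snd (?g 0)\<bar> = \<bar>\<phi>0 (fst (c 0), l) - \<phi>0 (fst (c' 0), l')\<bar>" using c c' by (simp add: is_characteristic_def)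
    also have "\<dots> \<le> G * norm ((fst (c 0), l) - (fst (c' 0), l'))" by (rule \<phi>0_lip) (use l in \<open>auto simp: strip_def\<close>)
    also have "\<dots> \<le> G * (norm (x - x') + e + \<bar>l - l'\<bar>)"
      using norm_Pair_le[of "fst (c 0) - fst (c' 0)" "l - l'"] X[of 0]
      by (intro mult_left_mono G_nonneg) simp
    finally have "\<bar>snd (?g 0)\<bar> \<le> G * (norm (x - x') + e + \<bar>l - l'\<bar>)" .
    moreover have "\<bar>snd (?g a - ?g 0)\<bar> \<le> e" using ge[OF that, of 0] norm_snd_le_norm[of "?g a - ?g 0"] by simp
    ultimately show ?thesis by simp
  qed
  have "D \<le> norm (fst (?g \<theta>0)) + \<bar>snd (?g \<theta>0)\<bar>"
    using norm_le_fst_snd[of "?g \<theta>0"] by (simp add: D_def)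
  also have "\<dots> \<le> (1 + G) * norm (x - x') + G * \<bar>l - l'\<bar> + (2 + G) * e"
    using X[OF \<theta>0(1)] Z[OF \<theta>0(1)] by (simp add: algebra_simps)
  also have "(2 + G) * e \<le> (2 + G) * (A + S * L) * \<bar>t - t'\<bar> + 1/2 * D"
  proof -
    have "(2 + G) * (S * L * D) = (S * L * (2 + G)) * D" by simp
    also have "\<dots> \<le> (S * L * (3 + G)) * D"
      using S_pos L_nonneg D0 by (intro mult_right_mono mult_left_mono) auto
    also have "\<dots> \<le> 1/2 * D" by (intro mult_right_mono small3 D0)
    finally show ?thesis by (simp add: e_def distrib_left mult_ac)
  qed
  finally have "D \<le> 2 * ((1 + G) * norm (x - x') + G * \<bar>l - l'\<bar> + (2 + G) * (A + S * L) * \<bar>t - t'\<bar>)" by simp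
  also have "\<dots> \<le> stab * (\<bar>t - t'\<bar> + norm (x - x') + \<bar>l - l'\<bar>)"
  proof -
    define k where "k = (2 + G) * (A + S * L)"
    have k: "k \<ge> 0" unfolding k_def using G_nonneg A_nonneg S_pos L_nonneg by auto
    have "(1 + G) * norm (x - x') \<le> ((1 + G) + k) * norm (x - x')" "G * \<bar>l - l'\<bar> \<le> ((1 + G) + k) * \<bar>l - l'\<bar>"
      "k * \<bar>t - t'\<bar> \<le> ((1 + G) + k) * \<bar>t - t'\<bar>"
      using k G_nonneg by (auto intro!: mult_right_mono)
    then have "(1 + G) * norm (x - x') + G * \<bar>l - l'\<bar> + k * \<bar>t - t'\<bar> \<le> ((1 + G) + k) * (\<bar>t - t'\<bar> + norm (x - x') + \<bar>l - l'\<bar>)"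
      unfolding distrib_left by linarith
    then have "2 * ((1 + G) * norm (x - x') + G * \<bar>l - l'\<bar> + k * \<bar>t - t'\<bar>) \<le> 2 * (((1 + G) + k) * (\<bar>t - t'\<bar> + norm (x - x') + \<bar>l - l'\<bar>))"
      by simp
    then show ?thesis unfolding stab_def k_def mult.assoc[of 2] .
  qed
  finally show ?thesis using D[OF th] by linarith
qed

lemma characteristic_exists:
  assumes t: "0 \<le> t" "t \<le> S" and l: "0 < l" "l < 1"
  shows "\<exists>c. is_characteristic (t, x, l) c"
proof -
  \<comment> \<open>The fixed point is sought among bounded continuous functions on the whole line;
    clamping \<theta> continues the integral by constants outside [0,1].\<close>
  let ?cl = "\<lambda>\<theta>::real. max 0 (min 1 \<theta>)"
  define f where "f c \<sigma> = t *\<^sub>R V (t * \<sigma>, apply_bcontfun c \<sigma>)" for c :: "real \<Rightarrow>\<^sub>C ((real^'n) \<times> real)" and \<sigma>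
  define F where "F c \<theta> = integral {0..?cl \<theta>} (f c)" for c :: "real \<Rightarrow>\<^sub>C ((real^'n) \<times> real)" and \<theta>
  \<comment> \<open>With \<open>F\<close> the displacement since \<theta> = 0: \<open>x\<close>
    minus the displacement still to come, and \<open>\<phi>0\<close> at the foot
    \<open>x - fst (F c 1)\<close> plus the displacement so far.\<close>
  define T where "T c \<theta> = (x - (fst (F c 1) - fst (F c \<theta>)), \<phi>0 (x - fst (F c 1), l) + snd (F c \<theta>))" for c \<theta>
  have fc: "continuous_on X (f c)" for c X
    unfolding f_def by (intro continuous_intros continuous_on_compose2[OF V_cont]) auto
  have fi: "f c integrable_on {a..b}" for c a b by (rule integrable_continuous_real[OF fc])
  have fb: "norm (f c \<sigma>) \<le> t * A" for c \<sigma> unfolding f_def using V_bound t by (simp add: mult_left_mono)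
  have Fb: "norm (F c \<theta>) \<le> t * A" for c \<theta>
  proof -
    have "norm (F c \<theta>) \<le> t * A * (?cl \<theta> - 0)"
      unfolding F_def by (rule integral_bound) (use fb fc in auto)
    also have "\<dots> \<le> t * A * 1" by (rule mult_left_mono) (use t A_nonneg in auto)
    finally show ?thesis by simp
  qed
  have Fc: "continuous_on UNIV (F c)" for c
    unfolding F_def
    by (rule continuous_on_compose2[OF indefinite_integral_continuous_1[OF fi[of c 0 1]]]) (auto intro!: continuous_intros)
  have Tb: "T c \<in> bcontfun" for c
  proof (rule bcontfun_normI)
    show "continuous_on UNIV (T c)" unfolding T_def by (intro continuous_intros Fc)
    fix \<theta>
    have "norm (fst (F c 1)) \<le> t * A" "norm (fst (F c \<theta>)) \<le> t * A" "\<bar>snd (F c \<theta>)\<bar> \<le> t * A"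
      using Fb[of c 1] Fb[of c \<theta>] norm_fst_le_norm[of "F c 1"] norm_fst_le_norm[of "F c \<theta>"]
        norm_snd_le_norm[of "F c \<theta>"] by auto
    moreover have "norm (T c \<theta>) \<le> norm (x - (fst (F c 1) - fst (F c \<theta>))) + norm (\<phi>0 (x - fst (F c 1), l) + snd (F c \<theta>))"
      unfolding T_def by (rule norm_Pair_le)
    moreover have "norm (x - (fst (F c 1) - fst (F c \<theta>))) \<le> norm x + (norm (fst (F c 1)) + norm (fst (F c \<theta>)))"
      using norm_triangle_ineq4[of x "fst (F c 1) - fst (F c \<theta>)"] norm_triangle_ineq4[of "fst (F c 1)" "fst (F c \<theta>)"] by linarith
    ultimately show "norm (T c \<theta>) \<le> norm x + 3 * (t * A) + \<bar>\<phi>0 (x - fst (F c 1), l)\<bar>" by auto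
  qed
  define \<Phi> where "\<Phi> c = Bcontfun (T c)" for c
  have \<Phi>: "apply_bcontfun (\<Phi> c) = T c" for c unfolding \<Phi>_def by (rule Bcontfun_inverse[OF Tb])
  have "\<exists>!c. \<Phi> c = c"
  proof (rule banach_fix_type[where c = "1/2"])
    show "\<forall>c c'. dist (\<Phi> c) (\<Phi> c') \<le> 1/2 * dist c c'"
    proof (intro allI, rule dist_bound)
      fix c c' :: "real \<Rightarrow>\<^sub>C ((real^'n) \<times> real)" and \<theta> :: real
      define e where "e = S * L * dist c c'"
      have e0: "e \<ge> 0" using S_pos L_nonneg by (simp add: e_def)
      have fe: "norm (f c \<sigma> - f c' \<sigma>) \<le> e" for \<sigma>
      proof -
        have "norm (V (t * \<sigma>, c \<sigma>) - V (t * \<sigma>, c' \<sigma>)) \<le> L * norm ((t * \<sigma>, c \<sigma>) - (t * \<sigma>, c' \<sigma>))" by (rule V_lip)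
        also have "norm ((t * \<sigma>, c \<sigma>) - (t * \<sigma>, c' \<sigma>)) = dist (c \<sigma>) (c' \<sigma>)" by (simp add: norm_Pair dist_norm)
        also have "L * dist (c \<sigma>) (c' \<sigma>) \<le> L * dist c c'" by (intro mult_left_mono dist_bounded L_nonneg)
        finally have "t * norm (V (t * \<sigma>, c \<sigma>) - V (t * \<sigma>, c' \<sigma>)) \<le> S * (L * dist c c')"
          using t L_nonneg by (intro mult_mono) auto
        then show ?thesis using t by (simp add: f_def e_def scaleR_diff_right[symmetric] mult.assoc)
      qed
      have Fe: "norm (F c \<theta> - F c' \<theta>) \<le> e" for \<theta>
      proof -
        have "F c \<theta> - F c' \<theta> = integral {0..?cl \<theta>} (\<lambda>\<sigma>. f c \<sigma> - f c' \<sigma>)"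
          unfolding F_def by (rule integral_diff[symmetric, OF fi fi])
        also have "norm \<dots> \<le> e * (?cl \<theta> - 0)"
          by (rule integral_bound) (use fe fc in \<open>auto intro!: continuous_intros\<close>)
        also have "\<dots> \<le> e * 1" by (rule mult_left_mono) (use e0 in auto)
        finally show ?thesis by simp
      qed
      have f1: "norm (fst (F c \<theta>) - fst (F c' \<theta>)) \<le> e" "\<bar>snd (F c \<theta>) - snd (F c' \<theta>)\<bar> \<le> e" for \<theta>
        using Fe[of \<theta>] norm_fst_le_norm[of "F c \<theta> - F c' \<theta>"]
          norm_snd_le_norm[of "F c \<theta> - F c' \<theta>"] by auto
      have "dist (T c \<theta>) (T c' \<theta>) \<le> norm (fst (T c \<theta>) - fst (T c' \<theta>)) + \<bar>snd (T c \<theta>) - snd (T c' \<theta>)\<bar>"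
        unfolding dist_norm using norm_le_fst_snd[of "T c \<theta> - T c' \<theta>"] by simp
      also have "norm (fst (T c \<theta>) - fst (T c' \<theta>)) \<le> 2 * e"
      proof -
        have "fst (T c \<theta>) - fst (T c' \<theta>) = (fst (F c \<theta>) - fst (F c' \<theta>)) - (fst (F c 1) - fst (F c' 1))"
          by (simp add: T_def)
        then show ?thesis using f1(1)[of \<theta>] f1(1)[of 1] norm_triangle_ineq4[of "fst (F c \<theta>) - fst (F c' \<theta>)" "fst (F c 1) - fst (F c' 1)"] by simp
      qed
      also have "\<bar>snd (T c \<theta>) - snd (T c' \<theta>)\<bar> \<le> G * e + e"
      proof -
        have "\<bar>\<phi>0 (x - fst (F c 1), l) - \<phi>0 (x - fst (F c' 1), l)\<bar> \<le> G * norm ((x - fst (F c 1), l) - (x - fst (F c' 1), l))"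
          by (rule \<phi>0_lip) (use l in \<open>auto simp: strip_def\<close>)
        also have "\<dots> \<le> G * e" using f1(1)[of 1]
          by (intro mult_left_mono G_nonneg) (simp add: norm_Pair norm_minus_commute)
        finally show ?thesis using f1(2)[of \<theta>] by (simp add: T_def)
      qed
      also have "2 * e + (G * e + e) = (S * L * (3 + G)) * dist c c'" by (simp add: e_def algebra_simps)
      also have "\<dots> \<le> 1/2 * dist c c'" by (rule mult_right_mono[OF small3]) simp
      finally show "dist (\<Phi> c \<theta>) (\<Phi> c' \<theta>) \<le> 1/2 * dist c c'" by (simp add: \<Phi>)
    qed
  qed auto
  then obtain c where "\<Phi> c = c" by blast
  then have c: "c \<theta> = T c \<theta>" for \<theta> using \<Phi>[of c] by metis
  have "is_characteristic (t, x, l) (apply_bcontfun c)"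
    unfolding is_characteristic_def
  proof (intro conjI ballI)
    fix \<theta> :: real assume th: "\<theta> \<in> {0..1}"
    have Fd: "(F c has_vector_derivative f c \<theta>) (at \<theta> within {0..1})"
    proof (rule has_vector_derivative_transform[OF th])
      show "((\<lambda>u. integral {0..u} (f c)) has_vector_derivative f c \<theta>) (at \<theta> within {0..1})"
        by (rule integral_has_vector_derivative[OF fc th])
      show "F c u = integral {0..u} (f c)" if "u \<in> {0..1}" for u using that by (simp add: F_def)
    qed
    have "(T c has_vector_derivative (fst (f c \<theta>), snd (f c \<theta>))) (at \<theta> within {0..1})"
    proof -
      have "((\<lambda>\<theta>. x - (fst (F c 1) - fst (F c \<theta>))) has_vector_derivative fst (f c \<theta>)) (at \<theta> within {0..1})"
        using bounded_linear.has_vector_derivative[OF bounded_linear_fst Fd]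
        by (auto intro!: derivative_eq_intros)
      moreover have "((\<lambda>\<theta>. \<phi>0 (x - fst (F c 1), l) + snd (F c \<theta>)) has_vector_derivative snd (f c \<theta>)) (at \<theta> within {0..1})"
        using bounded_linear.has_vector_derivative[OF bounded_linear_snd Fd]
        by (auto intro!: derivative_eq_intros)
      ultimately show ?thesis unfolding T_def by (rule has_vector_derivative_Pair)
    qed
    then have "(T c has_vector_derivative f c \<theta>) (at \<theta> within {0..1})" by (simp only: prod.collapse)
    then show "(apply_bcontfun c has_vector_derivative fst (t, x, l) *\<^sub>R V (fst (t, x, l) * \<theta>, c \<theta>)) (at \<theta> within {0..1})"
      using ext[of "apply_bcontfun c" "T c", OF c] by (simp add: f_def)
  next
    have "F c 0 = 0" by (simp add: F_def)
    then show "fst (c 1) = fst (snd (t, x, l))" "snd (c 0) = \<phi>0 (fst (c 0), snd (snd (t, x, l)))"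
      unfolding c by (simp_all add: T_def)
  qed
  then show ?thesis by blast
qed

section \<open>The characteristic through a point and the candidate solution\<close>

definition curve :: "real \<times> (real^'n) \<times> real \<Rightarrow> real \<Rightarrow> (real^'n) \<times> real" where
  "curve q = (SOME c. is_characteristic q c)"

definition dom :: "(real \<times> (real^'n) \<times> real) set" where
  "dom = {0<..<S} \<times> strip"

lemma mem_dom: "(t, x, l) \<in> dom \<longleftrightarrow> 0 < t \<and> t < S \<and> 0 < l \<and> l < 1"
  by (auto simp: dom_def strip_def)

lemma open_dom: "open dom"
  unfolding dom_def strip_def by (intro open_Times) auto

lemma curve_characteristic: "q \<in> dom \<Longrightarrow> is_characteristic q (curve q)"
proof -
  assume q: "q \<in> dom"
  obtain t x l where eq: "q = (t, x, l)" by (cases q)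
  have "\<exists>c. is_characteristic q c"
    unfolding eq by (rule characteristic_exists) (use q in \<open>auto simp: eq mem_dom\<close>)
  then show ?thesis unfolding curve_def by (rule someI_ex)
qed

lemma characteristic_unique:
  assumes "is_characteristic q c" "q \<in> dom" "\<theta> \<in> {0..1}"
  shows "c \<theta> = curve q \<theta>"
proof -
  obtain t x l where q: "q = (t, x, l)" by (cases q)
  have "norm (c \<theta> - curve q \<theta>) \<le> stab * (\<bar>t - t\<bar> + norm (x - x) + \<bar>l - l\<bar>)"
    by (rule characteristic_stable) (use assms curve_characteristic[OF assms(2)] q in \<open>auto simp: mem_dom\<close>)
  then show ?thesis by (simp add: q)
qed

lemma curve_lipschitz:
  assumes "q \<in> dom" "q' \<in> dom" "\<theta> \<in> {0..1}"
  shows "norm (curve q \<theta> - curve q' \<theta>) \<le> 3 * stab * norm (q - q')"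
proof -
  obtain t x l t' x' l' where q: "q = (t, x, l)" "q' = (t', x', l')" by (cases q, cases q')
  have "norm (curve q \<theta> - curve q' \<theta>) \<le> stab * (\<bar>t - t'\<bar> + norm (x - x') + \<bar>l - l'\<bar>)"
    by (rule characteristic_stable)
       (use assms curve_characteristic[OF assms(1)] curve_characteristic[OF assms(2)] q in \<open>auto simp: mem_dom\<close>)
  also have "\<dots> \<le> stab * (3 * norm (q - q'))"
    using norm_triple_ge[where t = "t - t'" and x = "x - x'" and z = "l - l'"] by (intro mult_left_mono stab_nonneg) (simp add: q)
  finally show ?thesis by simp
qed

lemma curve_props:
  assumes "(t, x, l) \<in> dom"
  shows "\<And>\<theta>. \<theta> \<in> {0..1} \<Longrightarrow> (curve (t, x, l) has_vector_derivative t *\<^sub>R V (t * \<theta>, curve (t, x, l) \<theta>)) (at \<theta> within {0..1})"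
    and "fst (curve (t, x, l) 1) = x" and "snd (curve (t, x, l) 0) = \<phi>0 (fst (curve (t, x, l) 0), l)"
  using curve_characteristic[OF assms] by (auto simp: is_characteristic_def)

text \<open>The initial piece of a characteristic, stretched to full length, is a characteristic for
  its own end point with the same label \<open>l\<close>, so uniqueness applies. This makes the
  curves of different times consistent and turns \<open>sol\<close> into a solution of the transport
  equation.\<close>

lemma curve_semigroup:
  assumes q: "(t, x, l) \<in> dom" and r: "0 < r" "r \<le> 1" and th: "\<theta> \<in> {0..1}"
  shows "curve (t * r, fst (curve (t, x, l) r), l) \<theta> = curve (t, x, l) (r * \<theta>)"
proof -
  let ?c = "curve (t, x, l)"
  have tr: "t * r \<le> t * 1" by (rule mult_left_mono) (use q r in \<open>auto simp: mem_dom\<close>)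
  then have trS: "t * r < S" using q by (simp only: mem_dom mult_1_right) linarith
  have q': "(t * r, fst (?c r), l) \<in> dom" using q r trS by (simp add: mem_dom)
  have "is_characteristic (t * r, fst (?c r), l) (?c \<circ> (\<lambda>\<theta>. r * \<theta>))"
    unfolding is_characteristic_def
  proof (intro conjI ballI)
    fix \<theta> :: real assume th: "\<theta> \<in> {0..1}"
    have r\<theta>: "r * \<theta> \<in> {0..1}" using th r by (auto simp: mult_le_one)
    have sub: "(\<lambda>\<theta>. r * \<theta>) ` {0..1} \<subseteq> {0..1}" using r by (auto simp: mult_le_one)
    have 1: "((\<lambda>\<theta>. r * \<theta>) has_vector_derivative r) (at \<theta> within {0..1})"
      by (auto intro!: derivative_eq_intros)
    have 2: "(?c has_vector_derivative t *\<^sub>R V (t * (r * \<theta>), ?c (r * \<theta>))) (at (r * \<theta>) within (\<lambda>\<theta>. r * \<theta>) ` {0..1})"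
      by (rule has_vector_derivative_within_subset[OF curve_props(1)[OF q r\<theta>] sub])
    show "((?c \<circ> (\<lambda>\<theta>. r * \<theta>)) has_vector_derivative fst (t * r, fst (?c r), l) *\<^sub>R
        V (fst (t * r, fst (?c r), l) * \<theta>, (?c \<circ> (\<lambda>\<theta>. r * \<theta>)) \<theta>)) (at \<theta> within {0..1})"
      using vector_diff_chain_within[OF 1 2] by (simp add: mult_ac)
  next
    show "fst ((?c \<circ> (\<lambda>\<theta>. r * \<theta>)) 1) = fst (snd (t * r, fst (?c r), l))"
      "snd ((?c \<circ> (\<lambda>\<theta>. r * \<theta>)) 0) = \<phi>0 (fst ((?c \<circ> (\<lambda>\<theta>. r * \<theta>)) 0), snd (snd (t * r, fst (?c r), l)))"
      using curve_props(2,3)[OF q] by simp_all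
  qed
  from characteristic_unique[OF this q' th] show ?thesis by simp
qed

definition sol :: "real \<times> (real^'n) \<times> real \<Rightarrow> real" where
  "sol q = snd (curve q 1)"

lemma sol_along_curve:
  assumes "(t, x, l) \<in> dom" "0 < r" "r \<le> 1"
  shows "sol (t * r, fst (curve (t, x, l) r), l) = snd (curve (t, x, l) r)"
  unfolding sol_def using curve_semigroup[OF assms, of 1] by simp

lemma curve_at_1: "(t, x, l) \<in> dom \<Longrightarrow> curve (t, x, l) 1 = (x, sol (t, x, l))"
  using curve_props(2)[of t x l] by (simp add: sol_def prod_eq_iff)

text \<open>Differentiate \<open>sol_along_curve\<close> at r = 1. The derivatives are one-sided,
  because the curve ends there, and the common factor \<open>t\<close> of the stretched time
  cancels.\<close>

lemma sol_transport:
  assumes q: "(t, x, l) \<in> dom" and d: "(sol has_derivative D) (at (t, x, l))"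
  shows "D (1, fst (V (t, x, sol (t, x, l))), 0) = snd (V (t, x, sol (t, x, l)))"
proof -
  let ?c = "curve (t, x, l)" and ?v = "V (t, x, sol (t, x, l))"
  have t: "t > 0" using q by (simp add: mem_dom)
  have cd: "(?c has_vector_derivative t *\<^sub>R ?v) (at 1 within {0..1})"
    using curve_props(1)[OF q, of 1] by (simp add: curve_at_1[OF q])
  have 1: "((\<lambda>r. snd (?c r)) has_vector_derivative t * snd ?v) (at 1 within {0..1})"
    using bounded_linear.has_vector_derivative[OF bounded_linear_snd cd] by simp
  have "((\<lambda>r. fst (?c r)) has_vector_derivative t *\<^sub>R fst ?v) (at 1 within {0..1})"
    using bounded_linear.has_vector_derivative[OF bounded_linear_fst cd] by simp
  then have "((\<lambda>r. fst (?c r)) has_derivative (\<lambda>s. s *\<^sub>R t *\<^sub>R fst ?v)) (at 1 within {0..1})"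
    by (simp add: has_vector_derivative_def)
  then have p: "((\<lambda>r. (t * r, fst (?c r), l)) has_derivative (\<lambda>s. (t * s, s *\<^sub>R t *\<^sub>R fst ?v, 0))) (at 1 within {0..1})"
    by (intro has_derivative_Pair has_derivative_const has_derivative_mult_right has_derivative_ident)
  have d1: "(sol has_derivative D) (at (t * 1, fst (?c 1), l))" using d curve_at_1[OF q] by simp
  have "((\<lambda>r. sol (t * r, fst (?c r), l)) has_derivative (\<lambda>s. D (t * s, s *\<^sub>R t *\<^sub>R fst ?v, 0))) (at 1 within {0..1})"
    by (rule has_derivative_compose[where f = "\<lambda>r. (t * r, fst (?c r), l)", OF p d1])
  moreover have "(\<lambda>s. D (t * s, s *\<^sub>R t *\<^sub>R fst ?v, 0)) = (\<lambda>s. s *\<^sub>R (t * D (1, fst ?v, 0)))"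
  proof
    fix s :: real
    have eq: "(t * s, s *\<^sub>R t *\<^sub>R fst ?v, 0::real) = (s * t) *\<^sub>R (1, fst ?v, 0)" by simp
    show "D (t * s, s *\<^sub>R t *\<^sub>R fst ?v, 0) = s *\<^sub>R (t * D (1, fst ?v, 0))"
      unfolding eq linear_cmul[OF has_derivative_linear[OF d]] by simp
  qed
  ultimately have 2: "((\<lambda>r. sol (t * r, fst (?c r), l)) has_vector_derivative t * D (1, fst ?v, 0)) (at 1 within {0..1})"
    unfolding has_vector_derivative_def by (simp only:)
  have 3: "((\<lambda>r. sol (t * r, fst (?c r), l)) has_vector_derivative t * snd ?v) (at 1 within {0..1})"
  proof (rule has_vector_derivative_transform_within[OF 1, of 1])
    fix r :: real assume r: "r \<in> {0..1}" "dist r 1 < 1"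
    then have "0 < r" "r \<le> 1" by (auto simp: dist_real_def)
    then show "snd (?c r) = sol (t * r, fst (?c r), l)" using sol_along_curve[OF q] by simp
  qed auto
  have "t * D (1, fst ?v, 0) = t * snd ?v"
    by (rule vector_derivative_unique_within_closed_interval[of 0 1 1, unfolded cbox_interval, OF _ _ 2 3]) auto
  then show ?thesis using t by simp
qed

lemma curve_displacement:
  assumes "(t, x, l) \<in> dom" "a \<in> {0..1}" "b \<in> {0..1}"
  shows "norm (curve (t, x, l) a - curve (t, x, l) b) \<le> t * A"
  by (rule vector_derivative_bound_within[OF curve_props(1)[OF assms(1)] _ assms(2,3)])
     (use assms(1) V_bound in \<open>auto simp: mem_dom intro!: mult_left_mono\<close>)

text \<open>The height moves by at most t A along the curve, and the foot is displaced by as much,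
  which changes \<open>\<phi>0\<close> by at most G t A.\<close>

lemma sol_near_initial:
  assumes q: "(t, x, l) \<in> dom"
  shows "\<bar>sol (t, x, l) - \<phi>0 (x, l)\<bar> \<le> t * (A * (1 + G))"
proof -
  let ?c = "curve (t, x, l)"
  have d: "norm (?c 1 - ?c 0) \<le> t * A" by (rule curve_displacement[OF q]) auto
  have f: "norm (x - fst (?c 0)) \<le> t * A"
    using d norm_fst_le_norm[of "?c 1 - ?c 0"] curve_props(2)[OF q] by simp
  have "\<bar>sol (t, x, l) - snd (?c 0)\<bar> \<le> t * A"
    using d norm_snd_le_norm[of "?c 1 - ?c 0"] by (simp add: sol_def)
  moreover have "\<bar>snd (?c 0) - \<phi>0 (x, l)\<bar> \<le> G * norm ((fst (?c 0), l) - (x, l))"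
    unfolding curve_props(3)[OF q] by (rule \<phi>0_lip) (use q in \<open>auto simp: strip_def mem_dom\<close>)
  moreover have "G * norm ((fst (?c 0), l) - (x, l)) \<le> G * (t * A)"
    using f by (intro mult_left_mono G_nonneg) (simp add: norm_Pair norm_minus_commute)
  ultimately show ?thesis by (simp add: algebra_simps)
qed

lemma sol_tendsto_initial:
  assumes l: "0 < l" "l < 1" and cont: "isCont \<phi>0 (x, l)"
  shows "(sol \<longlongrightarrow> \<phi>0 (x, l)) (at (0, x, l) within dom)"
proof -
  have "((\<lambda>q. \<phi>0 (snd q)) \<longlongrightarrow> \<phi>0 (x, l)) (at (0, x, l) within dom)"
    by (rule isCont_tendsto_compose[OF cont]) (auto intro!: tendsto_eq_intros)
  moreover have "((\<lambda>q. sol q - \<phi>0 (snd q)) \<longlongrightarrow> 0) (at (0, x, l) within dom)"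
  proof (rule Lim_null_comparison)
    show "\<forall>\<^sub>F q in at (0, x, l) within dom. norm (sol q - \<phi>0 (snd q)) \<le> fst q * (A * (1 + G))"
      unfolding eventually_at_topological using sol_near_initial by (intro exI[of _ UNIV]) auto
    have "((\<lambda>q. fst q * (A * (1 + G))) \<longlongrightarrow> 0 * (A * (1 + G))) (at (0, x, l) within dom)"
      by (intro tendsto_mult_right) (auto intro!: tendsto_eq_intros)
    then show "((\<lambda>q. fst q * (A * (1 + G))) \<longlongrightarrow> 0) (at (0, x, l) within dom)" by simp
  qed
  ultimately show ?thesis using tendsto_add by fastforce
qed

text \<open>A bound up to the boundary of the strip and down to time 0. Uniqueness rests on it:
  competing solutions come without any bound on their derivatives.\<close>

lemma sol_derivative_horizontal:
  assumes q: "(t, x, l) \<in> dom" and d: "(sol has_derivative D) (at (t, x, l))"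
  shows "\<bar>D (0, v, 0)\<bar> \<le> 3 * stab * norm v"
proof -
  have lin: "linear D" by (rule has_derivative_linear[OF d])
  have "((\<lambda>s. sol (t, x + s *\<^sub>R v, l)) has_derivative (\<lambda>s. D (0, s *\<^sub>R v, 0))) (at 0)"
    by (rule has_derivative_compose[where f = "\<lambda>s. (t, x + s *\<^sub>R v, l)"])
       (use d in \<open>auto intro!: derivative_eq_intros\<close>)
  moreover have "(\<lambda>s. D (0, s *\<^sub>R v, 0)) = (*) (D (0, v, 0))"
  proof
    fix s :: real
    show "D (0, s *\<^sub>R v, 0) = D (0, v, 0) * s" using linear_cmul[OF lin, of s "(0, v, 0)"] by simp
  qed
  ultimately have "((\<lambda>s. sol (t, x + s *\<^sub>R v, l)) has_real_derivative D (0, v, 0)) (at 0)"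
    by (simp only: has_field_derivative_def)
  then have "((\<lambda>s. (sol (t, x + s *\<^sub>R v, l) - sol (t, x, l)) / s) \<longlongrightarrow> D (0, v, 0)) (at 0)"
    by (simp add: DERIV_def)
  then have lim: "((\<lambda>s. \<bar>(sol (t, x + s *\<^sub>R v, l) - sol (t, x, l)) / s\<bar>) \<longlongrightarrow> \<bar>D (0, v, 0)\<bar>) (at 0)"
    by (rule tendsto_rabs)
  show ?thesis
  proof (rule tendsto_upperbound[OF lim])
    show "\<forall>\<^sub>F s in at 0. \<bar>(sol (t, x + s *\<^sub>R v, l) - sol (t, x, l)) / s\<bar> \<le> 3 * stab * norm v"
      unfolding eventually_at_topological
    proof (intro exI[of _ UNIV] conjI ballI impI)
      fix s :: real assume "s \<noteq> 0"
      have q': "(t, x + s *\<^sub>R v, l) \<in> dom" using q by (simp add: mem_dom)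
      have "\<bar>sol (t, x + s *\<^sub>R v, l) - sol (t, x, l)\<bar> \<le> norm (curve (t, x + s *\<^sub>R v, l) 1 - curve (t, x, l) 1)"
        unfolding sol_def
        using norm_snd_le_norm[of "curve (t, x + s *\<^sub>R v, l) 1 - curve (t, x, l) 1"] by simp
      also have "\<dots> \<le> 3 * stab * norm ((t, x + s *\<^sub>R v, l) - (t, x, l))" by (rule curve_lipschitz[OF q' q]) simp
      also have "norm ((t, x + s *\<^sub>R v, l) - (t, x, l)) = \<bar>s\<bar> * norm v" by (simp add: norm_Pair)
      finally show "\<bar>(sol (t, x + s *\<^sub>R v, l) - sol (t, x, l)) / s\<bar> \<le> 3 * stab * norm v"
        using \<open>s \<noteq> 0\<close> by (simp add: divide_le_eq mult_ac)
    qed auto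
  qed simp
qed

end

section \<open>Coordinates on R^d x R and remainder estimates\<close>

lemma coord_inner: "coord i p = p \<bullet> unit_vec i"
  by (cases i) (auto simp: coord_def unit_vec_def inner_prod_def inner_axis)

lemma unit_vec_Basis: "unit_vec i \<in> Basis"
  by (cases i) (auto simp: unit_vec_def Basis_prod_def)

lemma sum_option_UNIV:
  "(\<Sum>i\<in>(UNIV::'n::finite option set). f i) = f None + (\<Sum>k\<in>UNIV. f (Some k))"
  by (simp add: UNIV_option_conv sum.reindex)

lemma coord_expansion: "p = (\<Sum>i\<in>UNIV. coord i p *\<^sub>R unit_vec i)"
proof -
  have "(\<Sum>i\<in>UNIV. coord i p *\<^sub>R unit_vec i) = (\<Sum>k\<in>UNIV. fst p $ k *\<^sub>R axis k 1, snd p)"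
    by (simp add: sum_option_UNIV coord_def unit_vec_def fst_sum snd_sum prod_eq_iff)
  also have "(\<Sum>k\<in>UNIV. fst p $ k *\<^sub>R axis k 1) = fst p"
    by (rule basis_expansion[of "fst p", unfolded scalar_mult_eq_scaleR])
  finally show ?thesis by simp
qed

text \<open>The remainder is measured against \<open>r n\<close>, in the applications the increment
  of the parameter, and not against the increment of the argument, which may vanish.\<close>

lemma has_derivative_seqD_le:
  fixes f :: "'a::real_normed_vector \<Rightarrow> real"
  assumes d: "(f has_derivative D) (at p)" and Y: "Y \<longlonglongrightarrow> p"
    and le: "\<And>n. norm (Y n - p) \<le> C * r n" and r: "\<And>n. r n > 0"
  shows "(\<lambda>n. (f (Y n) - f p - D (Y n - p)) / r n) \<longlonglongrightarrow> 0"
proof (rule LIMSEQ_I)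
  fix e :: real assume e: "e > 0"
  have C: "C \<ge> 0" using le[of 0] r[of 0] by (metis norm_ge_zero order_trans zero_le_mult_iff less_le_not_le)
  \<comment> \<open>C + 1 in place of C covers C = 0.\<close>
  define e' where "e' = e / (2 * (C + 1))"
  have e': "e' > 0" using e C by (simp add: e'_def)
  obtain \<delta> where \<delta>: "\<delta> > 0" "\<And>y. norm (y - p) < \<delta> \<Longrightarrow> norm (f y - f p - D (y - p)) \<le> e' * norm (y - p)"
    using d e' unfolding has_derivative_at_alt by blast
  obtain n0 where n0: "\<And>n. n \<ge> n0 \<Longrightarrow> norm (Y n - p) < \<delta>" using LIMSEQ_D[OF Y \<delta>(1)] by blast
  show "\<exists>no. \<forall>n\<ge>no. norm ((f (Y n) - f p - D (Y n - p)) / r n - 0) < e"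
  proof (intro exI[of _ n0] allI impI)
    fix n assume "n \<ge> n0"
    then have "norm (f (Y n) - f p - D (Y n - p)) \<le> e' * norm (Y n - p)" by (intro \<delta>(2) n0)
    also have "\<dots> \<le> e' * (C * r n)" using e' le by (intro mult_left_mono) auto
    finally have 1: "norm ((f (Y n) - f p - D (Y n - p)) / r n) \<le> e' * C" using r[of n] by (simp add: pos_divide_le_eq mult.assoc)
    have "e' * C \<le> e' * (C + 1)" using e' by simp
    also have "\<dots> = e / 2" using C by (simp add: e'_def field_simps)
    finally show "norm ((f (Y n) - f p - D (Y n - p)) / r n - 0) < e" using 1 e by simp
  qed
qed

lemma has_derivative_lipschitz_bound:
  fixes f :: "'a::real_normed_vector \<Rightarrow> real"
  assumes d: "(f has_derivative D) (at p)" and W: "open W" "p \<in> W"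
    and lip: "\<And>x. x \<in> W \<Longrightarrow> \<bar>f x - f p\<bar> \<le> K * norm (x - p)"
  shows "\<bar>D v\<bar> \<le> K * norm v"
proof -
  have lin: "linear D" by (rule has_derivative_linear[OF d])
  have "((\<lambda>s. f (p + s *\<^sub>R v)) has_derivative (\<lambda>s. D (s *\<^sub>R v))) (at 0)"
    by (rule has_derivative_compose[where f = "\<lambda>s. p + s *\<^sub>R v"]) (use d in \<open>auto intro!: derivative_eq_intros\<close>)
  moreover have "(\<lambda>s. D (s *\<^sub>R v)) = (*) (D v)"
    by (rule ext) (simp add: linear_cmul[OF lin])
  ultimately have "((\<lambda>s. f (p + s *\<^sub>R v)) has_real_derivative D v) (at 0)"
    by (simp only: has_field_derivative_def)
  then have "((\<lambda>s. (f (p + s *\<^sub>R v) - f p) / s) \<longlongrightarrow> D v) (at 0)"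
    by (simp add: DERIV_def)
  then have lim: "((\<lambda>s. \<bar>(f (p + s *\<^sub>R v) - f p) / s\<bar>) \<longlongrightarrow> \<bar>D v\<bar>) (at 0)"
    by (rule tendsto_rabs)
  have "isCont (\<lambda>s. p + s *\<^sub>R v) 0" by (intro continuous_intros)
  then have "((\<lambda>s. p + s *\<^sub>R v) \<longlongrightarrow> p) (at 0)" by (simp add: isCont_def)
  then have "\<forall>\<^sub>F s in at 0. p + s *\<^sub>R v \<in> W" using topological_tendstoD W by blast
  then have "\<forall>\<^sub>F s in at 0. \<bar>(f (p + s *\<^sub>R v) - f p) / s\<bar> \<le> K * norm v"
  proof (rule eventually_mp[OF _ _, rotated])
    show "\<forall>\<^sub>F s in at 0. p + s *\<^sub>R v \<in> W \<longrightarrow> \<bar>(f (p + s *\<^sub>R v) - f p) / s\<bar> \<le> K * norm v"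
      unfolding eventually_at_topological
    proof (intro exI[of _ UNIV] conjI ballI impI)
      fix s :: real assume s: "s \<noteq> 0" and "p + s *\<^sub>R v \<in> W"
      then have "\<bar>f (p + s *\<^sub>R v) - f p\<bar> \<le> K * (\<bar>s\<bar> * norm v)" using lip by fastforce
      then show "\<bar>(f (p + s *\<^sub>R v) - f p) / s\<bar> \<le> K * norm v" using s by (simp add: divide_le_eq mult_ac)
    qed auto
  qed
  then show ?thesis by (intro tendsto_upperbound[OF lim]) auto
qed

lemma Csb_on_le: "Csb_on k f U \<Longrightarrow> j \<le> k \<Longrightarrow> Csb_on j f U"
proof (induction k)
  case (Suc k)
  then show ?case using Csb_on_Suc_le by (metis le_Suc_eq)
qed simp

section \<open>Regularity of the characteristics\<close>

text \<open>Half open, since at time 0 a curve sits on the edge of the time interval, outside the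
  open set where the velocity is differentiable.\<close>

definition unit_time :: "real measure" where
  "unit_time = restrict_space lborel {0<..1}"

lemma space_unit_time [simp]: "space unit_time = {0<..1}"
  by (simp add: unit_time_def space_restrict_space)

lemma emeasure_unit_time: "emeasure unit_time (space unit_time) = 1"
  by (simp add: unit_time_def emeasure_restrict_space space_restrict_space)

lemma finite_measure_unit_time: "finite_measure unit_time"
  by (rule finite_measureI) (simp only: emeasure_unit_time, simp)

lemma measurable_unit_time_cont:
  fixes f :: "real \<Rightarrow> 'b::topological_space"
  assumes "continuous_on {0<..1} f"
  shows "f \<in> borel_measurable unit_time"
proof -
  have "f \<in> borel_measurable (restrict_space borel {0<..1})"
    by (rule borel_measurable_continuous_on_restrict[OF assms])
  moreover have "sets (restrict_space lborel {0<..1::real}) = sets (restrict_space borel {0<..1})"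
    by (simp add: sets_restrict_space)
  ultimately show ?thesis unfolding unit_time_def by (simp cong: measurable_cong_sets)
qed

text \<open>The limits of integration are moved into an indicator, so that one fixed measure serves
  all \<theta>; half-open and closed intervals differ by a null set.\<close>

lemma unit_time_FTC:
  fixes F F' :: "real \<Rightarrow> real"
  assumes ab: "0 \<le> a" "a \<le> b" "b \<le> 1"
    and der: "\<And>\<theta>. \<theta> \<in> {0..1} \<Longrightarrow> (F has_vector_derivative F' \<theta>) (at \<theta> within {0..1})"
    and cont: "continuous_on {0..1} F'"
  shows "(\<integral>\<sigma>. (if a < \<sigma> \<and> \<sigma> \<le> b then 1 else 0) * F' \<sigma> \<partial>unit_time) = F b - F a"
proof -
  have "(\<integral>\<sigma>. (if a < \<sigma> \<and> \<sigma> \<le> b then 1 else 0) * F' \<sigma> \<partial>unit_time)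
      = (\<integral>\<sigma>. indicator {0<..1} \<sigma> *\<^sub>R ((if a < \<sigma> \<and> \<sigma> \<le> b then 1 else 0) * F' \<sigma>) \<partial>lborel)"
    unfolding unit_time_def by (rule integral_restrict_space) simp
  also have "\<dots> = (\<integral>\<sigma>. indicator {a<..b} \<sigma> *\<^sub>R F' \<sigma> \<partial>lborel)"
    by (rule Bochner_Integration.integral_cong) (use ab in \<open>auto simp: indicator_def\<close>)
  also have "\<dots> = (\<integral>\<sigma>. indicator {a..b} \<sigma> *\<^sub>R F' \<sigma> \<partial>lborel)"
  proof (rule integral_cong_AE)
    have c: "continuous_on {a..b} F'" by (rule continuous_on_subset[OF cont]) (use ab in auto)
    show m: "(\<lambda>\<sigma>. indicator {a..b} \<sigma> *\<^sub>R F' \<sigma>) \<in> borel_measurable lborel"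
      using borel_measurable_continuous_on_indicator[OF _ c] by simp
    have "continuous_on {a<..b} F'" by (rule continuous_on_subset[OF cont]) (use ab in auto)
    then show "(\<lambda>\<sigma>. indicator {a<..b} \<sigma> *\<^sub>R F' \<sigma>) \<in> borel_measurable lborel"
      using borel_measurable_continuous_on_indicator[of "{a<..b}" F'] by simp
    show "AE \<sigma> in lborel. indicator {a<..b} \<sigma> *\<^sub>R F' \<sigma> = indicator {a..b} \<sigma> *\<^sub>R F' \<sigma>"
      using AE_lborel_singleton[of a] by eventually_elim (auto simp: indicator_def)
  qed
  also have "\<dots> = F b - F a"
  proof (rule integral_FTC_Icc)
    show "(F has_vector_derivative F' x) (at x within {a..b})" if "a \<le> x" "x \<le> b" for x
      by (rule has_vector_derivative_within_subset[OF der]) (use that ab in auto)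
    show "continuous_on {a..b} F'" by (rule continuous_on_subset[OF cont]) (use ab in auto)
  qed (rule ab)
  finally show ?thesis .
qed

text \<open>The index \<open>(i, \<theta>)\<close> stands for the \<open>i\<close>-th component of a curve at parameter \<open>\<theta>\<close>.\<close>

definition index_measure :: "('n::finite option \<times> real) measure" where
  "index_measure = count_space UNIV \<Otimes>\<^sub>M unit_time"

lemma space_index_measure [simp]: "space index_measure = UNIV \<times> {0<..1}"
  by (simp add: index_measure_def space_pair_measure)

lemma sigma_finite_count_space_finite: "sigma_finite_measure (count_space (UNIV :: 'n::finite option set))"
  by (rule sigma_finite_measure_count_space_finite) simp

lemma emeasure_index_measure:
  "emeasure (index_measure :: ('n::finite option \<times> real) measure) (space index_measure) = ennreal (CARD('n) + 1)"
proof -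
  interpret sigma_finite_measure unit_time
    using finite_measure_unit_time by (simp add: finite_measure_def)
  have "emeasure (index_measure :: ('n option \<times> real) measure) (space index_measure) =
      emeasure (count_space (UNIV :: 'n option set)) UNIV * emeasure unit_time (space unit_time)"
    unfolding index_measure_def space_pair_measure
    by (subst emeasure_pair_measure_Times) (auto simp: sets.top[of unit_time, simplified])
  also have "\<dots> = ennreal (CARD('n) + 1)"
    by (simp only: emeasure_unit_time) (simp add: card_UNIV_option ennreal_of_nat_eq_real_of_nat)
  finally show ?thesis .
qed

lemma finite_measure_index: "finite_measure index_measure"
  by (rule finite_measureI) (simp only: emeasure_index_measure, simp)

lemma measure_index: "measure (index_measure :: ('n::finite option \<times> real) measure) (space index_measure) = CARD('n) + 1"
  unfolding measure_def emeasure_index_measure by simp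

lemma measurable_index_fst: "fst \<in> index_measure \<rightarrow>\<^sub>M count_space UNIV"
  unfolding index_measure_def by measurable

lemma measurable_index_snd: "snd \<in> index_measure \<rightarrow>\<^sub>M unit_time"
  unfolding index_measure_def by measurable

text \<open>The component index takes finitely many values, so it suffices to treat each of
  them.\<close>

lemma measurable_index_cases:
  assumes "\<And>i. (\<lambda>m. f i m) \<in> borel_measurable M" "g \<in> M \<rightarrow>\<^sub>M count_space (UNIV :: 'n::finite option set)"
  shows "(\<lambda>m. f (g m) m) \<in> borel_measurable M"
  by (rule measurable_compose_countable'[OF assms(1) assms(2)]) (auto intro: countable_finite)

lemma integral_index_measure:
  fixes f :: "'n::finite option \<times> real \<Rightarrow> real"
  assumes "integrable index_measure f"
  shows "(\<integral>p. f p \<partial>index_measure) = (\<Sum>j\<in>UNIV. \<integral>\<sigma>. f (j, \<sigma>) \<partial>unit_time)"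
proof -
  interpret A: sigma_finite_measure "count_space (UNIV :: 'n option set)" by (rule sigma_finite_count_space_finite)
  interpret B: sigma_finite_measure unit_time
    using finite_measure_unit_time by (simp add: finite_measure_def)
  interpret pair_sigma_finite "count_space (UNIV :: 'n option set)" unit_time ..
  have "(\<integral>p. f p \<partial>index_measure) = (\<integral>j. (\<integral>\<sigma>. f (j, \<sigma>) \<partial>unit_time) \<partial>count_space UNIV)"
    using integral_fst'[of f] assms by (simp add: index_measure_def)
  also have "\<dots> = (\<Sum>j\<in>UNIV. \<integral>\<sigma>. f (j, \<sigma>) \<partial>unit_time)"
    by (rule lebesgue_integral_count_space_finite) simp
  finally show ?thesis .
qed

lemma open_strip: "open (strip :: ((real^'n) \<times> real) set)"
  unfolding strip_def by (intro open_Times) auto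

text \<open>The velocity is differentiable on \<open>Q\<close> and merely Lipschitz elsewhere;
  \<open>curve_in\<close> accordingly leaves out \<theta> = 0. The order is \<open>Suc s\<close>
  because the linearised equation contains first derivatives of the data, which are then of order
  \<open>s\<close>.\<close>

locale smooth_characteristics = characteristics V \<phi>0 L A G S
  for V :: "real \<times> (real^'n) \<times> real \<Rightarrow> (real^'n) \<times> real"
    and \<phi>0 :: "(real^'n) \<times> real \<Rightarrow> real" and L A G S :: real +
  fixes Q :: "(real \<times> (real^'n) \<times> real) set" and s :: nat
  assumes Q_open: "open Q"
    and curve_in: "q \<in> dom \<Longrightarrow> 0 < \<theta> \<Longrightarrow> \<theta> \<le> 1 \<Longrightarrow> (fst q * \<theta>, curve q \<theta>) \<in> Q"
    and V_smooth: "Csb_on (Suc s) (\<lambda>p. coord i (V p)) Q"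
    and \<phi>0_smooth: "Csb_on (Suc s) \<phi>0 strip"
begin

text \<open>
  With \<open>f l \<sigma> q\<close> the \<open>l\<close>-th component of \<open>t V(t\<sigma>, c(\<sigma>))\<close>, the curve satisfies
  \<open>X\<^sub>k(\<theta>) = x\<^sub>k - \<integral>\<^bsub>\<theta>\<^esub>\<^bsup>1\<^esup> f\<close> and \<open>Z(\<theta>) = \<phi>\<^sub>0(X(0), l) + \<integral>\<^bsub>0\<^esub>\<^bsup>\<theta>\<^esup> f\<close>.  Linearising in \<open>q\<close>, with \<open>\<phi>\<^sub>0\<close>
  linearised at \<open>foot q\<close>, gives \<open>\<partial>\<^sub>v c = b v + \<integral> N \<partial>\<^sub>v c\<close>.  Here \<open>\<kappa>\<close> is the weight with which \<open>f l \<sigma>\<close>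
  enters \<open>c (i, \<theta>)\<close> in the linearisation: \<open>\<kappa>0\<close> from the integrals, \<open>\<kappa>1\<close> from \<open>X(0)\<close>.
\<close>

definition pos where "pos \<sigma> q = (fst q * \<sigma>, curve q \<sigma>)"
definition foot where "foot q = (fst (curve q 0), snd (snd q))"
definition c where "c m q = coord (fst m) (curve q (snd m))" for m :: "'n option \<times> real"
definition Vc where "Vc i p = coord i (V p)"
definition DV where "DV l j p = frechet_derivative (Vc l) (at p) (0, unit_vec j)" for l j :: "'n option"
definition DVt where "DVt l p = frechet_derivative (Vc l) (at p) (1, 0)" for l :: "'n option"
definition slope where "slope j q = frechet_derivative \<phi>0 (at (foot q)) (unit_vec j)" for j :: "'n option"
definition f where "f l \<sigma> q = fst q * Vc l (pos \<sigma> q)" for l :: "'n option"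
definition coef where "coef l j \<sigma> q = fst q * DV l j (pos \<sigma> q)" for l j :: "'n option"
text \<open>Derivative of \<open>f l \<sigma>\<close> in \<open>t\<close> with the curve frozen:
  once through the factor \<open>t\<close>, once through the time argument t \<sigma>.\<close>

definition \<alpha> where "\<alpha> l \<sigma> q = Vc l (pos \<sigma> q) + fst q * \<sigma> * DVt l (pos \<sigma> q)" for l :: "'n option"

definition \<kappa>0 :: "'n option \<Rightarrow> 'n option \<Rightarrow> real \<Rightarrow> real \<Rightarrow> real" where
  "\<kappa>0 i l \<theta> \<sigma> = (case i of None \<Rightarrow> if l = None \<and> \<sigma> \<le> \<theta> then 1 else 0 | Some k \<Rightarrow> if l = Some k \<and> \<theta> < \<sigma> then -1 else 0)"

definition \<kappa>1 :: "'n option \<Rightarrow> 'n option \<Rightarrow> 'n \<Rightarrow> real" where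
  "\<kappa>1 i l k = (if i = None \<and> l = Some k then -1 else 0)"

definition \<kappa> where "\<kappa> i l \<theta> \<sigma> q = \<kappa>0 i l \<theta> \<sigma> + (\<Sum>k\<in>UNIV. \<kappa>1 i l k * slope (Some k) q)"

definition N where
  "N p q = (\<Sum>l\<in>UNIV. \<kappa> (fst (fst p)) l (snd (fst p)) (snd (snd p)) q * coef l (fst (snd p)) (snd (snd p)) q)"
  for p :: "('n option \<times> real) \<times> ('n option \<times> real)"

definition \<beta> where "\<beta> m q = (\<integral>\<sigma>. (\<Sum>l\<in>UNIV. \<kappa> (fst m) l (snd m) \<sigma> q * \<alpha> l \<sigma> q) \<partial>unit_time)"

text \<open>Derivative of the prescribed data with the displacements frozen: of x in the horizontal
  rows, of \<open>\<phi>0\<close> at the foot in the vertical row.\<close>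

definition drift where
  "drift i q v = (case i of Some k \<Rightarrow> fst (snd v) $ k
     | None \<Rightarrow> (\<Sum>k\<in>UNIV. slope (Some k) q * fst (snd v) $ k) + slope None q * snd (snd v))"
  for v :: "real \<times> (real^'n) \<times> real"

definition b where "b v m q = drift (fst m) q v + fst v * \<beta> m q"

lemma foot_strip: "q \<in> dom \<Longrightarrow> foot q \<in> strip"
  by (cases q) (auto simp: foot_def strip_def mem_dom)

lemma pos_Q: "q \<in> dom \<Longrightarrow> \<sigma> \<in> {0<..1} \<Longrightarrow> pos \<sigma> q \<in> Q"
  using curve_in by (simp add: pos_def)

lemma Vc_has_derivative:
  assumes "p \<in> Q"
  shows "(Vc l has_derivative frechet_derivative (Vc l) (at p)) (at p)"
proof -
  have "Vc l differentiable (at p)" using V_smooth[of l] assms by (simp add: Vc_def[abs_def])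
  then show ?thesis by (simp add: frechet_derivative_works[symmetric])
qed

lemma Vc_lip: "\<bar>Vc l p - Vc l p'\<bar> \<le> L * norm (p - p')"
proof -
  have "\<bar>Vc l p - Vc l p'\<bar> = \<bar>(V p - V p') \<bullet> unit_vec l\<bar>" by (simp add: Vc_def coord_inner inner_diff_left)
  also have "\<dots> \<le> norm (V p - V p')" by (rule Basis_le_norm[OF unit_vec_Basis])
  finally show ?thesis using V_lip[of p p'] by linarith
qed

lemma Vc_bound: "\<bar>Vc l p\<bar> \<le> A"
  using Basis_le_norm[OF unit_vec_Basis, of "V p" l] V_bound[of p] by (simp add: Vc_def coord_inner)

lemma D_Vc_bound: "p \<in> Q \<Longrightarrow> \<bar>frechet_derivative (Vc l) (at p) v\<bar> \<le> L * norm v"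
  by (rule has_derivative_lipschitz_bound[OF Vc_has_derivative Q_open]) (auto intro: Vc_lip)

lemma DV_bound: "p \<in> Q \<Longrightarrow> \<bar>DV l j p\<bar> \<le> L" "p \<in> Q \<Longrightarrow> \<bar>DVt l p\<bar> \<le> L"
  using D_Vc_bound[of p l "(0, unit_vec j)"] D_Vc_bound[of p l "(1, 0)"] norm_Basis[OF unit_vec_Basis[of j]]
  by (auto simp: DV_def DVt_def norm_Pair)

lemma D_Vc_split:
  assumes "p \<in> Q"
  shows "frechet_derivative (Vc l) (at p) v = fst v * DVt l p + (\<Sum>j\<in>UNIV. DV l j p * coord j (snd v))"
proof -
  let ?D = "frechet_derivative (Vc l) (at p)"
  have lin: "linear ?D" by (rule has_derivative_linear[OF Vc_has_derivative[OF assms]])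
  have "v = fst v *\<^sub>R (1, 0) + (\<Sum>j\<in>UNIV. coord j (snd v) *\<^sub>R (0, unit_vec j))"
    using coord_expansion[of "snd v"] by (simp add: prod_eq_iff fst_sum snd_sum)
  then have "?D v = ?D (fst v *\<^sub>R (1, 0) + (\<Sum>j\<in>UNIV. coord j (snd v) *\<^sub>R (0, unit_vec j)))" by simp
  also have "\<dots> = fst v * ?D (1, 0) + (\<Sum>j\<in>UNIV. coord j (snd v) * ?D (0, unit_vec j))"
    by (simp only: linear_add[OF lin] linear_sum[OF lin] linear_cmul[OF lin] real_scaleR_def)
  finally show ?thesis by (simp add: DVt_def DV_def mult.commute)
qed

lemma \<phi>0_has_derivative:
  "a \<in> strip \<Longrightarrow> (\<phi>0 has_derivative frechet_derivative \<phi>0 (at a)) (at a)"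
  using \<phi>0_smooth by (simp add: frechet_derivative_works[symmetric])

lemma slope_bound: "q \<in> dom \<Longrightarrow> \<bar>slope j q\<bar> \<le> G"
proof -
  assume q: "q \<in> dom"
  have "\<bar>frechet_derivative \<phi>0 (at (foot q)) (unit_vec j)\<bar> \<le> G * norm (unit_vec j :: (real^'n) \<times> real)"
    by (rule has_derivative_lipschitz_bound[OF \<phi>0_has_derivative[OF foot_strip[OF q]] open_strip foot_strip[OF q]])
       (rule \<phi>0_lip[OF _ foot_strip[OF q]])
  then show ?thesis using norm_Basis[OF unit_vec_Basis[of j]] by (simp add: slope_def)
qed

lemma D_\<phi>0_split:
  assumes "q \<in> dom"
  shows "frechet_derivative \<phi>0 (at (foot q)) v = (\<Sum>j\<in>UNIV. slope j q * coord j v)"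
proof -
  let ?D = "frechet_derivative \<phi>0 (at (foot q))"
  have lin: "linear ?D" by (rule has_derivative_linear[OF \<phi>0_has_derivative[OF foot_strip[OF assms]]])
  have "?D v = ?D (\<Sum>j\<in>UNIV. coord j v *\<^sub>R unit_vec j)" using coord_expansion[of v] by simp
  also have "\<dots> = (\<Sum>j\<in>UNIV. coord j v * ?D (unit_vec j))"
    by (simp only: linear_sum[OF lin] linear_cmul[OF lin] real_scaleR_def)
  finally show ?thesis by (simp add: slope_def mult.commute)
qed

text \<open>In a horizontal row only the own component acts, with weight of modulus at most 1. In
  the vertical row the own component counts at most 1 and each of the n horizontal ones at most G,
  because it moves the foot.\<close>

lemma \<kappa>_sum_bound:
  assumes "q \<in> dom"
  shows "(\<Sum>l\<in>UNIV. \<bar>\<kappa> i l \<theta> \<sigma> q\<bar>) \<le> 1 + CARD('n) * G"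
proof (cases i)
  case None
  have "\<bar>\<kappa> None (Some k) \<theta> \<sigma> q\<bar> \<le> G" for k
  proof -
    have "\<kappa> None (Some k) \<theta> \<sigma> q = (\<Sum>k'\<in>UNIV. if k' = k then - slope (Some k') q else 0)"
      unfolding \<kappa>_def \<kappa>0_def \<kappa>1_def
      by (simp add: if_distrib[of "\<lambda>x. x * _"] cong: if_cong)
    then show ?thesis using slope_bound[OF assms, of "Some k"] by (simp add: sum.delta)
  qed
  then have "(\<Sum>k\<in>UNIV. \<bar>\<kappa> None (Some k) \<theta> \<sigma> q\<bar>) \<le> (\<Sum>k\<in>(UNIV::'n set). G)" by (intro sum_mono)
  moreover have "\<bar>\<kappa> None None \<theta> \<sigma> q\<bar> \<le> 1" by (simp add: \<kappa>_def \<kappa>0_def \<kappa>1_def)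
  ultimately show ?thesis by (simp add: None sum_option_UNIV)
next
  case (Some k)
  have "\<bar>\<kappa> i l \<theta> \<sigma> q\<bar> \<le> (if l = Some k then 1 else 0)" for l
    by (simp add: \<kappa>_def \<kappa>0_def \<kappa>1_def Some)
  then have "(\<Sum>l\<in>UNIV. \<bar>\<kappa> i l \<theta> \<sigma> q\<bar>) \<le> (\<Sum>l\<in>UNIV. if l = Some k then 1 else 0)" by (intro sum_mono)
  also have "\<dots> = 1" by simp
  also have "\<dots> \<le> 1 + CARD('n) * G" using G_nonneg by simp
  finally show ?thesis .
qed

text \<open>Sup bound of the kernel \<open>N\<close>: \<open>S * L\<close> for the coefficients, 1 +
  n G for the weights by \<open>\<kappa>_sum_bound\<close>.\<close>

definition B where "B = S * L * (1 + CARD('n) * G)"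

lemma B_props: "B \<ge> 0" "B * (CARD('n) + 1) \<le> 1/2"
proof -
  show "B \<ge> 0" unfolding B_def using S_pos L_nonneg G_nonneg by simp
  have "B * (CARD('n) + 1) \<le> S * L * (4 + CARD('n) * G) * (CARD('n) + 1)"
    unfolding B_def using S_pos L_nonneg G_nonneg by (intro mult_right_mono mult_left_mono) auto
  then show "B * (CARD('n) + 1) \<le> 1/2" using small by (rule order_trans)
qed

lemma weighted_bound:
  assumes "q \<in> dom" "\<And>l. \<bar>y l\<bar> \<le> K" "K \<ge> 0"
  shows "\<bar>\<Sum>l\<in>UNIV. \<kappa> i l \<theta> \<sigma> q * y l\<bar> \<le> (1 + CARD('n) * G) * K"
proof -
  have "\<bar>\<Sum>l\<in>UNIV. \<kappa> i l \<theta> \<sigma> q * y l\<bar> \<le> (\<Sum>l\<in>UNIV. \<bar>\<kappa> i l \<theta> \<sigma> q\<bar> * K)"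
    by (rule order_trans[OF sum_abs], rule sum_mono) (simp add: abs_mult assms mult_left_mono)
  also have "\<dots> = (\<Sum>l\<in>UNIV. \<bar>\<kappa> i l \<theta> \<sigma> q\<bar>) * K" by (simp add: sum_distrib_right)
  also have "\<dots> \<le> (1 + CARD('n) * G) * K" by (intro mult_right_mono \<kappa>_sum_bound assms)
  finally show ?thesis .
qed

lemma coef_bound:
  assumes "q \<in> dom" "\<sigma> \<in> {0<..1}"
  shows "\<bar>coef l j \<sigma> q\<bar> \<le> S * L"
proof -
  have "0 < fst q" "fst q < S" using assms by (auto simp: dom_def)
  then show ?thesis using DV_bound(1)[OF pos_Q[OF assms]] S_pos unfolding coef_def by (auto simp: abs_mult intro!: mult_mono)
qed

lemma N_bound:
  assumes "q \<in> dom" "x \<in> space index_measure"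
  shows "\<bar>N (m, x) q\<bar> \<le> B"
proof -
  have "\<bar>N (m, x) q\<bar> \<le> (1 + CARD('n) * G) * (S * L)"
    unfolding N_def using weighted_bound[OF assms(1), of "\<lambda>l. coef l (fst x) (snd x) q" "S * L"]
      coef_bound[OF assms(1), of "snd x"] assms(2) S_pos L_nonneg by (auto simp: mem_Times_iff)
  then show ?thesis by (simp add: B_def mult_ac)
qed

sublocale F: fredholm "index_measure :: ('n option \<times> real) measure" B
  by (intro fredholm.intro fredholm_axioms.intro finite_measure_index B_props)
     (simp only: measure_index B_props)

sublocale T: finite_measure unit_time by (rule finite_measure_unit_time)

end

section \<open>Integral equations of the curves and of their increments\<close>

context smooth_characteristics begin

lemma Basis_time: "(1, 0) \<in> (Basis :: (real \<times> (real^'n) \<times> real) set)"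
  and Basis_space: "(0, unit_vec j) \<in> (Basis :: (real \<times> (real^'n) \<times> real) set)"
  using unit_vec_Basis[of j] by (auto simp: Basis_prod_def)

lemma Vc_Csb: "k \<le> Suc s \<Longrightarrow> Csb_on k (Vc l) Q"
  using Csb_on_le[OF V_smooth[of l]] by (simp add: Vc_def[abs_def])

lemma DV_Csb: "k \<le> s \<Longrightarrow> Csb_on k (DV l j) Q" "k \<le> s \<Longrightarrow> Csb_on k (DVt l) Q"
  using Csb_on_le[of s _ Q k] V_smooth[of l] Basis_time Basis_space
  by (auto simp: DV_def[abs_def] DVt_def[abs_def] Vc_def[abs_def])

lemma slope_Csb: "k \<le> s \<Longrightarrow> Csb_on k (\<lambda>a. frechet_derivative \<phi>0 (at a) (unit_vec j)) strip"
  using Csb_on_le[of s _ strip k] \<phi>0_smooth unit_vec_Basis by auto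

lemma dom_time: "q \<in> dom \<Longrightarrow> 0 < fst q \<and> fst q < S"
  by (auto simp: dom_def)

lemma c_lip:
  assumes "q \<in> dom" "q' \<in> dom" "\<theta> \<in> {0..1}"
  shows "\<bar>c (i, \<theta>) q - c (i, \<theta>) q'\<bar> \<le> 3 * stab * norm (q - q')"
  using curve_lipschitz[OF assms] Basis_le_norm[OF unit_vec_Basis, of "curve q \<theta> - curve q' \<theta>" i]
  by (simp add: c_def coord_inner inner_diff_left)

lemma pos_cont: "q \<in> dom \<Longrightarrow> continuous_on {0<..1} (\<lambda>\<sigma>. pos \<sigma> q)"
  unfolding pos_def
  by (intro continuous_intros continuous_on_subset[OF characteristic_cont[OF curve_characteristic]]) auto

lemma pos_lip:
  assumes "q \<in> dom" "q' \<in> dom" "\<sigma> \<in> {0..1}"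
  shows "norm (pos \<sigma> q' - pos \<sigma> q) \<le> (1 + 3 * stab) * norm (q' - q)"
proof -
  have "norm (pos \<sigma> q' - pos \<sigma> q) \<le> \<bar>fst q' * \<sigma> - fst q * \<sigma>\<bar> + norm (curve q' \<sigma> - curve q \<sigma>)"
    using norm_le_fst_snd[of "pos \<sigma> q' - pos \<sigma> q"] by (simp add: pos_def)
  moreover have "\<bar>fst q' * \<sigma> - fst q * \<sigma>\<bar> \<le> norm (q' - q)"
  proof -
    have "\<bar>fst q' * \<sigma> - fst q * \<sigma>\<bar> = \<bar>fst (q' - q)\<bar> * \<sigma>" using assms(3) by (simp add: abs_mult left_diff_distrib[symmetric])
    also have "\<dots> \<le> norm (q' - q) * 1"
      using assms(3) norm_fst_le_norm[of "q' - q"] by (intro mult_mono) auto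
    finally show ?thesis by simp
  qed
  ultimately show ?thesis using curve_lipschitz[OF assms(2,1,3)] by (simp add: algebra_simps)
qed

lemma compose_pos_measurable:
  assumes "q \<in> dom" "continuous_on Q h"
  shows "(\<lambda>\<sigma>. h (pos \<sigma> q)) \<in> borel_measurable unit_time"
  by (rule measurable_unit_time_cont, rule continuous_on_compose2[OF assms(2) pos_cont[OF assms(1)]])
     (use pos_Q[OF assms(1)] in auto)

lemma continuous_if_Csb: "Csb_on k h U \<Longrightarrow> continuous_on U h"
  by (cases k) auto

lemma
  assumes "q \<in> dom"
  shows f_measurable: "(\<lambda>\<sigma>. f l \<sigma> q) \<in> borel_measurable unit_time"
    and coef_measurable: "(\<lambda>\<sigma>. coef l j \<sigma> q) \<in> borel_measurable unit_time"
    and \<alpha>_measurable: "(\<lambda>\<sigma>. \<alpha> l \<sigma> q) \<in> borel_measurable unit_time"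
proof -
  have [measurable]: "(\<lambda>\<sigma>. Vc l (pos \<sigma> q)) \<in> borel_measurable unit_time"
    "(\<lambda>\<sigma>. DV l j (pos \<sigma> q)) \<in> borel_measurable unit_time"
    "(\<lambda>\<sigma>. DVt l (pos \<sigma> q)) \<in> borel_measurable unit_time"
    by (intro compose_pos_measurable[OF assms] continuous_if_Csb[OF Vc_Csb[of 0]] continuous_if_Csb[OF DV_Csb(1)[of 0]]
        continuous_if_Csb[OF DV_Csb(2)[of 0]]; simp)+
  have [measurable]: "(\<lambda>\<sigma>. \<sigma>) \<in> borel_measurable unit_time"
    by (rule measurable_unit_time_cont) (intro continuous_intros)
  show "(\<lambda>\<sigma>. f l \<sigma> q) \<in> borel_measurable unit_time" unfolding f_def by measurable
  show "(\<lambda>\<sigma>. coef l j \<sigma> q) \<in> borel_measurable unit_time" unfolding coef_def by measurable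
  show "(\<lambda>\<sigma>. \<alpha> l \<sigma> q) \<in> borel_measurable unit_time" unfolding \<alpha>_def by measurable
qed

lemma f_bound: "q \<in> dom \<Longrightarrow> \<bar>f l \<sigma> q\<bar> \<le> S * A"
  unfolding f_def abs_mult using Vc_bound[of l "pos \<sigma> q"] dom_time[of q] S_pos by (intro mult_mono) auto

lemma \<alpha>_bound:
  assumes "q \<in> dom" "\<sigma> \<in> {0<..1}"
  shows "\<bar>\<alpha> l \<sigma> q\<bar> \<le> A + S * L"
proof -
  have "\<bar>fst q * \<sigma> * DVt l (pos \<sigma> q)\<bar> \<le> S * 1 * L"
    unfolding abs_mult using assms dom_time[OF assms(1)] DV_bound(2)[OF pos_Q[OF assms]] S_pos
    by (intro mult_mono) auto
  then show ?thesis using Vc_bound[of l "pos \<sigma> q"] unfolding \<alpha>_def by linarith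
qed

lemma time_measurable: "(\<lambda>\<sigma>. \<sigma>) \<in> borel_measurable unit_time"
  by (rule measurable_unit_time_cont) (intro continuous_intros)

lemma index_time_measurable: "snd \<in> borel_measurable (index_measure :: ('n option \<times> real) measure)"
  using measurable_compose[OF measurable_index_snd time_measurable] by simp

lemma \<kappa>_measurable:
  assumes g: "g \<in> M \<rightarrow>\<^sub>M count_space (UNIV :: 'n option set)" and th: "\<theta> \<in> borel_measurable M" and \<sigma>: "\<sigma> \<in> borel_measurable M"
  shows "(\<lambda>p. \<kappa> (g p) l (\<theta> p) (\<sigma> p) q) \<in> borel_measurable M"
proof (rule measurable_index_cases[OF _ g])
  fix i
  have "(\<lambda>p. \<kappa>0 i l (\<theta> p) (\<sigma> p)) \<in> borel_measurable M"
    using th \<sigma> by (cases i) (auto simp: \<kappa>0_def)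
  then show "(\<lambda>p. \<kappa> i l (\<theta> p) (\<sigma> p) q) \<in> borel_measurable M" unfolding \<kappa>_def by measurable
qed

lemma \<kappa>_measurable_time: "(\<lambda>\<sigma>. \<kappa> i l \<theta> \<sigma> q) \<in> borel_measurable unit_time"
  by (rule \<kappa>_measurable) (auto intro: time_measurable)

lemma c_measurable:
  assumes "q \<in> dom"
  shows "(\<lambda>m. c m q) \<in> borel_measurable index_measure"
  unfolding c_def
proof (rule measurable_index_cases[OF _ measurable_index_fst])
  fix i
  have "continuous_on {0<..1} (\<lambda>\<sigma>. coord i (curve q \<sigma>))"
    unfolding coord_inner
    by (intro continuous_intros continuous_on_subset[OF characteristic_cont[OF curve_characteristic[OF assms]]]) auto
  from measurable_compose[OF measurable_index_snd measurable_unit_time_cont[OF this]]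
  show "(\<lambda>m. coord i (curve q (snd m))) \<in> borel_measurable index_measure" .
qed

lemma N_measurable:
  assumes "q \<in> dom"
  shows "(\<lambda>p. N p q) \<in> borel_measurable (index_measure \<Otimes>\<^sub>M index_measure)"
  unfolding N_def
proof (intro borel_measurable_sum borel_measurable_times)
  fix l
  show "(\<lambda>p :: ('n option \<times> real) \<times> ('n option \<times> real). \<kappa> (fst (fst p)) l (snd (fst p)) (snd (snd p)) q) \<in> borel_measurable (index_measure \<Otimes>\<^sub>M index_measure)"
  proof (rule \<kappa>_measurable)
    show "(\<lambda>p :: ('n option \<times> real) \<times> ('n option \<times> real). fst (fst p)) \<in> (index_measure \<Otimes>\<^sub>M index_measure) \<rightarrow>\<^sub>M count_space UNIV"
      by (rule measurable_compose[OF measurable_fst measurable_index_fst])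
    show "(\<lambda>p :: ('n option \<times> real) \<times> ('n option \<times> real). snd (fst p)) \<in> borel_measurable (index_measure \<Otimes>\<^sub>M index_measure)"
      by (rule measurable_compose[OF measurable_fst index_time_measurable])
    show "(\<lambda>p :: ('n option \<times> real) \<times> ('n option \<times> real). snd (snd p)) \<in> borel_measurable (index_measure \<Otimes>\<^sub>M index_measure)"
      by (rule measurable_compose[OF measurable_snd index_time_measurable])
  qed
  show "(\<lambda>p. coef l (fst (snd p)) (snd (snd p)) q) \<in> borel_measurable (index_measure \<Otimes>\<^sub>M index_measure)"
  proof (rule measurable_index_cases)
    show "(\<lambda>p. fst (snd p)) \<in> (index_measure \<Otimes>\<^sub>M index_measure) \<rightarrow>\<^sub>M count_space UNIV"
      by (rule measurable_compose[OF measurable_snd measurable_index_fst])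
    show "(\<lambda>p. coef l j (snd (snd p)) q) \<in> borel_measurable (index_measure \<Otimes>\<^sub>M index_measure)" for j
      by (rule measurable_compose[OF measurable_compose[OF measurable_snd measurable_index_snd] coef_measurable[OF assms]])
  qed
qed

lemma b_measurable:
  assumes "q \<in> dom"
  shows "(\<lambda>m. b v m q) \<in> borel_measurable index_measure"
proof -
  have "(\<lambda>m. drift (fst m) q v) \<in> borel_measurable (index_measure :: ('n option \<times> real) measure)"
    by (rule measurable_index_cases[OF _ measurable_index_fst]) simp
  moreover have "(\<lambda>m. \<beta> m q) \<in> borel_measurable index_measure"
    unfolding \<beta>_def
  proof (rule T.borel_measurable_lebesgue_integral)
    have "(\<lambda>p. \<Sum>l\<in>UNIV. \<kappa> (fst (fst p)) l (snd (fst p)) (snd p) q * \<alpha> l (snd p) q) \<in> borel_measurable (index_measure \<Otimes>\<^sub>M unit_time)"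
    proof (intro borel_measurable_sum borel_measurable_times)
      fix l
      show "(\<lambda>p. \<kappa> (fst (fst p)) l (snd (fst p)) (snd p) q) \<in> borel_measurable (index_measure \<Otimes>\<^sub>M unit_time)"
        by (rule \<kappa>_measurable[OF measurable_compose[OF measurable_fst measurable_index_fst]
              measurable_compose[OF measurable_fst index_time_measurable] measurable_compose[OF measurable_snd time_measurable]])
      show "(\<lambda>p. \<alpha> l (snd p) q) \<in> borel_measurable (index_measure \<Otimes>\<^sub>M unit_time)"
        by (rule measurable_compose[OF measurable_snd \<alpha>_measurable[OF assms]])
    qed
    then show "(\<lambda>(m, \<sigma>). \<Sum>l\<in>UNIV. \<kappa> (fst m) l (snd m) \<sigma> q * \<alpha> l \<sigma> q) \<in> borel_measurable (index_measure \<Otimes>\<^sub>M unit_time)"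
      by (simp add: case_prod_unfold)
  qed
  ultimately show ?thesis unfolding b_def by measurable
qed

lemma curve_component_derivative:
  assumes "q \<in> dom" "\<theta> \<in> {0..1}"
  shows "((\<lambda>\<theta>. coord i (curve q \<theta>)) has_vector_derivative f i \<theta> q) (at \<theta> within {0..1})"
proof -
  obtain t x l where q: "q = (t, x, l)" by (cases q)
  have "(curve q has_vector_derivative t *\<^sub>R V (t * \<theta>, curve q \<theta>)) (at \<theta> within {0..1})"
    using curve_props(1)[of t x l \<theta>] assms q by simp
  from bounded_linear.has_vector_derivative[OF bounded_linear_inner_left[of "unit_vec i"] this]
  show ?thesis by (simp add: coord_inner f_def Vc_def pos_def q)
qed

lemma f_cont: "q \<in> dom \<Longrightarrow> continuous_on {0..1} (\<lambda>\<sigma>. f l \<sigma> q)"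
  unfolding f_def Vc_def coord_inner pos_def
  by (intro continuous_intros continuous_on_compose2[OF V_cont] characteristic_cont[OF curve_characteristic]) auto

lemma c_Some_eq:
  assumes "q \<in> dom" "\<theta> \<in> {0..1}"
  shows "c (Some k, \<theta>) q = fst (snd q) $ k - (\<integral>\<sigma>. (if \<theta> < \<sigma> then 1 else 0) * f (Some k) \<sigma> q \<partial>unit_time)"
proof -
  have "(\<integral>\<sigma>. (if \<theta> < \<sigma> then 1 else 0) * f (Some k) \<sigma> q \<partial>unit_time) = (\<integral>\<sigma>. (if \<theta> < \<sigma> \<and> \<sigma> \<le> 1 then 1 else 0) * f (Some k) \<sigma> q \<partial>unit_time)"
    by (rule Bochner_Integration.integral_cong) auto
  also have "\<dots> = coord (Some k) (curve q 1) - coord (Some k) (curve q \<theta>)"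
    by (rule unit_time_FTC[OF _ _ _ curve_component_derivative[OF assms(1)] f_cont[OF assms(1)]]) (use assms in auto)
  finally show ?thesis using curve_props(2)[of "fst q" "fst (snd q)" "snd (snd q)"] assms(1) by (simp add: c_def coord_def)
qed

lemma c_None_eq:
  assumes "q \<in> dom" "\<theta> \<in> {0..1}"
  shows "c (None, \<theta>) q = \<phi>0 (foot q) + (\<integral>\<sigma>. (if \<sigma> \<le> \<theta> then 1 else 0) * f None \<sigma> q \<partial>unit_time)"
proof -
  have "(\<integral>\<sigma>. (if \<sigma> \<le> \<theta> then 1 else 0) * f None \<sigma> q \<partial>unit_time) = (\<integral>\<sigma>. (if 0 < \<sigma> \<and> \<sigma> \<le> \<theta> then 1 else 0) * f None \<sigma> q \<partial>unit_time)"
    by (rule Bochner_Integration.integral_cong) auto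
  also have "\<dots> = coord None (curve q \<theta>) - coord None (curve q 0)"
    by (rule unit_time_FTC[OF _ _ _ curve_component_derivative[OF assms(1)] f_cont[OF assms(1)]]) (use assms in auto)
  finally show ?thesis using curve_props(3)[of "fst q" "fst (snd q)" "snd (snd q)"] assms(1) by (simp add: c_def coord_def foot_def)
qed

lemma foot_eq:
  assumes "q \<in> dom"
  shows "coord (Some k) (foot q) = fst (snd q) $ k - (\<integral>\<sigma>. f (Some k) \<sigma> q \<partial>unit_time)"
    "coord None (foot q) = snd (snd q)"
proof -
  have "(\<integral>\<sigma>. (if 0 < \<sigma> then 1 else 0) * f (Some k) \<sigma> q \<partial>unit_time) = (\<integral>\<sigma>. f (Some k) \<sigma> q \<partial>unit_time)"
    by (rule Bochner_Integration.integral_cong) auto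
  then show "coord (Some k) (foot q) = fst (snd q) $ k - (\<integral>\<sigma>. f (Some k) \<sigma> q \<partial>unit_time)"
    using c_Some_eq[OF assms, of 0 k] by (simp add: c_def coord_def foot_def)
qed (simp add: coord_def foot_def)

lemma foot_lip:
  assumes "q \<in> dom" "q' \<in> dom"
  shows "norm (foot q' - foot q) \<le> (1 + 3 * stab) * norm (q' - q)"
proof -
  have "norm (foot q' - foot q) \<le> norm (fst (curve q' 0 - curve q 0)) + norm (snd (snd (q' - q)))"
    using norm_le_fst_snd[of "foot q' - foot q"] by (simp add: foot_def)
  moreover have "norm (fst (curve q' 0 - curve q 0)) \<le> 3 * stab * norm (q' - q)"
    using norm_fst_le_norm curve_lipschitz[OF assms(2,1), of 0] by (rule order_trans) simp
  moreover have "norm (snd (snd (q' - q))) \<le> norm (q' - q)"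
    using norm_snd_le_norm[of "snd (q' - q)"] norm_snd_le_norm[of "q' - q"] by linarith
  ultimately show ?thesis by (simp add: algebra_simps)
qed

text \<open>Taylor remainders of \<open>\<phi>\<^sub>0\<close> here, and below of \<open>f\<close>, in the passage from \<open>q\<close> to \<open>q'\<close>.\<close>

definition rem0 where
  "rem0 i q q' = (if i = None then \<phi>0 (foot q') - \<phi>0 (foot q) - frechet_derivative \<phi>0 (at (foot q)) (foot q' - foot q) else 0)"
  for i :: "'n option"

text \<open>The rows of the weight matrix written out, so that the integral equations of height and
  horizontal position can be matched with the common form.\<close>

lemma kernel_sum:
  "(\<Sum>l\<in>UNIV. \<kappa> None l \<theta> \<sigma> q * y l) = (if \<sigma> \<le> \<theta> then 1 else 0) * y None - (\<Sum>k\<in>UNIV. slope (Some k) q * y (Some k))"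
  "(\<Sum>l\<in>UNIV. \<kappa> (Some k) l \<theta> \<sigma> q * y l) = - ((if \<theta> < \<sigma> then 1 else 0) * y (Some k))"
proof -
  have "\<kappa> None (Some k) \<theta> \<sigma> q = - slope (Some k) q" for k
    unfolding \<kappa>_def \<kappa>0_def \<kappa>1_def by (simp add: if_distrib[of "\<lambda>x. x * _"] cong: if_cong)
  moreover have "\<kappa> None None \<theta> \<sigma> q = (if \<sigma> \<le> \<theta> then 1 else 0)" by (simp add: \<kappa>_def \<kappa>0_def \<kappa>1_def)
  ultimately show "(\<Sum>l\<in>UNIV. \<kappa> None l \<theta> \<sigma> q * y l) = (if \<sigma> \<le> \<theta> then 1 else 0) * y None - (\<Sum>k\<in>UNIV. slope (Some k) q * y (Some k))"
    by (simp add: sum_option_UNIV sum_negf)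
  have "\<kappa> (Some k) l \<theta> \<sigma> q * y l = (if l = Some k then - ((if \<theta> < \<sigma> then 1 else 0) * y (Some k)) else 0)" for l
    by (simp add: \<kappa>_def \<kappa>0_def \<kappa>1_def)
  then show "(\<Sum>l\<in>UNIV. \<kappa> (Some k) l \<theta> \<sigma> q * y l) = - ((if \<theta> < \<sigma> then 1 else 0) * y (Some k))"
    by simp
qed

text \<open>The difference of the integral equations at \<open>q'\<close> and \<open>q\<close>, row
  by row. It is exact: \<open>\<phi>0\<close> is expanded with its remainder, while the increments
  of \<open>f\<close> are kept.\<close>

lemma c_increment:
  assumes q: "q \<in> dom" and q': "q' \<in> dom" and th: "\<theta> \<in> {0..1}"
  shows "c (i, \<theta>) q' - c (i, \<theta>) q = drift i q (q' - q)
    + (\<integral>\<sigma>. (\<Sum>l\<in>UNIV. \<kappa> i l \<theta> \<sigma> q * (f l \<sigma> q' - f l \<sigma> q)) \<partial>unit_time) + rem0 i q q'"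
proof -
  have fi: "integrable unit_time (\<lambda>\<sigma>. f l \<sigma> p)" if "p \<in> {q, q'}" for l p
    by (rule T.integrable_bounded[where K = "S * A"]) 
       (use that f_measurable[OF q] f_measurable[OF q'] f_bound[OF q] f_bound[OF q'] in auto)
  have gi: "integrable unit_time (\<lambda>\<sigma>. (if P \<sigma> then 1 else 0) * f l \<sigma> p)" if "p \<in> {q, q'}" "{\<sigma>. P \<sigma>} \<in> sets borel" for l p P
  proof (rule T.integrable_bounded[where K = "S * A"])
    have "Measurable.pred borel P" using that(2) by (simp add: pred_def)
    then have "Measurable.pred unit_time P" using measurable_compose[OF time_measurable] by fast
    then show "(\<lambda>\<sigma>. (if P \<sigma> then 1 else 0) * f l \<sigma> p) \<in> borel_measurable unit_time"
      using that(1) q q' f_measurable[of p l] by auto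
    show "\<bar>(if P \<sigma> then 1 else 0) * f l \<sigma> p\<bar> \<le> S * A" for \<sigma>
      using that(1) q q' f_bound[of p l \<sigma>] S_pos A_nonneg by auto
  qed
  have P: "{\<sigma>. \<theta> < \<sigma>} \<in> sets borel" "{\<sigma>. \<sigma> \<le> \<theta>} \<in> sets borel" by auto
  show ?thesis
  proof (cases i)
    case (Some k)
    have "(\<integral>\<sigma>. (\<Sum>l\<in>UNIV. \<kappa> i l \<theta> \<sigma> q * (f l \<sigma> q' - f l \<sigma> q)) \<partial>unit_time)
        = (\<integral>\<sigma>. (if \<theta> < \<sigma> then 1 else 0) * f (Some k) \<sigma> q - (if \<theta> < \<sigma> then 1 else 0) * f (Some k) \<sigma> q' \<partial>unit_time)"
      unfolding Some kernel_sum by (rule Bochner_Integration.integral_cong) (auto simp: algebra_simps)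
    also have "\<dots> = (\<integral>\<sigma>. (if \<theta> < \<sigma> then 1 else 0) * f (Some k) \<sigma> q \<partial>unit_time) - (\<integral>\<sigma>. (if \<theta> < \<sigma> then 1 else 0) * f (Some k) \<sigma> q' \<partial>unit_time)"
      by (rule Bochner_Integration.integral_diff) (use gi P in auto)
    finally show ?thesis
      unfolding Some c_Some_eq[OF q th] c_Some_eq[OF q' th] by (simp add: drift_def rem0_def Some)
  next
    case None
    have "(\<integral>\<sigma>. (\<Sum>l\<in>UNIV. \<kappa> i l \<theta> \<sigma> q * (f l \<sigma> q' - f l \<sigma> q)) \<partial>unit_time)
        = (\<integral>\<sigma>. ((if \<sigma> \<le> \<theta> then 1 else 0) * f None \<sigma> q' - (if \<sigma> \<le> \<theta> then 1 else 0) * f None \<sigma> q)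
          - (\<Sum>k\<in>UNIV. slope (Some k) q * (f (Some k) \<sigma> q' - f (Some k) \<sigma> q)) \<partial>unit_time)"
      unfolding None kernel_sum by (rule Bochner_Integration.integral_cong) (auto simp: algebra_simps)
    also have "\<dots> = ((\<integral>\<sigma>. (if \<sigma> \<le> \<theta> then 1 else 0) * f None \<sigma> q' \<partial>unit_time) - (\<integral>\<sigma>. (if \<sigma> \<le> \<theta> then 1 else 0) * f None \<sigma> q \<partial>unit_time))
        - (\<Sum>k\<in>UNIV. slope (Some k) q * ((\<integral>\<sigma>. f (Some k) \<sigma> q' \<partial>unit_time) - (\<integral>\<sigma>. f (Some k) \<sigma> q \<partial>unit_time)))"
    proof -
      have 1: "integrable unit_time (\<lambda>\<sigma>. (if \<sigma> \<le> \<theta> then 1 else 0) * f None \<sigma> q' - (if \<sigma> \<le> \<theta> then 1 else 0) * f None \<sigma> q)"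
        by (intro Bochner_Integration.integrable_diff) (use gi P in auto)
      have 2: "integrable unit_time (\<lambda>\<sigma>. slope (Some k) q * (f (Some k) \<sigma> q' - f (Some k) \<sigma> q))" for k
        by (intro integrable_mult_right Bochner_Integration.integrable_diff fi) auto
      have 3: "(\<integral>\<sigma>. (\<Sum>k\<in>UNIV. slope (Some k) q * (f (Some k) \<sigma> q' - f (Some k) \<sigma> q)) \<partial>unit_time)
        = (\<Sum>k\<in>UNIV. slope (Some k) q * ((\<integral>\<sigma>. f (Some k) \<sigma> q' \<partial>unit_time) - (\<integral>\<sigma>. f (Some k) \<sigma> q \<partial>unit_time)))"
        by (subst Bochner_Integration.integral_sum[OF 2]) (auto simp: fi)
      have 4: "integrable unit_time (\<lambda>\<sigma>. \<Sum>k\<in>UNIV. slope (Some k) q * (f (Some k) \<sigma> q' - f (Some k) \<sigma> q))"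
        by (rule Bochner_Integration.integrable_sum) (rule 2)
      have 5: "(\<integral>\<sigma>. (if \<sigma> \<le> \<theta> then 1 else 0) * f None \<sigma> q' - (if \<sigma> \<le> \<theta> then 1 else 0) * f None \<sigma> q \<partial>unit_time)
        = (\<integral>\<sigma>. (if \<sigma> \<le> \<theta> then 1 else 0) * f None \<sigma> q' \<partial>unit_time) - (\<integral>\<sigma>. (if \<sigma> \<le> \<theta> then 1 else 0) * f None \<sigma> q \<partial>unit_time)"
        by (rule Bochner_Integration.integral_diff) (use gi P in auto)
      show ?thesis unfolding Bochner_Integration.integral_diff[OF 1 4] 3 5 ..
    qed
    finally have I: "(\<integral>\<sigma>. (\<Sum>l\<in>UNIV. \<kappa> i l \<theta> \<sigma> q * (f l \<sigma> q' - f l \<sigma> q)) \<partial>unit_time) = \<dots>" .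
    \<comment> \<open>Expressing the foot by \<open>foot_eq\<close> brings in integrals over the
      whole of [0,1], whatever \<theta>; they account for \<open>\<kappa>1\<close>.\<close>
    have "frechet_derivative \<phi>0 (at (foot q)) (foot q' - foot q)
      = slope None q * (snd (snd q') - snd (snd q)) + (\<Sum>k\<in>UNIV. slope (Some k) q * (coord (Some k) (foot q') - coord (Some k) (foot q)))"
      unfolding D_\<phi>0_split[OF q] sum_option_UNIV
      by (simp add: coord_inner inner_diff_left) (simp add: coord_inner[symmetric] foot_eq(2)[OF q] foot_eq(2)[OF q'])
    also have "(\<Sum>k\<in>UNIV. slope (Some k) q * (coord (Some k) (foot q') - coord (Some k) (foot q)))
      = (\<Sum>k\<in>UNIV. slope (Some k) q * (fst (snd (q' - q)) $ k))
        - (\<Sum>k\<in>UNIV. slope (Some k) q * ((\<integral>\<sigma>. f (Some k) \<sigma> q' \<partial>unit_time) - (\<integral>\<sigma>. f (Some k) \<sigma> q \<partial>unit_time)))"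
      unfolding foot_eq(1)[OF q] foot_eq(1)[OF q'] sum_subtractf[symmetric]
      by (rule sum.cong) (auto simp: algebra_simps)
    finally show ?thesis
      unfolding I unfolding None c_None_eq[OF q th] c_None_eq[OF q' th] by (simp add: drift_def rem0_def)
  qed
qed

definition rem1 where
  "rem1 l \<sigma> q q' = (fst q' - fst q) * (Vc l (pos \<sigma> q') - Vc l (pos \<sigma> q))
    + fst q * (Vc l (pos \<sigma> q') - Vc l (pos \<sigma> q) - frechet_derivative (Vc l) (at (pos \<sigma> q)) (pos \<sigma> q' - pos \<sigma> q))"
  for l :: "'n option"

lemma f_increment:
  assumes q: "q \<in> dom" and \<sigma>: "\<sigma> \<in> {0<..1}"
  shows "f l \<sigma> q' - f l \<sigma> q = fst (q' - q) * \<alpha> l \<sigma> q + (\<Sum>j\<in>UNIV. coef l j \<sigma> q * (c (j, \<sigma>) q' - c (j, \<sigma>) q)) + rem1 l \<sigma> q q'"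
proof -
  define X where "X = (\<Sum>j\<in>UNIV. DV l j (pos \<sigma> q) * (c (j, \<sigma>) q' - c (j, \<sigma>) q))"
  have 1: "frechet_derivative (Vc l) (at (pos \<sigma> q)) (pos \<sigma> q' - pos \<sigma> q)
    = (fst q' - fst q) * \<sigma> * DVt l (pos \<sigma> q) + X"
    unfolding D_Vc_split[OF pos_Q[OF q \<sigma>]] X_def
    by (simp add: pos_def c_def coord_inner inner_diff_left left_diff_distrib)
  have 2: "(\<Sum>j\<in>UNIV. coef l j \<sigma> q * (c (j, \<sigma>) q' - c (j, \<sigma>) q)) = fst q * X"
    unfolding coef_def X_def sum_distrib_left by (simp only: mult.assoc)
  show ?thesis unfolding rem1_def 1 2 f_def \<alpha>_def by (simp add: algebra_simps)
qed

text \<open>Insert \<open>f_increment\<close> into \<open>c_increment\<close>: the increments of the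
  curve satisfy the linear equation up to two remainders. Divided by the increment of
  \<open>q\<close>, this is the form in which \<open>solution_has_derivative\<close> takes its
  premise \<open>rem\<close>.\<close>

lemma c_expansion:
  assumes q: "q \<in> dom" and q': "q' \<in> dom" and m: "m \<in> space index_measure"
  shows "c m q' - c m q - b (q' - q) m q - (\<integral>x. N (m, x) q * (c x q' - c x q) \<partial>index_measure)
    = rem0 (fst m) q q' + (\<integral>\<sigma>. (\<Sum>l\<in>UNIV. \<kappa> (fst m) l (snd m) \<sigma> q * rem1 l \<sigma> q q') \<partial>unit_time)"
    (is "?lhs = _")
    and "(\<lambda>\<sigma>. \<Sum>l\<in>UNIV. \<kappa> (fst m) l (snd m) \<sigma> q * rem1 l \<sigma> q q') \<in> borel_measurable unit_time"
proof -
  obtain i \<theta> where m_eq: "m = (i, \<theta>)" by (cases m)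
  have th: "\<theta> \<in> {0..1}" using m by (simp add: m_eq)
  let ?K = "\<lambda>y \<sigma>. \<Sum>l\<in>UNIV. \<kappa> i l \<theta> \<sigma> q * y l \<sigma>"
  have Km: "?K y \<in> borel_measurable unit_time" if "\<And>l. y l \<in> borel_measurable unit_time" for y
    by (intro borel_measurable_sum borel_measurable_times \<kappa>_measurable_time that)
  have Ki: "integrable unit_time (?K y)" if "\<And>l. y l \<in> borel_measurable unit_time" "\<And>l \<sigma>. \<sigma> \<in> {0<..1} \<Longrightarrow> \<bar>y l \<sigma>\<bar> \<le> C" "C \<ge> 0" for y C
    by (rule T.integrable_bounded[OF Km[OF that(1)], where K = "(1 + CARD('n) * G) * C"])
       (use weighted_bound[OF q] that in auto)
  define d where "d j \<sigma> = c (j, \<sigma>) q' - c (j, \<sigma>) q" for j \<sigma>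
  have dm: "d j \<in> borel_measurable unit_time" for j
  proof -
    have "(\<lambda>\<sigma>. c (j, \<sigma>) p) \<in> borel_measurable unit_time" if "p \<in> dom" for p
    proof (rule measurable_unit_time_cont)
      show "continuous_on {0<..1} (\<lambda>\<sigma>. c (j, \<sigma>) p)" unfolding c_def coord_inner fst_conv snd_conv
        by (intro continuous_intros continuous_on_subset[OF characteristic_cont[OF curve_characteristic[OF that]]]) auto
    qed
    then show ?thesis unfolding d_def using q q' by auto
  qed
  define D where "D = 3 * stab * norm (q' - q)"
  have D0: "D \<ge> 0" using stab_nonneg by (simp add: D_def)
  have db: "\<bar>d j \<sigma>\<bar> \<le> D" if "\<sigma> \<in> {0<..1}" for j \<sigma>
    using c_lip[OF q' q, of \<sigma> j] that by (simp add: d_def D_def)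
  let ?y2 = "\<lambda>l \<sigma>. \<Sum>j\<in>UNIV. coef l j \<sigma> q * d j \<sigma>"
  have y2m: "?y2 l \<in> borel_measurable unit_time" for l
    by (intro borel_measurable_sum borel_measurable_times coef_measurable[OF q] dm)
  have y2b: "\<bar>?y2 l \<sigma>\<bar> \<le> (CARD('n) + 1) * (S * L * D)" if "\<sigma> \<in> {0<..1}" for l \<sigma>
  proof -
    have "\<bar>?y2 l \<sigma>\<bar> \<le> (\<Sum>j\<in>(UNIV :: 'n option set). S * L * D)"
      by (rule order_trans[OF sum_abs], rule sum_mono)
         (use coef_bound[OF q that] db[OF that] S_pos L_nonneg in \<open>auto simp: abs_mult intro!: mult_mono\<close>)
    then show ?thesis by (simp add: card_UNIV_option add.commute)
  qed
  have y1b: "\<bar>fst (q' - q) * \<alpha> l \<sigma> q\<bar> \<le> \<bar>fst (q' - q)\<bar> * (A + S * L)" if "\<sigma> \<in> {0<..1}" for l \<sigma>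
    unfolding abs_mult by (intro mult_left_mono \<alpha>_bound[OF q that]) auto
  \<comment> \<open>Solving \<open>f_increment\<close> for \<open>rem1\<close> yields its
    measurability and a crude bound, without a look at the derivative inside it.\<close>
  have y3: "rem1 l \<sigma> q q' = (f l \<sigma> q' - f l \<sigma> q) - fst (q' - q) * \<alpha> l \<sigma> q - ?y2 l \<sigma>" if "\<sigma> \<in> {0<..1}" for l \<sigma>
    unfolding f_increment[OF q that, of l q'] d_def by simp
  let ?r = "\<lambda>l \<sigma>. (f l \<sigma> q' - f l \<sigma> q) - fst (q' - q) * \<alpha> l \<sigma> q - ?y2 l \<sigma>"
  have rm: "?r l \<in> borel_measurable unit_time" for l
    using f_measurable[OF q] f_measurable[OF q'] \<alpha>_measurable[OF q] y2m by measurable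
  have rb: "\<bar>?r l \<sigma>\<bar> \<le> 2 * (S * A) + \<bar>fst (q' - q)\<bar> * (A + S * L) + (CARD('n) + 1) * (S * L * D)" if "\<sigma> \<in> {0<..1}" for l \<sigma>
    using f_bound[OF q, of l \<sigma>] f_bound[OF q', of l \<sigma>] y1b[OF that, of l] y2b[OF that, of l] by linarith
  have pos: "0 \<le> \<bar>fst (q' - q)\<bar> * (A + S * L)" "0 \<le> (CARD('n) + 1) * (S * L * D)" "0 \<le> S * A"
    using A_nonneg S_pos L_nonneg D0 by auto
  have i1: "integrable unit_time (?K (\<lambda>l \<sigma>. fst (q' - q) * \<alpha> l \<sigma> q))"
    by (rule Ki[OF _ y1b pos(1)]) (intro borel_measurable_times borel_measurable_const \<alpha>_measurable[OF q])
  have i2: "integrable unit_time (?K ?y2)" by (rule Ki[OF y2m y2b pos(2)])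
  have i3: "integrable unit_time (?K ?r)" by (rule Ki[OF rm rb]) (use pos in auto)
  have "(\<integral>\<sigma>. ?K (\<lambda>l \<sigma>. f l \<sigma> q' - f l \<sigma> q) \<sigma> \<partial>unit_time)
      = (\<integral>\<sigma>. ?K (\<lambda>l \<sigma>. fst (q' - q) * \<alpha> l \<sigma> q) \<sigma> + ?K ?y2 \<sigma> + ?K ?r \<sigma> \<partial>unit_time)"
    by (rule Bochner_Integration.integral_cong) (auto simp: sum.distrib[symmetric] distrib_left[symmetric])
  also have "\<dots> = (\<integral>\<sigma>. ?K (\<lambda>l \<sigma>. fst (q' - q) * \<alpha> l \<sigma> q) \<sigma> \<partial>unit_time) + (\<integral>\<sigma>. ?K ?y2 \<sigma> \<partial>unit_time) + (\<integral>\<sigma>. ?K ?r \<sigma> \<partial>unit_time)"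
    using i1 i2 i3 by (subst Bochner_Integration.integral_add; simp)+
  also have "(\<integral>\<sigma>. ?K (\<lambda>l \<sigma>. fst (q' - q) * \<alpha> l \<sigma> q) \<sigma> \<partial>unit_time) = fst (q' - q) * \<beta> m q"
  proof -
    have "?K (\<lambda>l \<sigma>. fst (q' - q) * \<alpha> l \<sigma> q) \<sigma> = fst (q' - q) * ?K (\<lambda>l \<sigma>. \<alpha> l \<sigma> q) \<sigma>" for \<sigma>
      unfolding sum_distrib_left by (rule sum.cong) (auto simp: algebra_simps)
    then show ?thesis by (simp add: \<beta>_def m_eq)
  qed
  also have "(\<integral>\<sigma>. ?K ?y2 \<sigma> \<partial>unit_time) = (\<integral>x. N (m, x) q * (c x q' - c x q) \<partial>index_measure)"
  proof -
    have Ni: "integrable index_measure (\<lambda>x. N (m, x) q * (c x q' - c x q))"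
    proof (rule F.kernel_integrable[where C = D and B' = B])
      show "(\<lambda>x. c x q' - c x q) \<in> borel_measurable index_measure"
        by (intro borel_measurable_diff c_measurable q q')
      show "\<bar>c x q' - c x q\<bar> \<le> D" if "x \<in> space index_measure" for x
        using db[of "snd x" "fst x"] that by (auto simp: d_def)
      show "\<bar>N (m, x) q\<bar> \<le> B" if "x \<in> space index_measure" for x by (rule N_bound[OF q that])
      show "(\<lambda>x. N (m, x) q) \<in> borel_measurable index_measure"
        using measurable_Pair2[OF N_measurable[OF q] m] by simp
    qed
    \<comment> \<open>Exchanging the sums over \<open>l\<close> and \<open>j\<close> makes the
      kernel \<open>N\<close> appear; the sum over \<open>j\<close> and the integral over \<sigma>
      then form one integral over \<open>index_measure\<close>.\<close>
    have "?K ?y2 \<sigma> = (\<Sum>j\<in>UNIV. N (m, (j, \<sigma>)) q * d j \<sigma>)" for \<sigma>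
      unfolding N_def m_eq sum_distrib_left sum_distrib_right fst_conv snd_conv
      by (subst sum.swap) (simp add: mult.assoc)
    then have "(\<integral>\<sigma>. ?K ?y2 \<sigma> \<partial>unit_time) = (\<integral>\<sigma>. (\<Sum>j\<in>UNIV. N (m, (j, \<sigma>)) q * d j \<sigma>) \<partial>unit_time)" by simp
    also have "\<dots> = (\<Sum>j\<in>UNIV. \<integral>\<sigma>. N (m, (j, \<sigma>)) q * d j \<sigma> \<partial>unit_time)"
    proof (rule Bochner_Integration.integral_sum)
      fix j :: "'n option"
      show "integrable unit_time (\<lambda>\<sigma>. N (m, (j, \<sigma>)) q * d j \<sigma>)"
      proof (rule T.integrable_bounded[where K = "B * D"])
        show "(\<lambda>\<sigma>. N (m, (j, \<sigma>)) q * d j \<sigma>) \<in> borel_measurable unit_time"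
          unfolding N_def fst_conv snd_conv m_eq
          by (intro borel_measurable_times borel_measurable_sum dm coef_measurable[OF q] \<kappa>_measurable_time)
        show "\<bar>N (m, (j, \<sigma>)) q * d j \<sigma>\<bar> \<le> B * D" if "\<sigma> \<in> space unit_time" for \<sigma>
          unfolding abs_mult using N_bound[OF q, of "(j, \<sigma>)" m] db[of \<sigma> j] that B_props(1)
          by (intro mult_mono) auto
      qed
    qed
    also have "\<dots> = (\<integral>x. N (m, x) q * (c x q' - c x q) \<partial>index_measure)"
      unfolding integral_index_measure[OF Ni] d_def ..
    finally show ?thesis .
  qed
  also have "(\<integral>\<sigma>. ?K ?r \<sigma> \<partial>unit_time) = (\<integral>\<sigma>. (\<Sum>l\<in>UNIV. \<kappa> (fst m) l (snd m) \<sigma> q * rem1 l \<sigma> q q') \<partial>unit_time)"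
    by (rule Bochner_Integration.integral_cong) (auto simp: y3 m_eq)
  finally show "?lhs = rem0 (fst m) q q' + (\<integral>\<sigma>. (\<Sum>l\<in>UNIV. \<kappa> (fst m) l (snd m) \<sigma> q * rem1 l \<sigma> q q') \<partial>unit_time)"
    using c_increment[OF q q' th, of i] unfolding b_def m_eq by simp
  show "(\<lambda>\<sigma>. \<Sum>l\<in>UNIV. \<kappa> (fst m) l (snd m) \<sigma> q * rem1 l \<sigma> q q') \<in> borel_measurable unit_time"
  proof -
    have "(\<lambda>\<sigma>. \<Sum>l\<in>UNIV. \<kappa> (fst m) l (snd m) \<sigma> q * rem1 l \<sigma> q q') \<in> borel_measurable unit_time
      \<longleftrightarrow> ?K ?r \<in> borel_measurable unit_time"
      by (rule measurable_cong) (simp add: y3 m_eq)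
    then show ?thesis using Km[of ?r, OF rm] by blast
  qed
qed

end

section \<open>Smoothness of the curves by bootstrapping\<close>

context smooth_characteristics begin

text \<open>Near \<open>q\<close> the curves differ from the one at \<open>q\<close> by a Lipschitz
  bound, and that single curve is bounded by compactness; both are uniform in \<theta>.\<close>

lemma c_Cs_unif_0: "Cs_unif 0 (space index_measure) c dom"
proof -
  have L: "\<bar>c m q - c m q'\<bar> \<le> 3 * stab * norm (q - q')" if "q \<in> dom" "q' \<in> dom" "m \<in> space index_measure" for m q q'
    using c_lip[OF that(1,2), of "snd m" "fst m"] that(3) by auto
  have "continuous_on dom (c m)" if "m \<in> space index_measure" for m
  proof (rule continuous_on_sequentiallyI)
    fix X q assume X: "\<forall>n. X n \<in> dom" "q \<in> dom" "X \<longlonglongrightarrow> q"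
    have "(\<lambda>n. 3 * stab * norm (X n - q)) \<longlonglongrightarrow> 3 * stab * norm (q - q)" by (intro tendsto_intros X)
    then have "(\<lambda>n. 3 * stab * norm (X n - q)) \<longlonglongrightarrow> 0" by simp
    then have "(\<lambda>n. c m (X n) - c m q) \<longlonglongrightarrow> 0"
      by (rule Lim_null_comparison[rotated]) (use L[OF _ X(2) that] X(1) in auto)
    then show "(\<lambda>n. c m (X n)) \<longlonglongrightarrow> c m q" by (simp add: LIM_zero_iff)
  qed
  moreover have "loc_bdd (space index_measure) c dom"
  proof (rule loc_bddI)
    fix q assume q: "q \<in> dom"
    have "compact (curve q ` {0..1})"
      by (intro compact_continuous_image characteristic_cont[OF curve_characteristic[OF q]]) simp
    then obtain K where K: "\<And>\<theta>. \<theta> \<in> {0..1} \<Longrightarrow> norm (curve q \<theta>) \<le> K"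
      using compact_imp_bounded bounded_iff by (metis image_eqI)
    show "\<exists>r>0. \<exists>B. \<forall>i\<in>space index_measure. \<forall>p\<in>dom \<inter> ball q r. norm (c i p) \<le> B"
    proof (rule exI[of _ 1], rule conjI, simp, rule exI[of _ "K + 3 * stab"], intro ballI)
      fix m p assume m: "m \<in> space (index_measure :: ('n option \<times> real) measure)" and p: "p \<in> dom \<inter> ball q 1"
      have "\<bar>c m q\<bar> \<le> norm (curve q (snd m))"
        using Basis_le_norm[OF unit_vec_Basis, of "curve q (snd m)" "fst m"] by (simp add: c_def coord_inner)
      moreover have "norm (curve q (snd m)) \<le> K" using K m by auto
      moreover have "\<bar>c m p - c m q\<bar> \<le> 3 * stab * 1"
        by (rule order_trans[OF L mult_left_mono]) (use p q m stab_nonneg in \<open>auto simp: dist_norm norm_minus_commute\<close>)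
      ultimately show "norm (c m p) \<le> K + 3 * stab" by simp
    qed
  qed
  ultimately show ?thesis by simp
qed

text \<open>Ingredients of the induction step: \<open>V\<close> and \<open>\<phi>0\<close> enter the
  linearised equation through first derivatives, of order \<open>s\<close>, composed with the
  curves, of order \<open>k\<close> by hypothesis.\<close>

context
  fixes k :: nat
  assumes ks: "k \<le> s" and ck: "Cs_unif k (space index_measure) c dom"
begin

lemma fst_Cs_unif: "Cs_unif k I (\<lambda>_. fst) dom"
  by (rule Cs_unif_linear[OF open_dom bounded_linear_fst])

lemma pos_Cs_unif: "Cs_unif k {0<..1} pos dom"
proof -
  have "Cs_unif k {0<..1} (\<lambda>\<sigma> q. (fst q * \<sigma>) *\<^sub>R ((1, 0) :: real \<times> (real^'n) \<times> real)
      + (\<Sum>j\<in>UNIV. c (j, \<sigma>) q *\<^sub>R ((0, unit_vec j) :: real \<times> (real^'n) \<times> real))) dom"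
  proof (intro Cs_unif_add[OF open_dom] Cs_unif_sum[OF open_dom] Cs_unif_scaleR[OF open_dom] Cs_unif_mult[OF open_dom])
    show "Cs_unif k {0<..1} (\<lambda>i. fst) dom" by (rule fst_Cs_unif)
    show "Cs_unif k {0<..1} (\<lambda>i q. i :: real) dom" by (rule Cs_unif_const[of _ _ 1]) auto
    show "Cs_unif k {0<..1} (\<lambda>i. c (j, i)) dom" for j
      by (rule Cs_unif_reindex[OF ck, of "{0<..1}" "\<lambda>\<sigma>. (j, \<sigma>)"]) auto
  qed (auto intro!: Cs_unif_const[of _ _ "norm _"])
  moreover have "(fst q * \<sigma>) *\<^sub>R (1, 0) + (\<Sum>j\<in>UNIV. c (j, \<sigma>) q *\<^sub>R (0, unit_vec j)) = pos \<sigma> q" for \<sigma> q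
    using coord_expansion[of "curve q \<sigma>"] by (simp add: pos_def c_def prod_eq_iff fst_sum snd_sum)
  ultimately show ?thesis by (simp only:)
qed

lemma compose_pos_Cs_unif: "Csb_on k h Q \<Longrightarrow> Cs_unif k {0<..1} (\<lambda>\<sigma> q. h (pos \<sigma> q)) dom"
  by (rule Cs_unif_compose[OF open_dom _ _ pos_Cs_unif]) (use pos_Q in auto)

lemma f_Cs_unif: "Cs_unif k {0<..1} (f l) dom"
  unfolding f_def[abs_def]
  by (intro Cs_unif_mult[OF open_dom] fst_Cs_unif compose_pos_Cs_unif Vc_Csb) (use ks in simp)

lemma coef_Cs_unif: "Cs_unif k {0<..1} (coef l j) dom"
  unfolding coef_def[abs_def]
  by (intro Cs_unif_mult[OF open_dom] fst_Cs_unif compose_pos_Cs_unif DV_Csb ks)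

lemma \<alpha>_Cs_unif: "Cs_unif k {0<..1} (\<alpha> l) dom"
  unfolding \<alpha>_def[abs_def]
proof (intro Cs_unif_add[OF open_dom] Cs_unif_mult[OF open_dom] fst_Cs_unif)
  show "Cs_unif k {0<..1} (\<lambda>i q. Vc l (pos i q)) dom" by (rule compose_pos_Cs_unif[OF Vc_Csb]) (use ks in simp)
  show "Cs_unif k {0<..1} (\<lambda>i q. DVt l (pos i q)) dom" by (rule compose_pos_Cs_unif[OF DV_Csb(2)[OF ks]])
  show "Cs_unif k {0<..1} (\<lambda>i q. i :: real) dom" by (rule Cs_unif_const[of _ _ 1]) auto
qed

text \<open>\<theta> = 0 is not an index of \<open>c\<close>, so the foot is recovered from the
  integral formula \<open>foot_eq\<close>.\<close>

lemma foot_Cs_unif: "Cs_unif k {()} (\<lambda>_. foot) dom"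
proof -
  have comp: "Cs_unif k {()} (\<lambda>_ q. coord i (foot q)) dom" for i
  proof (cases i)
    case None
    have "Cs_unif k {()} (\<lambda>_ q. snd (snd q)) dom"
      by (rule Cs_unif_linear[OF open_dom bounded_linear_compose[OF bounded_linear_snd bounded_linear_snd]])
    then show ?thesis by (rule Cs_unif_cong[OF open_dom, rotated]) (simp add: None foot_eq)
  next
    case (Some j)
    have "Cs_unif k ({()} \<times> space unit_time) (\<lambda>p. f (Some j) (snd p)) dom"
      by (rule Cs_unif_reindex[OF f_Cs_unif]) auto
    then have "Cs_unif k {()} (\<lambda>i q. \<integral>\<sigma>. (\<lambda>p. f (Some j) (snd p)) (i, \<sigma>) q \<partial>unit_time) dom"
      by (rule T.Cs_unif_integral[OF open_dom]) (use f_measurable in simp)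
    then have i: "Cs_unif k {()} (\<lambda>i q. \<integral>\<sigma>. f (Some j) \<sigma> q \<partial>unit_time) dom" by simp
    have i2: "Cs_unif k {()} (\<lambda>i q. - (\<integral>\<sigma>. f (Some j) \<sigma> q \<partial>unit_time)) dom"
      by (rule Cs_unif_bounded_linear[OF open_dom bounded_linear_minus[OF bounded_linear_ident] i])
    have "Cs_unif k {()} (\<lambda>i q. fst (snd q) $ j + - (\<integral>\<sigma>. f (Some j) \<sigma> q \<partial>unit_time)) dom"
    proof (rule Cs_unif_add[OF open_dom Cs_unif_linear[OF open_dom] i2])
      show "bounded_linear (\<lambda>q. fst (snd q) $ j)"
        by (intro bounded_linear_compose[OF bounded_linear_vec_nth] bounded_linear_compose[OF bounded_linear_fst bounded_linear_snd])
    qed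
    then show ?thesis by (rule Cs_unif_cong[OF open_dom, rotated]) (simp add: Some foot_eq)
  qed
  have "Cs_unif k {()} (\<lambda>_ q. \<Sum>i\<in>UNIV. coord i (foot q) *\<^sub>R unit_vec i) dom"
    by (intro Cs_unif_sum[OF open_dom] Cs_unif_scaleR[OF open_dom] comp) (auto intro!: Cs_unif_const[of _ _ "norm _"])
  then show ?thesis by (simp only: coord_expansion[symmetric])
qed

lemma slope_Cs_unif: "Cs_unif k I (\<lambda>_. slope j) dom"
proof -
  have "Cs_unif k {()} (\<lambda>_ q. slope j q) dom"
    unfolding slope_def[abs_def]
    by (rule Cs_unif_compose[OF open_dom _ slope_Csb[OF ks] foot_Cs_unif]) (rule foot_strip)
  then show ?thesis by (rule Cs_unif_reindex) simp
qed

text \<open>The jumps of \<open>\<kappa>0\<close> are in the time arguments, which belong to the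
  index; in \<open>q\<close> only the slopes vary.\<close>

lemma \<kappa>_Cs_unif: "Cs_unif k I (\<lambda>p q. \<kappa> (g p) l (\<theta> p) (\<sigma> p) q) dom"
  unfolding \<kappa>_def[abs_def]
proof (intro Cs_unif_add[OF open_dom] Cs_unif_sum[OF open_dom] Cs_unif_mult[OF open_dom] slope_Cs_unif)
  show "Cs_unif k I (\<lambda>i q. \<kappa>0 (g i) l (\<theta> i) (\<sigma> i)) dom"
    by (rule Cs_unif_const[of _ _ 1]) (auto simp: \<kappa>0_def split: option.split)
  show "Cs_unif k I (\<lambda>i q. \<kappa>1 (g i) l j) dom" for j
    by (rule Cs_unif_const[of _ _ 1]) (auto simp: \<kappa>1_def)
qed simp

lemma N_Cs_unif: "Cs_unif k (space index_measure \<times> space index_measure) N dom"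
  unfolding N_def[abs_def]
proof (intro Cs_unif_sum[OF open_dom] Cs_unif_mult[OF open_dom] \<kappa>_Cs_unif)
  fix l
  have "Cs_unif k (UNIV \<times> {0<..1}) (\<lambda>(j, \<sigma>). coef l j \<sigma>) dom"
    by (rule Cs_unif_Times_finite) (auto intro: coef_Cs_unif)
  then have "Cs_unif k (space index_measure \<times> space index_measure) (\<lambda>p. (\<lambda>(j, \<sigma>). coef l j \<sigma>) (snd p)) dom"
    by (rule Cs_unif_reindex) auto
  then show "Cs_unif k (space index_measure \<times> space index_measure)
      (\<lambda>p :: ('n option \<times> real) \<times> ('n option \<times> real). coef l (fst (snd p)) (snd (snd p))) dom"
    by (simp add: case_prod_unfold)
qed simp

lemma b_Cs_unif: "Cs_unif k (space index_measure) (b v) dom"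
proof -
  have "Cs_unif k (space index_measure \<times> space unit_time)
      (\<lambda>p q. \<Sum>l\<in>UNIV. \<kappa> (fst (fst p)) l (snd (fst p)) (snd p) q * \<alpha> l (snd p) q) dom"
    by (intro Cs_unif_sum[OF open_dom] Cs_unif_mult[OF open_dom] \<kappa>_Cs_unif Cs_unif_reindex[OF \<alpha>_Cs_unif]) auto
  then have "Cs_unif k (space index_measure) (\<lambda>m q. \<integral>\<sigma>.
      (\<lambda>p q. \<Sum>l\<in>UNIV. \<kappa> (fst (fst p)) l (snd (fst p)) (snd p) q * \<alpha> l (snd p) q) (m, \<sigma>) q \<partial>unit_time) dom"
  proof (rule T.Cs_unif_integral[OF open_dom])
    fix m q assume "q \<in> dom"
    then show "(\<lambda>x. \<Sum>l\<in>UNIV. \<kappa> (fst (fst (m, x))) l (snd (fst (m, x))) (snd (m, x)) q * \<alpha> l (snd (m, x)) q) \<in> borel_measurable unit_time"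
      unfolding fst_conv snd_conv
      by (intro borel_measurable_sum borel_measurable_times \<kappa>_measurable_time \<alpha>_measurable)
  qed
  then have \<beta>: "Cs_unif k (space index_measure) \<beta> dom" by (simp add: \<beta>_def[abs_def])
  have "Cs_unif k I (\<lambda>p q. drift j q v) dom" for j and I :: "('n option \<times> real) set"
  proof (cases j)
    case None
    have "Cs_unif k I (\<lambda>p q. (\<Sum>k\<in>UNIV. slope (Some k) q * fst (snd v) $ k) + slope None q * snd (snd v)) dom"
      by (intro Cs_unif_add[OF open_dom] Cs_unif_sum[OF open_dom] Cs_unif_mult[OF open_dom] slope_Cs_unif)
         (auto intro!: Cs_unif_const[of _ _ "\<bar>_\<bar>"])
    then show ?thesis by (simp add: drift_def None)
  next
    case (Some k')
    show ?thesis by (simp add: drift_def Some) (rule Cs_unif_const[of _ _ "\<bar>fst (snd v) $ k'\<bar>"], simp)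
  qed
  then have "Cs_unif k (UNIV \<times> space (index_measure :: ('n option \<times> real) measure)) (\<lambda>(j, p) q. drift j q v) dom"
    using Cs_unif_Times_finite[of UNIV k "space (index_measure :: ('n option \<times> real) measure)" "\<lambda>j p q. drift j q v" dom] by simp
  from Cs_unif_reindex[OF this, of "space index_measure" "\<lambda>m. (fst m, m)"]
  have d: "Cs_unif k (space index_measure) (\<lambda>m q. drift (fst m) q v) dom" by simp
  have "Cs_unif k (space index_measure) (\<lambda>m q. drift (fst m) q v + fst v * \<beta> m q) dom"
    by (intro Cs_unif_add[OF open_dom d] Cs_unif_mult[OF open_dom _ \<beta>] Cs_unif_const[of _ _ "\<bar>fst v\<bar>"]) simp
  then show ?thesis by (simp add: b_def[abs_def])
qed

end

text \<open>\<open>foot\<close> and \<open>pos \<sigma>\<close> are Lipschitz in \<open>q\<close>,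
  so the Taylor remainders of \<open>\<phi>0\<close> and of the velocity are small relative to the
  increment of \<open>q\<close>. For \<open>rem1\<close> this holds at each \<sigma> separately,
  without uniformity; the Lipschitz constant of the velocity gives the dominating bound.\<close>

lemma remainder_tendsto:
  assumes q: "q \<in> dom" and X: "\<And>n. X n \<in> dom" "\<And>n. X n \<noteq> q" "X \<longlonglongrightarrow> q" and m: "m \<in> space index_measure"
  shows "(\<lambda>n. (c m (X n) - c m q - b (X n - q) m q - (\<integral>x. N (m, x) q * (c x (X n) - c x q) \<partial>index_measure)) / norm (X n - q)) \<longlonglongrightarrow> 0"
proof -
  let ?v = "\<lambda>n. norm (X n - q)"
  have vpos: "?v n > 0" for n using X(2) by simp
  define C where "C = 1 + 3 * stab"
  have C0: "C \<ge> 0" using stab_nonneg by (simp add: C_def)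
  have v0: "?v \<longlonglongrightarrow> 0" using X(3) by (simp add: LIM_zero tendsto_norm_zero)
  have Cv: "(\<lambda>n. C * ?v n) \<longlonglongrightarrow> 0" using tendsto_mult_right_zero[OF v0] .
  have r0: "(\<lambda>n. rem0 (fst m) q (X n) / ?v n) \<longlonglongrightarrow> 0"
  proof (cases "fst m = None")
    case True
    have fl: "norm (foot (X n) - foot q) \<le> C * ?v n" for n
      using foot_lip[OF q X(1)] by (simp add: C_def)
    have "(\<lambda>n. foot (X n)) \<longlonglongrightarrow> foot q"
      by (rule Lim_transform_bound[THEN LIM_zero_cancel, OF _ Cv]) (use fl C0 in auto)
    from has_derivative_seqD_le[OF \<phi>0_has_derivative[OF foot_strip[OF q]] this fl vpos]
    show ?thesis by (simp add: rem0_def True)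
  next
    case False
    show ?thesis unfolding rem0_def using False by (simp only: if_False div_0 tendsto_const)
  qed
  let ?J = "\<lambda>n \<sigma>. \<Sum>l\<in>UNIV. \<kappa> (fst m) l (snd m) \<sigma> q * rem1 l \<sigma> q (X n)"
  have "(\<lambda>n. \<integral>\<sigma>. ?J n \<sigma> / ?v n \<partial>unit_time) \<longlonglongrightarrow> (\<integral>\<sigma>. 0 \<partial>unit_time)"
  proof (rule T.integral_tendsto_bounded)
    show "(\<lambda>\<sigma>. ?J n \<sigma> / ?v n) \<in> borel_measurable unit_time" for n
      by (intro borel_measurable_divide c_expansion(2)[OF q X(1) m] borel_measurable_const)
    fix \<sigma> assume "\<sigma> \<in> space unit_time"
    then have \<sigma>: "\<sigma> \<in> {0<..1}" "\<sigma> \<in> {0..1}" by auto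
    have pl: "norm (pos \<sigma> (X n) - pos \<sigma> q) \<le> C * ?v n" for n
      using pos_lip[OF q X(1) \<sigma>(2)] by (simp add: C_def)
    have pt: "(\<lambda>n. pos \<sigma> (X n)) \<longlonglongrightarrow> pos \<sigma> q"
      by (rule Lim_transform_bound[THEN LIM_zero_cancel, OF _ Cv]) (use pl C0 in auto)
    have t: "\<bar>fst (X n) - fst q\<bar> \<le> ?v n" for n using norm_fst_le_norm[of "X n - q"] by simp
    have Vl: "\<bar>Vc l (pos \<sigma> (X n)) - Vc l (pos \<sigma> q)\<bar> \<le> L * (C * ?v n)" for l n
      by (rule order_trans[OF Vc_lip mult_left_mono[OF pl L_nonneg]])
    have Dl: "\<bar>frechet_derivative (Vc l) (at (pos \<sigma> q)) (pos \<sigma> (X n) - pos \<sigma> q)\<bar> \<le> L * (C * ?v n)" for l n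
      by (rule order_trans[OF D_Vc_bound[OF pos_Q[OF q \<sigma>(1)]] mult_left_mono[OF pl L_nonneg]])
    have r1: "(\<lambda>n. rem1 l \<sigma> q (X n) / ?v n) \<longlonglongrightarrow> 0" for l
    proof -
      have 1: "(\<lambda>n. ((fst (X n) - fst q) * (Vc l (pos \<sigma> (X n)) - Vc l (pos \<sigma> q))) / ?v n) \<longlonglongrightarrow> 0"
      proof (rule Lim_null_comparison)
        show "\<forall>\<^sub>F n in sequentially. norm (((fst (X n) - fst q) * (Vc l (pos \<sigma> (X n)) - Vc l (pos \<sigma> q))) / ?v n) \<le> L * (C * ?v n)"
        proof (intro always_eventually allI)
          fix n
          have "\<bar>(fst (X n) - fst q) * (Vc l (pos \<sigma> (X n)) - Vc l (pos \<sigma> q))\<bar> \<le> ?v n * (L * (C * ?v n))"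
            unfolding abs_mult by (intro mult_mono t Vl) auto
          then show "norm (((fst (X n) - fst q) * (Vc l (pos \<sigma> (X n)) - Vc l (pos \<sigma> q))) / ?v n) \<le> L * (C * ?v n)"
            using vpos[of n] by (simp add: pos_divide_le_eq mult_ac)
        qed
        show "(\<lambda>n. L * (C * ?v n)) \<longlonglongrightarrow> 0" by (rule tendsto_mult_right_zero[OF Cv])
      qed
      have 2: "(\<lambda>n. fst q * ((Vc l (pos \<sigma> (X n)) - Vc l (pos \<sigma> q) - frechet_derivative (Vc l) (at (pos \<sigma> q)) (pos \<sigma> (X n) - pos \<sigma> q)) / ?v n)) \<longlonglongrightarrow> 0"
        by (rule tendsto_mult_right_zero)
           (rule has_derivative_seqD_le[OF Vc_has_derivative[OF pos_Q[OF q \<sigma>(1)]] pt pl vpos])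
      show ?thesis using tendsto_add[OF 1 2] by (simp add: rem1_def add_divide_distrib)
    qed
    have "(\<lambda>n. \<Sum>l\<in>UNIV. \<kappa> (fst m) l (snd m) \<sigma> q * (rem1 l \<sigma> q (X n) / ?v n)) \<longlonglongrightarrow> (\<Sum>l\<in>(UNIV :: 'n option set). 0)"
      by (intro tendsto_sum tendsto_mult_right_zero r1)
    then show "(\<lambda>n. ?J n \<sigma> / ?v n) \<longlonglongrightarrow> 0" by (simp add: sum_divide_distrib)
    fix n
    \<comment> \<open>One S L C from the product of increments, where the two times differ by at
      most \<open>S\<close>, and two from the Taylor remainder.\<close>
    have "\<bar>rem1 l \<sigma> q (X n)\<bar> \<le> (3 * S * L * C) * ?v n" for l
    proof -
      have "\<bar>(fst (X n) - fst q) * (Vc l (pos \<sigma> (X n)) - Vc l (pos \<sigma> q))\<bar> \<le> S * (L * (C * ?v n))"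
        unfolding abs_mult using dom_time[OF q] dom_time[OF X(1)[of n]] L_nonneg C0 by (intro mult_mono Vl) auto
      moreover have "\<bar>Vc l (pos \<sigma> (X n)) - Vc l (pos \<sigma> q) - frechet_derivative (Vc l) (at (pos \<sigma> q)) (pos \<sigma> (X n) - pos \<sigma> q)\<bar> \<le> 2 * (L * (C * ?v n))"
        using Vl[of l n] Dl[of l n] by linarith
      then have "\<bar>fst q * (Vc l (pos \<sigma> (X n)) - Vc l (pos \<sigma> q) - frechet_derivative (Vc l) (at (pos \<sigma> q)) (pos \<sigma> (X n) - pos \<sigma> q))\<bar> \<le> S * (2 * (L * (C * ?v n)))"
        unfolding abs_mult using dom_time[OF q] L_nonneg C0 by (intro mult_mono) auto
      ultimately have "\<bar>rem1 l \<sigma> q (X n)\<bar> \<le> S * (L * (C * ?v n)) + S * (2 * (L * (C * ?v n)))"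
        unfolding rem1_def by linarith
      then show ?thesis by (simp add: algebra_simps)
    qed
    then have "\<bar>?J n \<sigma>\<bar> \<le> (1 + CARD('n) * G) * ((3 * S * L * C) * ?v n)"
      by (rule weighted_bound[OF q]) (use S_pos L_nonneg C0 in auto)
    then show "\<bar>?J n \<sigma> / ?v n\<bar> \<le> (1 + CARD('n) * G) * (3 * S * L * C)"
      using vpos[of n] by (simp add: pos_divide_le_eq mult.assoc)
  qed
  then have "(\<lambda>n. (\<integral>\<sigma>. ?J n \<sigma> \<partial>unit_time) / ?v n) \<longlonglongrightarrow> 0" by simp
  from tendsto_add[OF r0 this] show ?thesis
    unfolding c_expansion(1)[OF q X(1) m] by (simp add: add_divide_distrib)
qed

lemma b_linear: "b v m q = (\<Sum>e\<in>Basis. (v \<bullet> e) * b e m q)"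
proof -
  have "linear (\<lambda>v. b v m q)"
  proof (rule linearI)
    show "b (v + w) m q = b v m q + b w m q" for v w
      by (cases "fst m") (auto simp: b_def drift_def algebra_simps sum.distrib)
    show "b (r *\<^sub>R v) m q = r *\<^sub>R b v m q" for r v
      by (cases "fst m") (auto simp: b_def drift_def algebra_simps sum_distrib_left)
  qed
  from linear_Basis_expansion[OF this, of v] show ?thesis by simp
qed

text \<open>For each direction \<open>e\<close> the linearised equation has a solution, of order
  \<open>k\<close> by \<open>Cs_unif_solution\<close>, and \<open>remainder_tendsto\<close>
  identifies it with the partial derivative of \<open>c\<close>. One order is gained per step as
  long as \<open>k \<le> s\<close>.\<close>

lemma c_Cs_unif: "k \<le> Suc s \<Longrightarrow> Cs_unif k (space index_measure) c dom"
proof (induction k)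
  case 0
  show ?case by (rule c_Cs_unif_0)
next
  case (Suc k)
  have ks: "k \<le> s" and ck: "Cs_unif k (space index_measure) c dom" using Suc by auto
  \<comment> \<open>As in \<open>Cs_unif_solution\<close>, the middle clause makes the pointwise
    choices locally bounded.\<close>
  define sl where "sl e q y \<longleftrightarrow> y \<in> borel_measurable index_measure \<and>
      (\<forall>C\<ge>0. (\<forall>m\<in>space index_measure. \<bar>b e m q\<bar> \<le> C) \<longrightarrow> (\<forall>m\<in>space index_measure. \<bar>y m\<bar> \<le> 2 * C)) \<and>
      (\<forall>m\<in>space index_measure. y m = b e m q + (\<integral>x. N (m, x) q * y x \<partial>index_measure))" for e q y
  have ex: "\<exists>y. sl e q y" if q: "q \<in> dom" for e q
  proof -
    obtain C where C: "C > 0" "\<And>m. m \<in> space index_measure \<Longrightarrow> \<bar>b e m q\<bar> \<le> C"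
    proof -
      obtain r C where C: "r > 0" "C > 0" "\<And>m p. m \<in> space index_measure \<Longrightarrow> p \<in> dom \<Longrightarrow> dist q p < r \<Longrightarrow> norm (b e m p) \<le> C"
        using loc_bddE[OF Cs_unif_loc_bdd[OF b_Cs_unif[OF ks ck, of e]] q] by metis
      show ?thesis by (rule that[of C]) (use C q in auto)
    qed
    obtain y where y: "y \<in> borel_measurable index_measure" "\<And>m. m \<in> space index_measure \<Longrightarrow> \<bar>y m\<bar> \<le> 2 * C"
      "\<And>m. m \<in> space index_measure \<Longrightarrow> y m = b e m q + (\<integral>x. N (m, x) q * y x \<partial>index_measure)"
      by (rule F.solution_exists[OF b_measurable[OF q] C(2) _ N_measurable[OF q] N_bound[OF q]]) (use C(1) in auto)
    have "\<bar>y m\<bar> \<le> 2 * D" if D: "D \<ge> 0" "\<forall>m\<in>space index_measure. \<bar>b e m q\<bar> \<le> D" and m: "m \<in> space index_measure" for D m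
    proof (rule F.abs_bound_self_improve[OF y(1,2) _ D(1) m])
      fix m :: "'n option \<times> real" assume m: "m \<in> space index_measure"
      have "\<bar>\<integral>x. N (m, x) q * y x \<partial>index_measure\<bar> \<le> B * (\<integral>x. \<bar>y x\<bar> \<partial>index_measure)"
        by (rule F.kernel_bound[OF y(1,2) N_bound[OF q]])
      moreover have "\<bar>b e m q\<bar> \<le> D" using D(2) m by blast
      ultimately show "\<bar>y m\<bar> \<le> D + B * (\<integral>x. \<bar>y x\<bar> \<partial>index_measure)" using y(3)[OF m] by linarith
    qed
    then show ?thesis using y(1,3) unfolding sl_def by (intro exI[of _ y]) simp
  qed
  define y where "y e q = (SOME y. sl e q y)" for e q
  have "sl e q (y e q)" if "q \<in> dom" for e q
    unfolding y_def by (rule someI_ex[OF ex[OF that]])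
  then have ym: "\<And>e q. q \<in> dom \<Longrightarrow> y e q \<in> borel_measurable index_measure"
    and yC: "\<And>e q C m. q \<in> dom \<Longrightarrow> C \<ge> 0 \<Longrightarrow> (\<And>m. m \<in> space index_measure \<Longrightarrow> \<bar>b e m q\<bar> \<le> C) \<Longrightarrow> m \<in> space index_measure \<Longrightarrow> \<bar>y e q m\<bar> \<le> 2 * C"
    and yeq: "\<And>e q m. q \<in> dom \<Longrightarrow> m \<in> space index_measure \<Longrightarrow> y e q m = b e m q + (\<integral>x. N (m, x) q * y e q x \<partial>index_measure)"
    unfolding sl_def by blast+
  have yk: "Cs_unif k (space index_measure) (\<lambda>m q. y e q m) dom" for e
  proof (rule F.Cs_unif_solution[OF open_dom N_measurable N_bound b_Cs_unif[OF ks ck, of e] N_Cs_unif[OF ks ck]])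
    show "loc_bdd (space index_measure) (\<lambda>m q. y e q m) dom"
    proof (rule loc_bddI)
      fix q assume q: "q \<in> dom"
      obtain r C where C: "r > 0" "C > 0" "\<And>m p. m \<in> space index_measure \<Longrightarrow> p \<in> dom \<Longrightarrow> dist q p < r \<Longrightarrow> norm (b e m p) \<le> C"
        using loc_bddE[OF Cs_unif_loc_bdd[OF b_Cs_unif[OF ks ck, of e]] q] by metis
      have "\<bar>y e p m\<bar> \<le> 2 * C" if m: "m \<in> space index_measure" and p: "p \<in> dom" "dist q p < r" for m p
        by (rule yC[OF p(1) _ _ m]) (use C p in auto)
      then show "\<exists>r>0. \<exists>B. \<forall>m\<in>space index_measure. \<forall>p\<in>dom \<inter> ball q r. norm (y e p m) \<le> B"
        by (intro exI[of _ r] conjI C(1) exI[of _ "2 * C"]) auto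
    qed
  qed (use ym yeq b_measurable in auto)
  show ?case
  proof (rule Cs_unif_SucI[OF open_dom, where a' = "\<lambda>m q v. \<Sum>e\<in>Basis. (v \<bullet> e) * y e q m"])
    show "loc_bdd (space index_measure) c dom" by (rule Cs_unif_loc_bdd[OF c_Cs_unif_0])
    show "Cs_unif k (space index_measure) (\<lambda>m q. \<Sum>e'\<in>Basis. (e \<bullet> e') * y e' q m) dom" if e: "e \<in> Basis" for e
    proof -
      have "(\<Sum>e'\<in>Basis. (e \<bullet> e') * y e' q m) = y e q m" for m q
        using e by (simp add: inner_Basis if_distrib[of "\<lambda>x. x * _"] cong: if_cong)
      then show ?thesis using yk[of e] by simp
    qed
    fix m :: "'n option \<times> real" and q assume m: "m \<in> space index_measure" and q: "q \<in> dom"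
    obtain r where r: "r > 0" "ball q r \<subseteq> dom" using open_dom q open_contains_ball by blast
    have "\<exists>K. \<forall>e\<in>Basis. \<forall>m\<in>space index_measure. \<bar>y e q m\<bar> \<le> K"
    proof -
      have "\<exists>K. \<forall>m\<in>space index_measure. \<bar>y e q m\<bar> \<le> K" for e
      proof -
        obtain r' C where C: "r' > 0" "\<And>m p. m \<in> space index_measure \<Longrightarrow> p \<in> dom \<Longrightarrow> dist q p < r' \<Longrightarrow> norm (y e p m) \<le> C"
          using loc_bddE[OF Cs_unif_loc_bdd[OF yk[of e]] q] by metis
        have "\<forall>m\<in>space index_measure. \<bar>y e q m\<bar> \<le> C" using C(2)[OF _ q] C(1) by auto
        then show ?thesis ..
      qed
      then obtain K where K: "\<And>e m. m \<in> space index_measure \<Longrightarrow> \<bar>y e q m\<bar> \<le> K e" by metis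
      show ?thesis
      proof (intro exI[of _ "Max (K ` Basis)"] ballI)
        fix e :: "real \<times> (real^'n) \<times> real" and m :: "'n option \<times> real"
        assume "e \<in> Basis" "m \<in> space index_measure"
        then show "\<bar>y e q m\<bar> \<le> Max (K ` Basis)" by (intro order_trans[OF K]) auto
      qed
    qed
    then obtain K where K: "\<And>e m. e \<in> Basis \<Longrightarrow> m \<in> space index_measure \<Longrightarrow> \<bar>y e q m\<bar> \<le> K" by blast
    show "(c m has_derivative (\<lambda>v. \<Sum>e\<in>Basis. (v \<bullet> e) * y e q m)) (at q)"
    proof (rule F.solution_has_derivative[where y = "\<lambda>e. y e q" and b = "\<lambda>e m. b e m q" and N = "\<lambda>p. N p q" and L = "3 * stab" and K = K, OF r(1)])
      show "(\<lambda>m. c m p) \<in> borel_measurable index_measure" if "p \<in> ball q r" for p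
        using c_measurable that r(2) by blast
      show "\<bar>c m p - c m q\<bar> \<le> 3 * stab * norm (p - q)" if "m \<in> space index_measure" "p \<in> ball q r" for m p
        using c_lip[of p q "snd m" "fst m"] that r(2) q by auto
      show "(\<lambda>n. (c m (X n) - c m q - (\<Sum>e\<in>Basis. ((X n - q) \<bullet> e) * b e m q) - (\<integral>x. N (m, x) q * (c x (X n) - c x q) \<partial>index_measure)) / norm (X n - q)) \<longlonglongrightarrow> 0"
        if "\<And>n. X n \<in> ball q r" "\<And>n. X n \<noteq> q" "X \<longlonglongrightarrow> q" "m \<in> space index_measure" for X m
        unfolding b_linear[symmetric]
        by (rule remainder_tendsto[OF q _ that(2,3,4)]) (use that(1) r(2) in blast)
    qed (use q m b_measurable N_measurable N_bound ym K yeq in auto)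
  qed
qed

theorem sol_Cs_on: "Cs_on (Suc s) sol dom"
proof -
  have "Cs_on (Suc s) (c (None, 1)) dom"
    by (rule Cs_unif_imp_Cs_on[OF c_Cs_unif]) auto
  moreover have "c (None, 1) = sol" by (auto simp: c_def sol_def coord_def)
  ultimately show ?thesis by simp
qed

end

section \<open>The fluid domain\<close>

text \<open>Gronwall in both directions: as long as \<delta> is positive, exp (C \<theta>) \<delta>
  does not decrease, so \<delta> cannot reach a first zero; then exp (- C \<theta>) \<delta> does
  not increase. The derivative is asked for in the open interval, as the surface need not have one
  at time 0.\<close>

lemma positive_of_linear_decay:
  fixes \<delta> :: "real \<Rightarrow> real"
  assumes cont: "continuous_on {0..1} \<delta>" and pos: "\<delta> 0 > 0"
    and der: "\<And>\<theta>. 0 < \<theta> \<Longrightarrow> \<theta> < 1 \<Longrightarrow> (\<delta> has_real_derivative d \<theta>) (at \<theta>)"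
    and bound: "\<And>\<theta>. 0 < \<theta> \<Longrightarrow> \<theta> < 1 \<Longrightarrow> \<bar>d \<theta>\<bar> \<le> C * \<bar>\<delta> \<theta>\<bar>"
    and C: "C \<ge> 0" and th: "\<theta> \<in> {0..1}"
  shows "\<delta> \<theta> > 0" and "\<delta> \<theta> \<le> \<delta> 0 * exp C"
proof -
  have mono: "\<delta> 0 \<le> exp (C * b) * \<delta> b" if b: "0 < b" "b \<le> 1" "\<And>\<theta>. 0 < \<theta> \<Longrightarrow> \<theta> < b \<Longrightarrow> \<delta> \<theta> > 0" for b
  proof -
    have "exp (C * 0) * \<delta> 0 \<le> exp (C * b) * \<delta> b"
    proof (rule DERIV_nonneg_imp_increasing_open[OF less_imp_le[OF b(1)]])
      fix x assume x: "0 < x" "x < b"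
      have "((\<lambda>\<theta>. exp (C * \<theta>) * \<delta> \<theta>) has_real_derivative exp (C * x) * (C * \<delta> x + d x)) (at x)"
        using x b by (auto intro!: derivative_eq_intros der simp: algebra_simps)
      moreover have "C * \<delta> x + d x \<ge> 0" using bound[of x] b(3)[OF x] x b(2) by (simp add: abs_le_iff)
      ultimately show "\<exists>y. ((\<lambda>\<theta>. exp (C * \<theta>) * \<delta> \<theta>) has_real_derivative y) (at x) \<and> 0 \<le> y" by auto
    next
      show "continuous_on {0..b} (\<lambda>\<theta>. exp (C * \<theta>) * \<delta> \<theta>)"
        by (intro continuous_intros continuous_on_subset[OF cont]) (use b in auto)
    qed
    then show ?thesis by simp
  qed
  have all: "\<delta> \<theta> > 0" if "\<theta> \<in> {0..1}" for \<theta>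
  proof (rule ccontr)
    assume "\<not> \<delta> \<theta> > 0"
    define E where "E = {\<theta> \<in> {0..1}. \<delta> \<theta> \<le> 0}"
    have "E = {0..1} \<inter> \<delta> -` {..0}" by (auto simp: E_def)
    then have "closed E" using continuous_closed_preimage[OF cont] by auto
    moreover have "bounded E" by (rule bounded_subset[OF bounded_closed_interval[of 0 1]]) (auto simp: E_def)
    ultimately have "compact E" using compact_eq_bounded_closed by blast
    moreover have "\<theta> \<in> E" using that \<open>\<not> \<delta> \<theta> > 0\<close> by (simp add: E_def)
    ultimately obtain z where z: "z \<in> E" "\<And>y. y \<in> E \<Longrightarrow> z \<le> y"
      using continuous_attains_inf[of E "\<lambda>x. x"] by (auto intro: continuous_on_id)
    have z0: "0 < z" "z \<le> 1" using z(1) pos by (auto simp: E_def less_le)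
    have "\<delta> 0 \<le> exp (C * z) * \<delta> z"
    proof (rule mono[OF z0])
      fix y assume "0 < y" "y < z"
      then show "\<delta> y > 0" using z(2)[of y] z0 by (force simp: E_def)
    qed
    moreover have "exp (C * z) * \<delta> z \<le> 0" using z(1) by (auto simp: E_def mult_nonneg_nonpos)
    ultimately show False using pos by simp
  qed
  show "\<delta> \<theta> > 0" by (rule all[OF th])
  show "\<delta> \<theta> \<le> \<delta> 0 * exp C"
  proof (cases "\<theta> = 0")
    case True
    then show ?thesis using pos C by simp
  next
    case False
    have "exp (- (C * \<theta>)) * \<delta> \<theta> \<le> exp (- (C * 0)) * \<delta> 0"
    proof (rule DERIV_nonpos_imp_decreasing_open[where f = "\<lambda>\<theta>. exp (- (C * \<theta>)) * \<delta> \<theta>"])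
      show "0 \<le> \<theta>" using th by simp
      fix x assume x: "0 < x" "x < \<theta>"
      then have x1: "x < 1" using th by simp
      have "((\<lambda>\<theta>. exp (- (C * \<theta>)) * \<delta> \<theta>) has_real_derivative exp (- (C * x)) * (d x - C * \<delta> x)) (at x)"
        using x x1 by (auto intro!: derivative_eq_intros der simp: algebra_simps)
      moreover have "d x - C * \<delta> x \<le> 0" using bound[of x] all[of x] x x1 by (simp add: abs_le_iff)
      ultimately show "\<exists>y. ((\<lambda>\<theta>. exp (- (C * \<theta>)) * \<delta> \<theta>) has_real_derivative y) (at x) \<and> y \<le> 0"
        by (intro exI conjI) (auto intro: mult_nonneg_nonpos)
    next
      show "continuous_on {0..\<theta>} (\<lambda>\<theta>. exp (- (C * \<theta>)) * \<delta> \<theta>)"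
        by (intro continuous_intros continuous_on_subset[OF cont]) (use th in auto)
    qed
    then have "\<delta> \<theta> \<le> \<delta> 0 * exp (C * \<theta>)" by (simp add: exp_minus field_simps)
    also have "\<dots> \<le> \<delta> 0 * exp (C * 1)"
      using pos C th by (intro mult_left_mono) (auto intro: mult_left_le)
    finally show ?thesis by simp
  qed
qed

lemma null_sequence_below:
  fixes d :: real
  assumes "d > 0"
  obtains h where "\<And>n. 0 < h n \<and> h n < d" "h \<longlonglongrightarrow> 0"
\<comment> \<open>The shift by two puts already the first term strictly below
  \<open>d\<close>.\<close>
proof (rule that[of "\<lambda>n. d * inverse (real (Suc (Suc n)))"])
  fix n
  have "inverse (real (Suc (Suc n))) < 1" by (rule inverse_less_1_iff[THEN iffD2]) auto
  then have "d * inverse (real (Suc (Suc n))) < d * 1" using assms by (rule mult_strict_left_mono)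
  moreover have "0 < d * inverse (real (Suc (Suc n)))" using assms by (intro mult_pos_pos) auto
  ultimately show "0 < d * inverse (real (Suc (Suc n))) \<and> d * inverse (real (Suc (Suc n))) < d" by simp
next
  show "(\<lambda>n. d * inverse (real (Suc (Suc n)))) \<longlonglongrightarrow> 0"
    by (rule tendsto_mult_right_zero[OF LIMSEQ_Suc[OF LIMSEQ_inverse_real_of_nat]])
qed

locale hydrostatic_layer =
  fixes s :: nat and T g :: real
    and zb \<eta>0 :: "real^'n \<Rightarrow> real"
    and u0 :: "(real^'n) \<times> real \<Rightarrow> real^'n"
    and \<eta> :: "real \<times> (real^'n) \<Rightarrow> real"
    and u :: "real \<times> (real^'n) \<times> real \<Rightarrow> real^'n"
    and w :: "real \<times> (real^'n) \<times> real \<Rightarrow> real"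
    and \<phi>0 :: "(real^'n) \<times> real \<Rightarrow> real"
    and G K M :: real
  assumes T_pos: "T > 0"
    and zb_smooth: "Csb_on (Suc s) zb UNIV"
    and euler: "hydrostatic_euler g (\<lambda>_. 0) zb T \<eta>0 u0 \<eta> u w"
    and \<eta>_smooth: "Csb_on (Suc s) \<eta> ({0<..<T} \<times> UNIV)"
    and u_smooth: "Csb_on (Suc s) u (fluid_domain T zb \<eta>)"
    and w_smooth: "Csb_on (Suc s) w (fluid_domain T zb \<eta>)"
    and \<phi>0_smooth: "Csb_on (Suc s) \<phi>0 strip"
    and \<phi>0_bottom: "(\<phi>0 \<longlongrightarrow> zb x) (at (x, 0) within strip)"
    and \<phi>0_top: "(\<phi>0 \<longlongrightarrow> \<eta>0 x) (at (x, 1) within strip)"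
    and \<phi>0_deriv: "(x, l) \<in> strip \<Longrightarrow> deriv (\<lambda>\<mu>. \<phi>0 (x, \<mu>)) l > 0"
    and G_nonneg: "G \<ge> 0" and K_nonneg: "K \<ge> 0" and M_nonneg: "M \<ge> 0"
    and D\<eta>_bound: "p \<in> {0<..<T} \<times> UNIV \<Longrightarrow> \<bar>frechet_derivative \<eta> (at p) v\<bar> \<le> G * norm v"
    and Dzb_bound: "\<bar>frechet_derivative zb (at x) y\<bar> \<le> G * norm y"
    and D\<phi>0_bound: "a \<in> strip \<Longrightarrow> \<bar>frechet_derivative \<phi>0 (at a) b\<bar> \<le> G * norm b"
    and Du_bound: "q \<in> fluid_domain T zb \<eta> \<Longrightarrow> norm (frechet_derivative u (at q) h) \<le> K * norm h"
    and Dw_bound: "q \<in> fluid_domain T zb \<eta> \<Longrightarrow> \<bar>frechet_derivative w (at q) h\<bar> \<le> K * norm h"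
    and u_bound: "q \<in> fluid_domain T zb \<eta> \<Longrightarrow> norm (u q) \<le> M"
    and w_bound: "q \<in> fluid_domain T zb \<eta> \<Longrightarrow> \<bar>w q\<bar> \<le> M"
begin

abbreviation "Q \<equiv> fluid_domain T zb \<eta>"

lemma \<eta>_has_derivative:
  "0 < t \<Longrightarrow> t < T \<Longrightarrow> (\<eta> has_derivative frechet_derivative \<eta> (at (t, x))) (at (t, x))"
  using \<eta>_smooth by (simp add: frechet_derivative_works[symmetric])

lemma zb_has_derivative: "(zb has_derivative frechet_derivative zb (at x)) (at x)"
  using zb_smooth by (simp add: frechet_derivative_works[symmetric])

lemma u_has_derivative: "p \<in> Q \<Longrightarrow> (u has_derivative frechet_derivative u (at p)) (at p)"
  using u_smooth by (simp add: frechet_derivative_works[symmetric])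

lemma w_has_derivative: "p \<in> Q \<Longrightarrow> (w has_derivative frechet_derivative w (at p)) (at p)"
  using w_smooth by (simp add: frechet_derivative_works[symmetric])

lemma mem_strip: "(x, l) \<in> strip \<longleftrightarrow> 0 < l \<and> l < 1" by (auto simp: strip_def)

lemma mem_Q: "(t, x, z) \<in> Q \<longleftrightarrow> 0 < t \<and> t < T \<and> zb x < z \<and> z < \<eta> (t, x)"
  by (auto simp: fluid_domain_def fluid_slice_def)

lemma \<phi>0_has_derivative: "a \<in> strip \<Longrightarrow> (\<phi>0 has_derivative frechet_derivative \<phi>0 (at a)) (at a)"
  using \<phi>0_smooth by (simp add: frechet_derivative_works[symmetric])

lemma \<phi>0_lipschitz: "a \<in> strip \<Longrightarrow> b \<in> strip \<Longrightarrow> \<bar>\<phi>0 a - \<phi>0 b\<bar> \<le> G * norm (a - b)"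
  unfolding real_norm_def[symmetric]
proof (rule lipschitz_of_derivative_bound[where U = strip and f' = "\<lambda>p. frechet_derivative \<phi>0 (at p)"])
  show "convex (strip :: ((real^'n) \<times> real) set)" unfolding strip_def by (intro convex_Times) auto
  show "norm (frechet_derivative \<phi>0 (at p) v) \<le> G * norm v" if "p \<in> strip" for p v
    using D\<phi>0_bound[OF that] by simp
qed (auto intro: \<phi>0_has_derivative)

lemma \<phi>0_vertical_derivative:
  assumes "(x, l) \<in> strip"
  shows "((\<lambda>\<mu>. \<phi>0 (x, \<mu>)) has_real_derivative deriv (\<lambda>\<mu>. \<phi>0 (x, \<mu>)) l) (at l)"
proof -
  have "((\<lambda>\<mu>. \<phi>0 (x, \<mu>)) has_derivative (\<lambda>h. frechet_derivative \<phi>0 (at (x, l)) (0, h))) (at l)"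
    by (rule has_derivative_compose[where f = "\<lambda>\<mu>. (x, \<mu>)", OF _ \<phi>0_has_derivative[OF assms]])
       (auto intro!: derivative_eq_intros)
  then have "(\<lambda>\<mu>. \<phi>0 (x, \<mu>)) differentiable (at l)" by (auto simp: differentiable_def)
  then show ?thesis by (simp add: DERIV_deriv_iff_real_differentiable)
qed

lemma \<phi>0_strict_mono:
  assumes "0 < l" "l < l'" "l' < 1"
  shows "\<phi>0 (x, l) < \<phi>0 (x, l')"
proof (rule DERIV_pos_imp_increasing[OF assms(2)])
  fix m assume "l \<le> m" "m \<le> l'"
  then have "(x, m) \<in> strip" using assms by (auto simp: mem_strip)
  then show "\<exists>y. ((\<lambda>\<mu>. \<phi>0 (x, \<mu>)) has_real_derivative y) (at m) \<and> 0 < y"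
    using \<phi>0_vertical_derivative \<phi>0_deriv by blast
qed

lemma \<phi>0_vertical_limits:
  "((\<lambda>\<mu>. \<phi>0 (x, \<mu>)) \<longlongrightarrow> zb x) (at_right 0)" "((\<lambda>\<mu>. \<phi>0 (x, \<mu>)) \<longlongrightarrow> \<eta>0 x) (at_left 1)"
proof -
  have *: "filterlim (\<lambda>\<mu>. (x, \<mu>)) (at (x, b) within strip) F"
    if "filterlim (\<lambda>\<mu>. \<mu>) (nhds b) F" "\<forall>\<^sub>F \<mu> in F. \<mu> \<in> {0<..<1}" "\<forall>\<^sub>F \<mu> in F. \<mu> \<noteq> b" for b F
    unfolding filterlim_at
  proof
    show "\<forall>\<^sub>F \<mu> in F. (x, \<mu>) \<in> strip \<and> (x, \<mu>) \<noteq> (x, b)"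
      using that(2,3) by eventually_elim (auto simp: mem_strip)
    show "filterlim (Pair x) (nhds (x, b)) F" by (intro tendsto_Pair tendsto_const that)
  qed
  have "filterlim (\<lambda>\<mu>. (x, \<mu>)) (at (x, 0) within strip) (at_right 0)"
    by (rule *) (auto intro: tendsto_ident_at eventually_at_rightI[of 0 1])
  then show "((\<lambda>\<mu>. \<phi>0 (x, \<mu>)) \<longlongrightarrow> zb x) (at_right 0)" by (rule filterlim_compose[OF \<phi>0_bottom])
  have "filterlim (\<lambda>\<mu>. (x, \<mu>)) (at (x, 1) within strip) (at_left 1)"
    by (rule *) (auto intro: tendsto_ident_at eventually_at_leftI[of 0 1])
  then show "((\<lambda>\<mu>. \<phi>0 (x, \<mu>)) \<longlongrightarrow> \<eta>0 x) (at_left 1)" by (rule filterlim_compose[OF \<phi>0_top])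
qed

text \<open>\<open>\<phi>0\<close> increases in \<open>l\<close> between its limits at 0 and 1; the
  linear bounds are its Lipschitz estimate carried to those limits. They later locate preimages of
  points near the boundary.\<close>

lemma \<phi>0_between:
  assumes l: "0 < l" "l < 1"
  shows "zb x < \<phi>0 (x, l)" "\<phi>0 (x, l) < \<eta>0 x" "\<phi>0 (x, l) - zb x \<le> G * l" "\<eta>0 x - \<phi>0 (x, l) \<le> G * (1 - l)"
proof -
  \<comment> \<open>Comparing at l / 2 first leaves room for a strict inequality at
    \<open>l\<close>.\<close>
  have "zb x \<le> \<phi>0 (x, l / 2)"
    by (rule tendsto_upperbound[OF \<phi>0_vertical_limits(1)])
       (use l \<phi>0_strict_mono[of _ "l / 2" x] in \<open>auto intro!: eventually_at_rightI[of 0 "l / 2"] less_imp_le\<close>)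
  then show "zb x < \<phi>0 (x, l)" using \<phi>0_strict_mono[of "l / 2" l x] l by simp
  have "\<phi>0 (x, (1 + l) / 2) \<le> \<eta>0 x"
    by (rule tendsto_lowerbound[OF \<phi>0_vertical_limits(2)])
       (use l \<phi>0_strict_mono[of "(1 + l) / 2" _ x] in \<open>auto intro!: eventually_at_leftI[of "(1 + l) / 2" 1] less_imp_le\<close>)
  then show "\<phi>0 (x, l) < \<eta>0 x" using \<phi>0_strict_mono[of l "(1 + l) / 2" x] l by simp
  have lip: "\<bar>\<phi>0 (x, l) - \<phi>0 (x, \<mu>)\<bar> \<le> G * \<bar>l - \<mu>\<bar>" if "0 < \<mu>" "\<mu> < 1" for \<mu>
    using \<phi>0_lipschitz[of "(x, l)" "(x, \<mu>)"] that l by (simp add: mem_strip norm_Pair)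
  have "((\<lambda>\<mu>. \<phi>0 (x, l) - \<phi>0 (x, \<mu>)) \<longlongrightarrow> \<phi>0 (x, l) - zb x) (at_right 0)"
    by (intro tendsto_intros \<phi>0_vertical_limits)
  then show "\<phi>0 (x, l) - zb x \<le> G * l"
  proof (rule tendsto_upperbound)
    show "\<forall>\<^sub>F \<mu> in at_right 0. \<phi>0 (x, l) - \<phi>0 (x, \<mu>) \<le> G * l"
    proof (rule eventually_at_rightI[of 0 l])
      fix \<mu> assume "\<mu> \<in> {0<..<l}"
      then have "\<bar>\<phi>0 (x, l) - \<phi>0 (x, \<mu>)\<bar> \<le> G * \<bar>l - \<mu>\<bar>" "G * \<bar>l - \<mu>\<bar> \<le> G * l"
        using lip[of \<mu>] l G_nonneg by (auto intro!: mult_left_mono)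
      then show "\<phi>0 (x, l) - \<phi>0 (x, \<mu>) \<le> G * l" by linarith
    qed (rule l)
  qed simp
  have "((\<lambda>\<mu>. \<phi>0 (x, \<mu>) - \<phi>0 (x, l)) \<longlongrightarrow> \<eta>0 x - \<phi>0 (x, l)) (at_left 1)"
    by (intro tendsto_intros \<phi>0_vertical_limits)
  then show "\<eta>0 x - \<phi>0 (x, l) \<le> G * (1 - l)"
  proof (rule tendsto_upperbound)
    show "\<forall>\<^sub>F \<mu> in at_left 1. \<phi>0 (x, \<mu>) - \<phi>0 (x, l) \<le> G * (1 - l)"
    proof (rule eventually_at_leftI[of l 1])
      fix \<mu> assume "\<mu> \<in> {l<..<1}"
      then have "\<bar>\<phi>0 (x, l) - \<phi>0 (x, \<mu>)\<bar> \<le> G * \<bar>l - \<mu>\<bar>" "G * \<bar>l - \<mu>\<bar> \<le> G * (1 - l)"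
        using lip[of \<mu>] l G_nonneg by (auto intro!: mult_left_mono)
      then show "\<phi>0 (x, \<mu>) - \<phi>0 (x, l) \<le> G * (1 - l)" by linarith
    qed (rule l)
  qed simp
qed

lemma initial_depth: "zb x < \<eta>0 x"
  using \<phi>0_between(1,2)[of "1/2" x] by simp

lemma \<eta>_lipschitz:
  assumes "0 < t" "t < T" "0 < t'" "t' < T"
  shows "\<bar>\<eta> (t, x) - \<eta> (t', x')\<bar> \<le> G * norm ((t, x) - (t', x'))"
  unfolding real_norm_def[symmetric]
proof (rule lipschitz_of_derivative_bound[where U = "{0<..<T} \<times> UNIV" and f' = "\<lambda>p. frechet_derivative \<eta> (at p)"])
  show "convex ({0<..<T} \<times> (UNIV :: (real^'n) set))" by (intro convex_Times) auto
  show "(\<eta> has_derivative frechet_derivative \<eta> (at p)) (at p)" if "p \<in> {0<..<T} \<times> UNIV" for p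
    using \<eta>_has_derivative that by (cases p) auto
  show "norm (frechet_derivative \<eta> (at p) v) \<le> G * norm v" if "p \<in> {0<..<T} \<times> UNIV" for p v
    using D\<eta>_bound[OF that] by simp
qed (use assms in auto)

lemma \<eta>_initial: "(\<eta> \<longlongrightarrow> \<eta>0 x) (at (0, x) within {0<..<T} \<times> UNIV)"
  using euler by (simp add: hydrostatic_euler_def Let_def)

lemma \<eta>_initial_seq:
  assumes "\<And>n. 0 < t n \<and> t n < T" "t \<longlonglongrightarrow> 0" "X \<longlonglongrightarrow> x"
  shows "(\<lambda>n. \<eta> (t n, X n)) \<longlonglongrightarrow> \<eta>0 x"
proof -
  have "(t n, X n) \<in> {0<..<T} \<times> UNIV - {(0, x)}" for n using assms(1)[of n] by auto
  moreover have "(\<lambda>n. (t n, X n)) \<longlonglongrightarrow> (0, x)" by (intro tendsto_intros assms)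
  moreover have "(\<forall>i. Y i \<in> {0<..<T} \<times> UNIV - {(0, x)}) \<longrightarrow> Y \<longlonglongrightarrow> (0, x) \<longrightarrow> (\<lambda>i. \<eta> (Y i)) \<longlonglongrightarrow> \<eta>0 x" for Y
    using \<eta>_initial[of x] unfolding tendsto_at_iff_sequentially comp_def by (rule spec)
  ultimately show ?thesis by simp
qed

text \<open>Inherited from \<open>\<eta>\<close> along a sequence of times tending to 0.\<close>

lemma \<eta>0_lipschitz: "\<bar>\<eta>0 x - \<eta>0 y\<bar> \<le> G * norm (x - y)"
proof -
  obtain t where t: "\<And>n. 0 < t n \<and> t n < T" and "t \<longlonglongrightarrow> 0"
    using null_sequence_below[OF T_pos] by blast
  then have "(\<lambda>n. \<bar>\<eta> (t n, x) - \<eta> (t n, y)\<bar>) \<longlonglongrightarrow> \<bar>\<eta>0 x - \<eta>0 y\<bar>"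
    by (intro tendsto_intros \<eta>_initial_seq t)
  moreover have "\<bar>\<eta> (t n, x) - \<eta> (t n, y)\<bar> \<le> G * norm (x - y)" for n
    using \<eta>_lipschitz[of "t n" "t n" x y] t[of n] by (simp add: norm_Pair)
  ultimately show ?thesis by (intro LIMSEQ_le_const2) auto
qed

lemma inner_grad_\<eta>:
  assumes "0 < t" "t < T"
  shows "a \<bullet> grad (\<lambda>y. \<eta> (t, y)) x = frechet_derivative \<eta> (at (t, x)) (0, a)"
proof (rule inner_grad)
  show "((\<lambda>y. \<eta> (t, y)) has_derivative (\<lambda>a. frechet_derivative \<eta> (at (t, x)) (0, a))) (at x)"
    by (rule has_derivative_compose[where f = "\<lambda>y. (t, y)", OF _ \<eta>_has_derivative[OF assms]])
       (auto intro!: derivative_eq_intros)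
qed

lemma inner_grad_zb: "a \<bullet> grad zb x = frechet_derivative zb (at x) a"
  by (rule inner_grad[OF zb_has_derivative])

lemma surface_condition:
  assumes "0 < t" "t < T"
  shows "frechet_derivative \<eta> (at (t, x)) (1, cont_ext Q u (t, x, \<eta> (t, x))) = cont_ext Q w (t, x, \<eta> (t, x))"
proof -
  let ?D = "frechet_derivative \<eta> (at (t, x))" and ?a = "cont_ext Q u (t, x, \<eta> (t, x))"
  have lin: "linear ?D" by (rule has_derivative_linear[OF \<eta>_has_derivative[OF assms]])
  have "?D (1, ?a) = ?D (1, 0) + ?D (0, ?a)" using linear_add[OF lin, of "(1, 0)" "(0, ?a)"] by simp
  also have "\<dots> = deriv (\<lambda>\<tau>. \<eta> (\<tau>, x)) t + ?a \<bullet> grad (\<lambda>y. \<eta> (t, y)) x"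
    using has_derivative_deriv_time[OF \<eta>_has_derivative[OF assms]] inner_grad_\<eta>[OF assms] by simp
  also have "\<dots> = cont_ext Q w (t, x, \<eta> (t, x))"
    using euler assms by (simp add: hydrostatic_euler_def Let_def)
  finally show ?thesis .
qed

lemma bottom_condition:
  assumes "0 < t" "t < T"
  shows "frechet_derivative zb (at x) (cont_ext Q u (t, x, zb x)) = cont_ext Q w (t, x, zb x)"
  using euler assms inner_grad_zb[of "cont_ext Q u (t, x, zb x)" x] by (simp add: hydrostatic_euler_def Let_def)

text \<open>
  Stated over a convex set \<open>P\<close>, because positivity of the depth is proved with it and is then known
  only near a point.
\<close>

lemma extension_over_convex:
  assumes P: "convex P" "open P" "P \<noteq> {}" "P \<subseteq> {0<..<T} \<times> UNIV" and depth: "\<And>t x. (t, x) \<in> P \<Longrightarrow> zb x < \<eta> (t, x)"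
  obtains U W where
    "\<And>t x z. (t, x) \<in> P \<Longrightarrow> (t, x, z) \<in> Q \<Longrightarrow> U (t, x, z) = u (t, x, z) \<and> W (t, x, z) = w (t, x, z)"
    "\<And>p q. norm (U p - U q) \<le> CARD('n) * (K * (2 + 2 * G)) * norm (p - q)"
    "\<And>p q. \<bar>W p - W q\<bar> \<le> K * (2 + 2 * G) * norm (p - q)"
    "\<And>p. norm (U p) \<le> CARD('n) * M" "\<And>p. \<bar>W p\<bar> \<le> M"
    "\<And>t x z. (t, x) \<in> P \<Longrightarrow> (t, x, z) \<in> closure Q \<Longrightarrow> cont_ext Q u (t, x, z) = U (t, x, z) \<and> cont_ext Q w (t, x, z) = W (t, x, z)"
proof -
  define R where "R = {p \<in> Q. (fst p, fst (snd p)) \<in> P}"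
  define L where "L = K * (2 + 2 * G)"
  have L0: "L \<ge> 0" using K_nonneg G_nonneg by (simp add: L_def)
  obtain t0 x0 where t0: "(t0, x0) \<in> P" using P(3) by (metis all_not_in_conv surj_pair)
  have "(t0, x0, (zb x0 + \<eta> (t0, x0)) / 2) \<in> R"
    using depth[OF t0] t0 P(4) by (auto simp: R_def mem_Q)
  then have R: "R \<noteq> {}" by blast
  have \<eta>d: "(\<eta> has_derivative frechet_derivative \<eta> (at p)) (at p)" if "p \<in> P" for p
    using \<eta>_has_derivative that P(4) by (cases p) auto
  have \<eta>b: "\<bar>frechet_derivative \<eta> (at p) v\<bar> \<le> G * norm v" if "p \<in> P" for p v
    using D\<eta>_bound that P(4) by blast
  have ul: "norm (u p - u q) \<le> L * dist p q" if "p \<in> R" "q \<in> R" for p q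
  proof -
    obtain t x z t' x' z' where pq: "p = (t, x, z)" "q = (t', x', z')" by (cases p, cases q)
    show ?thesis unfolding pq dist_norm L_def
    proof (rule fluid_domain_lipschitz[where P = P and T = T and zb = zb and \<eta> = \<eta>
          and \<eta>' = "\<lambda>p. frechet_derivative \<eta> (at p)" and zb' = "\<lambda>x. frechet_derivative zb (at x)" and f' = "\<lambda>p. frechet_derivative u (at p)"])
      show "(t, x, z) \<in> Q" "(t', x', z') \<in> Q" "(t, x) \<in> P" "(t', x') \<in> P" using that pq by (auto simp: R_def)
      show "norm (frechet_derivative u (at p) h) \<le> K * norm h" if "p \<in> Q" for p h using Du_bound[OF that] by simp
    qed (fact P(1) P(4) K_nonneg G_nonneg | rule depth \<eta>d \<eta>b zb_has_derivative Dzb_bound u_has_derivative, assumption?)+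
  qed
  have wl: "\<bar>w p - w q\<bar> \<le> L * dist p q" if "p \<in> R" "q \<in> R" for p q
  proof -
    obtain t x z t' x' z' where pq: "p = (t, x, z)" "q = (t', x', z')" by (cases p, cases q)
    show ?thesis unfolding pq dist_norm L_def real_norm_def[symmetric]
    proof (rule fluid_domain_lipschitz[where P = P and T = T and zb = zb and \<eta> = \<eta>
          and \<eta>' = "\<lambda>p. frechet_derivative \<eta> (at p)" and zb' = "\<lambda>x. frechet_derivative zb (at x)" and f' = "\<lambda>p. frechet_derivative w (at p)"])
      show "(t, x, z) \<in> Q" "(t', x', z') \<in> Q" "(t, x) \<in> P" "(t', x') \<in> P" using that pq by (auto simp: R_def)
      show "norm (frechet_derivative w (at p) h) \<le> K * norm h" if "p \<in> Q" for p h using Dw_bound[OF that] by simp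
    qed (fact P(1) P(4) K_nonneg G_nonneg | rule depth \<eta>d \<eta>b zb_has_derivative Dzb_bound w_has_derivative, assumption?)+
  qed
  obtain U where U: "\<And>p. p \<in> R \<Longrightarrow> U p = u p" "\<And>p q. norm (U p - U q) \<le> CARD('n) * L * dist p q" "\<And>p. norm (U p) \<le> CARD('n) * M"
    by (rule lipschitz_extension_cart[OF R L0 ul, of M]) (use u_bound in \<open>auto simp: R_def\<close>)
  obtain W where W: "\<And>p. p \<in> R \<Longrightarrow> W p = w p" "\<And>p q. \<bar>W p - W q\<bar> \<le> L * dist p q" "\<And>p. \<bar>W p\<bar> \<le> M"
    by (rule lipschitz_extension_real[OF R L0 wl, of M]) (use w_bound in \<open>auto simp: R_def\<close>)
  have cont: "isCont f p" if "\<And>p q. norm (f p - f q) \<le> C * dist p q" for f :: "real \<times> (real^'n) \<times> real \<Rightarrow> 'z::real_normed_vector" and C p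
    unfolding isCont_def
  proof (rule Lim_null[THEN iffD2], rule Lim_null_comparison)
    show "\<forall>\<^sub>F q in at p. norm (f q - f p) \<le> C * dist q p" using that by (intro always_eventually) blast
    have "((\<lambda>q. C * dist q p) \<longlongrightarrow> C * dist p p) (at p)" by (intro tendsto_intros)
    then show "((\<lambda>q. C * dist q p) \<longlongrightarrow> 0) (at p)" by simp
  qed
  have contU: "isCont U p" for p by (rule cont[OF U(2)])
  have contW: "isCont W p" for p by (rule cont[of W L]) (use W(2) in simp)
  \<comment> \<open>The cylinder over \<open>P\<close>. Around a boundary point above
    \<open>P\<close> it is the neighbourhood that \<open>cont_ext_eq\<close> asks for.\<close>
  define O' where "O' = (\<lambda>p :: real \<times> (real^'n) \<times> real. (fst p, fst (snd p))) -` P"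
  have O': "open O'" unfolding O'_def by (intro open_vimage[OF P(2)] continuous_intros)
  show ?thesis
  proof (rule that[of U W])
    fix t x z assume tx: "(t, x) \<in> P"
    show "U (t, x, z) = u (t, x, z) \<and> W (t, x, z) = w (t, x, z)" if "(t, x, z) \<in> Q"
      using U(1) W(1) that tx by (simp add: R_def)
    show "cont_ext Q u (t, x, z) = U (t, x, z) \<and> cont_ext Q w (t, x, z) = W (t, x, z)" if "(t, x, z) \<in> closure Q"
      by (intro conjI cont_ext_eq[OF that O' _ contU] cont_ext_eq[OF that O' _ contW])
         (use tx U(1) W(1) in \<open>auto simp: O'_def R_def\<close>)
  qed (use U W in \<open>auto simp: L_def dist_norm\<close>)
qed

lemma boundary_in_closure:
  assumes "0 < t" "t < T" "zb x < \<eta> (t, x)"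
  shows "(t, x, zb x) \<in> closure Q" "(t, x, \<eta> (t, x)) \<in> closure Q"
proof -
  define D where "D = \<eta> (t, x) - zb x"
  have D: "D > 0" using assms(3) by (simp add: D_def)
  obtain h where h: "\<And>n. 0 < h n \<and> h n < D" and h0: "h \<longlonglongrightarrow> 0"
    using null_sequence_below[OF D] by blast
  have "(\<lambda>n. (t, x, zb x + h n)) \<longlonglongrightarrow> (t, x, zb x + 0)" by (intro tendsto_intros h0)
  moreover have "(t, x, zb x + h n) \<in> Q" for n using h[of n] assms by (auto simp: mem_Q D_def)
  ultimately show "(t, x, zb x) \<in> closure Q"
    unfolding closure_sequential by (intro exI[of _ "\<lambda>n. (t, x, zb x + h n)"]) simp
  have "(\<lambda>n. (t, x, \<eta> (t, x) - h n)) \<longlonglongrightarrow> (t, x, \<eta> (t, x) - 0)" by (intro tendsto_intros h0)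
  moreover have "(t, x, \<eta> (t, x) - h n) \<in> Q" for n using h[of n] assms by (auto simp: mem_Q D_def)
  ultimately show "(t, x, \<eta> (t, x)) \<in> closure Q"
    unfolding closure_sequential by (intro exI[of _ "\<lambda>n. (t, x, \<eta> (t, x) - h n)"]) simp
qed

text \<open>
  The initial depth is positive, and the kinematic conditions make \<open>\<eta> - zb\<close> satisfy a transport
  inequality along \<open>u\<close> at the surface.
\<close>

lemma depth_positive:
  assumes t1: "0 < t1" "t1 < T"
  shows "zb x1 < \<eta> (t1, x1)"
proof -
  define f where "f p = \<eta> p - zb (snd p)" for p
  define A where "A = CARD('n) * M"
  define L where "L = K * (2 + 2 * G)"
  \<comment> \<open>\<open>L\<close> for the difference of the vertical velocities at surface and
    bottom, the rest for the slope of the bottom applied to the difference of the horizontal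
    ones.\<close>
  define C where "C = L + CARD('n) * L * G"
  have L0: "L \<ge> 0" using K_nonneg G_nonneg by (simp add: L_def)
  have A0: "A \<ge> 0" using M_nonneg by (simp add: A_def)
  have fd: "(f has_derivative (\<lambda>v. frechet_derivative \<eta> (at (t, x)) v - frechet_derivative zb (at x) (snd v))) (at (t, x))"
    if "0 < t" "t < T" for t x
    unfolding f_def
    by (intro has_derivative_diff \<eta>_has_derivative that has_derivative_compose[OF has_derivative_snd[OF has_derivative_ident]])
       (simp add: zb_has_derivative)
  have cont: "continuous_on (cball x1 (A * t1)) (\<lambda>x. \<eta>0 x - zb x)"
  proof (intro continuous_intros)
    show "continuous_on (cball x1 (A * t1)) zb"
      by (rule continuous_at_imp_continuous_on) (use zb_has_derivative has_derivative_continuous in blast)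
    have "isCont \<eta>0 x" for x
      unfolding isCont_def
    proof (rule Lim_null[THEN iffD2], rule Lim_null_comparison)
      show "\<forall>\<^sub>F y in at x. norm (\<eta>0 y - \<eta>0 x) \<le> G * norm (y - x)" using \<eta>0_lipschitz by (intro always_eventually) simp
      have "((\<lambda>y. G * norm (y - x)) \<longlongrightarrow> G * norm (x - x)) (at x)" by (intro tendsto_intros)
      then show "((\<lambda>y. G * norm (y - x)) \<longlongrightarrow> 0) (at x)" by simp
    qed
    then show "continuous_on (cball x1 (A * t1)) \<eta>0" by (intro continuous_at_imp_continuous_on) auto
  qed
  \<comment> \<open>The initial depth may tend to 0 at infinity; the backward cone sees only a
    compact ball, on which it has a positive minimum.\<close>
  obtain y where y: "\<And>x. x \<in> cball x1 (A * t1) \<Longrightarrow> \<eta>0 y - zb y \<le> \<eta>0 x - zb x"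
  proof -
    have "A * t1 \<ge> 0" using A0 t1 by simp
    then have "cball x1 (A * t1) \<noteq> {}" by simp
    from continuous_attains_inf[OF compact_cball this cont] show ?thesis using that by blast
  qed
  have "(\<eta>0 y - zb y) * exp (- (C + 1) * t1) \<le> f (t1, x1)"
  proof (rule cone_lower_bound[where S = T and A = A and ?f0.0 = "\<lambda>x. \<eta>0 x - zb x"])
    show "f differentiable at (t, x)" if "0 < t" "t < T" for t x using fd[OF that] by (auto simp: differentiable_def)
    show "(f \<longlongrightarrow> \<eta>0 x - zb x) (at (0, x) within {0<..<T} \<times> UNIV)" for x
    proof -
      have "isCont zb x" using zb_has_derivative has_derivative_continuous by blast
      then have "((\<lambda>p. zb (snd p)) \<longlongrightarrow> zb x) (at (0, x) within {0<..<T} \<times> UNIV)"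
        by (rule isCont_tendsto_compose) (auto intro!: tendsto_eq_intros)
      then show ?thesis unfolding f_def by (intro tendsto_diff \<eta>_initial)
    qed
    show "0 < \<eta>0 y - zb y" using initial_depth[of y] by simp
    show "\<eta>0 y - zb y \<le> \<eta>0 x - zb x" if "norm (x - x1) \<le> A * t1" for x
      by (rule y) (use that in \<open>simp add: dist_norm norm_minus_commute\<close>)
    \<comment> \<open>The inequality is asked for only where there is fluid, and there the local
      extension can be built.\<close>
    fix t x assume t: "0 < t" "t < T" and fpos: "f (t, x) > 0"
    have "isCont f (t, x)" using fd[OF t] has_derivative_continuous by blast
    then obtain r where r: "r > 0" "\<And>p. dist p (t, x) < r \<Longrightarrow> f p > 0"
    proof -
      assume c: "isCont f (t, x)" and th: "\<And>r. r > 0 \<Longrightarrow> (\<And>p. dist p (t, x) < r \<Longrightarrow> f p > 0) \<Longrightarrow> thesis"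
      obtain d where d: "d > 0" "\<And>p. dist p (t, x) < d \<Longrightarrow> dist (f p) (f (t, x)) < f (t, x)"
        using c fpos unfolding continuous_at_eps_delta by blast
      show thesis by (rule th[OF d(1)]) (use d(2) in \<open>fastforce simp: dist_real_def\<close>)
    qed
    define P where "P = ball (t, x) (min r (min t (T - t)))"
    have tp: "(t, x) \<in> P" using r(1) t by (simp add: P_def)
    have Psub: "P \<subseteq> {0<..<T} \<times> UNIV"
    proof
      fix p assume "p \<in> P"
      then have "dist t (fst p) < min t (T - t)"
        using dist_fst_le[of "(t, x)" p] by (simp add: P_def)
      then show "p \<in> {0<..<T} \<times> UNIV" by (auto simp: dist_real_def mem_Times_iff)
    qed
    have Pd: "zb x' < \<eta> (t', x')" if "(t', x') \<in> P" for t' x'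
      using r(2)[of "(t', x')"] that by (simp add: P_def dist_commute f_def)
    obtain U W where UW: "\<And>p q. norm (U p - U q) \<le> CARD('n) * (K * (2 + 2 * G)) * norm (p - q)"
      "\<And>p q. \<bar>W p - W q\<bar> \<le> K * (2 + 2 * G) * norm (p - q)" "\<And>p. norm (U p) \<le> CARD('n) * M"
      "\<And>t x z. (t, x) \<in> P \<Longrightarrow> (t, x, z) \<in> closure Q \<Longrightarrow> cont_ext Q u (t, x, z) = U (t, x, z) \<and> cont_ext Q w (t, x, z) = W (t, x, z)"
      by (rule extension_over_convex[of P]) (use tp Psub Pd in \<open>auto simp: P_def\<close>)
    let ?s = "(t, x, \<eta> (t, x))" and ?b = "(t, x, zb x)"
    note cl = boundary_in_closure[OF t Pd[OF tp]]
    have nd: "norm (?s - ?b) = f (t, x)" using fpos by (simp add: f_def norm_Pair)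
    have lz: "linear (frechet_derivative zb (at x))" by (rule has_derivative_linear[OF zb_has_derivative])
    have s: "frechet_derivative \<eta> (at (t, x)) (1, U ?s) = W ?s"
      using surface_condition[OF t, of x] UW(4)[OF tp cl(2)] by simp
    have b: "frechet_derivative zb (at x) (U ?b) = W ?b"
      using bottom_condition[OF t, of x] UW(4)[OF tp cl(1)] by simp
    show "\<exists>a. norm a \<le> A \<and> frechet_derivative f (at (t, x)) (1, a) \<ge> - C * f (t, x)"
    proof (intro exI[of _ "U ?s"] conjI)
      show "norm (U ?s) \<le> A" using UW(3) by (simp add: A_def)
      have "frechet_derivative f (at (t, x)) (1, U ?s) = frechet_derivative \<eta> (at (t, x)) (1, U ?s) - frechet_derivative zb (at x) (U ?s)"
        unfolding frechet_derivative_at[OF fd[OF t, of x], symmetric] by simp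
      \<comment> \<open>The surface condition gives \<open>W ?s\<close>; the bottom condition,
        inserted as a zero, leaves differences of the velocity across the layer, which are at most a
        constant times the depth.\<close>
      also have "\<dots> = (W ?s - W ?b) - frechet_derivative zb (at x) (U ?s - U ?b)"
        using s b linear_diff[OF lz, of "U ?s" "U ?b"] by simp
      finally have e: "frechet_derivative f (at (t, x)) (1, U ?s) = (W ?s - W ?b) - frechet_derivative zb (at x) (U ?s - U ?b)" .
      have "\<bar>W ?s - W ?b\<bar> \<le> L * f (t, x)" using UW(2)[of ?s ?b] nd by (simp add: L_def)
      moreover have "\<bar>frechet_derivative zb (at x) (U ?s - U ?b)\<bar> \<le> G * (CARD('n) * L * f (t, x))"
        by (rule order_trans[OF Dzb_bound mult_left_mono[OF _ G_nonneg]]) (use UW(1)[of ?s ?b] nd in \<open>simp add: L_def\<close>)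
      ultimately have "frechet_derivative f (at (t, x)) (1, U ?s) \<ge> - (L * f (t, x) + G * (CARD('n) * L * f (t, x)))"
        unfolding e by linarith
      then show "frechet_derivative f (at (t, x)) (1, U ?s) \<ge> - C * f (t, x)" by (simp add: C_def algebra_simps)
    qed
  qed (use t1 A0 in auto)
  moreover have "(\<eta>0 y - zb y) * exp (- (C + 1) * t1) > 0" using initial_depth[of y] by simp
  ultimately show ?thesis by (simp add: f_def)
qed

end

lemma Csb_on_cong:
  assumes "open U"
  shows "(\<And>q. q \<in> U \<Longrightarrow> f q = g q) \<Longrightarrow> Csb_on k f U \<Longrightarrow> Csb_on k g U"
proof (induction k arbitrary: f g)
  case 0
  then show ?case using continuous_on_cong[of U U f g] image_cong[of U U f g] by auto
next
  case (Suc k)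
  have "continuous_on U g" using Suc.prems continuous_on_cong[of U U f g] by auto
  moreover have "bounded (g ` U)" using Suc.prems image_cong[of U U f g] by auto
  moreover have "g differentiable (at q)" if "q \<in> U" for q
  proof -
    have "f differentiable (at q)" using Suc.prems that by simp
    then obtain D where "(f has_derivative D) (at q)" by (auto simp: differentiable_def)
    then have "(g has_derivative D) (at q)"
      by (rule has_derivative_transform_within_open[OF _ assms that]) (rule Suc.prems(1))
    then show ?thesis by (auto simp: differentiable_def)
  qed
  moreover have "Csb_on k (\<lambda>q. frechet_derivative g (at q) e) U" if "e \<in> Basis" for e
  proof (rule Suc.IH)
    show "frechet_derivative f (at q) e = frechet_derivative g (at q) e" if "q \<in> U" for q
      using frechet_derivative_cong_open[OF assms that Suc.prems(1)] by simp
    show "Csb_on k (\<lambda>q. frechet_derivative f (at q) e) U" using Suc.prems that by simp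
  qed
  ultimately show ?case by simp
qed

lemma Csb_on_bounded_linear:
  assumes "open U" "bounded_linear A"
  shows "Csb_on k f U \<Longrightarrow> Csb_on k (\<lambda>p. A (f p)) U"
proof (induction k arbitrary: f)
  have bd: "bounded ((\<lambda>p. A (f p)) ` U)" if "bounded (f ` U)" for f
    using bounded_linear_image[OF that assms(2)] by (simp add: image_image)
  {
    case 0
    then show ?case using bd by (auto intro: bounded_linear.continuous_on[OF assms(2)])
  next
    case (Suc k)
    have d: "((\<lambda>p. A (f p)) has_derivative (\<lambda>v. A (frechet_derivative f (at p) v))) (at p)" if "p \<in> U" for p
      by (rule bounded_linear.has_derivative[OF assms(2)])
         (use Suc.prems that in \<open>simp add: frechet_derivative_works[symmetric]\<close>)
    have "Csb_on k (\<lambda>p. frechet_derivative (\<lambda>p. A (f p)) (at p) e) U" if e: "e \<in> Basis" for e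
    proof (rule Csb_on_cong[OF assms(1)])
      show "Csb_on k (\<lambda>p. A (frechet_derivative f (at p) e)) U" by (rule Suc.IH) (use Suc.prems e in simp)
      show "A (frechet_derivative f (at p) e) = frechet_derivative (\<lambda>p. A (f p)) (at p) e" if "p \<in> U" for p
        unfolding frechet_derivative_at[OF d[OF that], symmetric] ..
    qed
    then show ?case using Suc.prems bd d by (auto intro: bounded_linear.continuous_on[OF assms(2)] simp: differentiable_def)
  }
qed

lemma has_derivative_material:
  fixes f :: "real \<times> (real^'n) \<times> real \<Rightarrow> real"
  assumes d: "(f has_derivative D) (at (t, x, l))"
  shows "deriv (\<lambda>\<tau>. f (\<tau>, x, l)) t + a \<bullet> grad (\<lambda>y. f (t, y, l)) x = D (1, a, 0)"
proof -
  have "a \<bullet> grad (\<lambda>y. f (t, y, l)) x = D (0, a, 0)"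
  proof (rule inner_grad)
    show "((\<lambda>y. f (t, y, l)) has_derivative (\<lambda>a. D (0, a, 0))) (at x)"
      by (rule has_derivative_compose[where f = "\<lambda>y. (t, y, l)", OF _ d]) (auto intro!: derivative_eq_intros)
  qed
  moreover have "deriv (\<lambda>\<tau>. f (\<tau>, x, l)) t = D (1, 0)" by (rule has_derivative_deriv_time[OF d])
  moreover have "D (1, a, 0) = D (1, 0) + D (0, a, 0)"
    using linear_add[OF has_derivative_linear[OF d], of "(1, 0)" "(0, a, 0)"] by (simp add: zero_prod_def)
  ultimately show ?thesis by simp
qed

section \<open>The solution of the Cauchy problem\<close>

locale layer_flow = hydrostatic_layer s T g zb \<eta>0 u0 \<eta> u w \<phi>0 G K M
  for s :: nat and T g :: real
    and zb \<eta>0 :: "real^'n \<Rightarrow> real"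
    and u0 :: "(real^'n) \<times> real \<Rightarrow> real^'n"
    and \<eta> :: "real \<times> (real^'n) \<Rightarrow> real"
    and u :: "real \<times> (real^'n) \<times> real \<Rightarrow> real^'n"
    and w :: "real \<times> (real^'n) \<times> real \<Rightarrow> real"
    and \<phi>0 :: "(real^'n) \<times> real \<Rightarrow> real"
    and G K M :: real +
  fixes V :: "real \<times> (real^'n) \<times> real \<Rightarrow> (real^'n) \<times> real" and L A S :: real
  assumes V_Q: "p \<in> Q \<Longrightarrow> V p = (u p, w p)"
    and V_closure: "(t, x, z) \<in> closure Q \<Longrightarrow> 0 < t \<Longrightarrow> t < T \<Longrightarrow>
      cont_ext Q u (t, x, z) = fst (V (t, x, z)) \<and> cont_ext Q w (t, x, z) = snd (V (t, x, z))"
    and V_lipschitz: "norm (V p - V q) \<le> L * norm (p - q)"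
    and V_norm: "norm (V p) \<le> A"
    and L_pos: "L \<ge> 0" and A_pos: "A \<ge> 0" and S_pos: "S > 0" and S_le: "S \<le> T"
    and S_small: "S * L * (4 + CARD('n) * G) * (CARD('n) + 1) \<le> 1/2"
begin

sublocale flow: characteristics V \<phi>0 L A G S
  by unfold_locales (use V_lipschitz V_norm \<phi>0_lipschitz L_pos A_pos G_nonneg S_pos S_small in auto)

text \<open>At z = zb x the left side vanishes by the kinematic condition at the bottom; away from
  it the Lipschitz bound of \<open>V\<close> applies. This rate drives the Gronwall argument, and
  \<open>surface_rate\<close> is its counterpart.\<close>

lemma bottom_rate:
  assumes t: "0 < t" "t < T"
  shows "\<bar>snd (V (t, x, z)) - frechet_derivative zb (at x) (fst (V (t, x, z)))\<bar> \<le> L * (1 + G) * \<bar>z - zb x\<bar>"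
proof -
  let ?p = "(t, x, z)" and ?b = "(t, x, zb x)"
  let ?D = "frechet_derivative zb (at x)"
  have lin: "linear ?D" by (rule has_derivative_linear[OF zb_has_derivative])
  have b: "?D (fst (V ?b)) = snd (V ?b)"
    using bottom_condition[OF t, of x] V_closure[OF boundary_in_closure(1)[OF t depth_positive[OF t]] t] by simp
  have n: "norm (V ?p - V ?b) \<le> L * \<bar>z - zb x\<bar>" using V_lipschitz[of ?p ?b] by (simp add: norm_Pair)
  have "snd (V ?p) - ?D (fst (V ?p)) = snd (V ?p - V ?b) - ?D (fst (V ?p - V ?b))"
    using b by (simp add: linear_diff[OF lin])
  moreover have "\<bar>snd (V ?p - V ?b)\<bar> \<le> L * \<bar>z - zb x\<bar>" using norm_snd_le_norm[of "V ?p - V ?b"] n by simp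
  moreover have "\<bar>?D (fst (V ?p - V ?b))\<bar> \<le> G * (L * \<bar>z - zb x\<bar>)"
    by (rule order_trans[OF Dzb_bound mult_left_mono[OF order_trans[OF norm_fst_le_norm n] G_nonneg]])
  ultimately have "\<bar>snd (V ?p) - ?D (fst (V ?p))\<bar> \<le> L * \<bar>z - zb x\<bar> + G * (L * \<bar>z - zb x\<bar>)" by linarith
  then show ?thesis by (simp add: algebra_simps)
qed

lemma surface_rate:
  assumes t: "0 < t" "t < T"
  shows "\<bar>frechet_derivative \<eta> (at (t, x)) (1, fst (V (t, x, z))) - snd (V (t, x, z))\<bar> \<le> L * (1 + G) * \<bar>\<eta> (t, x) - z\<bar>"
proof -
  let ?p = "(t, x, z)" and ?b = "(t, x, \<eta> (t, x))"
  let ?D = "frechet_derivative \<eta> (at (t, x))"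
  have lin: "linear ?D" by (rule has_derivative_linear[OF \<eta>_has_derivative[OF t]])
  have b: "?D (1, fst (V ?b)) = snd (V ?b)"
    using surface_condition[OF t, of x] V_closure[OF boundary_in_closure(2)[OF t depth_positive[OF t]] t] by simp
  have n: "norm (V ?p - V ?b) \<le> L * \<bar>\<eta> (t, x) - z\<bar>"
    using V_lipschitz[of ?p ?b] by (simp add: norm_Pair abs_minus_commute)
  have "?D (1, fst (V ?p)) - snd (V ?p) = ?D (0, fst (V ?p - V ?b)) - snd (V ?p - V ?b)"
    using b linear_diff[OF lin, of "(1, fst (V ?p))" "(1, fst (V ?b))"] by simp
  moreover have "\<bar>snd (V ?p - V ?b)\<bar> \<le> L * \<bar>\<eta> (t, x) - z\<bar>" using norm_snd_le_norm[of "V ?p - V ?b"] n by simp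
  moreover have "\<bar>?D (0, fst (V ?p - V ?b))\<bar> \<le> G * (L * \<bar>\<eta> (t, x) - z\<bar>)"
  proof (rule order_trans[OF D\<eta>_bound mult_left_mono[OF _ G_nonneg]])
    show "(t, x) \<in> {0<..<T} \<times> UNIV" using t by simp
    show "norm (0::real, fst (V ?p - V ?b)) \<le> L * \<bar>\<eta> (t, x) - z\<bar>"
      using order_trans[OF norm_fst_le_norm n] by (simp add: norm_Pair)
  qed
  ultimately have "\<bar>?D (1, fst (V ?p)) - snd (V ?p)\<bar> \<le> L * \<bar>\<eta> (t, x) - z\<bar> + G * (L * \<bar>\<eta> (t, x) - z\<bar>)" by linarith
  then show ?thesis by (simp add: algebra_simps)
qed

text \<open>\<open>\<eta>\<close> is arbitrary at \<open>t = 0\<close>, outside its domain.\<close>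

definition surface where
  "surface p = (if fst p = 0 then \<eta>0 (snd p) else \<eta> p)" for p :: "real \<times> (real^'n)"

lemma \<eta>_near_initial:
  assumes t: "0 < t" "t < T"
  shows "\<bar>\<eta> (t, x) - \<eta>0 x\<bar> \<le> G * t"
proof -
  obtain h where h: "\<And>n. 0 < h n \<and> h n < t" and h0: "h \<longlonglongrightarrow> 0" using null_sequence_below[OF t(1)] by blast
  have "(\<lambda>n. \<eta> (h n, x)) \<longlonglongrightarrow> \<eta>0 x"
    by (rule \<eta>_initial_seq[OF _ h0 tendsto_const]) (use h t in \<open>meson less_trans\<close>)
  then have "(\<lambda>n. \<bar>\<eta> (t, x) - \<eta> (h n, x)\<bar>) \<longlonglongrightarrow> \<bar>\<eta> (t, x) - \<eta>0 x\<bar>" by (intro tendsto_intros)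
  moreover have "\<bar>\<eta> (t, x) - \<eta> (h n, x)\<bar> \<le> G * t" for n
  proof -
    have "\<bar>\<eta> (t, x) - \<eta> (h n, x)\<bar> \<le> G * \<bar>t - h n\<bar>"
      using \<eta>_lipschitz[of t "h n" x x] h[of n] t by (simp add: norm_Pair)
    also have "\<dots> \<le> G * t" by (intro mult_left_mono G_nonneg) (use h[of n] in auto)
    finally show ?thesis .
  qed
  ultimately show ?thesis by (intro LIMSEQ_le_const2) auto
qed

text \<open>The factor 2 arises when exactly one of the times is 0: the comparison then passes
  through \<open>\<eta>0\<close>, once in time and once in space.\<close>

lemma surface_lipschitz:
  assumes t: "0 \<le> t" "t < T" "0 \<le> t'" "t' < T"
  shows "\<bar>surface (t, x) - surface (t', x')\<bar> \<le> 2 * G * norm ((t, x) - (t', x'))"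
proof -
  let ?N = "norm ((t, x) - (t', x'))"
  have N: "\<bar>t - t'\<bar> \<le> ?N" "norm (x - x') \<le> ?N"
    using norm_fst_le_norm[of "(t, x) - (t', x')"] norm_snd_le_norm[of "(t, x) - (t', x')"] by auto
  have G: "G * \<bar>t - t'\<bar> \<le> G * ?N" "G * norm (x - x') \<le> G * ?N" "0 \<le> G * ?N"
    using N G_nonneg by (auto intro: mult_left_mono)
  have m: "\<bar>\<eta>0 x - \<eta>0 x'\<bar> \<le> G * norm (x - x')" by (rule \<eta>0_lipschitz)
  consider "t = 0" "t' = 0" | "t = 0" "t' > 0" | "t > 0" "t' = 0" | "t > 0" "t' > 0" using t by linarith
  then show ?thesis
  proof cases
    case 1
    then show ?thesis using m G by (simp add: surface_def)
  next
    case 2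
    then show ?thesis using m G \<eta>_near_initial[of t' x'] t by (simp add: surface_def)
  next
    case 3
    then show ?thesis using m G \<eta>_near_initial[of t x] t by (simp add: surface_def)
  next
    case 4
    then show ?thesis using \<eta>_lipschitz[of t t' x x'] G t by (simp add: surface_def)
  qed
qed

lemma surface_continuous: "continuous_on ({0..<T} \<times> UNIV) surface"
proof -
  have "(2 * G)-lipschitz_on ({0..<T} \<times> UNIV) surface"
  proof (rule lipschitz_onI)
    fix p q assume "p \<in> {0..<T} \<times> (UNIV :: (real^'n) set)" "q \<in> {0..<T} \<times> (UNIV :: (real^'n) set)"
    then show "dist (surface p) (surface q) \<le> 2 * G * dist p q"
      using surface_lipschitz[of "fst p" "fst q" "snd p" "snd q"] by (simp add: dist_norm mem_Times_iff)
  qed (use G_nonneg in simp)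
  then show ?thesis by (rule lipschitz_on_continuous_on)
qed

text \<open>In stretched time the Gronwall rate is t L (1 + G); \<open>T\<close> replaces
  \<open>t\<close> to make it the same for all curves.\<close>

definition rate where "rate = T * (L * (1 + G))"

lemma rate_nonneg: "rate \<ge> 0"
  unfolding rate_def using T_pos L_pos G_nonneg by simp

text \<open>Height above the bottom and depth below the surface are positive at the foot, because
  \<open>\<phi>0\<close> lies strictly between, and each changes along a curve at a rate at most
  proportional to itself. Positivity keeps the curves in the fluid; the upper bounds keep curves
  that start near the boundary close to it.\<close>

lemma
  assumes q: "(t, x, l) \<in> flow.dom" and th: "\<theta> \<in> {0..1}"
  defines "c \<equiv> flow.curve (t, x, l)"
  shows curve_above_bottom: "zb (fst (c \<theta>)) < snd (c \<theta>)"
      "snd (c \<theta>) - zb (fst (c \<theta>)) \<le> (\<phi>0 (fst (c 0), l) - zb (fst (c 0))) * exp rate"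
    and curve_below_surface: "snd (c \<theta>) < surface (t * \<theta>, fst (c \<theta>))"
      "surface (t * \<theta>, fst (c \<theta>)) - snd (c \<theta>) \<le> (\<eta>0 (fst (c 0)) - \<phi>0 (fst (c 0), l)) * exp rate"
proof -
  have t: "0 < t" "t < S" "t < T" and l: "0 < l" "l < 1" using q S_le by (auto simp: flow.mem_dom)
  have tt: "0 < t * \<theta>" "t * \<theta> < T" if "0 < \<theta>" "\<theta> \<le> 1" for \<theta>
  proof -
    have "t * \<theta> \<le> t * 1" using that t by (intro mult_left_mono) auto
    then show "t * \<theta> < T" using t(3) by simp
    show "0 < t * \<theta>" using that t by simp
  qed
  have cc: "continuous_on {0..1} c"
    unfolding c_def by (rule flow.characteristic_cont[OF flow.curve_characteristic[OF q]])
  have cd: "(c has_vector_derivative t *\<^sub>R V (t * \<theta>, c \<theta>)) (at \<theta>)" if "0 < \<theta>" "\<theta> < 1" for \<theta>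
    using flow.curve_props(1)[OF q, of \<theta>] that by (simp add: c_def at_within_Icc_at)
  have Xd: "((\<lambda>\<theta>. fst (c \<theta>)) has_derivative (\<lambda>s. s *\<^sub>R t *\<^sub>R fst (V (t * \<theta>, c \<theta>)))) (at \<theta>)"
    and Zd: "((\<lambda>\<theta>. snd (c \<theta>)) has_real_derivative t * snd (V (t * \<theta>, c \<theta>))) (at \<theta>)" if "0 < \<theta>" "\<theta> < 1" for \<theta>
    using bounded_linear.has_vector_derivative[OF bounded_linear_fst cd[OF that]]
      bounded_linear.has_vector_derivative[OF bounded_linear_snd cd[OF that]]
    by (simp_all add: has_vector_derivative_def has_real_derivative_iff_has_vector_derivative)
  have c0: "snd (c 0) = \<phi>0 (fst (c 0), l)" unfolding c_def by (rule flow.curve_props(3)[OF q])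
  have rt: "t * (L * (1 + G) * y) \<le> rate * y" if "y \<ge> 0" for y
  proof -
    have "t * (L * (1 + G)) \<le> T * (L * (1 + G))" using t L_pos G_nonneg by (intro mult_right_mono) auto
    from mult_right_mono[OF this that] show ?thesis by (simp add: rate_def mult.assoc)
  qed
  define \<delta> where "\<delta> \<theta> = snd (c \<theta>) - zb (fst (c \<theta>))" for \<theta>
  define d where "d \<theta> = t * (snd (V (t * \<theta>, c \<theta>)) - frechet_derivative zb (at (fst (c \<theta>))) (fst (V (t * \<theta>, c \<theta>))))" for \<theta>
  have zbc: "continuous_on UNIV zb"
    by (rule continuous_at_imp_continuous_on) (use zb_has_derivative has_derivative_continuous in blast)
  have 1: "continuous_on {0..1} \<delta>"
    unfolding \<delta>_def by (intro continuous_intros cc continuous_on_compose2[OF zbc]) auto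
  have 2: "\<delta> 0 > 0" using \<phi>0_between(1)[OF l, of "fst (c 0)"] by (simp add: \<delta>_def c0)
  have 3: "(\<delta> has_real_derivative d \<theta>) (at \<theta>)" if "0 < \<theta>" "\<theta> < 1" for \<theta>
  proof -
    let ?D = "frechet_derivative zb (at (fst (c \<theta>)))"
    have "((\<lambda>\<theta>. zb (fst (c \<theta>))) has_derivative (\<lambda>s. ?D (s *\<^sub>R t *\<^sub>R fst (V (t * \<theta>, c \<theta>))))) (at \<theta>)"
      by (rule has_derivative_compose[OF Xd[OF that] zb_has_derivative])
    moreover have "(\<lambda>s. ?D (s *\<^sub>R t *\<^sub>R fst (V (t * \<theta>, c \<theta>)))) = (*) (t * ?D (fst (V (t * \<theta>, c \<theta>))))"
      by (rule ext) (simp add: linear_cmul[OF has_derivative_linear[OF zb_has_derivative]])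
    ultimately have "((\<lambda>\<theta>. zb (fst (c \<theta>))) has_real_derivative t * ?D (fst (V (t * \<theta>, c \<theta>)))) (at \<theta>)"
      by (simp only: has_field_derivative_def)
    from DERIV_diff[OF Zd[OF that] this] show ?thesis by (simp add: \<delta>_def[abs_def] d_def right_diff_distrib)
  qed
  have 4: "\<bar>d \<theta>\<bar> \<le> rate * \<bar>\<delta> \<theta>\<bar>" if "0 < \<theta>" "\<theta> < 1" for \<theta>
  proof -
    have "\<bar>d \<theta>\<bar> \<le> t * (L * (1 + G) * \<bar>\<delta> \<theta>\<bar>)"
      using bottom_rate[OF tt[OF that(1) less_imp_le[OF that(2)]], of "fst (c \<theta>)" "snd (c \<theta>)"] t(1)
      by (simp add: d_def \<delta>_def abs_mult)
    then show ?thesis using rt[of "\<bar>\<delta> \<theta>\<bar>"] by simp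
  qed
  from positive_of_linear_decay[OF 1 2 3 4 rate_nonneg th]
  show "zb (fst (c \<theta>)) < snd (c \<theta>)" "snd (c \<theta>) - zb (fst (c \<theta>)) \<le> (\<phi>0 (fst (c 0), l) - zb (fst (c 0))) * exp rate"
    by (simp_all add: \<delta>_def c0)
  define \<epsilon> where "\<epsilon> \<theta> = surface (t * \<theta>, fst (c \<theta>)) - snd (c \<theta>)" for \<theta>
  define e where "e \<theta> = t * (frechet_derivative \<eta> (at (t * \<theta>, fst (c \<theta>))) (1, fst (V (t * \<theta>, c \<theta>))) - snd (V (t * \<theta>, c \<theta>)))" for \<theta>
  have 5: "continuous_on {0..1} \<epsilon>"
    unfolding \<epsilon>_def
  proof (intro continuous_on_diff continuous_on_compose2[OF surface_continuous] continuous_intros cc)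
    show "(\<lambda>\<theta>. (t * \<theta>, fst (c \<theta>))) ` {0..1} \<subseteq> {0..<T} \<times> UNIV"
    proof
      fix p assume "p \<in> (\<lambda>\<theta>. (t * \<theta>, fst (c \<theta>))) ` {0..1}"
      then obtain \<theta> where "p = (t * \<theta>, fst (c \<theta>))" "\<theta> \<in> {0..1}" by blast
      then show "p \<in> {0..<T} \<times> UNIV" using tt[of \<theta>] T_pos by (cases "\<theta> = 0") auto
    qed
  qed
  have 6: "\<epsilon> 0 > 0" using \<phi>0_between(2)[OF l, of "fst (c 0)"] by (simp add: \<epsilon>_def c0 surface_def)
  have 7: "(\<epsilon> has_real_derivative e \<theta>) (at \<theta>)" if th: "0 < \<theta>" "\<theta> < 1" for \<theta>
  proof -
    let ?D = "frechet_derivative \<eta> (at (t * \<theta>, fst (c \<theta>)))" and ?v = "fst (V (t * \<theta>, c \<theta>))"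
    have ed: "(\<eta> has_derivative ?D) (at (t * \<theta>, fst (c \<theta>)))"
      by (rule \<eta>_has_derivative[OF tt]) (use th in auto)
    have "((\<lambda>\<theta>. (t * \<theta>, fst (c \<theta>))) has_derivative (\<lambda>s. (t * s, s *\<^sub>R t *\<^sub>R ?v))) (at \<theta>)"
      by (intro has_derivative_Pair has_derivative_mult_right has_derivative_ident Xd th)
    from has_derivative_compose[OF this ed]
    have "((\<lambda>\<theta>. \<eta> (t * \<theta>, fst (c \<theta>))) has_derivative (\<lambda>s. ?D (t * s, s *\<^sub>R t *\<^sub>R ?v))) (at \<theta>)" .
    moreover have "(\<lambda>s. ?D (t * s, s *\<^sub>R t *\<^sub>R ?v)) = (*) (t * ?D (1, ?v))"
    proof
      fix s :: real
      have eq: "(t * s, s *\<^sub>R t *\<^sub>R ?v) = (s * t) *\<^sub>R (1, ?v)" by simp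
      show "?D (t * s, s *\<^sub>R t *\<^sub>R ?v) = t * ?D (1, ?v) * s"
        unfolding eq linear_cmul[OF has_derivative_linear[OF ed]] by simp
    qed
    ultimately have "((\<lambda>\<theta>. \<eta> (t * \<theta>, fst (c \<theta>))) has_real_derivative t * ?D (1, ?v)) (at \<theta>)"
      by (simp only: has_field_derivative_def)
    from DERIV_diff[OF this Zd[OF th]]
    have "((\<lambda>\<theta>. \<eta> (t * \<theta>, fst (c \<theta>)) - snd (c \<theta>)) has_real_derivative e \<theta>) (at \<theta>)" by (simp add: e_def right_diff_distrib)
    \<comment> \<open>On the open interval the times are positive, where \<open>surface\<close> is
      \<open>\<eta>\<close>.\<close>
    then show ?thesis
    proof (rule has_field_derivative_transform_within_open[of _ _ _ "{0<..<1}"])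
      show "\<eta> (t * y, fst (c y)) - snd (c y) = \<epsilon> y" if "y \<in> {0<..<1}" for y
        using that t by (simp add: \<epsilon>_def surface_def)
    qed (use th in auto)
  qed
  have 8: "\<bar>e \<theta>\<bar> \<le> rate * \<bar>\<epsilon> \<theta>\<bar>" if "0 < \<theta>" "\<theta> < 1" for \<theta>
  proof -
    have "\<bar>e \<theta>\<bar> \<le> t * (L * (1 + G) * \<bar>\<epsilon> \<theta>\<bar>)"
      using surface_rate[OF tt[OF that(1) less_imp_le[OF that(2)]], of "fst (c \<theta>)" "snd (c \<theta>)"] t(1) that
      by (simp add: e_def \<epsilon>_def surface_def abs_mult)
    then show ?thesis using rt[of "\<bar>\<epsilon> \<theta>\<bar>"] by simp
  qed
  from positive_of_linear_decay[OF 5 6 7 8 rate_nonneg th]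
  show "snd (c \<theta>) < surface (t * \<theta>, fst (c \<theta>))"
    "surface (t * \<theta>, fst (c \<theta>)) - snd (c \<theta>) \<le> (\<eta>0 (fst (c 0)) - \<phi>0 (fst (c 0), l)) * exp rate"
    by (simp_all add: \<epsilon>_def c0 surface_def)
qed

lemma curve_in_Q:
  assumes q: "(t, x, l) \<in> flow.dom" and th: "0 < \<theta>" "\<theta> \<le> 1"
  shows "(t * \<theta>, flow.curve (t, x, l) \<theta>) \<in> Q"
proof -
  have t: "0 < t" "t < S" using q by (auto simp: flow.mem_dom)
  have "t * \<theta> \<le> t * 1" using th t by (intro mult_left_mono) auto
  moreover have "t < T" using t S_le by linarith
  ultimately have "t * \<theta> < T" by linarith
  moreover have "0 < t * \<theta>" using t th by simp
  ultimately show ?thesis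
    using curve_above_bottom(1)[OF q, of \<theta>] curve_below_surface(1)[OF q, of \<theta>] th t(1) mem_Q[of "t * \<theta>" "fst (flow.curve (t, x, l) \<theta>)" "snd (flow.curve (t, x, l) \<theta>)"]
    by (simp add: surface_def)
qed

lemma sol_in_Q: "(t, x, l) \<in> flow.dom \<Longrightarrow> (t, x, flow.sol (t, x, l)) \<in> Q"
  using curve_in_Q[of t x l 1] flow.curve_at_1 by simp

text \<open>A substitute for boundary values of the solution, which lives on the open strip; it
  makes the layers fill the whole fluid domain.\<close>

lemma sol_near_boundary:
  assumes q: "(t, x, l) \<in> flow.dom"
  shows "flow.sol (t, x, l) - zb x \<le> G * l * exp rate" "\<eta> (t, x) - flow.sol (t, x, l) \<le> G * (1 - l) * exp rate"
proof -
  let ?X = "fst (flow.curve (t, x, l) 0)"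
  have l: "0 < l" "l < 1" "t > 0" using q by (auto simp: flow.mem_dom)
  have "flow.sol (t, x, l) - zb x \<le> (\<phi>0 (?X, l) - zb ?X) * exp rate"
    using curve_above_bottom(2)[OF q, of 1] by (simp add: flow.curve_at_1[OF q])
  also have "\<dots> \<le> G * l * exp rate" by (intro mult_right_mono \<phi>0_between(3)[OF l(1,2)]) simp
  finally show "flow.sol (t, x, l) - zb x \<le> G * l * exp rate" .
  have "\<eta> (t, x) - flow.sol (t, x, l) \<le> (\<eta>0 ?X - \<phi>0 (?X, l)) * exp rate"
    using curve_below_surface(2)[OF q, of 1] l(3) by (simp add: flow.curve_at_1[OF q] surface_def)
  also have "\<dots> \<le> G * (1 - l) * exp rate" by (intro mult_right_mono \<phi>0_between(4)[OF l(1,2)]) simp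
  finally show "\<eta> (t, x) - flow.sol (t, x, l) \<le> G * (1 - l) * exp rate" .
qed

lemma open_Q: "open Q"
proof -
  define O1 where "O1 = {0<..<T} \<times> (UNIV :: ((real^'n) \<times> real) set)"
  have O1: "open O1" unfolding O1_def by (intro open_Times) auto
  have zbc: "continuous_on UNIV zb"
    by (rule continuous_at_imp_continuous_on) (use zb_has_derivative has_derivative_continuous in blast)
  have \<eta>c: "continuous_on ({0<..<T} \<times> UNIV) \<eta>" using \<eta>_smooth by simp
  have c1: "continuous_on O1 (\<lambda>p. snd (snd p) - zb (fst (snd p)))"
    by (intro continuous_intros continuous_on_compose2[OF zbc]) auto
  have c2: "continuous_on O1 (\<lambda>p. \<eta> (fst p, fst (snd p)) - snd (snd p))"
    by (intro continuous_intros continuous_on_compose2[OF \<eta>c]) (auto simp: O1_def)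
  have "Q = (O1 \<inter> (\<lambda>p. snd (snd p) - zb (fst (snd p))) -` {0<..}) \<inter> (O1 \<inter> (\<lambda>p. \<eta> (fst p, fst (snd p)) - snd (snd p)) -` {0<..})"
    by (auto simp: O1_def fluid_domain_def fluid_slice_def)
  then show ?thesis
    using continuous_open_preimage[OF c1 O1, of "{0<..}"] continuous_open_preimage[OF c2 O1, of "{0<..}"] by auto
qed

sublocale smooth: smooth_characteristics V \<phi>0 L A G S Q s
proof unfold_locales
  show "open Q" by (rule open_Q)
  show "(fst q * \<theta>, flow.curve q \<theta>) \<in> Q" if "q \<in> flow.dom" "0 < \<theta>" "\<theta> \<le> 1" for q \<theta>
    using curve_in_Q that by (cases q) auto
  show "Csb_on (Suc s) \<phi>0 strip" by (rule \<phi>0_smooth)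
  fix i :: "'n option"
  show "Csb_on (Suc s) (\<lambda>p. coord i (V p)) Q"
  proof (cases i)
    case None
    have "w p = coord i (V p)" if "p \<in> Q" for p using V_Q[OF that] by (simp add: None coord_def)
    then show ?thesis by (rule Csb_on_cong[OF open_Q _ w_smooth])
  next
    case (Some k)
    have "u p $ k = coord i (V p)" if "p \<in> Q" for p using V_Q[OF that] by (simp add: Some coord_def)
    then show ?thesis by (rule Csb_on_cong[OF open_Q _ Csb_on_bounded_linear[OF open_Q bounded_linear_vec_nth u_smooth]])
  qed
qed

lemma dom_eq: "flow.dom = {0<..<S} \<times> strip" by (rule flow.dom_def)

lemma sol_has_derivative:
  "q \<in> flow.dom \<Longrightarrow> (flow.sol has_derivative frechet_derivative flow.sol (at q)) (at q)"
  using smooth.sol_Cs_on by (simp add: frechet_derivative_works[symmetric])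

text \<open>The solution stays in \<open>Q\<close>, where the continuous extension is the velocity
  itself, so the identity along characteristics is the equation.\<close>

lemma sol_layer_solution: "layer_solution (Suc s) Q u w \<phi>0 S flow.sol"
proof -
  have 1: "(t, x, flow.sol (t, x, l)) \<in> closure Q" if "(t, x, l) \<in> flow.dom" for t x l
    using sol_in_Q[OF that] closure_subset by blast
  have 2: "deriv (\<lambda>\<tau>. flow.sol (\<tau>, x, l)) t + cont_ext Q u (t, x, flow.sol (t, x, l)) \<bullet> grad (\<lambda>y. flow.sol (t, y, l)) x
      = cont_ext Q w (t, x, flow.sol (t, x, l))" if q: "(t, x, l) \<in> flow.dom" for t x l
  proof -
    have "cont_ext Q u (t, x, flow.sol (t, x, l)) = fst (V (t, x, flow.sol (t, x, l)))"
      "cont_ext Q w (t, x, flow.sol (t, x, l)) = snd (V (t, x, flow.sol (t, x, l)))"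
      using sol_in_Q[OF q] V_Q[OF sol_in_Q[OF q]] by (auto simp: cont_ext_def)
    then show ?thesis
      unfolding has_derivative_material[OF sol_has_derivative[OF q]]
      using flow.sol_transport[OF q sol_has_derivative[OF q]] by simp
  qed
  have 3: "(flow.sol \<longlongrightarrow> \<phi>0 (x, l)) (at (0, x, l) within flow.dom)" if "(x, l) \<in> strip" for x l
  proof (rule flow.sol_tendsto_initial)
    show "isCont \<phi>0 (x, l)" using \<phi>0_has_derivative[OF that] has_derivative_continuous by blast
  qed (use that in \<open>auto simp: mem_strip\<close>)
  show ?thesis
    unfolding layer_solution_def dom_eq[symmetric]
    using smooth.sol_Cs_on 1 2 3 by (auto simp del: Cs_on.simps)
qed

end

section \<open>Calculus of \<open>Cs_on\<close> functions\<close>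

lemma Cs_on_binary:
  fixes f :: "'a::euclidean_space \<Rightarrow> 'b::real_normed_vector" and g :: "'a \<Rightarrow> 'c::real_normed_vector"
  assumes "open U" "Cs_on k f U" "Cs_on k g U"
    and op: "\<And>W. open W \<Longrightarrow> Cs_unif k {()} (\<lambda>_. f) W \<Longrightarrow> Cs_unif k {()} (\<lambda>_. g) W \<Longrightarrow> Cs_unif k {()} (\<lambda>_. h) W"
  shows "Cs_on k h U"
proof (rule Cs_on_local)
  fix p assume p: "p \<in> U"
  obtain W1 where W1: "open W1" "p \<in> W1" "W1 \<subseteq> U" "Csb_on k f W1"
    using Cs_on_imp_local_Csb_on[OF assms(1) p assms(2)] by blast
  obtain W2 where W2: "open W2" "p \<in> W2" "W2 \<subseteq> U" "Csb_on k g W2"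
    using Cs_on_imp_local_Csb_on[OF assms(1) p assms(3)] by blast
  have "Csb_on k f (W1 \<inter> W2)" by (rule Csb_on_subset[OF W1(4)]) simp
  moreover have "Csb_on k g (W1 \<inter> W2)" by (rule Csb_on_subset[OF W2(4)]) simp
  ultimately have "Cs_unif k {()} (\<lambda>_. h) (W1 \<inter> W2)"
    by (intro op open_Int W1 W2 Csb_on_imp_Cs_unif)
  then have "Cs_on k h (W1 \<inter> W2)" using Cs_unif_imp_Cs_on[of k "{()}" "\<lambda>_. h"] by simp
  then show "\<exists>W. open W \<and> p \<in> W \<and> Cs_on k h W" using W1 W2 by (intro exI[of _ "W1 \<inter> W2"]) auto
qed

lemma Cs_on_add: "open U \<Longrightarrow> Cs_on k f U \<Longrightarrow> Cs_on k g U \<Longrightarrow> Cs_on k (\<lambda>p. f p + g p) U"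
  by (rule Cs_on_binary[of U k f g]) (auto intro: Cs_unif_add)

lemma Cs_on_scaleR:
  fixes f :: "'a::euclidean_space \<Rightarrow> real"
  shows "open U \<Longrightarrow> Cs_on k f U \<Longrightarrow> Cs_on k g U \<Longrightarrow> Cs_on k (\<lambda>p. f p *\<^sub>R g p) U"
  by (rule Cs_on_binary[of U k f g]) (auto intro: Cs_unif_scaleR)

lemma Cs_on_mult:
  fixes f g :: "'a::euclidean_space \<Rightarrow> real"
  assumes "open U" "Cs_on k f U" "Cs_on k g U"
  shows "Cs_on k (\<lambda>p. f p * g p) U"
  using Cs_on_scaleR[OF assms] by simp

lemma Cs_on_const: "Cs_on k (\<lambda>p. a :: 'b::real_normed_vector) (U :: 'a::euclidean_space set)"
  using Cs_unif_imp_Cs_on[of k "{()}" "\<lambda>_ _. a" U] Cs_unif_const[of "{()}" "\<lambda>_. a" "norm a" k U] by simp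

lemma Cs_on_linear: "open U \<Longrightarrow> bounded_linear A \<Longrightarrow> Cs_on k A (U :: 'a::euclidean_space set)"
  using Cs_unif_imp_Cs_on[of k "{()}" "\<lambda>_. A" U] Cs_unif_linear[of U A k "{()}"] by simp

lemma Cs_on_cong:
  assumes "open U"
  shows "(\<And>q. q \<in> U \<Longrightarrow> f q = g q) \<Longrightarrow> Cs_on k f U \<Longrightarrow> Cs_on k g U"
proof (induction k arbitrary: f g)
  case 0
  then show ?case using continuous_on_cong[of U U f g] by auto
next
  case (Suc k)
  have "continuous_on U g" using Suc.prems continuous_on_cong[of U U f g] by auto
  moreover have "g differentiable (at q)" if "q \<in> U" for q
  proof -
    have "f differentiable (at q)" using Suc.prems that by simp
    then obtain D where "(f has_derivative D) (at q)" by (auto simp: differentiable_def)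
    then have "(g has_derivative D) (at q)"
      by (rule has_derivative_transform_within_open[OF _ assms that]) (rule Suc.prems(1))
    then show ?thesis by (auto simp: differentiable_def)
  qed
  moreover have "Cs_on k (\<lambda>q. frechet_derivative g (at q) e) U" if "e \<in> Basis" for e
  proof (rule Suc.IH)
    show "frechet_derivative f (at q) e = frechet_derivative g (at q) e" if "q \<in> U" for q
      using frechet_derivative_cong_open[OF assms that Suc.prems(1)] by simp
    show "Cs_on k (\<lambda>q. frechet_derivative f (at q) e) U" using Suc.prems that by simp
  qed
  ultimately show ?case by simp
qed

lemma Cs_on_SucI:
  assumes U: "open U" and d: "\<And>q. q \<in> U \<Longrightarrow> (f has_derivative f' q) (at q)"
    and k: "\<And>e. e \<in> Basis \<Longrightarrow> Cs_on k (\<lambda>q. f' q e) U"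
  shows "Cs_on (Suc k) f U"
proof -
  have "continuous_on U f"
    by (rule continuous_at_imp_continuous_on) (use d has_derivative_continuous in blast)
  moreover have "Cs_on k (\<lambda>q. frechet_derivative f (at q) e) U" if "e \<in> Basis" for e
  proof (rule Cs_on_cong[OF U _ k[OF that]])
    show "f' q e = frechet_derivative f (at q) e" if "q \<in> U" for q
      unfolding frechet_derivative_at[OF d[OF that], symmetric] ..
  qed
  moreover have "\<forall>q\<in>U. f differentiable (at q)" using d by (blast intro: differentiableI)
  ultimately show ?thesis by simp
qed

lemma Cs_on_inverse_pos: "Cs_on k (inverse :: real \<Rightarrow> real) {0<..}"
proof (induction k)
  case 0
  show ?case by (auto intro!: continuous_intros)
next
  case (Suc k)
  show ?case
  proof (rule Cs_on_SucI)
    show "(inverse has_derivative (\<lambda>e. - (inverse q * e * inverse q))) (at q)" if "q \<in> {0<..}" for q :: real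
      by (rule has_derivative_inverse') (use that in simp)
    show "Cs_on k (\<lambda>q. - (inverse q * e * inverse q)) {0<..}" for e :: real
    proof -
      have "Cs_on k (\<lambda>q. (- e) * (inverse q * inverse q)) {0<..}"
        by (intro Cs_on_mult Cs_on_const Suc.IH) auto
      then show ?thesis by (simp add: mult_ac)
    qed
  qed simp
qed

lemma Cs_on_le: "Cs_on k f U \<Longrightarrow> j \<le> k \<Longrightarrow> Cs_on j f U"
proof (induction k)
  case (Suc k)
  then show ?case using Cs_on_Suc_le by (metis le_Suc_eq)
qed simp

section \<open>Uniqueness and the diffeomorphism\<close>

text \<open>
  Graph maps \<open>(x, l) \<mapsto> (x, \<sigma> (x, l))\<close> are inverted one derivative at a time: the derivative of the
  inverse is a \<open>C\<^sup>k\<close> function composed with the inverse itself.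
\<close>

context
  fixes \<sigma> :: "(real^'n) \<times> real \<Rightarrow> real" and U V :: "((real^'n) \<times> real) set" and k :: nat
  assumes U: "open U" and V: "open V" and \<sigma>: "Cs_on (Suc k) \<sigma> U"
    and vert: "\<And>p. p \<in> U \<Longrightarrow> frechet_derivative \<sigma> (at p) (0, 1) > 0"
    and bij: "bij_betw (\<lambda>p. (fst p, \<sigma> p)) U V"
begin

lemma graph_map_has_derivative:
  assumes "p \<in> U"
  shows "((\<lambda>p. (fst p, \<sigma> p)) has_derivative (\<lambda>v. (fst v, frechet_derivative \<sigma> (at p) v))) (at p)"
proof -
  have "(\<sigma> has_derivative frechet_derivative \<sigma> (at p)) (at p)"
    using \<sigma> assms by (simp add: frechet_derivative_works[symmetric])
  then show ?thesis by (intro has_derivative_Pair has_derivative_fst has_derivative_ident)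
qed

lemma graph_map_Cs_on: "Cs_on (Suc k) (\<lambda>p. (fst p, \<sigma> p)) U"
proof -
  have "Cs_on (Suc k) (\<lambda>p. (fst p, 0) + \<sigma> p *\<^sub>R (0 :: real^'n, 1 :: real)) U"
    by (intro Cs_on_add U Cs_on_scaleR \<sigma> Cs_on_const Cs_on_linear bounded_linear_Pair bounded_linear_fst bounded_linear_zero)
  then show ?thesis by simp
qed

lemma graph_map_inverse_Cs_on: "Cs_on (Suc k) (inv_into U (\<lambda>p. (fst p, \<sigma> p))) V"
proof -
  let ?F = "\<lambda>p. (fst p, \<sigma> p)"
  define Gi where "Gi = inv_into U ?F"
  let ?D = "\<lambda>p. frechet_derivative \<sigma> (at p)"
  \<comment> \<open>The inverse of the derivative of the graph map: the vertical component solves D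
    (fst v, r) = snd v for r.\<close>
  define g' where "g' p v = (fst v, (snd v - ?D p (fst v, 0)) * inverse (?D p (0, 1)))" for p v
  have GiU: "Gi y \<in> U" "?F (Gi y) = y" if "y \<in> V" for y
  proof -
    have y: "y \<in> ?F ` U" using that bij by (simp add: bij_betw_def)
    show "Gi y \<in> U" unfolding Gi_def by (rule inv_into_into[OF y])
    show "?F (Gi y) = y" unfolding Gi_def by (rule f_inv_into_f[OF y])
  qed
  have GiF: "Gi (?F p) = p" if "p \<in> U" for p
    unfolding Gi_def by (rule inv_into_f_f[OF bij_betw_imp_inj_on[OF bij] that])
  have der: "(Gi has_derivative g' (Gi y)) (at y)" if y: "y \<in> V" for y
  proof (rule has_derivative_inverse_strong_x[where f = ?F and S = U and f' = "\<lambda>v. (fst v, ?D (Gi y) v)"])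
    show "continuous_on U ?F" using graph_map_Cs_on by simp
    show "(?F has_derivative (\<lambda>v. (fst v, ?D (Gi y) v))) (at (Gi y))"
      by (rule graph_map_has_derivative[OF GiU(1)[OF y]])
    have "(\<sigma> has_derivative ?D (Gi y)) (at (Gi y))"
      using \<sigma> GiU(1)[OF y] by (simp add: frechet_derivative_works[symmetric])
    then have lin: "linear (?D (Gi y))" by (rule has_derivative_linear)
    show "(\<lambda>v. (fst v, ?D (Gi y) v)) \<circ> g' (Gi y) = id"
    proof
      fix v
      let ?r = "(snd v - ?D (Gi y) (fst v, 0)) * inverse (?D (Gi y) (0, 1))"
      have "?D (Gi y) (fst v, ?r) = ?D (Gi y) ((fst v, 0) + ?r *\<^sub>R (0, 1))" by simp
      also have "\<dots> = ?D (Gi y) (fst v, 0) + ?r * ?D (Gi y) (0, 1)"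
        by (simp only: linear_add[OF lin] linear_cmul[OF lin] real_scaleR_def)
      also have "?r * ?D (Gi y) (0, 1) = snd v - ?D (Gi y) (fst v, 0)"
        using vert[OF GiU(1)[OF y]] by (simp only: mult.assoc) simp
      also have "?D (Gi y) (fst v, 0) + (snd v - ?D (Gi y) (fst v, 0)) = snd v" by simp
      finally show "((\<lambda>v. (fst v, ?D (Gi y) v)) \<circ> g' (Gi y)) v = id v" by (simp add: g'_def)
    qed
  qed (use U GiU y GiF in auto)
  have h: "Cs_on k (\<lambda>p. g' p e) U" if e: "e \<in> Basis" for e
  proof -
    have inv: "Cs_on k (\<lambda>p. inverse (?D p (0, 1))) U"
    proof (rule Cs_on_compose[OF U _ _ Cs_on_inverse_pos])
      have "(0, 1) \<in> (Basis :: ((real^'n) \<times> real) set)" by (simp add: Basis_prod_def)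
      then show "Cs_on k (\<lambda>p. ?D p (0, 1)) U" using \<sigma> by simp
    qed (use vert in auto)
    have "Cs_on k (\<lambda>p. ?D p (fst e, 0)) U"
    \<comment> \<open>For the vertical basis vector the term vanishes; for a horizontal one
      \<open>(fst e, 0)\<close> is \<open>e\<close> itself and the term is a partial
      derivative.\<close>
    proof (cases "fst e = 0")
      case True
      have "0 = ?D p (fst e, 0)" if "p \<in> U" for p
      proof -
        have "(\<sigma> has_derivative ?D p) (at p)" using \<sigma> that by (simp add: frechet_derivative_works[symmetric])
        from linear_0[OF has_derivative_linear[OF this]] show ?thesis by (simp add: True zero_prod_def)
      qed
      then show ?thesis by (rule Cs_on_cong[OF U _ Cs_on_const])
    next
      case False
      then have "(fst e, 0) \<in> (Basis :: ((real^'n) \<times> real) set)" using e by (auto simp: Basis_prod_def)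
      then show ?thesis using \<sigma> by simp
    qed
    then have "Cs_on k (\<lambda>p. (fst e, 0) + ((snd e + (- 1) * ?D p (fst e, 0)) * inverse (?D p (0, 1))) *\<^sub>R (0 :: real^'n, 1 :: real)) U"
      by (intro Cs_on_add U Cs_on_scaleR Cs_on_mult Cs_on_const inv)
    then show ?thesis by (simp add: g'_def)
  qed
  have "j \<le> Suc k \<Longrightarrow> Cs_on j Gi V" for j
  proof (induction j)
    case 0
    then show ?case using der by (auto intro!: continuous_at_imp_continuous_on dest: has_derivative_continuous)
  next
    case (Suc j)
    show ?case
    proof (rule Cs_on_SucI[OF V der])
      fix e :: "(real^'n) \<times> real" assume e: "e \<in> Basis"
      show "Cs_on j (\<lambda>y. g' (Gi y) e) V"
        by (rule Cs_on_compose[OF V U _ Cs_on_le[OF h[OF e]] Suc.IH]) (use GiU Suc.prems in auto)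
    qed
  qed
  then show ?thesis by (simp only: Gi_def order_refl)
qed

text \<open>The horizontal rows are those of the identity, so in the Leibniz sum only the identity
  permutation survives and leaves the vertical derivative.\<close>

lemma graph_map_det:
  assumes "p \<in> U"
  shows "det_lin (frechet_derivative (\<lambda>p. (fst p, \<sigma> p)) (at p)) > 0"
proof -
  let ?F' = "\<lambda>v. (fst v, frechet_derivative \<sigma> (at p) v)"
  have F': "frechet_derivative (\<lambda>p. (fst p, \<sigma> p)) (at p) = ?F'"
    using frechet_derivative_at[OF graph_map_has_derivative[OF assms]] by simp
  define E where "E i j = coord i (?F' (unit_vec j))" for i j :: "'n option"
  have row: "E (Some k) j = (if j = Some k then 1 else 0)" for k j
    by (cases j) (auto simp: E_def coord_def unit_vec_def axis_def)
  \<comment> \<open>A permutation that fixes every \<open>Some k\<close> has only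
    \<open>None\<close> left as the image of \<open>None\<close>.\<close>
  have id: "\<pi> = id" if perm: "\<pi> permutes UNIV" and fx: "\<And>k. \<pi> (Some k) = Some k" for \<pi> :: "'n option \<Rightarrow> 'n option"
  proof
    fix i
    show "\<pi> i = id i"
    proof (cases i)
      case None
      obtain j where j: "\<pi> j = None" using permutes_surj[OF perm] by (metis surjD)
      then show ?thesis using fx None by (cases j) auto
    qed (use fx in simp)
  qed
  have "det_lin ?F' = (\<Sum>\<pi> | \<pi> permutes UNIV. of_int (sign \<pi>) * (\<Prod>i\<in>UNIV. E i (\<pi> i)))"
    by (simp add: det_lin_def det_def E_def)
  also have "\<dots> = (\<Sum>\<pi>\<in>{id}. of_int (sign \<pi>) * (\<Prod>i\<in>UNIV. E i (\<pi> i)))"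
  proof (rule sum.mono_neutral_right)
    show "finite {\<pi> :: 'n option \<Rightarrow> 'n option. \<pi> permutes UNIV}" by (simp add: finite_permutations)
    show "{id} \<subseteq> {\<pi> :: 'n option \<Rightarrow> 'n option. \<pi> permutes UNIV}" by (simp add: permutes_id)
    show "\<forall>\<pi>\<in>{\<pi>. \<pi> permutes UNIV} - {id}. of_int (sign \<pi>) * (\<Prod>i\<in>UNIV. E i (\<pi> i)) = 0"
    proof
      fix \<pi> :: "'n option \<Rightarrow> 'n option" assume \<pi>: "\<pi> \<in> {\<pi>. \<pi> permutes UNIV} - {id}"
      then obtain k where "\<pi> (Some k) \<noteq> Some k" using id by auto
      then have "E (Some k) (\<pi> (Some k)) = 0" by (simp add: row)
      then have "(\<Prod>i\<in>UNIV. E i (\<pi> i)) = 0" by (intro prod_zero) auto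
      then show "of_int (sign \<pi>) * (\<Prod>i\<in>UNIV. E i (\<pi> i)) = 0" by simp
    qed
  qed
  also have "\<dots> = E None None * (\<Prod>k\<in>UNIV. E (Some k) (Some k))"
    by (simp add: UNIV_option_conv prod.reindex)
  also have "\<dots> = frechet_derivative \<sigma> (at p) (0, 1)"
    by (simp add: row) (simp add: E_def coord_def unit_vec_def)
  finally show ?thesis using vert[OF assms] F' by simp
qed

end

lemma filterlim_at_slice:
  assumes "0 < l" "l < 1"
  shows "filterlim (\<lambda>p. (fst p, snd p, l)) (at (0, x :: real^'n, l) within {0<..<S} \<times> strip) (at (0, x) within {0<..<S} \<times> UNIV)"
  unfolding filterlim_at
proof
  show "\<forall>\<^sub>F p in at (0, x) within {0<..<S} \<times> UNIV. (fst p, snd p, l) \<in> {0<..<S} \<times> strip \<and> (fst p, snd p, l) \<noteq> (0, x, l)"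
    unfolding eventually_at_topological using assms by (intro exI[of _ UNIV]) (auto simp: strip_def)
  show "((\<lambda>p. (fst p, snd p, l)) \<longlongrightarrow> (0, x, l)) (at (0, x) within {0<..<S} \<times> UNIV)"
    by (auto intro!: tendsto_eq_intros)
qed

lemma slice_has_derivative:
  fixes \<psi> :: "real \<times> (real^'n) \<times> real \<Rightarrow> real"
  assumes "(\<psi> has_derivative D) (at (t, x, l))"
  shows "((\<lambda>p. \<psi> (fst p, snd p, l)) has_derivative (\<lambda>v. D (fst v, snd v, 0))) (at (t, x))"
  by (rule has_derivative_compose[where f = "\<lambda>p. (fst p, snd p, l)"])
     (use assms in \<open>auto intro!: derivative_eq_intros\<close>)

section \<open>Comparison of solutions: uniqueness, monotonicity in the label, bijectivity\<close>

context layer_flow begin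

text \<open>\<open>L\<close> from the vertical velocity, and from the horizontal one
  \<open>L\<close> times the bound on the horizontal slope of \<open>flow.sol\<close>.\<close>

definition Lip where "Lip = L + 3 * flow.stab * L"

text \<open>Both equations are read along the velocity at height \<open>z\<close>. For
  \<open>flow.sol\<close> this differs from its own velocity, and the correction is a horizontal
  derivative of \<open>flow.sol\<close>, which is bounded. \<open>D\<close> may belong to a
  competing solution or to \<open>flow.sol\<close> at another label; both uses occur below.\<close>

lemma difference_rate:
  assumes q: "(t, x, l) \<in> flow.dom" and D: "D (1, fst (V (t, x, z)), 0) = snd (V (t, x, z))"
  shows "\<bar>D (1, fst (V (t, x, z)), 0) - frechet_derivative flow.sol (at (t, x, l)) (1, fst (V (t, x, z)), 0)\<bar>
    \<le> Lip * \<bar>z - flow.sol (t, x, l)\<bar>"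
proof -
  let ?D = "frechet_derivative flow.sol (at (t, x, l))" and ?v = "V (t, x, z)" and ?v' = "V (t, x, flow.sol (t, x, l))"
  note d = sol_has_derivative[OF q]
  have lin: "linear ?D" by (rule has_derivative_linear[OF d])
  have n: "norm (?v - ?v') \<le> L * \<bar>z - flow.sol (t, x, l)\<bar>"
    using V_lipschitz[of "(t, x, z)" "(t, x, flow.sol (t, x, l))"] by (simp add: norm_Pair)
  have "?D (1, fst ?v, 0) = ?D (1, fst ?v', 0) + ?D (0, fst (?v - ?v'), 0)"
    using linear_add[OF lin, of "(1, fst ?v', 0)" "(0, fst (?v - ?v'), 0)"] by simp
  then have "D (1, fst ?v, 0) - ?D (1, fst ?v, 0) = snd (?v - ?v') - ?D (0, fst (?v - ?v'), 0)"
    using D flow.sol_transport[OF q d] by simp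
  moreover have "\<bar>snd (?v - ?v')\<bar> \<le> L * \<bar>z - flow.sol (t, x, l)\<bar>" using norm_snd_le_norm[of "?v - ?v'"] n by simp
  moreover have "\<bar>?D (0, fst (?v - ?v'), 0)\<bar> \<le> 3 * flow.stab * (L * \<bar>z - flow.sol (t, x, l)\<bar>)"
    by (rule order_trans[OF flow.sol_derivative_horizontal[OF q d] mult_left_mono[OF order_trans[OF norm_fst_le_norm n]]])
       (use flow.stab_nonneg in simp)
  ultimately have "\<bar>D (1, fst ?v, 0) - ?D (1, fst ?v, 0)\<bar>
      \<le> L * \<bar>z - flow.sol (t, x, l)\<bar> + 3 * flow.stab * (L * \<bar>z - flow.sol (t, x, l)\<bar>)" by linarith
  then show ?thesis by (simp add: Lip_def algebra_simps)
qed

lemma V_fst_bound: "norm (fst (V p)) \<le> A"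
  using order_trans[OF norm_fst_le_norm V_norm] .

text \<open>At a fixed label the squared difference, with a decaying exponential factor, cannot grow
  along the velocity of \<psi>. So \<epsilon> minus it starts at \<epsilon> and stays positive by
  the minimum principle, for every \<epsilon>. The square handles both signs and is
  differentiable.\<close>

lemma solution_unique:
  assumes \<psi>: "layer_solution (Suc s) Q u w \<phi>0 S \<psi>" and q1: "(t1, x1, l) \<in> flow.dom"
  shows "\<psi> (t1, x1, l) = flow.sol (t1, x1, l)"
proof -
  have l: "0 < l" "l < 1" and t1: "0 < t1" "t1 < S" using q1 by (auto simp: flow.mem_dom)
  have dom: "(t, x, l) \<in> flow.dom" if "0 < t" "t < S" for t x using that l by (simp add: flow.mem_dom)
  have \<psi>d: "(\<psi> has_derivative frechet_derivative \<psi> (at q)) (at q)" if "q \<in> flow.dom" for q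
  proof -
    have "\<psi> differentiable (at q)" using \<psi> that by (auto simp: layer_solution_def dom_eq)
    then show ?thesis by (simp add: frechet_derivative_works[symmetric])
  qed
  \<comment> \<open>A competitor may touch the boundary of \<open>Q\<close>; there the traces are
    values of \<open>V\<close>.\<close>
  have transport: "frechet_derivative \<psi> (at (t, x, l)) (1, fst (V (t, x, \<psi> (t, x, l))), 0) = snd (V (t, x, \<psi> (t, x, l)))"
    if t: "0 < t" "t < S" for t x
  proof -
    have cl: "(t, x, \<psi> (t, x, l)) \<in> closure Q"
      and eq: "deriv (\<lambda>\<tau>. \<psi> (\<tau>, x, l)) t + cont_ext Q u (t, x, \<psi> (t, x, l)) \<bullet> grad (\<lambda>y. \<psi> (t, y, l)) x = cont_ext Q w (t, x, \<psi> (t, x, l))"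
      using \<psi> dom[OF t, of x] unfolding layer_solution_def dom_eq[symmetric] by auto
    have "t < T" using t S_le by linarith
    from V_closure[OF cl t(1) this] show ?thesis
      using eq unfolding has_derivative_material[OF \<psi>d[OF dom[OF t]]] by simp
  qed
  define \<delta> where "\<delta> p = \<psi> (fst p, snd p, l) - flow.sol (fst p, snd p, l)" for p
  have \<delta>d: "(\<delta> has_derivative (\<lambda>v. frechet_derivative \<psi> (at (t, x, l)) (fst v, snd v, 0) - frechet_derivative flow.sol (at (t, x, l)) (fst v, snd v, 0))) (at (t, x))"
    if t: "0 < t" "t < S" for t x
    unfolding \<delta>_def[abs_def]
    by (intro has_derivative_diff slice_has_derivative \<psi>d sol_has_derivative dom t)
  have \<delta>0: "(\<delta> \<longlongrightarrow> 0) (at (0, x) within {0<..<S} \<times> UNIV)" for x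
  proof -
    have "(\<psi> \<longlongrightarrow> \<phi>0 (x, l)) (at (0, x, l) within {0<..<S} \<times> strip)"
      "(flow.sol \<longlongrightarrow> \<phi>0 (x, l)) (at (0, x, l) within {0<..<S} \<times> strip)"
      using \<psi> sol_layer_solution l by (auto simp: layer_solution_def mem_strip)
    from tendsto_diff[OF filterlim_compose[OF this(1) filterlim_at_slice[OF l]] filterlim_compose[OF this(2) filterlim_at_slice[OF l]]]
    show ?thesis by (simp add: \<delta>_def[abs_def])
  qed
  have small: "(\<delta> (t1, x1))\<^sup>2 * exp (- (2 * Lip * t1)) \<le> \<epsilon>" if \<epsilon>: "\<epsilon> > 0" for \<epsilon>
  proof -
    define f where "f p = \<epsilon> - (\<delta> p)\<^sup>2 * exp (- (2 * Lip * fst p))" for p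
    let ?\<Delta> = "\<lambda>t x v. frechet_derivative \<psi> (at (t, x, l)) (fst v, snd v, 0) - frechet_derivative flow.sol (at (t, x, l)) (fst v, snd v, 0)"
    have fd: "(f has_derivative (\<lambda>v. - (2 * \<delta> (t, x) * ?\<Delta> t x v * exp (- (2 * Lip * t)) - (\<delta> (t, x))\<^sup>2 * (2 * Lip * fst v * exp (- (2 * Lip * t)))))) (at (t, x))"
      if t: "0 < t" "t < S" for t x
      unfolding f_def[abs_def]
      by (rule derivative_eq_intros \<delta>d[OF t] refl | simp)+ (simp add: fun_eq_iff algebra_simps)
    have "\<epsilon> * exp (- (0 + 1) * t1) \<le> f (t1, x1)"
    proof (rule cone_lower_bound[where S = S and A = A and ?f0.0 = "\<lambda>_. \<epsilon>"])
      show "f differentiable at (t, x)" if "0 < t" "t < S" for t x using fd[OF that] by (auto simp: differentiable_def)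
      show "(f \<longlongrightarrow> \<epsilon>) (at (0, x) within {0<..<S} \<times> UNIV)" for x
      proof -
        have "(f \<longlongrightarrow> \<epsilon> - 0\<^sup>2 * exp (- (2 * Lip * fst (0 :: real, x)))) (at (0, x) within {0<..<S} \<times> UNIV)"
          unfolding f_def[abs_def] by (intro tendsto_intros \<delta>0)
        then show ?thesis by simp
      qed
      fix t x assume t: "0 < t" "t < S"
      let ?a = "fst (V (t, x, \<psi> (t, x, l)))"
      show "\<exists>a. norm a \<le> A \<and> frechet_derivative f (at (t, x)) (1, a) \<ge> - 0 * f (t, x)"
      proof (intro exI[of _ ?a] conjI V_fst_bound)
        have r: "\<bar>?\<Delta> t x (1, ?a)\<bar> \<le> Lip * \<bar>\<delta> (t, x)\<bar>"
          using difference_rate[of t x l "frechet_derivative \<psi> (at (t, x, l))" "\<psi> (t, x, l)", OF dom[OF t] transport[OF t]]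
          by (simp add: \<delta>_def)
        have "\<delta> (t, x) * ?\<Delta> t x (1, ?a) \<le> \<bar>\<delta> (t, x)\<bar> * (Lip * \<bar>\<delta> (t, x)\<bar>)"
          using mult_left_mono[OF r, of "\<bar>\<delta> (t, x)\<bar>"] abs_ge_self[of "\<delta> (t, x) * ?\<Delta> t x (1, ?a)"] unfolding abs_mult by linarith
        also have "\<dots> = Lip * (\<delta> (t, x))\<^sup>2" by (simp add: power2_eq_square)
        finally have "2 * (\<delta> (t, x) * ?\<Delta> t x (1, ?a)) - 2 * (Lip * (\<delta> (t, x))\<^sup>2) \<le> 0" by simp
        then have "(2 * (\<delta> (t, x) * ?\<Delta> t x (1, ?a)) - 2 * (Lip * (\<delta> (t, x))\<^sup>2)) * exp (- (2 * Lip * t)) \<le> 0"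
          by (rule mult_nonpos_nonneg) simp
        then show "frechet_derivative f (at (t, x)) (1, ?a) \<ge> - 0 * f (t, x)"
          unfolding frechet_derivative_at[OF fd[OF t, of x], symmetric] by (simp add: algebra_simps)
      qed
    qed (use \<epsilon> t1 A_pos in auto)
    moreover have "\<epsilon> * exp (- (0 + 1) * t1) \<ge> 0" using \<epsilon> by simp
    ultimately show ?thesis by (simp add: f_def)
  qed
  have "(\<delta> (t1, x1))\<^sup>2 * exp (- (2 * Lip * t1)) \<le> 0"
    by (rule field_le_epsilon) (use small in simp)
  then have "\<delta> (t1, x1) = 0" by (simp add: mult_le_0_iff)
  then show ?thesis by (simp add: \<delta>_def)
qed

text \<open>
  The minimum principle is applied to the gap \<open>sol (t, x, l + h) - sol (t, x, l)\<close>, and then \<open>h \<rightarrow> 0\<close>: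
  \<open>\<partial>\<^sub>\<lambda> sol\<close> itself need not be differentiable.
\<close>

lemma sol_vertical_derivative_pos:
  assumes q1: "(t1, x1, l) \<in> flow.dom"
  shows "frechet_derivative flow.sol (at (t1, x1, l)) (0, 0, 1) > 0"
proof -
  have l: "0 < l" "l < 1" and t1: "0 < t1" "t1 < S" using q1 by (auto simp: flow.mem_dom)
  \<comment> \<open>Half the distance to the ends keeps [l - r, l + r] inside the open unit
    interval.\<close>
  define r where "r = min l (1 - l) / 2"
  have r: "r > 0" "0 < l - r" "l + r < 1" using l by (auto simp: r_def min_def field_simps)
  \<comment> \<open>What the backward cone sees at time 0, for all steps h \<le> r at once; the
    minimum \<open>m\<close> of the slope over this compact set does not depend on
    \<open>h\<close>.\<close>
  define J where "J = cball x1 (A * t1) \<times> {l - r..l + r}"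
  have Js: "J \<subseteq> strip" using r by (auto simp: J_def strip_def)
  let ?d = "\<lambda>a. frechet_derivative \<phi>0 (at a) (0, 1)"
  have dv: "?d (x, \<mu>) = deriv (\<lambda>\<mu>. \<phi>0 (x, \<mu>)) \<mu>" if "(x, \<mu>) \<in> strip" for x \<mu>
  proof -
    have lin: "linear (frechet_derivative \<phi>0 (at (x, \<mu>)))" by (rule has_derivative_linear[OF \<phi>0_has_derivative[OF that]])
    have "((\<lambda>\<mu>. \<phi>0 (x, \<mu>)) has_derivative (\<lambda>h. frechet_derivative \<phi>0 (at (x, \<mu>)) (0, h))) (at \<mu>)"
      by (rule has_derivative_compose[where f = "\<lambda>\<mu>. (x, \<mu>)", OF _ \<phi>0_has_derivative[OF that]])
         (auto intro!: derivative_eq_intros)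
    moreover have "(\<lambda>h. frechet_derivative \<phi>0 (at (x, \<mu>)) (0, h)) = (*) (?d (x, \<mu>))"
    proof
      fix h :: real
      show "frechet_derivative \<phi>0 (at (x, \<mu>)) (0, h) = ?d (x, \<mu>) * h" using linear_cmul[OF lin, of h "(0, 1)"] by simp
    qed
    ultimately have "((\<lambda>\<mu>. \<phi>0 (x, \<mu>)) has_real_derivative ?d (x, \<mu>)) (at \<mu>)" by (simp only: has_field_derivative_def)
    from DERIV_imp_deriv[OF this] show ?thesis by simp
  qed
  have "(0, 1) \<in> (Basis :: ((real^'n) \<times> real) set)" by (simp add: Basis_prod_def)
  then have "Csb_on s ?d strip" using \<phi>0_smooth by simp
  then have "continuous_on strip ?d" by (cases s) auto
  then have cont: "continuous_on J ?d" by (rule continuous_on_subset[OF _ Js])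
  have "compact J" unfolding J_def by (intro compact_Times) auto
  moreover have "J \<noteq> {}"
  proof -
    have "A * t1 \<ge> 0" using A_pos t1 by simp
    then have "(x1, l) \<in> J" using r by (simp add: J_def)
    then show ?thesis by blast
  qed
  ultimately obtain a0 where a0: "a0 \<in> J" "\<And>a. a \<in> J \<Longrightarrow> ?d a0 \<le> ?d a"
    using continuous_attains_inf[OF _ _ cont] by blast
  define m where "m = ?d a0"
  have m: "m > 0"
  proof -
    obtain x \<mu> where "a0 = (x, \<mu>)" by fastforce
    then show ?thesis using a0(1) Js dv[of x \<mu>] \<phi>0_deriv[of x \<mu>] by (auto simp: m_def)
  qed
  have initial: "m * (l2 - l1) \<le> \<phi>0 (x, l2) - \<phi>0 (x, l1)" if x: "norm (x - x1) \<le> A * t1" and ll: "l - r \<le> l1" "l1 < l2" "l2 \<le> l + r" for x l1 l2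
  proof -
    obtain \<xi> where \<xi>: "l1 < \<xi>" "\<xi> < l2" "\<phi>0 (x, l2) - \<phi>0 (x, l1) = (l2 - l1) * deriv (\<lambda>\<mu>. \<phi>0 (x, \<mu>)) \<xi>"
    proof -
      have "\<exists>z. l1 < z \<and> z < l2 \<and> \<phi>0 (x, l2) - \<phi>0 (x, l1) = (l2 - l1) * deriv (\<lambda>\<mu>. \<phi>0 (x, \<mu>)) z"
        by (rule MVT2[OF ll(2)]) (use ll r in \<open>auto intro!: \<phi>0_vertical_derivative simp: mem_strip\<close>)
      then show ?thesis using that by blast
    qed
    have xJ: "(x, \<xi>) \<in> J" using x ll \<xi> by (auto simp: J_def dist_norm norm_minus_commute)
    have "m \<le> deriv (\<lambda>\<mu>. \<phi>0 (x, \<mu>)) \<xi>" using a0(2)[OF xJ] dv[of x \<xi>] xJ Js by (auto simp: m_def)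
    then have "(l2 - l1) * m \<le> (l2 - l1) * deriv (\<lambda>\<mu>. \<phi>0 (x, \<mu>)) \<xi>" using ll by (intro mult_left_mono) auto
    then show ?thesis using \<xi>(3) by (simp add: mult.commute)
  qed
  define E where "E = exp (- (Lip + 1) * t1)"
  have gap: "m * h * E \<le> flow.sol (t1, x1, l + h) - flow.sol (t1, x1, l)" if h: "0 < h" "h \<le> r" for h
  proof -
    define f where "f p = flow.sol (fst p, snd p, l + h) - flow.sol (fst p, snd p, l)" for p
    have lh: "0 < l + h" "l + h < 1" using l h r by auto
    have dom: "(t, x, l) \<in> flow.dom" "(t, x, l + h) \<in> flow.dom" if "0 < t" "t < S" for t x
      using that l lh by (auto simp: flow.mem_dom)
    let ?D = "\<lambda>t x l. frechet_derivative flow.sol (at (t, x, l))"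
    have fd: "(f has_derivative (\<lambda>v. ?D t x (l + h) (fst v, snd v, 0) - ?D t x l (fst v, snd v, 0))) (at (t, x))"
      if t: "0 < t" "t < S" for t x
      unfolding f_def[abs_def] by (intro has_derivative_diff slice_has_derivative sol_has_derivative dom t)
    have "m * h * exp (- (Lip + 1) * t1) \<le> f (t1, x1)"
    proof (rule cone_lower_bound[where S = S and A = A and ?f0.0 = "\<lambda>x. \<phi>0 (x, l + h) - \<phi>0 (x, l)"])
      show "f differentiable at (t, x)" if "0 < t" "t < S" for t x using fd[OF that] by (auto simp: differentiable_def)
      show "(f \<longlongrightarrow> \<phi>0 (x, l + h) - \<phi>0 (x, l)) (at (0, x) within {0<..<S} \<times> UNIV)" for x
      proof -
        have "(flow.sol \<longlongrightarrow> \<phi>0 (x, l + h)) (at (0, x, l + h) within {0<..<S} \<times> strip)"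
          "(flow.sol \<longlongrightarrow> \<phi>0 (x, l)) (at (0, x, l) within {0<..<S} \<times> strip)"
          using sol_layer_solution l lh by (auto simp: layer_solution_def mem_strip)
        from tendsto_diff[OF filterlim_compose[OF this(1) filterlim_at_slice[OF lh]] filterlim_compose[OF this(2) filterlim_at_slice[OF l]]]
        show ?thesis by (simp add: f_def[abs_def])
      qed
      show "m * h \<le> \<phi>0 (x, l + h) - \<phi>0 (x, l)" if "norm (x - x1) \<le> A * t1" for x
        using initial[OF that, of l "l + h"] h r by simp
      fix t x assume t: "0 < t" "t < S" and fpos: "f (t, x) > 0"
      \<comment> \<open>The velocity of the upper layer: along it the upper transport equation holds
        as it stands, and the lower one is corrected by \<open>difference_rate\<close>.\<close>
      let ?a = "fst (V (t, x, flow.sol (t, x, l + h)))"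
      show "\<exists>a. norm a \<le> A \<and> frechet_derivative f (at (t, x)) (1, a) \<ge> - Lip * f (t, x)"
      proof (intro exI[of _ ?a] conjI V_fst_bound)
        have "\<bar>?D t x (l + h) (1, ?a, 0) - ?D t x l (1, ?a, 0)\<bar> \<le> Lip * \<bar>f (t, x)\<bar>"
          using difference_rate[of t x l "?D t x (l + h)" "flow.sol (t, x, l + h)", OF dom(1)[OF t]
              flow.sol_transport[OF dom(2)[OF t] sol_has_derivative[OF dom(2)[OF t]]]]
          by (simp add: f_def)
        then have "?D t x (l + h) (1, ?a, 0) - ?D t x l (1, ?a, 0) \<ge> - (Lip * f (t, x))" using fpos by linarith
        then show "frechet_derivative f (at (t, x)) (1, ?a) \<ge> - Lip * f (t, x)"
          unfolding frechet_derivative_at[OF fd[OF t, of x], symmetric] by simp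
      qed
    qed (use m h t1 A_pos in auto)
    then show ?thesis by (simp add: f_def E_def)
  qed
  have d: "((\<lambda>\<mu>. flow.sol (t1, x1, \<mu>)) has_real_derivative frechet_derivative flow.sol (at (t1, x1, l)) (0, 0, 1)) (at l)"
    by (rule has_derivative_deriv_last[OF sol_has_derivative[OF q1]])
  then have "((\<lambda>h. (flow.sol (t1, x1, l + h) - flow.sol (t1, x1, l)) / h) \<longlongrightarrow> frechet_derivative flow.sol (at (t1, x1, l)) (0, 0, 1)) (at_right 0)"
    unfolding DERIV_def by (rule filterlim_mono[OF _ order_refl at_le]) simp
  then have "m * E \<le> frechet_derivative flow.sol (at (t1, x1, l)) (0, 0, 1)"
  proof (rule tendsto_lowerbound)
    show "\<forall>\<^sub>F h in at_right 0. m * E \<le> (flow.sol (t1, x1, l + h) - flow.sol (t1, x1, l)) / h"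
      by (rule eventually_at_rightI[OF _ r(1)]) (use gap in \<open>simp add: pos_le_divide_eq mult_ac\<close>)
  qed simp
  moreover have "m * E > 0" using m by (simp add: E_def)
  ultimately show ?thesis by linarith
qed

lemma sol_vertical_deriv:
  assumes "(t, x, l) \<in> flow.dom"
  shows "deriv (\<lambda>\<mu>. flow.sol (t, x, \<mu>)) l > 0"
  using DERIV_imp_deriv[OF has_derivative_deriv_last[OF sol_has_derivative[OF assms]]] sol_vertical_derivative_pos[OF assms]
  by simp

text \<open>Strict monotonicity in \<open>l\<close> makes the map injective. Surjectivity is the
  intermediate value theorem on each vertical line, between two labels so close to 0 and 1 that
  \<open>sol_near_boundary\<close> puts the given point between their images.\<close>

lemma sol_diffeo:
  assumes t: "0 < t" "t < S"
  shows "oriented_Cs_diffeo (Suc s) (\<lambda>(x, l). (x, flow.sol (t, x, l))) strip (fluid_slice zb (\<lambda>x. \<eta> (t, x)))"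
proof -
  define \<sigma> where "\<sigma> p = flow.sol (t, p)" for p
  let ?F = "\<lambda>p. (fst p, \<sigma> p)" and ?V = "fluid_slice zb (\<lambda>x. \<eta> (t, x))"
  have F: "(\<lambda>(x, l). (x, flow.sol (t, x, l))) = ?F" by (auto simp: \<sigma>_def)
  have tT: "t < T" using t S_le by linarith
  have dom: "(t, p) \<in> flow.dom" if "p \<in> strip" for p using that t by (cases p) (simp add: flow.mem_dom mem_strip)
  have \<sigma>d: "(\<sigma> has_derivative (\<lambda>v. frechet_derivative flow.sol (at (t, p)) (0, v))) (at p)" if "p \<in> strip" for p
    unfolding \<sigma>_def[abs_def]
    by (rule has_derivative_compose[where f = "\<lambda>p. (t, p)", OF _ sol_has_derivative[OF dom[OF that]]])
       (auto intro!: derivative_eq_intros)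
  have \<sigma>Cs: "Cs_on (Suc s) \<sigma> strip"
    unfolding \<sigma>_def[abs_def]
  proof (rule Cs_on_compose[OF open_strip flow.open_dom _ smooth.sol_Cs_on])
    show "(\<lambda>p. (t, p)) ` strip \<subseteq> flow.dom" using dom by blast
    have "Cs_on (Suc s) (\<lambda>p. (t, 0) + (0, p)) (strip :: ((real^'n) \<times> real) set)"
      by (intro Cs_on_add open_strip Cs_on_const Cs_on_linear bounded_linear_Pair bounded_linear_zero bounded_linear_ident)
    then show "Cs_on (Suc s) (\<lambda>p. (t, p)) (strip :: ((real^'n) \<times> real) set)" by simp
  qed
  have vert: "frechet_derivative \<sigma> (at p) (0, 1) > 0" if "p \<in> strip" for p
    unfolding frechet_derivative_at[OF \<sigma>d[OF that], symmetric]
    using sol_vertical_derivative_pos[of t "fst p" "snd p"] dom[OF that] by simp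
  have vd: "((\<lambda>\<mu>. \<sigma> (x, \<mu>)) has_real_derivative deriv (\<lambda>\<mu>. \<sigma> (x, \<mu>)) l) (at l)" "deriv (\<lambda>\<mu>. \<sigma> (x, \<mu>)) l > 0"
    if "0 < l" "l < 1" for x l
  proof -
    have q: "(t, x, l) \<in> flow.dom" using that t by (simp add: flow.mem_dom)
    from has_derivative_deriv_last[OF sol_has_derivative[OF q]]
    show "((\<lambda>\<mu>. \<sigma> (x, \<mu>)) has_real_derivative deriv (\<lambda>\<mu>. \<sigma> (x, \<mu>)) l) (at l)"
      unfolding \<sigma>_def by (metis DERIV_imp_deriv)
    show "deriv (\<lambda>\<mu>. \<sigma> (x, \<mu>)) l > 0" using sol_vertical_deriv[OF q] by (simp add: \<sigma>_def)
  qed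
  have mono: "\<sigma> (x, l) < \<sigma> (x, l')" if "0 < l" "l < l'" "l' < 1" for x l l'
    by (rule DERIV_pos_imp_increasing[OF that(2)]) (use vd that in \<open>meson less_le_trans le_less_trans\<close>)
  have openV: "open ?V"
  proof -
    have "continuous_on UNIV (\<lambda>p. (t, p) :: real \<times> (real^'n) \<times> real)" by (intro continuous_intros)
    moreover have "?V = (\<lambda>p. (t, p)) -` Q" using t tT by (auto simp: fluid_domain_def)
    ultimately show ?thesis using open_vimage[OF open_Q] by metis
  qed
  have bij: "bij_betw ?F strip ?V"
    unfolding bij_betw_def
  proof
    show "inj_on ?F strip"
    proof (rule inj_onI)
      fix p p' assume p: "p \<in> strip" "p' \<in> strip" "?F p = ?F p'"
      obtain x l x' l' where eq: "p = (x, l)" "p' = (x', l')" by (cases p, cases p')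
      then show "p = p'" using p mono[of l l' x] mono[of l' l x] by (auto simp: mem_strip) (metis less_irrefl linorder_neqE)
    qed
    show "?F ` strip = ?V"
    proof
      show "?F ` strip \<subseteq> ?V"
      proof
        fix y assume "y \<in> ?F ` strip"
        then obtain p where p: "p \<in> strip" "y = ?F p" by blast
        obtain x l where eq: "p = (x, l)" by fastforce
        have "(t, x, flow.sol (t, x, l)) \<in> Q" by (rule sol_in_Q) (use dom[OF p(1)] eq in simp)
        then show "y \<in> ?V" using p eq by (simp add: \<sigma>_def mem_Q fluid_slice_def)
      qed
      show "?V \<subseteq> ?F ` strip"
      proof
        fix y assume "y \<in> ?V"
        obtain x z where y: "y = (x, z)" by fastforce
        with \<open>y \<in> ?V\<close> have z: "zb x < z" "z < \<eta> (t, x)" by (auto simp: fluid_slice_def)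
        \<comment> \<open>The 1 makes \<open>C\<close> positive, also for G = 0, and the comparisons
          below strict.\<close>
        define C where "C = G * exp rate + 1"
        have C: "C > 0" unfolding C_def using G_nonneg by (simp add: add_nonneg_pos)
        \<comment> \<open>Small enough for the layer \<open>l1\<close> to lie below
          \<open>z\<close>; the cut at 1/2, used for \<open>l2\<close> as well, ensures l1 \<le>
          l2.\<close>
        define l1 where "l1 = min (1/2) ((z - zb x) / C)"
        define l2 where "l2 = max (1/2) (1 - (\<eta> (t, x) - z) / C)"
        have "l1 \<le> (z - zb x) / C" by (simp add: l1_def)
        then have l1C: "l1 * C \<le> z - zb x" using C by (simp only: pos_le_divide_eq)
        have l1: "0 < l1" "l1 \<le> 1/2" unfolding l1_def using z C by (simp_all add: min_def)
        have "1 - l2 \<le> (\<eta> (t, x) - z) / C" by (simp add: l2_def)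
        then have l2C: "(1 - l2) * C \<le> \<eta> (t, x) - z" using C by (simp only: pos_le_divide_eq)
        have l2: "1/2 \<le> l2" "l2 < 1" unfolding l2_def using z C by (simp_all add: max_def)
        have "\<sigma> (x, l1) - zb x \<le> G * l1 * exp rate"
          unfolding \<sigma>_def by (rule sol_near_boundary(1)) (use l1 t in \<open>simp add: flow.mem_dom\<close>)
        also have "\<dots> < l1 * C" using l1(1) by (simp add: C_def algebra_simps)
        finally have a: "\<sigma> (x, l1) \<le> z" using l1C by simp
        have "\<eta> (t, x) - \<sigma> (x, l2) \<le> G * (1 - l2) * exp rate"
          unfolding \<sigma>_def by (rule sol_near_boundary(2)) (use l2 t in \<open>simp add: flow.mem_dom\<close>)
        also have "\<dots> < (1 - l2) * C" using l2(2) by (simp add: C_def algebra_simps)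
        finally have b: "z \<le> \<sigma> (x, l2)" using l2C by simp
        have "\<exists>\<mu>. l1 \<le> \<mu> \<and> \<mu> \<le> l2 \<and> \<sigma> (x, \<mu>) = z"
        proof (rule IVT[where f = "\<lambda>\<mu>. \<sigma> (x, \<mu>)", OF a b])
          show "l1 \<le> l2" using l1 l2 by linarith
          show "\<forall>\<mu>. l1 \<le> \<mu> \<and> \<mu> \<le> l2 \<longrightarrow> isCont (\<lambda>\<mu>. \<sigma> (x, \<mu>)) \<mu>"
            using vd(1) l1 l2 by (meson DERIV_isCont le_less_trans less_le_trans)
        qed
        then obtain \<mu> where \<mu>: "l1 \<le> \<mu>" "\<mu> \<le> l2" "\<sigma> (x, \<mu>) = z" by blast
        then have "(x, \<mu>) \<in> strip" using l1 l2 by (auto simp: mem_strip)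
        then show "y \<in> ?F ` strip" using \<mu>(3) y by (intro image_eqI[of _ _ "(x, \<mu>)"]) auto
      qed
    qed
  qed
  note graph = open_strip openV \<sigma>Cs vert bij
  show ?thesis
    unfolding oriented_Cs_diffeo_def F
    using bij graph_map_Cs_on[OF graph] graph_map_inverse_Cs_on[OF graph] graph_map_det[OF graph] by blast
qed

end

theorem theorem2p3:
  fixes s :: nat and T g :: real
    and zb \<eta>0 :: "real^'n \<Rightarrow> real"
    and u0 :: "(real^'n) \<times> real \<Rightarrow> real^'n"
    and \<eta> :: "real \<times> (real^'n) \<Rightarrow> real"
    and u :: "real \<times> (real^'n) \<times> real \<Rightarrow> real^'n"
    and w :: "real \<times> (real^'n) \<times> real \<Rightarrow> real"
    and \<phi>0 :: "(real^'n) \<times> real \<Rightarrow> real"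
  assumes "CARD('n) \<in> {1, 2}" and "s \<ge> 1" and "T > 0" and "g > 0"
    and "Csb_on s zb UNIV"
    and "hydrostatic_euler g (\<lambda>_. 0) zb T \<eta>0 u0 \<eta> u w"
    and "Csb_on s \<eta> ({0<..<T} \<times> UNIV)"
    and "Csb_on s u (fluid_domain T zb \<eta>)"
    and "Csb_on s w (fluid_domain T zb \<eta>)"
    and "Csb_on s \<phi>0 strip"
    and "\<forall>x. (\<phi>0 \<longlongrightarrow> zb x) (at (x, 0) within strip)"
    and "\<forall>x. (\<phi>0 \<longlongrightarrow> \<eta>0 x) (at (x, 1) within strip)"
    and "\<forall>(x, l)\<in>strip. deriv (\<lambda>\<mu>. \<phi>0 (x, \<mu>)) l > 0"
  shows "\<exists>S \<phi>. 0 < S \<and> S \<le> T \<and>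
    layer_solution s (fluid_domain T zb \<eta>) u w \<phi>0 S \<phi> \<and>
    (\<forall>\<psi>. layer_solution s (fluid_domain T zb \<eta>) u w \<phi>0 S \<psi> \<longrightarrow>
         (\<forall>p\<in>{0<..<S} \<times> strip. \<psi> p = \<phi> p)) \<and>
    ((INF (x, l)\<in>strip. deriv (\<lambda>\<mu>. \<phi>0 (x, \<mu>)) l) > 0 \<longrightarrow>
      (\<forall>t\<in>{0<..<S}.
         (\<forall>(x, l)\<in>strip. deriv (\<lambda>\<mu>. \<phi> (t, x, \<mu>)) l > 0) \<and>
         oriented_Cs_diffeo s (\<lambda>(x, l). (x, \<phi> (t, x, l))) strip
           (fluid_slice zb (\<lambda>x. \<eta> (t, x)))))"
proof -
  obtain k where s: "s = Suc k" using assms(2) by (cases s) auto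
  note smooth = assms(5,7-10)[unfolded s]
  obtain B1 where B1: "B1 > 0" "\<And>x y. norm (frechet_derivative zb (at x) y) \<le> B1 * norm y"
    using Csb_on_Suc_derivative_bound[OF smooth(1)] by auto
  obtain B2 where B2: "B2 > 0" "\<And>p v. p \<in> {0<..<T} \<times> UNIV \<Longrightarrow> norm (frechet_derivative \<eta> (at p) v) \<le> B2 * norm v"
    using Csb_on_Suc_derivative_bound[OF smooth(2)] by blast
  obtain B3 where B3: "B3 > 0" "\<And>p v. p \<in> fluid_domain T zb \<eta> \<Longrightarrow> norm (frechet_derivative u (at p) v) \<le> B3 * norm v"
    using Csb_on_Suc_derivative_bound[OF smooth(3)] by blast
  obtain B4 where B4: "B4 > 0" "\<And>p v. p \<in> fluid_domain T zb \<eta> \<Longrightarrow> norm (frechet_derivative w (at p) v) \<le> B4 * norm v"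
    using Csb_on_Suc_derivative_bound[OF smooth(4)] by blast
  obtain B5 where B5: "B5 > 0" "\<And>p v. p \<in> strip \<Longrightarrow> norm (frechet_derivative \<phi>0 (at p) v) \<le> B5 * norm v"
    using Csb_on_Suc_derivative_bound[OF smooth(5)] by blast
  obtain M1 where M1: "M1 > 0" "\<And>q. q \<in> fluid_domain T zb \<eta> \<Longrightarrow> norm (u q) \<le> M1"
    using smooth(3) by (auto simp: bounded_pos)
  obtain M2 where M2: "M2 > 0" "\<And>q. q \<in> fluid_domain T zb \<eta> \<Longrightarrow> norm (w q) \<le> M2"
    using smooth(4) by (auto simp: bounded_pos)
  define G where "G = B1 + B2 + B5"
  define K where "K = B3 + B4"
  define M where "M = M1 + M2"
  have enlarge: "r \<le> b * norm v \<Longrightarrow> b \<le> c \<Longrightarrow> r \<le> c * norm v" for r b c :: real and v :: "'c::real_normed_vector"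
    by (rule order_trans[OF _ mult_right_mono]) auto
  have nonneg: "G \<ge> 0" "K \<ge> 0" "M \<ge> 0"
    using B1(1) B2(1) B3(1) B4(1) B5(1) M1(1) M2(1) by (simp_all add: G_def K_def M_def)
  interpret hydrostatic_layer k T g zb \<eta>0 u0 \<eta> u w \<phi>0 G K M
  proof
    show "\<bar>frechet_derivative \<eta> (at p) v\<bar> \<le> G * norm v" if "p \<in> {0<..<T} \<times> UNIV" for p v
      using enlarge[OF B2(2)[OF that]] B1(1) B5(1) by (simp add: G_def)
    show "\<bar>frechet_derivative zb (at x) y\<bar> \<le> G * norm y" for x y
      using enlarge[OF B1(2)] B2(1) B5(1) by (simp add: G_def)
    show "\<bar>frechet_derivative \<phi>0 (at a) b\<bar> \<le> G * norm b" if "a \<in> strip" for a b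
      using enlarge[OF B5(2)[OF that]] B2(1) B1(1) by (simp add: G_def)
    show "norm (frechet_derivative u (at q) h) \<le> K * norm h" if "q \<in> fluid_domain T zb \<eta>" for q h
      using enlarge[OF B3(2)[OF that]] B4(1) by (simp add: K_def)
    show "\<bar>frechet_derivative w (at q) h\<bar> \<le> K * norm h" if "q \<in> fluid_domain T zb \<eta>" for q h
      using enlarge[OF B4(2)[OF that]] B3(1) by (simp add: K_def)
    show "norm (u q) \<le> M" if "q \<in> fluid_domain T zb \<eta>" for q
      using M1(2)[OF that] M2(1) by (simp add: M_def)
    show "\<bar>w q\<bar> \<le> M" if "q \<in> fluid_domain T zb \<eta>" for q
      using M2(2)[OF that] M1(1) by (simp add: M_def)
    show "deriv (\<lambda>\<mu>. \<phi>0 (x, \<mu>)) l > 0" if "(x, l) \<in> strip" for x l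
      using assms(13) that by fast
  qed (rule assms(3,6) smooth nonneg assms(11)[rule_format] assms(12)[rule_format])+
  \<comment> \<open>With positive depth at all times in (0, T), the extension can be made over the
    whole time slab.\<close>
  have P: "convex ({0<..<T} \<times> (UNIV :: (real^'n) set))" "open ({0<..<T} \<times> (UNIV :: (real^'n) set))"
    "{0<..<T} \<times> (UNIV :: (real^'n) set) \<noteq> {}"
    using assms(3) by (simp_all add: convex_Times open_Times)
  have depth: "zb x < \<eta> (t, x)" if "(t, x) \<in> {0<..<T} \<times> UNIV" for t x
    using depth_positive[of t x] that by simp
  obtain U W where
    UW: "\<And>t x z. (t, x) \<in> {0<..<T} \<times> UNIV \<Longrightarrow> (t, x, z) \<in> Q \<Longrightarrow> U (t, x, z) = u (t, x, z) \<and> W (t, x, z) = w (t, x, z)"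
    and lip: "\<And>p q. norm (U p - U q) \<le> CARD('n) * (K * (2 + 2 * G)) * norm (p - q)"
      "\<And>p q. \<bar>W p - W q\<bar> \<le> K * (2 + 2 * G) * norm (p - q)"
    and bd: "\<And>p. norm (U p) \<le> CARD('n) * M" "\<And>p. \<bar>W p\<bar> \<le> M"
    and cl: "\<And>t x z. (t, x) \<in> {0<..<T} \<times> UNIV \<Longrightarrow> (t, x, z) \<in> closure Q \<Longrightarrow>
      cont_ext Q u (t, x, z) = U (t, x, z) \<and> cont_ext Q w (t, x, z) = W (t, x, z)"
    by (rule extension_over_convex[OF P order_refl depth]) metis+
  \<comment> \<open>Sum of the Lipschitz constants of \<open>U\<close> and \<open>W\<close>, as the
    norm of a pair is at most the sum of the norms.\<close>
  define L where "L = CARD('n) * (K * (2 + 2 * G)) + K * (2 + 2 * G)"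
  define c where "c = L * (4 + CARD('n) * G) * (CARD('n) + 1)"
  \<comment> \<open>S c \<le> 1/2 is the smallness condition; c + 1 avoids a zero
    denominator.\<close>
  define S where "S = min T (1 / (2 * (c + 1)))"
  have L: "L \<ge> 0" using K_nonneg G_nonneg by (simp add: L_def)
  have c: "c \<ge> 0" using L G_nonneg by (simp add: c_def)
  have S: "S > 0" "S \<le> T" using assms(3) c by (simp_all add: S_def)
  interpret layer_flow k T g zb \<eta>0 u0 \<eta> u w \<phi>0 G K M "\<lambda>p. (U p, W p)" L "CARD('n) * M + M" S
  proof
    show "(U p, W p) = (u p, w p)" if "p \<in> Q" for p
    proof -
      obtain t x z where p: "p = (t, x, z)" by (cases p)
      then show ?thesis using UW[of t x z] that by (simp add: mem_Q)
    qed
    show "cont_ext Q u (t, x, z) = fst (U (t, x, z), W (t, x, z)) \<and> cont_ext Q w (t, x, z) = snd (U (t, x, z), W (t, x, z))"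
      if "(t, x, z) \<in> closure Q" "0 < t" "t < T" for t x z
      using cl[of t x z] that by simp
    show "norm ((U p, W p) - (U q, W q)) \<le> L * norm (p - q)" for p q
    proof -
      have "norm ((U p, W p) - (U q, W q)) \<le> norm (U p - U q) + \<bar>W p - W q\<bar>"
        using norm_Pair_le[of "U p - U q" "W p - W q"] by simp
      also have "\<dots> \<le> L * norm (p - q)" using add_mono[OF lip(1)[of p q] lip(2)[of p q]] by (simp only: L_def distrib_right)
      finally show ?thesis .
    qed
    show "norm (U p, W p) \<le> CARD('n) * M + M" for p
      using norm_Pair_le[of "U p" "W p"] add_mono[OF bd(1)[of p] bd(2)[of p]] by simp
    have "S * c \<le> 1 / (2 * (c + 1)) * c" using c by (intro mult_right_mono) (simp_all add: S_def)
    also have "\<dots> \<le> 1/2" using c by (simp add: field_simps)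
    finally show "S * L * (4 + CARD('n) * G) * (CARD('n) + 1) \<le> 1/2" by (simp only: c_def mult.assoc)
    show "CARD('n) * M + M \<ge> 0" using M_nonneg by simp
  qed (use L S in simp_all)
  show ?thesis
    unfolding s
  proof (intro exI[of _ S] exI[of _ flow.sol] conjI S sol_layer_solution allI impI ballI)
    fix \<psi> p assume "layer_solution (Suc k) Q u w \<phi>0 S \<psi>" "p \<in> {0<..<S} \<times> (strip :: ((real^'n) \<times> real) set)"
    then show "\<psi> p = flow.sol p"
      using solution_unique[of \<psi> "fst p" "fst (snd p)" "snd (snd p)"] by (simp add: dom_eq)
  next
    fix t y assume t: "t \<in> {0<..<S}" and y: "y \<in> (strip :: ((real^'n) \<times> real) set)"
    obtain x l where "y = (x, l)" by fastforce
    then show "case y of (x, l) \<Rightarrow> 0 < deriv (\<lambda>\<mu>. flow.sol (t, x, \<mu>)) l"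
      using t y sol_vertical_deriv[of t x l] by (simp add: dom_eq)
  next
    fix t assume "t \<in> {0<..<S}"
    then show "oriented_Cs_diffeo (Suc k) (\<lambda>(x, l). (x, flow.sol (t, x, l))) strip (fluid_slice zb (\<lambda>x. \<eta> (t, x)))"
      using sol_diffeo[of t] by simp
  qed
qed

end
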